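(* Let $F=(f,g):\mathbb{R}^2\to\mathbb{R}^2$ be a local homeomorphism such that, for some $s>0$, $F|_{\mathbb{R}^2\setminus D_s}$ is differentiable. If $F$ satisfies the $W$-condition, then $F$ is globally injective and $F(\mathbb{R}^2)$ is a convex set.
   Context: $D_s=\{z\in\mathbb{R}^2:\|z\|<s\}$ is the open disc of radius $s$ centered at the origin. For $\theta\in\mathbb{R}$ let $R_\theta=\begin{pmatrix}\cos\theta&-\sin\theta\\ \sin\theta&\cos\theta\end{pmatrix}$ and $F_\theta=R_\theta\circ F\circ R_{-\theta}$. Let $\mathbb{R}^+=(0,+\infty)$ and let $\mathcal{P}$ be the set of all nondecreasing functions $P:\mathbb{R}^+\to\mathbb{R}^+$ such that for every $M>0$ there exists a large constant $N$ (depending on $M$ and $P$) with $\int_2^N\frac{1}{P(x)}\,dx>M$. $W$-condition: $F$ satisfies the $W$-condition if there is a function $P\in\mathcal{P}$ such that, for each $\theta\in\mathbb{R}$, there does not exist a sequence $(x_k,y_k)\in\mathbb{R}^2$ (of points outside $D_s$, where $F_\theta$ is differentiable) with $x_k\to+\infty$ such that $F_\theta(x_k,y_k)\to T$ for some $T\in\mathbb{R}^2$ and $DF_\theta(x_k,y_k)$ has a real eigenvalue $\lambda_k$ satisfying $\lambda_kP(x_k)\to 0$. *)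

theory Defs
  imports "HOL-Analysis.Analysis"
begin

definition local_homeomorphism ::
    "('a::topological_space \<Rightarrow> 'b::topological_space) \<Rightarrow> bool" where
  "local_homeomorphism F \<longleftrightarrow>
     (\<forall>z. \<exists>U g. open U \<and> z \<in> U \<and> open (F ` U) \<and> homeomorphism U (F ` U) F g)"

definition rot_mat :: "real \<Rightarrow> real^2^2" where
  "rot_mat \<theta> = vector [vector [cos \<theta>, - sin \<theta>], vector [sin \<theta>, cos \<theta>]]"

definition rot_conj :: "real \<Rightarrow> (real^2 \<Rightarrow> real^2) \<Rightarrow> real^2 \<Rightarrow> real^2" where
  "rot_conj \<theta> F = (\<lambda>z. rot_mat \<theta> *v F (rot_mat (- \<theta>) *v z))"

definition real_eigenvalue :: "('a::real_vector \<Rightarrow> 'a) \<Rightarrow> real \<Rightarrow> bool" where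
  "real_eigenvalue D c \<longleftrightarrow> (\<exists>v. v \<noteq> 0 \<and> D v = c *\<^sub>R v)"

text \<open>
  Functions from the positive reals to themselves are total functions on the reals whose values
  at nonpositive arguments are irrelevant. Monotonicity and positivity make \<open>1 / P\<close> integrable on
  every interval \<open>{2..N}\<close>, and the integral is 0 when \<open>N < 2\<close>, so the default value of
  \<^const>\<open>integral\<close> never matters.
\<close>

definition growth_functions :: "(real \<Rightarrow> real) set" where
  "growth_functions =
     {P. mono_on {0<..} P \<and> (\<forall>x>0. P x > 0) \<and>
         (\<forall>M>0. \<exists>N. integral {2..N} (\<lambda>x. 1 / P x) > M)}"

text \<open>
  The derivative is that of the restriction to the complement of the open disc. It is the usual
  one at every point of norm greater than \<open>s\<close>, hence at all but finitely many terms of a sequence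
  whose first coordinates tend to infinity. Likewise \<open>P\<close> is evaluated at a nonpositive argument
  for at most finitely many terms.
\<close>

definition W_condition :: "real \<Rightarrow> (real^2 \<Rightarrow> real^2) \<Rightarrow> bool" where
  "W_condition s F \<longleftrightarrow>
     (\<exists>P\<in>growth_functions. \<forall>\<theta>.
        \<not> (\<exists>(z :: nat \<Rightarrow> real^2) (c :: nat \<Rightarrow> real) (T :: real^2).
              (\<forall>k. z k \<notin> ball 0 s) \<and>
              filterlim (\<lambda>k. z k $ 1) at_top sequentially \<and>
              (\<lambda>k. rot_conj \<theta> F (z k)) \<longlonglongrightarrow> T \<and>
              (\<forall>k. \<exists>D. (rot_conj \<theta> F has_derivative D) (at (z k) within - ball 0 s) \<and>
                       real_eigenvalue D (c k)) \<and>
              (\<lambda>k. c k * P (z k $ 1)) \<longlonglongrightarrow> 0))"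

end

theory Submission
  imports Defs
begin

text \<open>
  In complex notation, write \<open>w\<close> for points of the source and \<open>z\<close> for points of the target. A continuous
  right inverse of \<open>F\<close> over a part of the target is called a section. If every segment
  \<open>[F p, F q]\<close> has a section from \<open>p\<close> to \<open>q\<close>, then \<open>F\<close> is injective and its range is convex. If some segment has
  none, one sweeps a parallelogram by parallel segments (\<open>segment_lifts_all\<close>, \<open>sweep\<close>). The first segment that
  does not lift is the flat edge of a half-Reeb region: a section \<open>\<Phi>\<close> is defined below the edge and escapes
  to infinity at a compact set \<open>K\<close> of singular points of it. The proof shows that the W-condition excludes
  half-Reeb regions (\<open>no_half_reeb\<close>). Normalise the edge to be vertical.

  \<^item> The section of a half-Reeb region stays in a strip parallel to the edge (\<open>half_reeb_bounded\<close>). Where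
  \<open>Re (F w)\<close> is least among the values \<open>w\<close> of the section with \<open>Re w \<ge> X\<close>, the functional \<open>Re\<close> is a left
  eigenvector of the derivative; integrating the eigenvalue bound of the W-condition over \<open>X\<close> would make the bounded minimum tend to infinity.

  \<^item> Lines of nearby slopes can be swept in place of the edge (\<open>tangent_family\<close>). This gives
  half-Reeb regions with singular sets \<open>K u\<close> for all slopes \<open>u\<close> in an interval: the lines are the tangents of
  a convex set \<open>H\<close>, and all the sections are parts of one section on the complement of \<open>H\<close>. Each section
  lies in a strip of direction \<open>u\<close>, of a width that a category argument makes uniform. So points near
  the tangent of slope \<open>u\<close> are carried far out in the direction \<open>u\<close>, and the section covers a whole sector
  (\<open>sector_lifted\<close>). Here one needs that \<open>K u\<close> has no gaps (\<open>singular_set_no_gap\<close>), and that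
  the sections of all slopes use the same end of their strips (\<open>common_end\<close>).

  \<^item> On this sector \<open>F\<close> is injective, with bounded image. When \<open>w\<close> moves away from the origin, \<open>F w\<close>
  approaches \<open>H\<close> from the left; when \<open>w\<close> turns, \<open>F w\<close> moves along the boundary of \<open>H\<close>. The sense of this
  motion shows that \<open>F\<close> reverses orientation (\<open>sector_orientation\<close>), so its Jacobian is nowhere positive and
  the eigenvalues of the derivative are real.

  \<^item> The W-condition bounds the eigenvalues away from zero in a subinterval of directions
  (\<open>eigenvalues_bounded_below\<close>). Hence the Jacobian is bounded away from zero on a sector of infinite area that
  is mapped injectively to a bounded set, which is absurd (\<open>eigenvalue_bound_contradiction\<close>).
\<close>


section \<open>Local homeomorphisms of the plane and their sections\<close>

definition section_on :: "(complex \<Rightarrow> complex) \<Rightarrow> complex set \<Rightarrow> (complex \<Rightarrow> complex) \<Rightarrow> bool" where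
  "section_on F S \<Phi> \<longleftrightarrow> continuous_on S \<Phi> \<and> (\<forall>z\<in>S. F (\<Phi> z) = z)"

lemma section_on_subset: "section_on F S \<Phi> \<Longrightarrow> T \<subseteq> S \<Longrightarrow> section_on F T \<Phi>"
  unfolding section_on_def using continuous_on_subset by blast

lemma section_on_cong: "section_on F S \<Phi> \<Longrightarrow> (\<And>z. z \<in> S \<Longrightarrow> \<Psi> z = \<Phi> z) \<Longrightarrow> section_on F S \<Psi>"
  unfolding section_on_def by (auto cong: continuous_on_cong)

lemma section_onD: "section_on F S \<Phi> \<Longrightarrow> z \<in> S \<Longrightarrow> F (\<Phi> z) = z"
  unfolding section_on_def by blast

lemma section_on_open_Un:
  assumes "\<And>z. z \<in> S \<Longrightarrow> \<exists>e>0. section_on F (S \<inter> ball z e) \<Phi>"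
  shows "section_on F S \<Phi>"
  unfolding section_on_def
proof
  show "continuous_on S \<Phi>"
    unfolding continuous_on_eq_continuous_within
  proof
    fix z assume z: "z \<in> S"
    then obtain e where e: "e > 0" "section_on F (S \<inter> ball z e) \<Phi>" using assms by blast
    then have "continuous (at z within S \<inter> ball z e) \<Phi>"
      using z by (auto simp: section_on_def continuous_on_eq_continuous_within)
    moreover have "at z within S \<inter> ball z e = at z within S"
      by (rule at_within_nhd[of z "ball z e"]) (use e in auto)
    ultimately show "continuous (at z within S) \<Phi>" by simp
  qed
  show "\<forall>z\<in>S. F (\<Phi> z) = z"
  proof
    fix z assume z: "z \<in> S"
    then obtain e where "e > 0" "section_on F (S \<inter> ball z e) \<Phi>" using assms by blast
    then show "F (\<Phi> z) = z" using z by (auto simp: section_on_def)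
  qed
qed

lemma tendsto_close:
  fixes l x :: "nat \<Rightarrow> 'a::real_normed_vector"
  assumes "l \<longlonglongrightarrow> a" "(\<lambda>n. dist (l n) (x n)) \<longlonglongrightarrow> 0"
  shows "x \<longlonglongrightarrow> a"
proof (rule Lim_transform[OF assms(1)])
  show "(\<lambda>n. x n - l n) \<longlonglongrightarrow> 0"
    using assms(2) by (simp add: dist_norm norm_minus_commute[of "l _"] tendsto_norm_zero_iff)
qed

locale local_homeo =
  fixes F :: "complex \<Rightarrow> complex"
  assumes cont_F: "continuous_on UNIV F"
    and locally_inj: "\<exists>e>0. inj_on F (ball w e)"
begin

lemma cont_F_on: "continuous_on S F"
  using cont_F continuous_on_subset by blast

lemma tendsto_F: "(f \<longlongrightarrow> w) G \<Longrightarrow> ((\<lambda>n. F (f n)) \<longlongrightarrow> F w) G"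
  using cont_F by (auto simp: continuous_on_eq_continuous_at intro: isCont_tendsto_compose)

text \<open>Invariance of domain on small balls.\<close>

lemma open_image: assumes "open U" shows "open (F ` U)"
proof (subst open_subopen, safe)
  fix w assume w: "w \<in> U"
  obtain e where e: "e > 0" "inj_on F (ball w e)" using locally_inj by blast
  have "open (F ` (U \<inter> ball w e))"
    by (rule invariance_of_domain) (use e assms cont_F_on in \<open>auto intro: inj_on_subset\<close>)
  then show "\<exists>T. open T \<and> F w \<in> T \<and> T \<subseteq> F ` U"
    using w e by (intro exI[of _ "F ` (U \<inter> ball w e)"]) auto
qed

text \<open>Two sections that agree somewhere agree on a connected set, because \<open>F\<close> is locally injective:
  all lifting arguments below rest on this.\<close>

lemma section_unique:
  assumes S: "connected S" and 1: "section_on F S \<Phi>" and 2: "section_on F S \<Psi>"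
    and a: "a \<in> S" "\<Phi> a = \<Psi> a" and z: "z \<in> S"
  shows "\<Phi> z = \<Psi> z"
proof -
  let ?T = "{z\<in>S. \<Phi> z = \<Psi> z}"
  have c: "continuous_on S \<Phi>" "continuous_on S \<Psi>" using 1 2 by (auto simp: section_on_def)
  have "closedin (top_of_set S) ?T"
  proof -
    have "closedin (top_of_set S) (S \<inter> (\<lambda>z. \<Phi> z - \<Psi> z) -` {0})"
      by (intro continuous_closedin_preimage continuous_intros c)
    moreover have "S \<inter> (\<lambda>z. \<Phi> z - \<Psi> z) -` {0} = ?T" by auto
    ultimately show ?thesis by simp
  qed
  moreover have "openin (top_of_set S) ?T"
  proof (subst openin_subopen, safe)
    fix z assume z: "z \<in> S" "\<Phi> z = \<Psi> z"
    obtain e where e: "e > 0" "inj_on F (ball (\<Phi> z) e)" using locally_inj by blast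
    let ?V = "(S \<inter> \<Phi> -` ball (\<Phi> z) e) \<inter> (S \<inter> \<Psi> -` ball (\<Phi> z) e)"
    have "openin (top_of_set S) ?V"
      by (intro openin_Int continuous_openin_preimage_gen c) auto
    moreover have "z \<in> ?V" using z e by auto
    moreover have "?V \<subseteq> ?T"
    proof
      fix y assume y: "y \<in> ?V"
      have "\<Phi> y = \<Psi> y" by (rule inj_onD[OF e(2)]) (use y 1 2 in \<open>auto simp: section_on_def\<close>)
      then show "y \<in> ?T" using y by simp
    qed
    ultimately show "\<exists>T. openin (top_of_set S) T \<and> z \<in> T \<and> T \<subseteq> ?T" by blast
  qed
  ultimately have "?T = {} \<or> ?T = S" using S connected_clopen by blast
  then show ?thesis using a z by blast
qed

lemma section_unique_convex:
  "convex S \<Longrightarrow> section_on F S \<Phi> \<Longrightarrow> section_on F S \<Psi> \<Longrightarrow> a \<in> S \<Longrightarrow> \<Phi> a = \<Psi> a \<Longrightarrow> z \<in> S \<Longrightarrow> \<Phi> z = \<Psi> z"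
  using section_unique convex_connected by blast

lemma section_on_inv_into:
  assumes "open V" "inj_on F V"
  shows "section_on F (F ` V) (inv_into V F)"
  unfolding section_on_def
proof
  show "continuous_on (F ` V) (inv_into V F)"
    by (rule continuous_on_inverse_open) (use assms cont_F_on in auto)
qed (simp add: f_inv_into_f)

text \<open>The local inverse of \<open>F\<close> at \<open>w\<close> over a whole disc, together with the sheet \<open>U\<close> on which it inverts \<open>F\<close>. In
  this form local injectivity enters most lifting arguments.\<close>

lemma local_section:
  obtains r U \<psi> where "r > 0" "open U" "w \<in> U" "section_on F (ball (F w) r) \<psi>"
    "\<And>v. v \<in> U \<Longrightarrow> F v \<in> ball (F w) r \<and> \<psi> (F v) = v" "\<psi> ` ball (F w) r \<subseteq> U"
proof -
  obtain e where e: "e > 0" "inj_on F (ball w e)" using locally_inj by blast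
  have o: "open (F ` ball w e)" by (simp add: open_image)
  then obtain r where r: "r > 0" "ball (F w) r \<subseteq> F ` ball w e"
    using e(1) by (metis centre_in_ball image_eqI open_contains_ball)
  let ?\<psi> = "inv_into (ball w e) F"
  let ?U = "ball w e \<inter> F -` ball (F w) r"
  show ?thesis
  proof
    show "open ?U" by (intro open_Int open_ball open_vimage cont_F)
    show "section_on F (ball (F w) r) ?\<psi>"
      using section_on_inv_into[OF _ e(2)] section_on_subset r(2) by blast
    show "F v \<in> ball (F w) r \<and> ?\<psi> (F v) = v" if "v \<in> ?U" for v
      using that e(2) by auto
    show "?\<psi> ` ball (F w) r \<subseteq> ?U"
    proof safe
      fix z assume "z \<in> ball (F w) r"
      then have z: "z \<in> ball (F w) r" "z \<in> F ` ball w e" using r(2) by auto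
      show "?\<psi> z \<in> ball w e" by (rule inv_into_into[OF z(2)])
      show "?\<psi> z \<in> F -` ball (F w) r" using f_inv_into_f[OF z(2)] z(1) by simp
    qed
  qed (use r e in auto)
qed

text \<open>Otherwise pairs of distinct points with equal images accumulate at a pair of points of \<open>L\<close>. Its members
  agree because \<open>F\<close> is injective on \<open>L\<close>, and there \<open>F\<close> is not locally injective.\<close>

lemma inj_near_compact:
  assumes L: "compact L" "inj_on F L"
  obtains d where "d > 0" "inj_on F (\<Union>l\<in>L. ball l d)"
proof -
  have "\<exists>d>0. inj_on F (\<Union>l\<in>L. ball l d)"
  proof (rule ccontr)
    assume c: "\<not> ?thesis"
    have "\<exists>x y l l'. x \<noteq> y \<and> F x = F y \<and> l \<in> L \<and> l' \<in> L \<and> dist l x < 1 / Suc n \<and> dist l' y < 1 / Suc n" for n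
    proof -
      have "\<not> inj_on F (\<Union>l\<in>L. ball l (1 / Suc n))" using c by simp
      then show ?thesis unfolding inj_on_def by fastforce
    qed
    then obtain x y l l' where xy: "\<And>n. x n \<noteq> y n" "\<And>n. F (x n) = F (y n)" "\<And>n. l n \<in> L" "\<And>n. l' n \<in> L"
        "\<And>n. dist (l n) (x n) < 1 / Suc n" "\<And>n. dist (l' n) (y n) < 1 / Suc n"
      by metis
    obtain a r1 where a: "a \<in> L" "strict_mono r1" "(l \<circ> r1) \<longlonglongrightarrow> a"
      using L(1) xy(3) unfolding compact_def by (metis (no_types))
    obtain b r2 where b: "b \<in> L" "strict_mono r2" "((l' \<circ> r1) \<circ> r2) \<longlonglongrightarrow> b"
      using L(1) xy(4) unfolding compact_def by (metis (no_types) comp_apply)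
    have sm: "strict_mono (r1 \<circ> r2)" using a b by (simp add: strict_mono_o)
    have lim0: "(\<lambda>n. 1 / real (Suc ((r1 \<circ> r2) n))) \<longlonglongrightarrow> 0"
      using LIMSEQ_subseq_LIMSEQ[OF LIMSEQ_inverse_real_of_nat sm] by (simp add: o_def inverse_eq_divide)
    have la: "(\<lambda>n. l ((r1 \<circ> r2) n)) \<longlonglongrightarrow> a" using LIMSEQ_subseq_LIMSEQ[OF a(3) b(2)] by (simp add: o_def)
    have lb: "(\<lambda>n. l' ((r1 \<circ> r2) n)) \<longlonglongrightarrow> b" using b(3) by (simp add: o_def)
    have d1: "(\<lambda>n. dist (l ((r1 \<circ> r2) n)) (x ((r1 \<circ> r2) n))) \<longlonglongrightarrow> 0"
      by (rule tendsto_sandwich[OF _ _ tendsto_const lim0]) (use xy(5) in \<open>auto intro!: always_eventually less_imp_le\<close>)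
    have d2: "(\<lambda>n. dist (l' ((r1 \<circ> r2) n)) (y ((r1 \<circ> r2) n))) \<longlonglongrightarrow> 0"
      by (rule tendsto_sandwich[OF _ _ tendsto_const lim0]) (use xy(6) in \<open>auto intro!: always_eventually less_imp_le\<close>)
    have xa: "(\<lambda>n. x ((r1 \<circ> r2) n)) \<longlonglongrightarrow> a" by (rule tendsto_close[OF la d1])
    have yb: "(\<lambda>n. y ((r1 \<circ> r2) n)) \<longlonglongrightarrow> b" by (rule tendsto_close[OF lb d2])
    have "F a = F b" using tendsto_F[OF xa] tendsto_F[OF yb] xy(2) LIMSEQ_unique by simp
    then have ab: "a = b" using L(2) a(1) b(1) by (meson inj_onD)
    obtain e where e: "e > 0" "inj_on F (ball a e)" using locally_inj by blast
    have "eventually (\<lambda>n. x ((r1 \<circ> r2) n) \<in> ball a e) sequentially"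
      using topological_tendstoD[OF xa, of "ball a e"] e by auto
    moreover have "eventually (\<lambda>n. y ((r1 \<circ> r2) n) \<in> ball a e) sequentially"
      using topological_tendstoD[OF yb, of "ball a e"] e ab by auto
    ultimately have "eventually (\<lambda>n. False) sequentially"
      by eventually_elim (use e xy in \<open>metis inj_onD\<close>)
    then show False by simp
  qed
  then show ?thesis using that by blast
qed

text \<open>\<open>F\<close> is injective near the compact image of a section, so its inverse there extends the section.\<close>

lemma section_extends:
  assumes Q: "compact Q" and s: "section_on F Q \<Phi>"
  obtains \<epsilon> \<Psi> where "\<epsilon> > 0" "section_on F (\<Union>q\<in>Q. ball q \<epsilon>) \<Psi>" "\<And>z. z \<in> Q \<Longrightarrow> \<Psi> z = \<Phi> z"
proof -
  have cL: "compact (\<Phi> ` Q)" using s Q by (simp add: section_on_def compact_continuous_image)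
  have "inj_on F (\<Phi> ` Q)" by (rule inj_onI) (metis s section_onD imageE)
  then obtain d where d: "d > 0" "inj_on F (\<Union>l\<in>\<Phi>`Q. ball l d)" using inj_near_compact cL by blast
  let ?V = "\<Union>l\<in>\<Phi>`Q. ball l d"
  have oV: "open ?V" by auto
  then have "open (F ` ?V)" by (rule open_image)
  moreover have sub: "Q \<subseteq> F ` ?V"
  proof
    fix z assume z: "z \<in> Q"
    then have "\<Phi> z \<in> ?V" using d(1) centre_in_ball by blast
    then show "z \<in> F ` ?V" using s z by (metis imageI section_onD)
  qed
  ultimately obtain e where e: "e > 0" "(\<Union>q\<in>Q. ball q e) \<subseteq> F ` ?V"
    using compact_subset_open_imp_ball_epsilon_subset[OF Q] by metis
  show ?thesis
  proof
    show "e > 0" by fact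
    show "section_on F (\<Union>q\<in>Q. ball q e) (inv_into ?V F)"
      by (rule section_on_subset[OF section_on_inv_into[OF oV d(2)] e(2)])
    show "inv_into ?V F z = \<Phi> z" if "z \<in> Q" for z
    proof -
      have "\<Phi> z \<in> ?V" using d(1) that centre_in_ball by blast
      then show ?thesis using d(2) inv_into_f_f s that section_onD by metis
    qed
  qed
qed

text \<open>At a limit point \<open>k\<close> of a convex set, a section either leaves every compact set or coincides
  with a local inverse of \<open>F\<close>: a finite limit point \<open>w\<close> of values satisfies \<open>F w = k\<close>.\<close>

lemma section_dichotomy:
  assumes S: "convex S" and s: "section_on F S \<Phi>"
  shows "filterlim \<Phi> at_infinity (at k within S) \<or>
    (\<exists>r>0. \<exists>\<psi>. section_on F (ball k r) \<psi> \<and> (\<forall>z\<in>S \<inter> ball k r. \<Phi> z = \<psi> z))"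
proof (cases "filterlim \<Phi> at_infinity (at k within S)")
  case False
  then obtain B where B: "\<not> eventually (\<lambda>z. B \<le> norm (\<Phi> z)) (at k within S)"
    by (auto simp: filterlim_at_infinity[of 0, simplified])
  have "\<exists>z. z \<in> S \<and> dist z k < 1 / Suc n \<and> norm (\<Phi> z) \<le> B" for n
  proof -
    have "\<not> (\<forall>x\<in>S. x \<noteq> k \<and> dist x k < 1 / Suc n \<longrightarrow> B \<le> norm (\<Phi> x))"
      using B unfolding eventually_at by (metis of_nat_0_less_iff zero_less_Suc zero_less_divide_1_iff)
    then show ?thesis by (metis linorder_le_less_linear less_imp_le)
  qed
  then obtain z where z: "\<And>n. z n \<in> S" "\<And>n. dist (z n) k < 1 / Suc n" "\<And>n. norm (\<Phi> (z n)) \<le> B" by metis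
  have zk: "z \<longlonglongrightarrow> k"
  proof -
    have "(\<lambda>n. dist (z n) k) \<longlonglongrightarrow> 0"
      by (rule tendsto_sandwich[OF _ _ tendsto_const LIMSEQ_inverse_real_of_nat])
         (use z(2) in \<open>auto intro!: always_eventually less_imp_le simp: inverse_eq_divide\<close>)
    then show ?thesis using tendsto_dist_iff by blast
  qed
  have "compact (cball (0::complex) B)" by simp
  then obtain w r where w: "strict_mono r" "((\<lambda>n. \<Phi> (z n)) \<circ> r) \<longlonglongrightarrow> w"
    unfolding compact_def using z(3) by (metis mem_cball_0)
  have "(\<lambda>n. F (\<Phi> (z (r n)))) \<longlonglongrightarrow> F w" using tendsto_F[OF w(2)] by (simp add: o_def)
  moreover have "(\<lambda>n. F (\<Phi> (z (r n)))) = z \<circ> r" using z(1) s by (auto simp: section_onD)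
  ultimately have Fw: "F w = k" using LIMSEQ_subseq_LIMSEQ[OF zk w(1)] LIMSEQ_unique by metis
  obtain \<rho> U \<psi> where l: "\<rho> > 0" "open U" "w \<in> U" "section_on F (ball (F w) \<rho>) \<psi>"
    "\<And>v. v \<in> U \<Longrightarrow> F v \<in> ball (F w) \<rho> \<and> \<psi> (F v) = v" using local_section by metis
  have "eventually (\<lambda>n. \<Phi> (z (r n)) \<in> U) sequentially"
    using topological_tendstoD[OF w(2) l(2,3)] by (simp add: o_def)
  then obtain n where n: "\<Phi> (z (r n)) \<in> U" unfolding eventually_sequentially by blast
  let ?a = "z (r n)"
  have a: "?a \<in> S" "F (\<Phi> ?a) = ?a" using z s by (auto simp: section_onD)
  then have ab: "?a \<in> ball k \<rho>" "\<psi> ?a = \<Phi> ?a" using l(5)[OF n] Fw by auto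
  have sa: "section_on F (S \<inter> ball k \<rho>) \<Phi>" by (rule section_on_subset[OF s]) simp
  have sb: "section_on F (S \<inter> ball k \<rho>) \<psi>" by (rule section_on_subset[OF l(4)]) (simp add: Fw)
  have "\<Phi> y = \<psi> y" if y: "y \<in> S \<inter> ball k \<rho>" for y
    by (rule section_unique_convex[OF _ sa sb _ _ y, of ?a]) (use S a ab in \<open>auto simp: convex_Int\<close>)
  then show ?thesis using l Fw by blast
qed simp

end

section \<open>Sweeping a parallelogram by lifted segments\<close>

lemma filterlim_at_infinity_iff_norm:
  fixes f :: "'a \<Rightarrow> 'b::real_normed_vector"
  shows "filterlim f at_infinity G \<longleftrightarrow> (\<forall>B. eventually (\<lambda>z. B \<le> norm (f z)) G)"
  by (simp add: filterlim_at_infinity_conv_norm_at_top filterlim_at_top)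

lemma closed_ball_disjoint:
  fixes C :: "'a::metric_space set"
  assumes "closed C" "z \<notin> C" obtains e where "e > 0" "ball z e \<inter> C = {}"
proof -
  obtain e where "e > 0" "ball z e \<subseteq> - C" using assms open_contains_ball[of "- C"] by auto
  then show ?thesis using that by blast
qed

context local_homeo begin

text \<open>A section on a convex set extends to its closure as long as it has finite limits, and by the dichotomy
  above it escapes to infinity at the remaining points.\<close>

lemma section_completion:
  assumes S: "convex S" and s: "section_on F S \<Phi>" and E: "closed (closure S - S)"
    and K: "K = {k \<in> closure S - S. filterlim \<Phi> at_infinity (at k within S)}"
  obtains \<Phi>' where "section_on F (closure S - K) \<Phi>'" "\<And>z. z \<in> S \<Longrightarrow> \<Phi>' z = \<Phi> z" "closed K"
    "\<And>k. k \<in> K \<Longrightarrow> filterlim \<Phi>' at_infinity (at k within closure S - K)"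
proof -
  define \<Phi>' where "\<Phi>' = (\<lambda>z. if z \<in> S then \<Phi> z else Lim (at z within S) \<Phi>)"
  have nontriv: "at z within S \<noteq> bot" if "z \<in> closure S - S" for z
    using that by (auto simp: closure_def trivial_limit_within)
  have loc: "\<exists>r>0. \<exists>\<psi>. section_on F (ball k r) \<psi> \<and> (\<forall>z\<in>closure S \<inter> ball k r. \<Phi>' z = \<psi> z \<and> z \<notin> K
        \<and> (z \<notin> S \<longrightarrow> (\<Phi> \<longlongrightarrow> \<psi> z) (at z within S)))"
    if k: "k \<in> closure S - S" "k \<notin> K" for k
  proof -
    obtain r \<psi> where r: "r > 0" "section_on F (ball k r) \<psi>" "\<And>z. z \<in> S \<inter> ball k r \<Longrightarrow> \<Phi> z = \<psi> z"
      using section_dichotomy[OF S s, of k] k K by blast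
    have "\<Phi>' z = \<psi> z \<and> z \<notin> K \<and> (z \<notin> S \<longrightarrow> (\<Phi> \<longlongrightarrow> \<psi> z) (at z within S))" if z: "z \<in> closure S \<inter> ball k r" for z
    proof (cases "z \<in> S")
      case True
      then show ?thesis using r(3)[of z] z K by (auto simp: \<Phi>'_def)
    next
      case False
      then have nt: "at z within S \<noteq> bot" using z nontriv by auto
      have "continuous (at z) \<psi>" using r(2) z by (auto simp: section_on_def continuous_on_eq_continuous_at)
      then have 1: "(\<psi> \<longlongrightarrow> \<psi> z) (at z within S)" by (metis continuous_at_imp_continuous_at_within continuous_within)
      have ev: "eventually (\<lambda>y. \<psi> y = \<Phi> y) (at z within S)"
      proof -
        have "eventually (\<lambda>y. y \<in> ball k r) (at z within S)"
          using z by (intro eventually_at_topological[THEN iffD2] exI[of _ "ball k r"]) auto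
        moreover have "eventually (\<lambda>y. y \<in> S) (at z within S)" by (simp add: eventually_at_filter)
        ultimately show ?thesis by eventually_elim (use r(3) in auto)
      qed
      have 2: "(\<Phi> \<longlongrightarrow> \<psi> z) (at z within S)" using Lim_transform_eventually[OF 1 ev] .
      have "\<Phi>' z = \<psi> z" using False 2 nt by (simp add: \<Phi>'_def tendsto_Lim)
      moreover have "z \<notin> K" using 2 nt K not_tendsto_and_filterlim_at_infinity by blast
      ultimately show ?thesis using 2 by blast
    qed
    then show ?thesis using r by blast
  qed
  show ?thesis
  proof
    show "section_on F (closure S - K) \<Phi>'"
    proof (rule section_on_open_Un)
      fix z assume z: "z \<in> closure S - K"
      show "\<exists>e>0. section_on F ((closure S - K) \<inter> ball z e) \<Phi>'"
      proof (cases "z \<in> S")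
        case True
        then obtain e where e: "e > 0" "ball z e \<inter> (closure S - S) = {}"
          using closed_ball_disjoint[OF E, of z] by blast
        have "section_on F ((closure S - K) \<inter> ball z e) \<Phi>"
          by (rule section_on_subset[OF s]) (use e in auto)
        then have "section_on F ((closure S - K) \<inter> ball z e) \<Phi>'"
          by (rule section_on_cong) (use e in \<open>auto simp: \<Phi>'_def\<close>)
        then show ?thesis using e by blast
      next
        case False
        then obtain r \<psi> where r: "r > 0" "section_on F (ball z r) \<psi>"
            "\<forall>y\<in>closure S \<inter> ball z r. \<Phi>' y = \<psi> y"
          using loc[of z] z by blast
        have "section_on F ((closure S - K) \<inter> ball z r) \<psi>" by (rule section_on_subset[OF r(2)]) auto
        then have "section_on F ((closure S - K) \<inter> ball z r) \<Phi>'"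
          by (rule section_on_cong) (use r(3) in auto)
        then show ?thesis using r by blast
      qed
    qed
    show "\<Phi>' z = \<Phi> z" if "z \<in> S" for z using that by (simp add: \<Phi>'_def)
    have "open (- K)"
    proof (subst open_contains_ball, safe)
      fix z assume z: "z \<notin> K"
      show "\<exists>e>0. ball z e \<subseteq> - K"
      proof (cases "z \<in> closure S - S")
        case True
        then obtain r \<psi> where r: "r > 0" "\<forall>y\<in>closure S \<inter> ball z r. y \<notin> K" using loc[of z] z by blast
        moreover have "K \<subseteq> closure S" using K by blast
        ultimately show ?thesis by blast
      next
        case False
        then obtain e where e: "e > 0" "ball z e \<inter> (closure S - S) = {}"
          using closed_ball_disjoint[OF E, of z] by blast
        moreover have "K \<subseteq> closure S - S" using K by blast
        ultimately show ?thesis by blast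
      qed
    qed
    then show "closed K" by (simp add: closed_def)
    show "filterlim \<Phi>' at_infinity (at k within closure S - K)" if k: "k \<in> K" for k
    proof -
      have kk: "k \<in> closure S - S" "filterlim \<Phi> at_infinity (at k within S)" using k K by auto
      have "eventually (\<lambda>z. B \<le> norm (\<Phi>' z)) (at k within closure S - K)" for B
      proof -
        have "eventually (\<lambda>z. B \<le> norm (\<Phi> z)) (at k within S)"
          using kk(2) filterlim_at_infinity_iff_norm by blast
        then obtain d where d: "d > 0" "\<And>z. z \<in> S \<Longrightarrow> z \<noteq> k \<Longrightarrow> dist z k < d \<Longrightarrow> B \<le> norm (\<Phi> z)"
          unfolding eventually_at by blast
        have "B \<le> norm (\<Phi>' z)" if z: "z \<in> closure S - K" "dist z k < d" for z
        proof (cases "z \<in> S")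
          case True then show ?thesis using d z kk by (auto simp: \<Phi>'_def)
        next
          case False
          then obtain r \<psi> where "r > 0" "\<forall>y\<in>closure S \<inter> ball z r. \<Phi>' y = \<psi> y \<and> (y \<notin> S \<longrightarrow> (\<Phi> \<longlongrightarrow> \<psi> y) (at y within S))"
            using loc[of z] z by blast
          then have l: "(\<Phi> \<longlongrightarrow> \<Phi>' z) (at z within S)" using False z by auto
          have "eventually (\<lambda>y. y \<in> ball k d) (at z within S)"
            using z by (intro eventually_at_topological[THEN iffD2] exI[of _ "ball k d"]) (auto simp: dist_commute)
          moreover have "eventually (\<lambda>y. y \<in> S) (at z within S)" by (simp add: eventually_at_filter)
          ultimately have ev: "eventually (\<lambda>y. B \<le> norm (\<Phi> y)) (at z within S)"
            by eventually_elim (use d kk in \<open>auto simp: dist_commute\<close>)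
          show ?thesis
            by (rule tendsto_lowerbound[OF tendsto_norm[OF l] ev]) (use nontriv False z in auto)
        qed
        then show ?thesis unfolding eventually_at using d by blast
      qed
      then show ?thesis by (simp add: filterlim_at_infinity_iff_norm)
    qed
  qed
qed

end

definition box_at :: "real set \<Rightarrow> real set \<Rightarrow> complex set" where
  "box_at I J = {z. Re z \<in> I \<and> Im z \<in> J}"

lemma convex_box_at: "convex I \<Longrightarrow> convex J \<Longrightarrow> convex (box_at I J)"
  unfolding convex_def box_at_def by simp

lemma closed_box_at: "closed I \<Longrightarrow> closed J \<Longrightarrow> closed (box_at I J)"
proof -
  assume "closed I" "closed J"
  then have "closed (Re -` I \<inter> Im -` J)"
    by (intro closed_Int closed_vimage) (auto intro: continuous_intros)
  moreover have "box_at I J = Re -` I \<inter> Im -` J" by (auto simp: box_at_def)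
  ultimately show ?thesis by simp
qed

lemma compact_box_at: "compact (box_at {a..b} {c..d})"
proof -
  have "box_at {a..b} {c..d} = cbox (Complex a c) (Complex b d)"
    by (auto simp: box_at_def in_cbox_complex_iff)
  then show ?thesis by simp
qed

lemma closure_box_at:
  assumes "0 < T" shows "closure (box_at {0..<T} {0..1}) = box_at {0..T} {0..1}"
proof
  show "closure (box_at {0..<T} {0..1}) \<subseteq> box_at {0..T} {0..1}"
    by (rule closure_minimal) (auto simp: box_at_def intro!: closed_box_at[of "{0..T}" "{0..1}", unfolded box_at_def, simplified])
  show "box_at {0..T} {0..1} \<subseteq> closure (box_at {0..<T} {0..1})"
  proof
    fix z assume z: "z \<in> box_at {0..T} {0..1}"
    have "(\<lambda>n. Complex (Re z * (1 - inverse (real (Suc n)))) (Im z)) \<longlonglongrightarrow> Complex (Re z * (1 - 0)) (Im z)"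
      by (intro tendsto_intros LIMSEQ_inverse_real_of_nat)
    then have "(\<lambda>n. Complex (Re z * (1 - inverse (real (Suc n)))) (Im z)) \<longlonglongrightarrow> z" by simp
    moreover have "Complex (Re z * (1 - inverse (real (Suc n)))) (Im z) \<in> box_at {0..<T} {0..1}" for n
    proof -
      define a where "a = inverse (real (Suc n))"
      have a: "0 < a" "a \<le> 1" by (simp_all add: a_def field_simps)
      have r: "0 \<le> Re z" "Re z \<le> T" using z by (auto simp: box_at_def)
      have "0 \<le> Re z * (1 - a)" using a r by simp
      moreover have "Re z * (1 - a) < T"
      proof (cases "Re z = 0")
        case False
        then have "0 < Re z * a" using a r by simp
        then show ?thesis using r by (simp add: algebra_simps)
      qed (use assms in simp)
      ultimately have "0 \<le> Re z * (1 - inverse (real (Suc n)))" "Re z * (1 - inverse (real (Suc n))) < T"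
        by (simp_all add: a_def)
      then show ?thesis using z by (simp add: box_at_def)
    qed
    ultimately show "z \<in> closure (box_at {0..<T} {0..1})"
      unfolding closure_sequential
      by (intro exI[of _ "\<lambda>n. Complex (Re z * (1 - inverse (real (Suc n)))) (Im z)"]) simp
  qed
qed

context local_homeo begin

text \<open>The vertical segments over \<open>t\<close> near a lifted one lift as well, with end points on the given
  lifts \<open>\<alpha>\<close> and \<open>\<beta>\<close> of the horizontal edges.\<close>

lemma lifted_segment_nearby:
  assumes al: "section_on F (box_at {0..1} {0}) \<alpha>" and be: "section_on F (box_at {0..1} {1}) \<beta>"
    and t: "t \<in> {0..1}" and s: "section_on F (box_at {t} {0..1}) \<sigma>"
    and e: "\<sigma> (of_real t) = \<alpha> (of_real t)" "\<sigma> (Complex t 1) = \<beta> (Complex t 1)"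
  obtains \<epsilon> \<Psi> where "\<epsilon> > 0" "section_on F (box_at {t-\<epsilon><..<t+\<epsilon>} {0..1}) \<Psi>" "\<And>z. z \<in> box_at {t} {0..1} \<Longrightarrow> \<Psi> z = \<sigma> z"
    "\<And>t'. t' \<in> {0..1} \<Longrightarrow> \<bar>t' - t\<bar> < \<epsilon> \<Longrightarrow> \<Psi> (of_real t') = \<alpha> (of_real t') \<and> \<Psi> (Complex t' 1) = \<beta> (Complex t' 1)"
proof -
  have cs: "compact (box_at {t} {0..1})" using compact_box_at[of t t 0 1] by simp
  obtain \<epsilon> \<Psi> where P: "\<epsilon> > 0" "section_on F (\<Union>q\<in>box_at {t} {0..1}. ball q \<epsilon>) \<Psi>" "\<And>z. z \<in> box_at {t} {0..1} \<Longrightarrow> \<Psi> z = \<sigma> z"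
    using section_extends[OF cs s] by blast
  have "box_at {t-\<epsilon><..<t+\<epsilon>} {0..1} \<subseteq> (\<Union>q\<in>box_at {t} {0..1}. ball q \<epsilon>)"
  proof
    fix z assume z: "z \<in> box_at {t-\<epsilon><..<t+\<epsilon>} {0..1}"
    then have "Complex t (Im z) \<in> box_at {t} {0..1}" by (simp add: box_at_def)
    moreover have "dist (Complex t (Im z)) z < \<epsilon>"
    proof -
      have "dist (Complex t (Im z)) z = \<bar>t - Re z\<bar>" by (simp add: dist_norm cmod_def)
      then show ?thesis using z by (auto simp: box_at_def)
    qed
    ultimately show "z \<in> (\<Union>q\<in>box_at {t} {0..1}. ball q \<epsilon>)" by auto
  qed
  then have sP: "section_on F (box_at {t-\<epsilon><..<t+\<epsilon>} {0..1}) \<Psi>" using P(2) section_on_subset by blast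
  have uniq: "\<Psi> z = \<gamma> z" if g: "section_on F (box_at {0..1} {c}) \<gamma>" and c: "c \<in> {0..1}" and eq: "\<sigma> (Complex t c) = \<gamma> (Complex t c)"
    and z: "z \<in> box_at {0..1} {c}" "\<bar>Re z - t\<bar> < \<epsilon>" for \<gamma> c z
  proof -
    have zz: "z \<in> box_at ({0..1} \<inter> {t-\<epsilon><..<t+\<epsilon>}) {c}" using z by (auto simp: box_at_def)
    have s1: "section_on F (box_at ({0..1} \<inter> {t-\<epsilon><..<t+\<epsilon>}) {c}) \<Psi>"
      by (rule section_on_subset[OF sP]) (use c in \<open>auto simp: box_at_def\<close>)
    have s2: "section_on F (box_at ({0..1} \<inter> {t-\<epsilon><..<t+\<epsilon>}) {c}) \<gamma>"
      by (rule section_on_subset[OF g]) (auto simp: box_at_def)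
    have cv: "convex (box_at ({0..1} \<inter> {t-\<epsilon><..<t+\<epsilon>}) {c})" by (intro convex_box_at convex_Int) auto
    show ?thesis
      by (rule section_unique_convex[OF cv s1 s2 _ _ zz, of "Complex t c"])
         (use t c P eq in \<open>auto simp: box_at_def\<close>)
  qed
  have "\<Psi> (of_real t') = \<alpha> (of_real t') \<and> \<Psi> (Complex t' 1) = \<beta> (Complex t' 1)" if "t' \<in> {0..1}" "\<bar>t' - t\<bar> < \<epsilon>" for t'
    using uniq[OF al, of "of_real t'"] uniq[OF be, of "Complex t' 1"] that e by (auto simp: box_at_def complex_of_real_def)
  then show ?thesis using that P sP by blast
qed

text \<open>If all segments over an interval lift, uniqueness glues the lifts to one section.\<close>

lemma glue_lifted_segments:
  assumes al: "section_on F (box_at {0..1} {0}) \<alpha>" and be: "section_on F (box_at {0..1} {1}) \<beta>"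
    and J: "J \<subseteq> {0..1}"
    and s: "\<And>t. t \<in> J \<Longrightarrow> section_on F (box_at {t} {0..1}) (\<sigma> t)"
    and e: "\<And>t. t \<in> J \<Longrightarrow> \<sigma> t (of_real t) = \<alpha> (of_real t)" "\<And>t. t \<in> J \<Longrightarrow> \<sigma> t (Complex t 1) = \<beta> (Complex t 1)"
  shows "section_on F (box_at J {0..1}) (\<lambda>z. \<sigma> (Re z) z)"
proof (rule section_on_open_Un)
  fix z assume z: "z \<in> box_at J {0..1}"
  define t where "t = Re z"
  have t: "t \<in> J" "t \<in> {0..1}" using z J by (auto simp: t_def box_at_def)
  obtain \<epsilon> \<Psi> where P: "\<epsilon> > 0" "section_on F (box_at {t-\<epsilon><..<t+\<epsilon>} {0..1}) \<Psi>" "\<And>z. z \<in> box_at {t} {0..1} \<Longrightarrow> \<Psi> z = \<sigma> t z"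
    "\<And>t'. t' \<in> {0..1} \<Longrightarrow> \<bar>t' - t\<bar> < \<epsilon> \<Longrightarrow> \<Psi> (of_real t') = \<alpha> (of_real t') \<and> \<Psi> (Complex t' 1) = \<beta> (Complex t' 1)"
    using lifted_segment_nearby[OF al be t(2) s[OF t(1)] e(1)[OF t(1)] e(2)[OF t(1)]] by blast
  have sub: "box_at J {0..1} \<inter> ball z \<epsilon> \<subseteq> box_at {t-\<epsilon><..<t+\<epsilon>} {0..1}"
  proof
    fix y assume y: "y \<in> box_at J {0..1} \<inter> ball z \<epsilon>"
    have "\<bar>Re (y - z)\<bar> \<le> norm (y - z)" by (rule abs_Re_le_cmod)
    then have "\<bar>Re y - t\<bar> < \<epsilon>" using y by (simp add: t_def dist_norm norm_minus_commute)
    then show "y \<in> box_at {t-\<epsilon><..<t+\<epsilon>} {0..1}" using y by (auto simp: box_at_def)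
  qed
  have "section_on F (box_at J {0..1} \<inter> ball z \<epsilon>) \<Psi>" by (rule section_on_subset[OF P(2) sub])
  then have "section_on F (box_at J {0..1} \<inter> ball z \<epsilon>) (\<lambda>z. \<sigma> (Re z) z)"
  proof (rule section_on_cong)
    fix y assume y: "y \<in> box_at J {0..1} \<inter> ball z \<epsilon>"
    have yJ: "Re y \<in> J" "\<bar>Re y - t\<bar> < \<epsilon>" "Re y \<in> {0..1}" using y sub J by (auto simp: box_at_def)
    have s2: "section_on F (box_at {Re y} {0..1}) \<Psi>"
      by (rule section_on_subset[OF P(2)]) (use yJ in \<open>auto simp: box_at_def\<close>)
    have cv: "convex (box_at {Re y} {0..1})" by (intro convex_box_at) auto
    show "\<sigma> (Re y) y = \<Psi> y"
      by (rule section_unique_convex[OF cv s[OF yJ(1)] s2, of "of_real (Re y)"])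
         (use y yJ e(1)[OF yJ(1)] P(4)[of "Re y"] in \<open>auto simp: box_at_def\<close>)
  qed
  then show "\<exists>e>0. section_on F (box_at J {0..1} \<inter> ball z e) (\<lambda>z. \<sigma> (Re z) z)" using P by blast
qed

text \<open>The first segment that does not lift: the lifts of the earlier ones fill the rectangle up to it, and
  escape to infinity exactly along a nonempty compact part \<open>K\<close> of its interior.\<close>

lemma sweep_rectangle:
  assumes al: "section_on F (box_at {0..1} {0}) \<alpha>" and be: "section_on F (box_at {0..1} {1}) \<beta>"
    and s: "section_on F (box_at {0} {0..1}) \<sigma>" "\<sigma> 0 = \<alpha> 0" "\<sigma> \<i> = \<beta> \<i>"
  shows "(\<exists>\<Phi>. section_on F (box_at {0..1} {0..1}) \<Phi> \<and> (\<forall>z\<in>box_at {0..1} {0}. \<Phi> z = \<alpha> z) \<and> (\<forall>z\<in>box_at {0..1} {1}. \<Phi> z = \<beta> z))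
   \<or> (\<exists>T K \<Phi>. 0 < T \<and> T \<le> 1 \<and> compact K \<and> K \<noteq> {} \<and> K \<subseteq> box_at {T} {0<..<1} \<and>
        section_on F (box_at {0..T} {0..1} - K) \<Phi> \<and>
        (\<forall>k\<in>K. filterlim \<Phi> at_infinity (at k within box_at {0..T} {0..1} - K)) \<and>
        (\<forall>z\<in>box_at {0..T} {0}. \<Phi> z = \<alpha> z) \<and> (\<forall>z\<in>box_at {0..T} {1}. \<Phi> z = \<beta> z))"
proof -
  define good where "good = (\<lambda>t \<sigma>. section_on F (box_at {t} {0..1}) \<sigma> \<and> \<sigma> (of_real t) = \<alpha> (of_real t) \<and> \<sigma> (Complex t 1) = \<beta> (Complex t 1))"
  have edge: "\<Phi> z = \<gamma> z" if "section_on F (box_at J {0..1}) \<Phi>" "section_on F (box_at {0..1} {c}) \<gamma>" "\<Phi> a = \<gamma> a"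
      "a \<in> box_at J {c}" "z \<in> box_at J {c}" "convex J" "J \<subseteq> {0..1}" "c \<in> {0..1}" for \<Phi> \<gamma> c a z J
  proof -
    have s1: "section_on F (box_at J {c}) \<Phi>" by (rule section_on_subset[OF that(1)]) (use that in \<open>auto simp: box_at_def\<close>)
    have s2: "section_on F (box_at J {c}) \<gamma>" by (rule section_on_subset[OF that(2)]) (use that in \<open>auto simp: box_at_def\<close>)
    show ?thesis by (rule section_unique_convex[OF _ s1 s2 that(4,3,5)]) (use that in \<open>auto intro: convex_box_at\<close>)
  qed
  have i_eq: "Complex 0 1 = \<i>" by (simp add: complex_eq_iff)
  have g0: "good 0 \<sigma>" using s by (simp add: good_def i_eq)
  show ?thesis
  proof (cases "\<forall>t\<in>{0..1}. \<exists>\<sigma>. good t \<sigma>")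
    case True
    then obtain \<tau> where tau: "\<And>t. t \<in> {0..1} \<Longrightarrow> good t (\<tau> t)" by metis
    let ?P = "\<lambda>z. \<tau> (Re z) z"
    have sP: "section_on F (box_at {0..1} {0..1}) ?P"
      by (rule glue_lifted_segments[OF al be]) (use tau in \<open>auto simp: good_def\<close>)
    have "?P z = \<alpha> z" if "z \<in> box_at {0..1} {0}" for z
      by (rule edge[OF sP al, of 0]) (use that tau[of 0] in \<open>auto simp: good_def box_at_def\<close>)
    moreover have "?P z = \<beta> z" if "z \<in> box_at {0..1} {1}" for z
      by (rule edge[OF sP be, of \<i>]) (use that tau[of 0] in \<open>auto simp: good_def box_at_def i_eq\<close>)
    ultimately show ?thesis using sP by (intro disjI1 exI[of _ ?P]) blast
  next
    case False
    define bad where "bad = {t\<in>{0..1}. \<not>(\<exists>\<sigma>. good t \<sigma>)}"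
    have bne: "bad \<noteq> {}" using False by (auto simp: bad_def)
    have op: "\<exists>\<epsilon>>0. \<forall>t'\<in>{0..1}. \<bar>t' - t\<bar> < \<epsilon> \<longrightarrow> t' \<notin> bad" if t: "t \<in> {0..1}" "t \<notin> bad" for t
    proof -
      obtain \<sigma>' where g: "good t \<sigma>'" using t by (auto simp: bad_def)
      obtain \<epsilon> \<Psi> where P: "\<epsilon> > 0" "section_on F (box_at {t-\<epsilon><..<t+\<epsilon>} {0..1}) \<Psi>"
        "\<And>t'. t' \<in> {0..1} \<Longrightarrow> \<bar>t' - t\<bar> < \<epsilon> \<Longrightarrow> \<Psi> (of_real t') = \<alpha> (of_real t') \<and> \<Psi> (Complex t' 1) = \<beta> (Complex t' 1)"
        using lifted_segment_nearby[OF al be t(1)] g unfolding good_def by metis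
      have "good t' \<Psi>" if t': "t' \<in> {0..1}" "\<bar>t' - t\<bar> < \<epsilon>" for t'
      proof -
        have "section_on F (box_at {t'} {0..1}) \<Psi>"
          by (rule section_on_subset[OF P(2)]) (use t' in \<open>auto simp: box_at_def\<close>)
        then show ?thesis using P(3)[OF t'] by (simp add: good_def)
      qed
      then show ?thesis using P(1) unfolding bad_def by blast
    qed
    \<comment> \<open>the infimum is attained, because lifting is an open condition\<close>
    define T where "T = Inf bad"
    have bdd: "bdd_below bad" by (rule bdd_belowI[of _ 0]) (auto simp: bad_def)
    have T01: "T \<in> {0..1}"
    proof -
      obtain b where b: "b \<in> bad" using bne by blast
      have "T \<le> b" using cInf_lower[OF b bdd] by (simp add: T_def)
      moreover have "0 \<le> T" unfolding T_def by (rule cInf_greatest[OF bne]) (auto simp: bad_def)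
      ultimately show ?thesis using b by (auto simp: bad_def)
    qed
    have Tbad: "T \<in> bad"
    proof (rule ccontr)
      assume "T \<notin> bad"
      then obtain \<epsilon> where e: "\<epsilon> > 0" "\<forall>t'\<in>{0..1}. \<bar>t' - T\<bar> < \<epsilon> \<longrightarrow> t' \<notin> bad" using op[OF T01] by blast
      then obtain t' where t': "t' \<in> bad" "t' < T + \<epsilon>" using cInf_lessD[OF bne, of "T + \<epsilon>"] by (auto simp: T_def)
      moreover have "T \<le> t'" using cInf_lower[OF t'(1) bdd] by (simp add: T_def)
      ultimately have "\<bar>t' - T\<bar> < \<epsilon>" "t' \<in> {0..1}" by (auto simp: bad_def)
      then show False using e(2) t'(1) by blast
    qed
    have "0 \<notin> bad" using g0 by (auto simp: bad_def)
    then have T0: "0 < T" using Tbad T01 by (metis atLeastAtMost_iff order_le_less)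
    have before: "\<exists>\<sigma>. good t \<sigma>" if "t \<in> {0..<T}" for t
    proof (rule ccontr)
      assume "\<not> ?thesis"
      then have "t \<in> bad" using that T01 by (auto simp: bad_def)
      then have "T \<le> t" using cInf_lower[OF _ bdd] by (simp add: T_def)
      then show False using that by simp
    qed
    then obtain \<tau> where tau: "\<And>t. t \<in> {0..<T} \<Longrightarrow> good t (\<tau> t)" by metis
    let ?P = "\<lambda>z. \<tau> (Re z) z"
    let ?S = "box_at {0..<T} {0..1}"
    have sP: "section_on F ?S ?P"
      by (rule glue_lifted_segments[OF al be]) (use tau T01 in \<open>auto simp: good_def\<close>)
    have clS: "closure ?S = box_at {0..T} {0..1}" using closure_box_at[OF T0] .
    have Eeq: "closure ?S - ?S = box_at {T} {0..1}" unfolding clS using T0 by (auto simp: box_at_def)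
    have cE: "closed (closure ?S - ?S)" unfolding Eeq by (intro closed_box_at) auto
    define K where "K = {k \<in> closure ?S - ?S. filterlim ?P at_infinity (at k within ?S)}"
    obtain \<Phi> where Phi: "section_on F (closure ?S - K) \<Phi>" "\<And>z. z \<in> ?S \<Longrightarrow> \<Phi> z = ?P z" "closed K"
      "\<And>k. k \<in> K \<Longrightarrow> filterlim \<Phi> at_infinity (at k within closure ?S - K)"
      using section_completion[OF _ sP cE K_def] by (metis convex_box_at convex_real_interval(7) convex_real_interval(5))
    have KE: "K \<subseteq> box_at {T} {0..1}" using K_def Eeq by blast
    have cK: "compact K"
      using KE Phi(3) compact_box_at[of T T 0 1] by (metis atLeastAtMost_singleton compact_Int_closed inf.absorb_iff2)
    have corner: "Complex T c \<notin> K \<and> (\<forall>z\<in>box_at {0..T} {c}. \<Phi> z = \<gamma> z)"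
      if c: "c \<in> {0..1}" and g: "section_on F (box_at {0..1} {c}) \<gamma>" and tg: "\<And>t. t \<in> {0..<T} \<Longrightarrow> \<tau> t (Complex t c) = \<gamma> (Complex t c)" for c \<gamma>
    proof -
      let ?A = "box_at {0..<T} {c}" and ?x = "\<lambda>n. Complex (T * (1 - inverse (real (Suc n)))) c"
      have lx: "?x \<longlonglongrightarrow> Complex T c"
        using tendsto_Complex[OF tendsto_mult[OF tendsto_const tendsto_diff[OF tendsto_const LIMSEQ_inverse_real_of_nat]] tendsto_const, of T 1 c] by simp
      have xA: "?x n \<in> ?A" for n using T0 by (auto simp: box_at_def field_simps)
      have xne: "?x n \<noteq> Complex T c" for n using T0 by (auto simp: field_simps)
      have cg: "continuous_on (box_at {0..1} {c}) \<gamma>" using g by (simp add: section_on_def)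
      have lg: "(\<lambda>n. \<gamma> (?x n)) \<longlonglongrightarrow> \<gamma> (Complex T c)"
        by (rule continuous_on_tendsto_compose[OF cg lx]) (use T01 xA in \<open>auto simp: box_at_def intro!: always_eventually less_imp_le dest: order_less_le_trans\<close>)
      have eqg: "\<Phi> (?x n) = \<gamma> (?x n)" for n
        using Phi(2)[of "?x n"] xA[of n] c tg by (auto simp: box_at_def)
      have nK: "Complex T c \<notin> K"
      proof
        assume "Complex T c \<in> K"
        then have "filterlim \<Phi> at_infinity (at (Complex T c) within closure ?S - K)" using Phi(4) by blast
        moreover have "filterlim ?x (at (Complex T c) within closure ?S - K) sequentially"
        proof (subst filterlim_at, intro conjI lx)
          have "?x n \<in> closure ?S - K \<and> ?x n \<noteq> Complex T c" for n
            unfolding clS using xA[of n] xne[of n] c KE by (auto simp: box_at_def)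
          then show "eventually (\<lambda>n. ?x n \<in> closure ?S - K \<and> ?x n \<noteq> Complex T c) sequentially" by simp
        qed
        ultimately have "filterlim (\<lambda>n. \<Phi> (?x n)) at_infinity sequentially" by (rule filterlim_compose)
        then show False using lg eqg not_tendsto_and_filterlim_at_infinity[OF sequentially_bot lg] by simp
      qed
      have sub: "box_at {0..T} {c} \<subseteq> closure ?S - K"
      proof
        fix z assume z: "z \<in> box_at {0..T} {c}"
        have "z \<notin> K"
        proof
          assume zK: "z \<in> K"
          then have "Re z = T" using KE by (auto simp: box_at_def)
          then have "z = Complex T c" using z by (simp add: box_at_def complex_eq_iff)
          then show False using zK nK by simp
        qed
        then show "z \<in> closure ?S - K" unfolding clS using z c by (auto simp: box_at_def)
      qed
      have s1: "section_on F (box_at {0..T} {c}) \<Phi>" by (rule section_on_subset[OF Phi(1) sub])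
      have s2: "section_on F (box_at {0..T} {c}) \<gamma>" by (rule section_on_subset[OF g]) (use T01 in \<open>auto simp: box_at_def\<close>)
      have cv: "convex (box_at {0..T} {c})" by (intro convex_box_at) auto
      have "\<Phi> z = \<gamma> z" if "z \<in> box_at {0..T} {c}" for z
        by (rule section_unique_convex[OF cv s1 s2 _ eqg that, of 0]) (use xA[of 0] in \<open>auto simp: box_at_def\<close>)
      then show ?thesis using nK by blast
    qed
    have c0: "Complex T 0 \<notin> K \<and> (\<forall>z\<in>box_at {0..T} {0}. \<Phi> z = \<alpha> z)"
      by (rule corner[OF _ al]) (use tau in \<open>auto simp: good_def complex_of_real_def\<close>)
    have c1: "Complex T 1 \<notin> K \<and> (\<forall>z\<in>box_at {0..T} {1}. \<Phi> z = \<beta> z)"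
      by (rule corner[OF _ be]) (use tau in \<open>auto simp: good_def\<close>)
    have Kne: "K \<noteq> {}"
    proof
      assume "K = {}"
      then have "section_on F (box_at {T} {0..1}) \<Phi>"
        using Phi(1) T0 unfolding clS by (auto elim!: section_on_subset simp: box_at_def)
      then have "good T \<Phi>" using c0 c1 T0 by (auto simp: good_def box_at_def complex_of_real_def)
      then show False using Tbad by (auto simp: bad_def)
    qed
    have Kin: "K \<subseteq> box_at {T} {0<..<1}"
    proof
      fix k assume k: "k \<in> K"
      then have "Re k = T" "0 \<le> Im k" "Im k \<le> 1" using KE by (auto simp: box_at_def)
      moreover have "Im k \<noteq> 0" "Im k \<noteq> 1" using c0 c1 k \<open>Re k = T\<close> by (metis complex_surj)+
      ultimately show "k \<in> box_at {T} {0<..<1}" by (simp add: box_at_def)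
    qed
    show ?thesis
      using T0 T01 cK Kne Kin Phi(1) Phi(4) c0 c1 unfolding clS
      by (intro disjI2 exI[of _ T] exI[of _ K] exI[of _ \<Phi>]) auto
  qed
qed

end

definition pmap :: "complex \<Rightarrow> complex \<Rightarrow> complex \<Rightarrow> complex \<Rightarrow> complex" where
  "pmap a w l \<zeta> = a + of_real (Re \<zeta>) * w + of_real (Im \<zeta>) * l"

text \<open>Cramer's rule for the inverse of \<open>pmap a w l\<close>.\<close>

definition pinv :: "complex \<Rightarrow> complex \<Rightarrow> complex \<Rightarrow> complex \<Rightarrow> complex" where
  "pinv a w l z = Complex (- Im (cnj l * (z - a)) / Im (cnj w * l)) (Im (cnj w * (z - a)) / Im (cnj w * l))"

abbreviation par :: "complex \<Rightarrow> complex \<Rightarrow> complex \<Rightarrow> real set \<Rightarrow> real set \<Rightarrow> complex set" where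
  "par a w l I J \<equiv> pmap a w l ` box_at I J"

lemma pinv_pmap [simp]: "Im (cnj w * l) \<noteq> 0 \<Longrightarrow> pinv a w l (pmap a w l \<zeta>) = \<zeta>"
  by (simp add: pinv_def pmap_def complex_eq_iff field_simps) (simp add: algebra_simps)?

lemma pmap_pinv [simp]:
  assumes "Im (cnj w * l) \<noteq> 0" shows "pmap a w l (pinv a w l z) = z"
proof -
  define D where "D = Im (cnj w * l)"
  have D: "D \<noteq> 0" "D = Re w * Im l - Im w * Re l" using assms by (auto simp: D_def)
  have 1: "Im (cnj l * (z - a)) = Re l * Im (z - a) - Im l * Re (z - a)" by simp
  have 2: "Im (cnj w * (z - a)) = Re w * Im (z - a) - Im w * Re (z - a)" by simp
  have "Re (pmap a w l (pinv a w l z)) = Re a + (- (Re l * Im (z - a) - Im l * Re (z - a)) * Re w + (Re w * Im (z - a) - Im w * Re (z - a)) * Re l) / D"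
    unfolding pmap_def pinv_def 1 2 D_def[symmetric] by (simp add: add_divide_distrib)
  also have "- (Re l * Im (z - a) - Im l * Re (z - a)) * Re w + (Re w * Im (z - a) - Im w * Re (z - a)) * Re l = D * Re (z - a)"
    unfolding D(2) by algebra
  finally have r: "Re (pmap a w l (pinv a w l z)) = Re z" using D(1) by simp
  have "Im (pmap a w l (pinv a w l z)) = Im a + (- (Re l * Im (z - a) - Im l * Re (z - a)) * Im w + (Re w * Im (z - a) - Im w * Re (z - a)) * Im l) / D"
    unfolding pmap_def pinv_def 1 2 D_def[symmetric] by (simp add: add_divide_distrib)
  also have "- (Re l * Im (z - a) - Im l * Re (z - a)) * Im w + (Re w * Im (z - a) - Im w * Re (z - a)) * Im l = D * Im (z - a)"
    unfolding D(2) by algebra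
  finally have "Im (pmap a w l (pinv a w l z)) = Im z" using D(1) by simp
  then show ?thesis using r by (simp add: complex_eq_iff)
qed

lemma continuous_pmap: "continuous_on S (pmap a w l)"
  unfolding pmap_def by (intro continuous_intros)

lemma continuous_pinv: "continuous_on S (pinv a w l)"
proof -
  have "continuous_on S (\<lambda>z. - Im (cnj l * (z - a)) / Im (cnj w * l))"
    "continuous_on S (\<lambda>z. Im (cnj w * (z - a)) / Im (cnj w * l))"
    unfolding divide_inverse by (intro continuous_intros)+
  then have "continuous_on S (\<lambda>z. Complex (- Im (cnj l * (z - a)) / Im (cnj w * l)) (Im (cnj w * (z - a)) / Im (cnj w * l)))"
    by (intro continuous_on_Complex)
  then show ?thesis by (simp add: pinv_def[abs_def])
qed

lemma Re_Im_rmul [simp]: "Re (complex_of_real r * z) = r * Re z" "Im (complex_of_real r * z) = r * Im z"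
  by simp_all

lemma convex_par: assumes "convex I" "convex J" shows "convex (par a w l I J)"
proof (rule convexI)
  fix x y u v assume x: "x \<in> par a w l I J" and y: "y \<in> par a w l I J" and uv: "0 \<le> u" "0 \<le> v" "u + v = (1::real)"
  obtain \<xi> \<eta> where e: "\<xi> \<in> box_at I J" "\<eta> \<in> box_at I J" "x = pmap a w l \<xi>" "y = pmap a w l \<eta>" using x y by blast
  have "u *\<^sub>R \<xi> + v *\<^sub>R \<eta> \<in> box_at I J" by (rule convexD[OF convex_box_at]) (use assms e uv in auto)
  moreover have "pmap a w l (u *\<^sub>R \<xi> + v *\<^sub>R \<eta>) = of_real (u + v) * a + of_real u * (pmap a w l \<xi> - a) + of_real v * (pmap a w l \<eta> - a)"
    unfolding uv by (simp add: pmap_def algebra_simps)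
  then have "pmap a w l (u *\<^sub>R \<xi> + v *\<^sub>R \<eta>) = u *\<^sub>R x + v *\<^sub>R y"
    by (simp add: e scaleR_conv_of_real algebra_simps)
  ultimately show "u *\<^sub>R x + v *\<^sub>R y \<in> par a w l I J" by (metis imageI)
qed

context local_homeo begin

lemma local_homeo_pinv:
  assumes "Im (cnj w * l) \<noteq> 0" shows "local_homeo (\<lambda>z. pinv a w l (F z))"
proof
  show "continuous_on UNIV (\<lambda>z. pinv a w l (F z))"
    by (rule continuous_on_compose2[OF continuous_pinv[of UNIV] cont_F]) simp
  fix v
  obtain e where e: "e > 0" "inj_on F (ball v e)" using locally_inj by blast
  have "inj_on (\<lambda>z. pinv a w l (F z)) (ball v e)"
    by (rule inj_onI) (metis assms e(2) inj_onD pmap_pinv)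
  then show "\<exists>e>0. inj_on (\<lambda>z. pinv a w l (F z)) (ball v e)" using e by blast
qed

text \<open>The affine coordinates of a parallelogram reduce this to the rectangle.\<close>

lemma sweep:
  assumes D: "Im (cnj w * l) \<noteq> 0"
    and al: "section_on F (par a w l {0..1} {0}) \<alpha>" and be: "section_on F (par a w l {0..1} {1}) \<beta>"
    and s: "section_on F (par a w l {0} {0..1}) \<sigma>" "\<sigma> a = \<alpha> a" "\<sigma> (a + l) = \<beta> (a + l)"
  shows "(\<exists>\<Phi>. section_on F (par a w l {0..1} {0..1}) \<Phi> \<and> (\<forall>z\<in>par a w l {0..1} {0}. \<Phi> z = \<alpha> z) \<and> (\<forall>z\<in>par a w l {0..1} {1}. \<Phi> z = \<beta> z))
   \<or> (\<exists>T K \<Phi>. 0 < T \<and> T \<le> 1 \<and> compact K \<and> K \<noteq> {} \<and> K \<subseteq> par a w l {T} {0<..<1} \<and>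
        section_on F (par a w l {0..T} {0..1} - K) \<Phi> \<and>
        (\<forall>k\<in>K. filterlim \<Phi> at_infinity (at k within par a w l {0..T} {0..1} - K)) \<and>
        (\<forall>z\<in>par a w l {0..T} {0}. \<Phi> z = \<alpha> z) \<and> (\<forall>z\<in>par a w l {0..T} {1}. \<Phi> z = \<beta> z))"
proof -
  let ?p = "pmap a w l" and ?q = "pinv a w l"
  define G where "G = (\<lambda>z. ?q (F z))"
  interpret G: local_homeo G unfolding G_def by (rule local_homeo_pinv[OF D])
  have injp: "inj ?p" by (metis D injI pinv_pmap)
  have to_G: "section_on G S (\<lambda>\<zeta>. \<Phi> (?p \<zeta>))" if "section_on F (?p ` S) \<Phi>" for S \<Phi>
    using that D unfolding section_on_def G_def
    by (auto intro!: continuous_on_compose2[of "?p ` S" \<Phi>] continuous_pmap)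
  have from_G: "section_on F (?p ` S) (\<lambda>z. \<Psi> (?q z))" if "section_on G S \<Psi>" for S \<Psi>
  proof -
    have "F (\<Psi> \<zeta>) = ?p \<zeta>" if "\<zeta> \<in> S" for \<zeta>
      using \<open>section_on G S \<Psi>\<close> that D unfolding section_on_def G_def by (metis pmap_pinv)
    then show ?thesis
      using that D unfolding section_on_def
      by (auto intro!: continuous_on_compose2[of S \<Psi>] continuous_pinv)
  qed
  have p0: "?p 0 = a" "?p \<i> = a + l" by (simp_all add: pmap_def)
  have diff: "?p ` (A - B) = ?p ` A - ?p ` B" for A B using injp by (rule image_set_diff)
  have pq: "?q (?p \<zeta>) = \<zeta>" for \<zeta> by (rule pinv_pmap[OF D])
  have edge: "\<forall>z\<in>?p ` S. \<Psi> (?q z) = \<gamma> z" if "\<forall>\<zeta>\<in>S. \<Psi> \<zeta> = \<gamma> (?p \<zeta>)" for S \<Psi> and \<gamma> :: "complex \<Rightarrow> complex"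
  proof
    fix z assume "z \<in> ?p ` S"
    then obtain \<zeta> where "\<zeta> \<in> S" "z = ?p \<zeta>" by blast
    then show "\<Psi> (?q z) = \<gamma> z" using that pq[of \<zeta>] by simp
  qed
  have s': "\<sigma> (?p 0) = \<alpha> (?p 0)" "\<sigma> (?p \<i>) = \<beta> (?p \<i>)" using s by (simp_all add: p0)
  from G.sweep_rectangle[OF to_G[OF al] to_G[OF be] to_G[OF s(1)] s'] show ?thesis
  proof (elim disjE exE conjE, goal_cases)
    case (1 \<Psi>)
    then show ?case
      by (intro disjI1 exI[of _ "\<lambda>z. \<Psi> (?q z)"] conjI from_G edge)
  next
    case (2 T K \<Psi>)
    let ?\<Phi> = "\<lambda>z. \<Psi> (?q z)"
    have lim: "filterlim ?\<Phi> at_infinity (at k within ?p ` box_at {0..T} {0..1} - ?p ` K)" if k: "k \<in> ?p ` K" for k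
    proof -
      obtain \<kappa> where kap: "\<kappa> \<in> K" "k = ?p \<kappa>" using k by blast
      have "filterlim ?q (at \<kappa> within box_at {0..T} {0..1} - K) (at k within ?p ` box_at {0..T} {0..1} - ?p ` K)"
      proof (subst filterlim_at, intro conjI)
        have "continuous (at k) ?q" using continuous_pinv[of UNIV] by (simp add: continuous_on_eq_continuous_at)
        then show "(?q \<longlongrightarrow> \<kappa>) (at k within ?p ` box_at {0..T} {0..1} - ?p ` K)"
          using kap(2) pq[of \<kappa>] continuous_at_imp_continuous_at_within[of k ?q] by (simp add: continuous_within)
        show "eventually (\<lambda>x. ?q x \<in> box_at {0..T} {0..1} - K \<and> ?q x \<noteq> \<kappa>) (at k within ?p ` box_at {0..T} {0..1} - ?p ` K)"
          unfolding eventually_at_filter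
        proof (intro always_eventually allI impI, elim DiffE imageE)
          fix x \<xi> assume x: "x \<noteq> k" "x \<notin> ?p ` K" "x = ?p \<xi>" "\<xi> \<in> box_at {0..T} {0..1}"
          then have "\<xi> \<notin> K" "\<xi> \<noteq> \<kappa>" using kap by auto
          then show "?q x \<in> box_at {0..T} {0..1} - K \<and> ?q x \<noteq> \<kappa>" using x pq[of \<xi>] by simp
        qed
      qed
      then show ?thesis by (rule filterlim_compose[OF bspec[OF 2(7) kap(1)]])
    qed
    show ?case
    proof (intro disjI2 exI[of _ T] exI[of _ "?p ` K"] exI[of _ ?\<Phi>] conjI)
      show "compact (?p ` K)" using 2 by (intro compact_continuous_image continuous_pmap) auto
      show "section_on F (?p ` box_at {0..T} {0..1} - ?p ` K) ?\<Phi>" using from_G[OF 2(6)] by (simp add: diff)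
      show "?p ` K \<subseteq> ?p ` box_at {T} {0<..<1}" using 2 by (intro image_mono)
      show "\<forall>k\<in>?p ` K. filterlim ?\<Phi> at_infinity (at k within ?p ` box_at {0..T} {0..1} - ?p ` K)" using lim by blast
    qed (use 2 in \<open>simp_all add: edge\<close>)
  qed
qed

end

section \<open>Half-Reeb regions\<close>

text \<open>A half-Reeb region: a compact convex set with a section that is defined up to a flat edge
  \<open>Re (m z) = h\<close> except for a part \<open>K\<close> of the interior of that edge, where it escapes to infinity. The
  preimages of the segments parallel to the edge are compact arcs whose limit is not.\<close>

definition half_reeb :: "(complex \<Rightarrow> complex) \<Rightarrow> complex \<Rightarrow> complex set \<Rightarrow> real \<Rightarrow> complex set \<Rightarrow> (complex \<Rightarrow> complex) \<Rightarrow> bool" where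
  "half_reeb F m \<Delta> h K \<Phi> \<longleftrightarrow> m \<noteq> 0 \<and> compact \<Delta> \<and> convex \<Delta> \<and> (\<forall>z\<in>\<Delta>. Re (m * z) \<le> h) \<and>
     compact K \<and> K \<noteq> {} \<and> (\<forall>k\<in>K. Re (m * k) = h \<and> (\<exists>\<rho>>0. ball k \<rho> \<inter> {z. Re (m * z) \<le> h} \<subseteq> \<Delta>)) \<and>
     section_on F (\<Delta> - K) \<Phi> \<and> (\<forall>k\<in>K. filterlim \<Phi> at_infinity (at k within \<Delta> - K))"

lemma half_reeb_scale:
  assumes "half_reeb F m \<Delta> h K \<Phi>" "r > 0" shows "half_reeb F (of_real r * m) \<Delta> (r * h) K \<Phi>"
  using assms by (simp add: half_reeb_def mult.assoc)

text \<open>An unsuccessful sweep by segments in direction \<open>l\<close> is a half-Reeb region for every linear functional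
  that is constant on them and increases along the sweep.\<close>

lemma half_reeb_parallelogram:
  assumes T: "0 < T" and D: "Im (cnj w * l) \<noteq> 0" and m: "m \<noteq> 0" "Re (m * l) = 0" "Re (m * w) > 0"
    and K: "compact K" "K \<noteq> {}" "K \<subseteq> par a w l {T} {0<..<1}"
    and s: "section_on F (par a w l {0..T} {0..1} - K) \<Phi>"
      "\<forall>k\<in>K. filterlim \<Phi> at_infinity (at k within par a w l {0..T} {0..1} - K)"
  shows "half_reeb F m (par a w l {0..T} {0..1}) (Re (m * (a + of_real T * w))) K \<Phi>"
proof -
  have Re_m: "Re (m * pmap a w l \<zeta>) = Re (m * a) + Re \<zeta> * Re (m * w)" for \<zeta>
  proof -
    have "m * pmap a w l \<zeta> = m * a + of_real (Re \<zeta>) * (m * w) + of_real (Im \<zeta>) * (m * l)"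
      by (simp add: pmap_def algebra_simps)
    then show ?thesis using m(2) by (simp del: times_complex.sel)
  qed
  have h: "Re (m * (a + of_real T * w)) = Re (m * a) + T * Re (m * w)"
    using Re_m[of "of_real T"] by (simp add: pmap_def)
  have "\<exists>\<rho>>0. ball k \<rho> \<inter> {z. Re (m * z) \<le> Re (m * (a + of_real T * w))} \<subseteq> par a w l {0..T} {0..1}" if k: "k \<in> K" for k
  proof -
    obtain \<kappa> where kap: "\<kappa> \<in> box_at {T} {0<..<1}" "k = pmap a w l \<kappa>" using K(3) k by blast
    let ?O = "pinv a w l -` {\<zeta>. 0 < Re \<zeta> \<and> 0 < Im \<zeta> \<and> Im \<zeta> < 1}"
    have "open {\<zeta>. 0 < Re \<zeta> \<and> 0 < Im \<zeta> \<and> Im \<zeta> < 1}"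
      by (intro open_Collect_conj open_Collect_less continuous_intros)
    then have "open ?O" by (rule open_vimage) (rule continuous_pinv)
    moreover have "k \<in> ?O" using kap D T by (simp add: box_at_def)
    ultimately obtain \<rho> where r: "\<rho> > 0" "ball k \<rho> \<subseteq> ?O" by (meson open_contains_ball)
    have "z \<in> par a w l {0..T} {0..1}" if z: "z \<in> ball k \<rho>" "Re (m * z) \<le> Re (m * (a + of_real T * w))" for z
    proof -
      define \<zeta> where "\<zeta> = pinv a w l z"
      have zz: "z = pmap a w l \<zeta>" using D by (simp add: \<zeta>_def)
      have "0 < Re \<zeta>" "0 < Im \<zeta>" "Im \<zeta> < 1" using r z by (auto simp: \<zeta>_def)
      moreover have "Re \<zeta> \<le> T" using z(2) m(3) unfolding zz Re_m h by simp
      ultimately show ?thesis unfolding zz by (simp add: box_at_def)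
    qed
    then show ?thesis using r(1) by blast
  qed
  moreover have "Re (m * k) = Re (m * (a + of_real T * w))" if k: "k \<in> K" for k
  proof -
    obtain \<kappa> where kap: "\<kappa> \<in> box_at {T} {0<..<1}" "k = pmap a w l \<kappa>" using K(3) k by blast
    then show ?thesis unfolding kap(2) Re_m h by (simp add: box_at_def)
  qed
  moreover have "Re (m * z) \<le> Re (m * (a + of_real T * w))" if z: "z \<in> par a w l {0..T} {0..1}" for z
  proof -
    obtain \<zeta> where "\<zeta> \<in> box_at {0..T} {0..1}" "z = pmap a w l \<zeta>" using z by blast
    then show ?thesis using m(3) by (simp add: Re_m h box_at_def del: times_complex.sel)
  qed
  moreover have "compact (par a w l {0..T} {0..1})" by (intro compact_continuous_image continuous_pmap compact_box_at)
  moreover have "convex (par a w l {0..T} {0..1})" by (intro convex_par) auto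
  ultimately show ?thesis unfolding half_reeb_def using m K s by blast
qed

section \<open>The W-condition keeps half-Reeb regions in strips\<close>

text \<open>Conjugation by a rotation \<open>m\<close> preserves real eigenvalues and only turns the limit of the values, so the rotation
  survives only in the coordinate \<open>Re (m * w)\<close>.\<close>

definition complex_W :: "real \<Rightarrow> (real \<Rightarrow> real) \<Rightarrow> (complex \<Rightarrow> complex) \<Rightarrow> bool" where
  "complex_W s P F \<longleftrightarrow> (\<forall>m. norm m = 1 \<longrightarrow>
     \<not> (\<exists>w c T. (\<forall>k. s < norm (w k)) \<and> filterlim (\<lambda>k. Re (m * w k)) at_top sequentially \<and>
          (\<lambda>k. F (w k)) \<longlonglongrightarrow> T \<and>
          (\<forall>k. \<exists>D. (F has_derivative D) (at (w k)) \<and> real_eigenvalue D (c k)) \<and>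
          (\<lambda>k. c k * P (Re (m * w k))) \<longlonglongrightarrow> 0))"

locale W_homeo = local_homeo +
  fixes s :: real and P :: "real \<Rightarrow> real"
  assumes diff_F: "s < norm w \<Longrightarrow> F differentiable at w"
    and growth_P: "P \<in> growth_functions"
    and W: "complex_W s P F"

lemma Re_mult_cnj_self: "Re (m * cnj m) = (norm m)\<^sup>2"
  by (metis complex_norm_square Re_complex_of_real)

text \<open>The map \<open>D - c\<close> takes values in the kernel of the functional, so it is not surjective, hence not
  injective.\<close>

lemma left_eigenvector_real_eigenvalue:
  fixes D :: "complex \<Rightarrow> complex"
  assumes D: "linear D" and m: "m \<noteq> 0" and e: "\<And>h. Re (m * D h) = c * Re (m * h)"
  shows "real_eigenvalue D c"
proof -
  define E where "E = (\<lambda>h. D h - c *\<^sub>R h)"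
  have lE: "linear E" unfolding E_def using D
    by (intro linear_compose_sub linear_scaleR) auto
  have "\<not> surj E"
  proof
    assume "surj E"
    then obtain h where "E h = cnj m" by (metis surjD)
    moreover have "Re (m * E h) = 0" using e[of h] by (simp add: E_def algebra_simps)
    ultimately have "Re (m * cnj m) = 0" by simp
    then show False using m by (simp only: Re_mult_cnj_self) simp
  qed
  then have "\<not> inj E" using linear_inj_imp_surj[OF lE] by blast
  then obtain h where "h \<noteq> 0" "E h = 0" using linear_injective_0[OF lE] by blast
  then show ?thesis unfolding real_eigenvalue_def E_def by auto
qed

text \<open>A comparison principle for Dini derivatives. Jumps of the nondecreasing function \<open>\<mu>\<close> go up and only
  help.\<close>

lemma left_growth_comparison:
  fixes \<mu> G :: "real \<Rightarrow> real"
  assumes ab: "a \<le> b" and mono: "mono_on {a..b} \<mu>" and G: "continuous_on {a..b} G"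
    and loc: "\<And>x. a < x \<Longrightarrow> x \<le> b \<Longrightarrow> \<exists>d>0. \<forall>t. 0 < t \<and> t < d \<and> a \<le> x - t \<longrightarrow> G x - G (x - t) \<le> \<mu> x - \<mu> (x - t)"
  shows "G b - G a \<le> \<mu> b - \<mu> a"
proof -
  define S where "S = {x\<in>{a..b}. \<forall>y\<in>{x..b}. G b - G y \<le> \<mu> b - \<mu> y}"
  have bS: "b \<in> S" using ab by (simp add: S_def)
  have bdd: "bdd_below S" by (rule bdd_belowI[of _ a]) (simp add: S_def)
  define c where "c = Inf S"
  have c: "a \<le> c" "c \<le> b"
    unfolding c_def using bS cInf_lower[OF bS bdd] by (auto intro!: cInf_greatest simp: S_def)
  have above: "G b - G y \<le> \<mu> b - \<mu> y" if y: "c < y" "y \<le> b" for y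
  proof -
    obtain x where "x \<in> S" "x < y" using y cInf_lessD[of S y] bS by (auto simp: c_def)
    then show ?thesis using y by (auto simp: S_def)
  qed
  have atc: "G b - G c \<le> \<mu> b - \<mu> c"
  proof (cases "c = b")
    case False
    then have cb: "c < b" using c by simp
    have "continuous_on {c..b} G" using G c by (auto intro: continuous_on_subset)
    then have "continuous (at_right c) G" using continuous_on_Icc_at_rightD[OF _ cb] by (simp add: continuous_within)
    then have "((\<lambda>y. G b - G y) \<longlongrightarrow> G b - G c) (at_right c)"
      by (intro tendsto_intros) (simp add: continuous_within)
    moreover have "eventually (\<lambda>y. G b - G y \<le> \<mu> b - \<mu> c) (at_right c)"
      using eventually_at_right_less[of c] eventually_at_right_real[OF cb]
    proof eventually_elim
      case (elim y)
      then have "G b - G y \<le> \<mu> b - \<mu> y" using above by auto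
      moreover have "\<mu> c \<le> \<mu> y" using elim c by (intro mono_onD[OF mono]) auto
      ultimately show ?case by linarith
    qed
    ultimately show ?thesis using tendsto_upperbound by (metis trivial_limit_at_right_real)
  qed simp
  have "c = a"
  proof (rule ccontr)
    assume "c \<noteq> a"
    then have ac: "a < c" using c by simp
    then obtain d where d: "d > 0" "\<And>t. 0 < t \<Longrightarrow> t < d \<Longrightarrow> a \<le> c - t \<Longrightarrow> G c - G (c - t) \<le> \<mu> c - \<mu> (c - t)"
      using loc[of c] c by blast
    define e where "e = min d (c - a) / 2"
    have e: "0 < e" "e < d" "a \<le> c - e" using d(1) ac by (auto simp: e_def min_def field_simps)
    have "c - e \<in> S" unfolding S_def
    proof (intro CollectI conjI ballI)
      show "c - e \<in> {a..b}" using e c by auto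
      fix y assume y: "y \<in> {c - e..b}"
      show "G b - G y \<le> \<mu> b - \<mu> y"
      proof (cases "y < c")
        case True
        then have "G c - G (c - (c - y)) \<le> \<mu> c - \<mu> (c - (c - y))" using e y by (intro d(2)) auto
        then show ?thesis using atc by simp
      next
        case False
        then show ?thesis using above[of y] atc y by (cases "y = c") auto
      qed
    qed
    then have "c \<le> c - e" using cInf_lower[OF _ bdd] by (simp add: c_def)
    then show False using e by simp
  qed
  then show ?thesis using atc by simp
qed

text \<open>The integrals of \<open>1 / P\<close> exceed every bound only through integrable \<open>1 / P\<close>.\<close>

lemma growth_function_integral:
  assumes P: "P \<in> growth_functions"
  obtains N where "B < N" "2 < N" "(\<lambda>x. 1 / P x) integrable_on {2..N}" "M < integral {2..N} (\<lambda>x. 1 / P x)"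
proof -
  have pos: "\<And>x. x > 0 \<Longrightarrow> P x > 0" and mono: "mono_on {0<..} P"
    and big: "\<And>M. M > 0 \<Longrightarrow> \<exists>N. integral {2..N} (\<lambda>x. 1 / P x) > M"
    using P by (auto simp: growth_functions_def)
  define M' where "M' = max (max 1 M) ((\<bar>B\<bar> + 2) / P 2)"
  have "M' > 0" by (simp add: M'_def less_max_iff_disj)
  then obtain N where N: "integral {2..N} (\<lambda>x. 1 / P x) > M'" using big by blast
  have M1: "M' \<ge> 1" "M' \<ge> M" "M' \<ge> (\<bar>B\<bar> + 2) / P 2" by (auto simp: M'_def)
  have int: "(\<lambda>x. 1 / P x) integrable_on {2..N}"
  proof (rule ccontr)
    assume "\<not> ?thesis"
    then have "integral {2..N} (\<lambda>x. 1 / P x) = 0" by (rule not_integrable_integral)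
    then show False using N M1 by simp
  qed
  have N2: "2 < N"
  proof (rule ccontr)
    assume "\<not> ?thesis"
    then have "integral {2..N} (\<lambda>x. 1 / P x) = 0" by (cases "N = 2") auto
    then show False using N M1 by simp
  qed
  have "integral {2..N} (\<lambda>x. 1 / P x) \<le> integral {2..N} (\<lambda>x. 1 / P 2)"
  proof (rule integral_le[OF int])
    fix x assume x: "x \<in> {2..N}"
    have "P 2 \<le> P x" using x by (intro mono_onD[OF mono]) auto
    then show "1 / P x \<le> 1 / P 2" using pos[of 2] by (simp add: frac_le)
  qed (rule integrable_const_ivl)
  also have "\<dots> = (N - 2) / P 2" using N2 by simp
  finally have "(\<bar>B\<bar> + 2) / P 2 < (N - 2) / P 2" using N M1 by linarith
  then have "\<bar>B\<bar> + 2 < N - 2" using pos[of 2] by (simp add: divide_less_cancel)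
  then show ?thesis using that[of N] int N2 N M1 by linarith
qed

context local_homeo begin

text \<open>A section over an open set is also a left inverse of \<open>F\<close> near each of its values, so it has no branches
  that accumulate there.\<close>

lemma section_local_inverse:
  assumes "open O'" "section_on F O' \<Phi>" "\<zeta> \<in> O'"
  obtains e where "e > 0" "\<And>v. v \<in> ball (\<Phi> \<zeta>) e \<Longrightarrow> F v \<in> O' \<and> \<Phi> (F v) = v"
proof -
  let ?w = "\<Phi> \<zeta>"
  have Fw: "F ?w = \<zeta>" using assms section_onD by blast
  obtain r U \<psi> where l: "r > 0" "open U" "?w \<in> U" "section_on F (ball (F ?w) r) \<psi>"
    "\<And>v. v \<in> U \<Longrightarrow> F v \<in> ball (F ?w) r \<and> \<psi> (F v) = v" using local_section by metis
  obtain r' where r': "r' > 0" "ball \<zeta> r' \<subseteq> O'" using assms by (meson open_contains_ball)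
  let ?b = "ball \<zeta> (min r r')"
  have s1: "section_on F ?b \<Phi>" by (rule section_on_subset[OF assms(2)]) (use r' in auto)
  have s2: "section_on F ?b \<psi>" by (rule section_on_subset[OF l(4)]) (auto simp: Fw)
  have eq: "\<Phi> z = \<psi> z" if "z \<in> ?b" for z
    by (rule section_unique_convex[OF convex_ball s1 s2 _ _ that, of \<zeta>]) (use l r' l(5)[OF l(3)] Fw in auto)
  have "open (U \<inter> F -` ?b)" by (intro open_Int l open_vimage cont_F open_ball)
  moreover have "?w \<in> U \<inter> F -` ?b" using l r' Fw by simp
  ultimately obtain e where e: "e > 0" "ball ?w e \<subseteq> U \<inter> F -` ?b" by (meson open_contains_ball)
  show ?thesis
  proof (rule that[OF e(1)])
    fix v assume "v \<in> ball ?w e"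
    then have "v \<in> U" "F v \<in> ?b" using e(2) by auto
    then show "F v \<in> O' \<and> \<Phi> (F v) = v" using eq l(5) r' by auto
  qed
qed

end

lemma has_derivative_along:
  fixes F :: "complex \<Rightarrow> complex"
  assumes "(F has_derivative D) (at w)"
  shows "((\<lambda>t. Re (m * F (w + of_real t * h))) has_real_derivative Re (m * D h)) (at 0)"
proof -
  have "((\<lambda>t. w + of_real t * h) has_derivative (\<lambda>t. of_real t * h)) (at 0)"
    by (auto intro!: derivative_eq_intros)
  then have "((\<lambda>t. F (w + of_real t * h)) has_derivative (\<lambda>t. D (of_real t * h))) (at 0)"
    by (rule has_derivative_compose) (use assms in simp)
  then have "((\<lambda>t. Re (m * F (w + of_real t * h))) has_derivative (\<lambda>t. Re (m * D (of_real t * h)))) (at 0)"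
    by (intro bounded_linear.has_derivative[OF bounded_linear_Re] has_derivative_mult_right)
  moreover have "D (of_real t * h) = of_real t * D h" for t
    using linear_scale[OF has_derivative_linear[OF assms], of t h] by (simp add: scaleR_conv_of_real)
  ultimately have "((\<lambda>t. Re (m * F (w + of_real t * h))) has_derivative (\<lambda>t. Re (m * D h) * t)) (at 0)"
    by (simp add: algebra_simps)
  then show ?thesis by (simp add: has_field_derivative_def)
qed

context W_homeo begin

lemma W_contradiction:
  assumes "norm m = 1" "\<And>k. s < norm (w k)" "filterlim (\<lambda>k. Re (m * w k)) at_top sequentially"
    "(\<lambda>k. F (w k)) \<longlonglongrightarrow> T" "\<And>k. \<exists>D. (F has_derivative D) (at (w k)) \<and> real_eigenvalue D (c k)"
    "(\<lambda>k. c k * P (Re (m * w k))) \<longlonglongrightarrow> 0"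
  shows False
  using W[unfolded complex_W_def, rule_format, OF assms(1)] assms(2-)
  by (metis (no_types, lifting))

text \<open>Where \<open>Re (m F)\<close> is minimal subject to \<open>x \<ge> X\<close>, the vector \<open>m\<close> is a left eigenvector of the derivative.
  The minimum grows with \<open>X\<close> at least at the rate of the eigenvalue and stays below \<open>h\<close>, so the
  eigenvalue cannot stay above a multiple of \<open>1 / P (X)\<close>, whose integral diverges. The
  W-condition would keep it above such a multiple.\<close>

lemma half_reeb_no_escape:
  assumes hr: "half_reeb F m \<Delta> h K \<Phi>" and m1: "norm m = 1" and tau: "\<tau> = 1 \<or> \<tau> = -1"
    and unb: "\<And>B. \<exists>z\<in>\<Delta>-K. B < \<tau> * Re (m * \<Phi> z)"
  shows False
proof -
  define f where "f = (\<lambda>z. Re (m * z))"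
  define x where "x = (\<lambda>w. \<tau> * Re (m * w))"
  have hr': "compact \<Delta>" "convex \<Delta>" "\<And>z. z \<in> \<Delta> \<Longrightarrow> f z \<le> h" "compact K" "K \<noteq> {}" "\<And>k. k \<in> K \<Longrightarrow> f k = h"
      "\<And>k. k \<in> K \<Longrightarrow> \<exists>\<rho>>0. ball k \<rho> \<inter> {z. f z \<le> h} \<subseteq> \<Delta>" "section_on F (\<Delta> - K) \<Phi>"
    using hr by (auto simp: half_reeb_def f_def)
  have m0: "m \<noteq> 0" using m1 by auto
  have contf: "continuous_on S f" for S unfolding f_def by (intro continuous_intros)
  have contx: "continuous_on S x" for S unfolding x_def by (intro continuous_intros)
  have contPhi: "continuous_on (\<Delta> - K) \<Phi>" using hr'(8) by (simp add: section_on_def)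
  have mm: "Re (m * cnj m) = 1"
    by (simp only: Re_mult_cnj_self m1) simp
  have xle: "x w \<le> norm w" for w
  proof -
    have "\<bar>Re (m * w)\<bar> \<le> norm (m * w)" by (rule abs_Re_le_cmod)
    then show ?thesis using tau m1 by (auto simp: x_def norm_mult)
  qed
  \<comment> \<open>Values of large norm occur only in the interior or on the flat edge.\<close>
  have frontier_bounded: "\<exists>B. \<forall>z\<in>frontier \<Delta>. f z < h \<longrightarrow> norm (\<Phi> z) \<le> B"
  proof -
    define Q where "Q = closure (frontier \<Delta> \<inter> {z. f z < h})"
    have QD: "Q \<subseteq> frontier \<Delta>" unfolding Q_def by (rule closure_minimal) (auto simp: frontier_closed)
    have D: "frontier \<Delta> \<subseteq> \<Delta>" using hr'(1) compact_imp_closed frontier_subset_closed by blast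
    have cQ: "compact Q" using QD D hr'(1) compact_closure bounded_subset compact_imp_bounded
      unfolding Q_def by (metis Int_lower1 order_trans)
    have "Q \<inter> K = {}"
    proof (rule ccontr)
      assume "Q \<inter> K \<noteq> {}"
      then obtain k where k: "k \<in> Q" "k \<in> K" by blast
      then obtain \<rho> where r: "\<rho> > 0" "ball k \<rho> \<inter> {z. f z \<le> h} \<subseteq> \<Delta>" using hr'(7) by blast
      obtain y where y: "y \<in> frontier \<Delta>" "f y < h" "y \<in> ball k \<rho>"
        using k(1) r(1) unfolding Q_def closure_approachable by (auto simp: dist_commute)
      have "open (ball k \<rho> \<inter> {z. f z < h})" by (intro open_Int open_ball open_Collect_less contf continuous_intros)
      then have "y \<in> interior \<Delta>" using r(2) y by (intro interiorI[of "ball k \<rho> \<inter> {z. f z < h}"]) auto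
      then show False using y(1) by (simp add: frontier_def)
    qed
    then have "continuous_on Q \<Phi>" using QD D by (intro continuous_on_subset[OF contPhi]) auto
    then have "bounded (\<Phi> ` Q)" using cQ compact_continuous_image compact_imp_bounded by blast
    then obtain B where B: "\<And>z. z \<in> Q \<Longrightarrow> norm (\<Phi> z) \<le> B" by (auto simp: bounded_iff)
    moreover have "frontier \<Delta> \<inter> {z. f z < h} \<subseteq> Q" unfolding Q_def by (rule closure_subset)
    ultimately show ?thesis by blast
  qed
  then obtain B0 where B0: "\<And>z. z \<in> frontier \<Delta> \<Longrightarrow> f z < h \<Longrightarrow> norm (\<Phi> z) \<le> B0" by blast
  \<comment> \<open>The minimum over this set is below \<open>h\<close>, so it is attained away from the edge.\<close>
  define A where "A = (\<lambda>X. {z\<in>\<Delta>-K. X \<le> x (\<Phi> z)})"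
  have min: "\<exists>\<zeta>\<in>A X. (\<forall>z\<in>A X. f \<zeta> \<le> f z) \<and> f \<zeta> < h" for X
  proof -
    have "\<exists>z0\<in>A X. f z0 < h"
    proof -
      obtain z where z: "z \<in> \<Delta> - K" "X < x (\<Phi> z)" using unb[of X] by (auto simp: x_def)
      show ?thesis
      proof (cases "f z < h")
        case True then show ?thesis using z by (auto simp: A_def intro: less_imp_le)
      next
        case False
        then have fz: "f z = h" using hr'(3)[of z] z by auto
        obtain k where k: "k \<in> K" using hr'(5) by blast
        then obtain \<rho> where r: "\<rho> > 0" "ball k \<rho> \<inter> {z. f z \<le> h} \<subseteq> \<Delta>" using hr'(7) by blast
        define p where "p = k - of_real (\<rho>/2) * cnj m"
        have "f p = f k - \<rho>/2 * Re (m * cnj m)" by (simp add: p_def f_def algebra_simps)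
        then have fp: "f p < h" using mm hr'(6)[OF k] r by simp
        have "dist k p < \<rho>" using r m1 by (simp add: p_def dist_norm norm_mult)
        then have pD: "p \<in> \<Delta>" using r fp by auto
        define \<gamma> where "\<gamma> = (\<lambda>t::real. (1 - t) *\<^sub>R z + t *\<^sub>R p)"
        have gD: "\<gamma> t \<in> \<Delta>" "t > 0 \<Longrightarrow> f (\<gamma> t) < h" if t: "t \<in> {0..1}" for t
        proof -
          show "\<gamma> t \<in> \<Delta>" unfolding \<gamma>_def using t z pD by (intro convexD[OF hr'(2)]) auto
          have "f (\<gamma> t) = (1 - t) * f z + t * f p" by (simp add: \<gamma>_def f_def scaleR_conv_of_real algebra_simps)
          then have "f (\<gamma> t) = h - t * (h - f p)" by (simp add: fz algebra_simps)
          then show "f (\<gamma> t) < h" if "t > 0" using that fp by simp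
        qed
        have gK: "\<gamma> t \<in> \<Delta> - K" if t: "t \<in> {0..1}" for t
        proof (cases "t = 0")
          case True then show ?thesis using z by (simp add: \<gamma>_def)
        next
          case False then show ?thesis using gD[OF t] t hr'(6) by fastforce
        qed
        have "continuous_on {0..1} (\<lambda>t. x (\<Phi> (\<gamma> t)))"
        proof (rule continuous_on_compose2[OF contx[of UNIV]])
          show "continuous_on {0..1} (\<lambda>t. \<Phi> (\<gamma> t))"
            by (rule continuous_on_compose2[OF contPhi]) (use gK in \<open>auto simp: \<gamma>_def intro!: continuous_intros\<close>)
        qed simp
        then have "((\<lambda>t. x (\<Phi> (\<gamma> t))) \<longlongrightarrow> x (\<Phi> (\<gamma> 0))) (at_right 0)"
          by (rule continuous_on_Icc_at_rightD) simp
        then have "eventually (\<lambda>t. X < x (\<Phi> (\<gamma> t))) (at_right 0)"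
          by (rule order_tendstoD) (use z in \<open>simp add: \<gamma>_def\<close>)
        then have "eventually (\<lambda>t. X < x (\<Phi> (\<gamma> t)) \<and> t \<in> {0<..<1}) (at_right 0)"
          using eventually_at_right_real[of 0 1] by (auto elim: eventually_elim2)
        then obtain t where "X < x (\<Phi> (\<gamma> t))" "0 < t" "t < 1"
          by (metis (mono_tags, lifting) eventually_happens' trivial_limit_at_right_real greaterThanLessThan_iff)
        then show ?thesis using gK[of t] gD[of t] by (auto simp: A_def intro!: bexI[of _ "\<gamma> t"])
      qed
    qed
    then obtain z0 where z0: "z0 \<in> A X" "f z0 < h" by blast
    define C where "C = {z\<in>\<Delta>. f z \<le> f z0}"
    have cC: "compact C"
    proof -
      have "closed {z. f z \<le> f z0}" by (intro closed_Collect_le contf continuous_intros)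
      moreover have "C = \<Delta> \<inter> {z. f z \<le> f z0}" by (auto simp: C_def)
      ultimately show ?thesis using hr'(1) by (simp add: compact_Int_closed)
    qed
    have CK: "C \<subseteq> \<Delta> - K" using hr'(6) z0(2) by (force simp: C_def)
    have "closed (C \<inter> (\<lambda>z. x (\<Phi> z)) -` {X..})"
    proof (rule continuous_closed_preimage)
      show "continuous_on C (\<lambda>z. x (\<Phi> z))"
        by (rule continuous_on_compose2[OF contx[of UNIV] continuous_on_subset[OF contPhi CK]]) simp
    qed (use cC compact_imp_closed in auto)
    then have cC': "compact (C \<inter> (\<lambda>z. x (\<Phi> z)) -` {X..})"
      using cC by (metis Int_absorb1 Int_lower1 compact_Int_closed)
    have "z0 \<in> C \<inter> (\<lambda>z. x (\<Phi> z)) -` {X..}" using z0 by (auto simp: A_def C_def)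
    then obtain \<zeta> where ze: "\<zeta> \<in> C \<inter> (\<lambda>z. x (\<Phi> z)) -` {X..}"
        "\<And>z. z \<in> C \<inter> (\<lambda>z. x (\<Phi> z)) -` {X..} \<Longrightarrow> f \<zeta> \<le> f z"
      using continuous_attains_inf[OF cC' _ contf] by blast
    have "\<zeta> \<in> A X" using ze(1) CK by (auto simp: A_def)
    moreover have "f \<zeta> < h" using ze(1) z0(2) by (auto simp: C_def)
    moreover have "f \<zeta> \<le> f z" if "z \<in> A X" for z
    proof (cases "f z \<le> f z0")
      case True then show ?thesis using that by (intro ze(2)) (auto simp: A_def C_def)
    next
      case False then show ?thesis using ze(1) by (auto simp: C_def)
    qed
    ultimately show ?thesis by blast
  qed
  define \<zeta> where "\<zeta> = (\<lambda>X. SOME z. z \<in> A X \<and> (\<forall>y\<in>A X. f z \<le> f y) \<and> f z < h)"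
  have zeta: "\<zeta> X \<in> A X" "\<And>y. y \<in> A X \<Longrightarrow> f (\<zeta> X) \<le> f y" "f (\<zeta> X) < h" for X
    using someI_ex[of "\<lambda>z. z \<in> A X \<and> (\<forall>y\<in>A X. f z \<le> f y) \<and> f z < h"] min[of X] unfolding \<zeta>_def by blast+
  define \<mu> where "\<mu> = (\<lambda>X. f (\<zeta> X))"
  have mono: "\<mu> X \<le> \<mu> Y" if "X \<le> Y" for X Y
    unfolding \<mu>_def by (rule zeta(2)) (use zeta(1)[of Y] that in \<open>auto simp: A_def\<close>)
  define X1 where "X1 = max (max B0 s) 2"
  have crit: "\<exists>c. 0 \<le> c \<and> (\<exists>D. (F has_derivative D) (at (\<Phi> (\<zeta> X))) \<and> real_eigenvalue D (c * \<tau>)) \<and> x (\<Phi> (\<zeta> X)) = X \<and>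
      (0 < c \<longrightarrow> (\<exists>d>0. \<forall>t. 0 < t \<and> t < d \<longrightarrow> c / 2 * t \<le> \<mu> X - \<mu> (X - t)))" if X: "X1 < X" for X
  proof -
    define w where "w = \<Phi> (\<zeta> X)"
    have zA: "\<zeta> X \<in> \<Delta> - K" "X \<le> x w" using zeta(1)[of X] by (auto simp: A_def w_def)
    have Fw: "F w = \<zeta> X" using hr'(8) zA section_onD by (simp add: w_def)
    have nw: "B0 < norm w" "s < norm w" using X zA(2) xle[of w] by (auto simp: X1_def)
    have zi: "\<zeta> X \<in> interior \<Delta>"
      using B0[of "\<zeta> X"] zeta(3)[of X] nw zA closure_subset by (force simp: w_def frontier_def)
    define O' where "O' = interior \<Delta> \<inter> {z. f z < h}"
    have oO: "open O'" unfolding O'_def by (intro open_Int open_interior open_Collect_less contf continuous_intros)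
    have OD: "O' \<subseteq> \<Delta> - K" using interior_subset hr'(6) by (force simp: O'_def)
    have sO: "section_on F O' \<Phi>" by (rule section_on_subset[OF hr'(8) OD])
    obtain e where e: "e > 0" "\<And>v. v \<in> ball w e \<Longrightarrow> F v \<in> O' \<and> \<Phi> (F v) = v"
      using section_local_inverse[OF oO sO, of "\<zeta> X"] zi zeta(3)[of X] by (auto simp: O'_def w_def)
    have inA: "F v \<in> A Y" if "v \<in> ball w e" "Y \<le> x v" for v Y
      using e(2)[OF that(1)] that(2) OD by (auto simp: A_def)
    \<comment> \<open>A minimum in the open set \<open>x > X\<close> could be lowered, since \<open>F\<close> is open.\<close>
    have xw: "x w = X"
    proof (rule ccontr)
      assume "x w \<noteq> X"
      then have xw: "X < x w" using zA by simp
      have "open (ball w e \<inter> {v. X < x v})" by (intro open_Int open_ball open_Collect_less contx continuous_intros)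
      then have "open (F ` (ball w e \<inter> {v. X < x v}))" by (rule open_image)
      moreover have "\<zeta> X \<in> F ` (ball w e \<inter> {v. X < x v})" using e(1) xw Fw by (intro image_eqI[of _ _ w]) auto
      ultimately obtain r where r: "r > 0" "ball (\<zeta> X) r \<subseteq> F ` (ball w e \<inter> {v. X < x v})"
        by (meson open_contains_ball)
      define y where "y = \<zeta> X - of_real (r/2) * cnj m"
      have "y \<in> ball (\<zeta> X) r" using r m1 by (simp add: y_def dist_norm norm_mult)
      then obtain v where v: "v \<in> ball w e" "X < x v" "F v = y" using r by blast
      have "f (\<zeta> X) \<le> f y" using zeta(2) inA[OF v(1), of X] v by auto
      moreover have "f y = f (\<zeta> X) - r/2 * Re (m * cnj m)" by (simp add: y_def f_def algebra_simps)
      ultimately show False using mm r by simp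
    qed
    obtain D where D: "(F has_derivative D) (at w)" using diff_F[OF nw(2)] unfolding differentiable_def by blast
    then have linD: "linear D" by (rule has_derivative_linear)
    have near: "eventually (\<lambda>t. w + of_real t * v \<in> ball w e) (at_right (0::real))" for v
    proof -
      have "((\<lambda>t. w + of_real t * v) \<longlongrightarrow> w + of_real 0 * v) (at_right 0)" by (intro tendsto_intros)
      then show ?thesis using e(1) by (intro topological_tendstoD) auto
    qed
    have nonneg: "0 \<le> Re (m * D v)" if v: "0 \<le> x v" for v
    proof (rule ccontr)
      assume neg: "\<not> ?thesis"
      have "\<exists>d>0. \<forall>t>0. t < d \<longrightarrow> Re (m * F (w + of_real (0 + t) * v)) < Re (m * F (w + of_real 0 * v))"
        by (rule has_real_derivative_neg_dec_right[where S=UNIV, simplified, OF has_derivative_along[OF D]]) (use neg in simp)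
      then obtain d where d: "d > 0" "\<And>t. 0 < t \<Longrightarrow> t < d \<Longrightarrow> f (F (w + of_real t * v)) < f (F w)"
        by (auto simp: f_def)
      have "eventually (\<lambda>t. t \<in> {0<..<d}) (at_right (0::real))" using d eventually_at_right_real by blast
      then have "eventually (\<lambda>t. False) (at_right (0::real))" using near[of v]
      proof eventually_elim
        case (elim t)
        have "x (w + of_real t * v) = X + t * x v" using xw by (simp add: x_def algebra_simps)
        then have "X \<le> x (w + of_real t * v)" using elim v by simp
        then have "f (\<zeta> X) \<le> f (F (w + of_real t * v))" using zeta(2) inA elim by blast
        then show ?case using d(2)[of t] elim(1) Fw by simp
      qed
      then show False by simp
    qed
    define v0 where "v0 = of_real \<tau> * cnj m"
    have xv0: "x v0 = 1"
    proof -
      have "x v0 = \<tau> * \<tau> * Re (m * cnj m)" by (simp add: x_def v0_def algebra_simps)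
      then show ?thesis using mm tau by auto
    qed
    define c where "c = Re (m * D v0)"
    have c0: "0 \<le> c" unfolding c_def by (rule nonneg) (simp add: xv0)
    \<comment> \<open>Directions along \<open>x = X\<close> are critical; this is the left eigenvector.\<close>
    have eig: "Re (m * D v) = c * \<tau> * Re (m * v)" for v
    proof -
      define u where "u = v - of_real (x v) * v0"
      have xu: "x u = 0" "x (- u) = 0"
      proof -
        have lin: "x (v - of_real r * b) = x v - r * x b" for r b by (simp add: x_def algebra_simps)
        show "x u = 0" using xv0 by (simp add: u_def lin)
        moreover have "x (- u) = - x u" by (simp add: x_def algebra_simps)
        ultimately show "x (- u) = 0" by simp
      qed
      have "D (- u) = - D u" by (rule linear_neg[OF linD])
      then have "Re (m * D u) = 0" using nonneg[of u] nonneg[of "- u"] xu by simp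
      moreover have "D u = D v - of_real (x v) * D v0"
        using linear_diff[OF linD] linear_scale[OF linD, of "x v" v0] by (simp add: u_def scaleR_conv_of_real)
      ultimately show ?thesis by (simp add: c_def x_def algebra_simps)
    qed
    \<comment> \<open>Moving against \<open>v0\<close> lowers the minimum at the rate of the eigenvalue.\<close>
    have growth: "\<exists>d>0. \<forall>t. 0 < t \<and> t < d \<longrightarrow> c / 2 * t \<le> \<mu> X - \<mu> (X - t)" if cpos: "0 < c"
    proof -
      have "((\<lambda>t. Re (m * F (w + of_real t * (- v0))) + c / 2 * t) has_real_derivative Re (m * D (- v0)) + c / 2) (at 0)"
        by (intro DERIV_add has_derivative_along[OF D]) (auto intro!: derivative_eq_intros)
      moreover have "Re (m * D (- v0)) + c / 2 < 0"
      proof -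
        have "Re (m * D (- v0)) = - c" using linear_neg[OF linD, of v0] by (simp add: c_def)
        then show ?thesis using cpos by linarith
      qed
      ultimately have "\<exists>d>0. \<forall>t>0. t < d \<longrightarrow> Re (m * F (w + of_real (0 + t) * (- v0))) + c / 2 * (0 + t) < Re (m * F (w + of_real 0 * (- v0))) + c / 2 * 0"
        by (rule has_real_derivative_neg_dec_right[where S=UNIV, simplified])
      then obtain d where d: "d > 0" "\<And>t. 0 < t \<Longrightarrow> t < d \<Longrightarrow> f (F (w + of_real t * (- v0))) + c / 2 * t < f (F w)"
        by (auto simp: f_def)
      have "\<exists>e'>0. \<forall>t. 0 < t \<and> t < e' \<longrightarrow> w + of_real t * (- v0) \<in> ball w e"
        using near[of "- v0"] unfolding eventually_at_right_field by blast
      then obtain e' where e': "e' > 0" "\<And>t. 0 < t \<Longrightarrow> t < e' \<Longrightarrow> w + of_real t * (- v0) \<in> ball w e" by blast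
      have "c / 2 * t \<le> \<mu> X - \<mu> (X - t)" if t: "0 < t" "t < min d e'" for t
      proof -
        have "x (w + of_real t * (- v0)) = X - t * x v0" using xw by (simp add: x_def algebra_simps)
        then have "F (w + of_real t * (- v0)) \<in> A (X - t)" using inA e' t xv0 by auto
        then have "\<mu> (X - t) \<le> f (F (w + of_real t * (- v0)))" unfolding \<mu>_def by (rule zeta(2))
        then show ?thesis using d(2)[of t] t Fw by (simp add: \<mu>_def)
      qed
      then show ?thesis using d(1) e'(1) by (intro exI[of _ "min d e'"]) auto
    qed
    have "real_eigenvalue D (c * \<tau>)" by (rule left_eigenvector_real_eigenvalue[OF linD m0 eig])
    then show ?thesis using c0 D xw growth unfolding w_def by blast
  qed
  define c where "c = (\<lambda>X. SOME c. 0 \<le> c \<and> (\<exists>D. (F has_derivative D) (at (\<Phi> (\<zeta> X))) \<and> real_eigenvalue D (c * \<tau>)) \<and> x (\<Phi> (\<zeta> X)) = X \<and>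
      (0 < c \<longrightarrow> (\<exists>d>0. \<forall>t. 0 < t \<and> t < d \<longrightarrow> c / 2 * t \<le> \<mu> X - \<mu> (X - t))))"
  have c: "0 \<le> c X" "\<exists>D. (F has_derivative D) (at (\<Phi> (\<zeta> X))) \<and> real_eigenvalue D (c X * \<tau>)" "x (\<Phi> (\<zeta> X)) = X"
      "0 < c X \<Longrightarrow> \<exists>d>0. \<forall>t. 0 < t \<and> t < d \<longrightarrow> c X / 2 * t \<le> \<mu> X - \<mu> (X - t)" if "X1 < X" for X
    using someI_ex[OF crit[OF that]] unfolding c_def by blast+
  have Ppos: "\<And>x. x > 0 \<Longrightarrow> P x > 0" and Pmono: "mono_on {0<..} P"
    using growth_P by (auto simp: growth_functions_def)
  \<comment> \<open>Otherwise a subsequence violates the W-condition in the direction \<open>\<tau> * m\<close>.\<close>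
  have "\<exists>\<delta>>0. \<exists>X2>X1. \<forall>X\<ge>X2. \<delta> \<le> c X * P X"
  proof (rule ccontr)
    assume neg: "\<not> ?thesis"
    have "\<exists>X\<ge>X1 + 1 + real n. c X * P X < inverse (real (Suc n))" for n
    proof (rule ccontr)
      assume "\<not> ?thesis"
      then have "\<forall>X\<ge>X1 + 1 + real n. inverse (real (Suc n)) \<le> c X * P X" by (simp add: not_less)
      moreover have "inverse (real (Suc n)) > 0" "X1 + 1 + real n > X1" by simp_all
      ultimately show False using neg by blast
    qed
    then obtain Y where Y: "\<And>n. X1 + 1 + real n \<le> Y n" "\<And>n. c (Y n) * P (Y n) < inverse (real (Suc n))" by metis
    have YX: "X1 < Y n" for n using Y(1)[of n] by linarith
    have "\<zeta> (Y n) \<in> \<Delta>" for n using zeta(1)[of "Y n"] by (auto simp: A_def)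
    then obtain T r where r: "strict_mono r" "((\<lambda>n. \<zeta> (Y n)) \<circ> r) \<longlonglongrightarrow> T"
      using hr'(1) unfolding compact_def by metis
    define w where "w = (\<lambda>n. \<Phi> (\<zeta> (Y (r n))))"
    have xw: "Re (of_real \<tau> * m * w n) = Y (r n)" for n
      using c(3)[OF YX] by (simp add: w_def x_def mult.assoc)
    have "norm (of_real \<tau> * m) = 1" using m1 tau by (auto simp: norm_mult)
    moreover have "s < norm (w n)" for n
    proof -
      have "s < Y (r n)" using YX[of "r n"] by (simp add: X1_def)
      also have "\<dots> \<le> norm (w n)" using xle[of "w n"] c(3)[OF YX] by (simp add: w_def)
      finally show ?thesis .
    qed
    moreover have "filterlim (\<lambda>n. Re (of_real \<tau> * m * w n)) at_top sequentially"
    proof -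
      have "filterlim (\<lambda>n. Y n) at_top sequentially"
        by (rule filterlim_at_top_mono[OF filterlim_real_sequentially])
           (rule always_eventually, rule allI, smt (verit) Y(1) X1_def)
      then have "filterlim (\<lambda>n. Y (r n)) at_top sequentially"
        using r(1) filterlim_compose filterlim_subseq by blast
      then show ?thesis by (simp only: xw)
    qed
    moreover have "(\<lambda>n. F (w n)) \<longlonglongrightarrow> T"
    proof -
      have "F (w n) = \<zeta> (Y (r n))" for n
        using zeta(1)[of "Y (r n)"] hr'(8) by (auto simp: w_def A_def intro: section_onD)
      then show ?thesis using r(2) by (simp add: o_def)
    qed
    moreover have "\<exists>D. (F has_derivative D) (at (w n)) \<and> real_eigenvalue D (c (Y (r n)) * \<tau>)" for n
      using c(2)[OF YX] by (simp add: w_def)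
    moreover have "(\<lambda>n. c (Y (r n)) * \<tau> * P (Re (of_real \<tau> * m * w n))) \<longlonglongrightarrow> 0"
    proof -
      have "(\<lambda>n. c (Y n) * P (Y n)) \<longlonglongrightarrow> 0"
      proof (rule tendsto_sandwich[OF _ _ tendsto_const LIMSEQ_inverse_real_of_nat])
        have "0 \<le> c (Y n) * P (Y n)" for n
          using c(1)[OF YX[of n]] Ppos[of "Y n"] YX[of n] by (simp add: X1_def)
        then show "eventually (\<lambda>n. 0 \<le> c (Y n) * P (Y n)) sequentially" by simp
        show "eventually (\<lambda>n. c (Y n) * P (Y n) \<le> inverse (real (Suc n))) sequentially"
          using Y(2) by (auto intro!: always_eventually less_imp_le)
      qed
      then have "(\<lambda>n. \<tau> * (c (Y (r n)) * P (Y (r n)))) \<longlonglongrightarrow> \<tau> * 0"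
        using LIMSEQ_subseq_LIMSEQ[OF _ r(1)] by (intro tendsto_intros) (auto simp: o_def)
      then show ?thesis by (simp only: xw) (simp add: mult_ac)
    qed
    ultimately show False by (rule W_contradiction)
  qed
  then obtain \<delta> X2 where d: "\<delta> > 0" "X1 < X2" "\<And>X. X2 \<le> X \<Longrightarrow> \<delta> \<le> c X * P X" by blast
  have X2: "2 < X2" using d(2) by (simp add: X1_def)
  have bound: "\<delta> / 2 * (integral {2..N} (\<lambda>x. 1 / P x) - integral {2..X2 + 1} (\<lambda>x. 1 / P x)) \<le> h - \<mu> X2"
    if N: "X2 + 1 \<le> N" and int: "(\<lambda>x. 1 / P x) integrable_on {2..N}" for N
  proof -
    \<comment> \<open>The shift by one: just before \<open>X\<close>, the integrand of \<open>G\<close> is evaluated beyond \<open>X\<close>, where \<open>1 / P\<close> is at most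
      \<open>1 / P X\<close>.\<close>
    define G where "G = (\<lambda>X. \<delta> / 2 * integral {2..X + 1} (\<lambda>x. 1 / P x))"
    have "G (N - 1) - G X2 \<le> \<mu> (N - 1) - \<mu> X2"
    proof (rule left_growth_comparison)
      show "X2 \<le> N - 1" using N by simp
      show "mono_on {X2..N - 1} \<mu>" by (simp add: mono mono_on_def)
      show "continuous_on {X2..N - 1} G" unfolding G_def
        by (intro continuous_intros continuous_on_compose2[OF indefinite_integral_continuous_1[OF int]]) (use X2 in auto)
      fix X assume X: "X2 < X" "X \<le> N - 1"
      then have cX: "\<delta> \<le> c X * P X" "X1 < X" "0 < P X" using d X2 Ppos[of X] by auto
      then have c0: "0 < c X" using c(1)[of X] d(1) by (metis mult_zero_left order_le_less not_le)
      then obtain \<epsilon> where e: "\<epsilon> > 0" "\<And>t. 0 < t \<Longrightarrow> t < \<epsilon> \<Longrightarrow> c X / 2 * t \<le> \<mu> X - \<mu> (X - t)" using c(4)[OF cX(2)] by blast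
      have "G X - G (X - t) \<le> \<mu> X - \<mu> (X - t)" if t: "0 < t" "t < min \<epsilon> 1" "X2 \<le> X - t" for t
      proof -
        have int1: "(\<lambda>x. 1 / P x) integrable_on {2..X + 1}"
          by (rule integrable_on_subinterval[OF int]) (use X in auto)
        have int2: "(\<lambda>x. 1 / P x) integrable_on {X - t + 1..X + 1}"
          by (rule integrable_on_subinterval[OF int]) (use X X2 t in auto)
        have "integral {2..X - t + 1} (\<lambda>x. 1 / P x) + integral {X - t + 1..X + 1} (\<lambda>x. 1 / P x) = integral {2..X + 1} (\<lambda>x. 1 / P x)"
          by (rule Henstock_Kurzweil_Integration.integral_combine[OF _ _ int1]) (use X2 t in auto)
        moreover have "integral {X - t + 1..X + 1} (\<lambda>x. 1 / P x) \<le> integral {X - t + 1..X + 1} (\<lambda>x. 1 / P X)"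
        proof (rule integral_le[OF int2 integrable_const_ivl])
          fix y assume y: "y \<in> {X - t + 1..X + 1}"
          have "P X \<le> P y" using y t X X2 by (intro mono_onD[OF Pmono]) auto
          then show "1 / P y \<le> 1 / P X" using cX(3) by (simp add: frac_le)
        qed
        ultimately have "G X - G (X - t) \<le> \<delta> / 2 * (t / P X)"
          unfolding G_def right_diff_distrib[symmetric] using d(1) t by (intro mult_left_mono) auto
        also have "\<dots> \<le> c X / 2 * t"
        proof -
          have "\<delta> / P X \<le> c X" using cX by (simp add: pos_divide_le_eq)
          then have "\<delta> / P X * (t / 2) \<le> c X * (t / 2)" using t by (intro mult_right_mono) auto
          then show ?thesis by (simp add: mult_ac)
        qed
        finally show ?thesis using e(2)[of t] t by auto
      qed
      then show "\<exists>d>0. \<forall>t. 0 < t \<and> t < d \<and> X2 \<le> X - t \<longrightarrow> G X - G (X - t) \<le> \<mu> X - \<mu> (X - t)"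
        using e(1) by (intro exI[of _ "min \<epsilon> 1"]) auto
    qed
    moreover have "\<mu> (N - 1) < h" unfolding \<mu>_def by (rule zeta(3))
    ultimately show ?thesis by (simp add: G_def algebra_simps)
  qed
  define M where "M = (h - \<mu> X2) * 2 / \<delta> + integral {2..X2 + 1} (\<lambda>x. 1 / P x)"
  obtain N where N: "X2 + 1 < N" "(\<lambda>x. 1 / P x) integrable_on {2..N}" "M < integral {2..N} (\<lambda>x. 1 / P x)"
    using growth_function_integral[OF growth_P] by metis
  have "(h - \<mu> X2) * 2 / \<delta> < integral {2..N} (\<lambda>x. 1 / P x) - integral {2..X2 + 1} (\<lambda>x. 1 / P x)"
    using N(3) by (simp add: M_def)
  then have "\<delta> / 2 * ((h - \<mu> X2) * 2 / \<delta>) < \<delta> / 2 * (integral {2..N} (\<lambda>x. 1 / P x) - integral {2..X2 + 1} (\<lambda>x. 1 / P x))"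
    using d(1) by (intro mult_strict_left_mono) auto
  then show False using bound[of N] N d(1) by simp
qed

text \<open>Both directions of escape are excluded by the previous lemma, for the normalised functional.\<close>

theorem half_reeb_bounded:
  assumes hr: "half_reeb F m \<Delta> h K \<Phi>"
  obtains M where "\<And>z. z \<in> \<Delta> - K \<Longrightarrow> \<bar>Re (m * \<Phi> z)\<bar> \<le> M"
proof -
  define r where "r = inverse (norm m)"
  have m: "m \<noteq> 0" "r > 0" using hr by (auto simp: half_reeb_def r_def)
  have n1: "norm (of_real r * m) = 1" using m by (simp add: r_def norm_mult norm_inverse)
  have ex: "\<exists>B. \<forall>z\<in>\<Delta>-K. \<tau> * Re (of_real r * m * \<Phi> z) \<le> B" if "\<tau> = 1 \<or> \<tau> = -1" for \<tau>
    using half_reeb_no_escape[OF half_reeb_scale[OF hr m(2)] n1 that] by (meson not_less)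
  obtain B1 where B1: "\<And>z. z \<in> \<Delta> - K \<Longrightarrow> Re (of_real r * m * \<Phi> z) \<le> B1" using ex[of 1] by auto
  obtain B2 where B2: "\<And>z. z \<in> \<Delta> - K \<Longrightarrow> - Re (of_real r * m * \<Phi> z) \<le> B2" using ex[of "-1"] by auto
  have "\<bar>Re (m * \<Phi> z)\<bar> \<le> max B1 B2 / r" if "z \<in> \<Delta> - K" for z
  proof -
    have "Re (of_real r * m * \<Phi> z) = r * Re (m * \<Phi> z)" by (simp add: mult.assoc)
    then have "\<bar>r * Re (m * \<Phi> z)\<bar> \<le> max B1 B2" using B1[OF that] B2[OF that] by linarith
    then have "r * \<bar>Re (m * \<Phi> z)\<bar> \<le> max B1 B2" using m(2) by (simp only: abs_mult abs_of_pos)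
    then show ?thesis using m(2) by (simp add: pos_le_divide_eq mult.commute)
  qed
  then show ?thesis using that by blast
qed

end

section \<open>Small eigenvalues in open sets of directions\<close>

context W_homeo begin

text \<open>The W-condition measures eigenvalues against \<open>P (x)\<close>, where \<open>x\<close> may tend to infinity as slowly as one
  likes while the point itself escapes. If eigenvalues tending to zero occurred in a dense set of
  directions, nested intervals would give one direction in which such points have \<open>x \<in> [n, 2n]\<close> and
  eigenvalue below \<open>1 / (n P (2n))\<close>.\<close>

lemma eigenvalues_bounded_below:
  assumes u: "u1 < u2"
  obtains v1 v2 R \<epsilon> where "u1 < v1" "v1 < v2" "v2 < u2" "\<epsilon> > 0"
    "\<And>w D c. R < \<bar>Im w\<bar> \<Longrightarrow> v1 < - Re w / Im w \<Longrightarrow> - Re w / Im w < v2 \<Longrightarrow> norm (F w) \<le> C \<Longrightarrow>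
       (F has_derivative D) (at w) \<Longrightarrow> real_eigenvalue D c \<Longrightarrow> \<epsilon> \<le> \<bar>c\<bar>"
proof (rule ccontr)
  assume neg: "\<not> thesis"
  note obtain_rule = that
  have small: "\<exists>w D c. R < \<bar>Im w\<bar> \<and> a < - Re w / Im w \<and> - Re w / Im w < b \<and> norm (F w) \<le> C \<and>
      (F has_derivative D) (at w) \<and> real_eigenvalue D c \<and> \<bar>c\<bar> < \<epsilon>"
    if "u1 < a" "a < b" "b < u2" "\<epsilon> > 0" for a b R \<epsilon>
  proof (rule ccontr)
    assume "\<not> ?thesis"
    then have "\<epsilon> \<le> \<bar>c\<bar>" if "R < \<bar>Im w\<bar>" "a < - Re w / Im w" "- Re w / Im w < b" "norm (F w) \<le> C"
       "(F has_derivative D) (at w)" "real_eigenvalue D c" for w D c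
      using that by (meson not_less)
    then show False using neg obtain_rule[OF \<open>u1 < a\<close> \<open>a < b\<close> \<open>b < u2\<close> \<open>\<epsilon> > 0\<close>] by blast
  qed
  have Ppos: "\<And>x. x > 0 \<Longrightarrow> P x > 0" and Pmono: "mono_on {0<..} P"
    using growth_P by (auto simp: growth_functions_def)
  \<comment> \<open>for all slopes of the interval the coordinate of \<open>w\<close> is in \<open>[n, 2 n]\<close>, so one witness serves the whole interval\<close>
  define good where "good = (\<lambda>(n::nat) (a, b, w, c). \<forall>u. a \<le> u \<and> u \<le> b \<longrightarrow> real n \<le> Re w + u * Im w \<and> Re w + u * Im w \<le> 2 * real n \<and>
      s < norm w \<and> norm (F w) \<le> C \<and> (\<exists>D. (F has_derivative D) (at w) \<and> real_eigenvalue D c) \<and> \<bar>c\<bar> * P (2 * real n) < 1 / real n)"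
  define St where "St = (\<lambda>(n::nat) (a, b, w::complex, c::real). u1 < a \<and> a < b \<and> b < u2 \<and> (n > 0 \<longrightarrow> good n (a, b, w, c)))"
  have ex0: "\<exists>x. St 0 x"
    using u by (intro exI[of _ "(u1 + (u2 - u1) / 3, u1 + 2 * (u2 - u1) / 3, 0, 0)"]) (simp add: St_def field_simps)
  have step: "\<exists>y. St (Suc n) y \<and> fst x \<le> fst y \<and> fst (snd y) \<le> fst (snd x)" if x: "St n x" for n x
  proof -
    obtain a b w0 c0 where x_eq: "x = (a, b, w0, c0)" by (cases x)
    have ab: "u1 < a" "a < b" "b < u2" using x by (auto simp: St_def x_eq)
    define d where "d = (b - a) / 3"
    have d: "d > 0" "a + d < b - d" "b - a = 3 * d" using ab by (auto simp: d_def field_simps)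
    define k where "k = real (Suc n)"
    have k: "k > 0" "k \<ge> 1" by (simp_all add: k_def)
    have P2k: "P (2 * k) > 0" using Ppos k by simp
    define R where "R = max (max s (2 * k / d)) 0"
    obtain w D c where w: "R < \<bar>Im w\<bar>" "a + d < - Re w / Im w" "- Re w / Im w < b - d" "norm (F w) \<le> C"
        "(F has_derivative D) (at w)" "real_eigenvalue D c" "\<bar>c\<bar> < 1 / (k * P (2 * k))"
      using small[of "a + d" "b - d" "1 / (k * P (2 * k))" R] ab d k P2k by auto
    define y where "y = Im w"
    define \<sigma> where "\<sigma> = - Re w / y"
    have y: "y \<noteq> 0" "2 * k / \<bar>y\<bar> < d" "s < \<bar>y\<bar>"
    proof -
      show y0: "y \<noteq> 0" using w(1) by (auto simp: y_def R_def)
      have "2 * k / d < \<bar>y\<bar>" using w(1) by (simp add: y_def R_def)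
      then show "2 * k / \<bar>y\<bar> < d" using d(1) y0 by (simp add: field_simps)
      show "s < \<bar>y\<bar>" using w(1) by (simp add: y_def R_def)
    qed
    have lin: "Re w + u * Im w = (u - \<sigma>) * y" for u using y by (simp add: \<sigma>_def y_def field_simps)
    have sn: "s < norm w" using y(3) abs_Im_le_cmod[of w] by (simp add: y_def)
    have cP: "\<bar>c\<bar> * P (2 * k) < 1 / k" using w(7) k P2k by (simp add: field_simps)
    \<comment> \<open>the coordinate \<open>(u - \<sigma>) * y\<close> runs through \<open>[k, 2 k]\<close> as \<open>u\<close> runs through this interval\<close>
    define a' where "a' = min (\<sigma> + k / y) (\<sigma> + 2 * k / y)"
    define b' where "b' = max (\<sigma> + k / y) (\<sigma> + 2 * k / y)"
    have sg: "a + d < \<sigma>" "\<sigma> < b - d" using w by (auto simp: \<sigma>_def y_def)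
    have ky: "\<bar>k / y\<bar> < d" "\<bar>2 * k / y\<bar> < d"
    proof -
      show "\<bar>2 * k / y\<bar> < d" using y k by simp
      have "\<bar>k / y\<bar> \<le> \<bar>2 * k / y\<bar>" using k by (simp add: divide_right_mono)
      then show "\<bar>k / y\<bar> < d" using \<open>\<bar>2 * k / y\<bar> < d\<close> by simp
    qed
    define e where "e = k / y"
    have e: "e \<noteq> 0" "- d < e" "e < d" "- d < 2 * e" "2 * e < d" "2 * k / y = 2 * e"
    proof -
      have a: "\<bar>e\<bar> < d" "\<bar>2 * e\<bar> < d" using ky unfolding e_def by (simp_all only: times_divide_eq_right)
      show "- d < e" "e < d" "- d < 2 * e" "2 * e < d" using a by linarith+
      show "e \<noteq> 0" "2 * k / y = 2 * e" using y k by (simp_all add: e_def)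
    qed
    have ab': "a \<le> a'" "b' \<le> b" "a' < b'"
      using sg e d(1) unfolding a'_def b'_def e(6) e_def[symmetric] by (auto simp: min_def max_def)
    have "k \<le> (u - \<sigma>) * y \<and> (u - \<sigma>) * y \<le> 2 * k" if "a' \<le> u" "u \<le> b'" for u
    proof (cases "y > 0")
      case True
      then have "k / y \<le> 2 * k / y" using k by (simp add: field_simps)
      then have "k / y \<le> u - \<sigma>" "u - \<sigma> \<le> 2 * k / y" using that by (auto simp: a'_def b'_def)
      then show ?thesis using True by (simp add: field_simps)
    next
      case False
      then have yn: "y < 0" using y by simp
      then have "2 * k / y \<le> k / y" using k by (simp add: field_simps)
      then have "2 * k / y \<le> u - \<sigma>" "u - \<sigma> \<le> k / y" using that by (auto simp: a'_def b'_def)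
      then show ?thesis using yn by (simp add: neg_divide_le_eq neg_le_divide_eq)
    qed
    then have "good (Suc n) (a', b', w, c)"
      unfolding good_def using w lin sn cP by (auto simp: k_def)
    then have "St (Suc n) (a', b', w, c)" using ab ab' by (auto simp: St_def)
    then show ?thesis using ab' by (intro exI[of _ "(a', b', w, c)"]) (simp add: x_eq)
  qed
  obtain X where X: "\<And>n. St n (X n)" "\<And>n. fst (X n) \<le> fst (X (Suc n)) \<and> fst (snd (X (Suc n))) \<le> fst (snd (X n))"
    using dependent_nat_choice[of St "\<lambda>n x y. fst x \<le> fst y \<and> fst (snd y) \<le> fst (snd x)"] ex0 step by metis
  define a b w c where "a = (\<lambda>n. fst (X n))" and "b = (\<lambda>n. fst (snd (X n)))" and "w = (\<lambda>n. fst (snd (snd (X n))))"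
    and "c = (\<lambda>n. snd (snd (snd (X n))))"
  have Xeq: "X n = (a n, b n, w n, c n)" for n by (simp add: a_def b_def w_def c_def)
  have ab: "u1 < a n" "a n < b n" "b n < u2" for n using X(1)[of n] by (auto simp: St_def Xeq)
  have inca: "a m \<le> a n" if "m \<le> n" for m n
    using that by (rule lift_Suc_mono_le[rotated]) (use X(2) in \<open>simp add: a_def\<close>)
  have decb: "b n \<le> b m" if "m \<le> n" for m n
    using that by (rule lift_Suc_antimono_le[rotated]) (use X(2) in \<open>simp add: b_def\<close>)
  have amb: "a m < b n" for m n
    using ab(2)[of "max m n"] inca[of m "max m n"] decb[of n "max m n"] by simp
  \<comment> \<open>the direction common to all the nested intervals\<close>
  define u where "u = (SUP n. a n)"
  have bdd: "bdd_above (range a)" by (rule bdd_aboveI[of _ u2]) (use ab in \<open>auto, smt (verit)\<close>)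
  have u: "a n \<le> u" "u \<le> b n" for n
  proof -
    show "a n \<le> u" unfolding u_def by (rule cSUP_upper[OF _ bdd]) simp
    show "u \<le> b n" unfolding u_def by (rule cSUP_least) (use amb in \<open>auto intro: less_imp_le\<close>)
  qed
  have good: "real n \<le> Re (w n) + u * Im (w n)" "Re (w n) + u * Im (w n) \<le> 2 * real n" "s < norm (w n)" "norm (F (w n)) \<le> C"
     "\<exists>D. (F has_derivative D) (at (w n)) \<and> real_eigenvalue D (c n)" "\<bar>c n\<bar> * P (2 * real n) < 1 / real n" if "n > 0" for n
    using X(1)[of n] that u[of n] unfolding St_def Xeq good_def by auto
  define q where "q = sqrt (1 + u\<^sup>2)"
  have q: "q \<ge> 1" by (simp add: q_def)
  define m where "m = Complex (1 / q) (- u / q)"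
  have nm: "norm m = 1"
  proof -
    have "(norm m)\<^sup>2 = (1 / q)\<^sup>2 + (u / q)\<^sup>2" by (simp add: m_def cmod_power2)
    also have "\<dots> = (1 + u\<^sup>2) / q\<^sup>2" by (simp add: power_divide add_divide_distrib)
    also have "\<dots> = 1" by (simp add: q_def add_pos_nonneg less_imp_neq[symmetric])
    finally show ?thesis by (simp add: power2_eq_1_iff) (smt (verit) norm_ge_zero)
  qed
  have Rem: "Re (m * z) = (Re z + u * Im z) / q" for z by (simp add: m_def add_divide_distrib)
  have "compact (cball (0::complex) C)" by simp
  moreover have "\<And>n. F (w (Suc n)) \<in> cball 0 C" using good(4) by simp
  ultimately obtain T r where r: "strict_mono r" "((\<lambda>n. F (w (Suc n))) \<circ> r) \<longlonglongrightarrow> T"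
    unfolding compact_def by metis
  define w' c' where "w' = (\<lambda>n. w (Suc (r n)))" and "c' = (\<lambda>n. c (Suc (r n)))"
  have rn: "n \<le> r n" for n by (rule seq_suble[OF r(1)])
  have "filterlim (\<lambda>n. Re (m * w' n)) at_top sequentially"
  proof (rule filterlim_at_top_mono)
    have "filterlim (\<lambda>n. 1 / q * real n) at_top sequentially"
      by (rule filterlim_tendsto_pos_mult_at_top[OF tendsto_const _ filterlim_real_sequentially]) (use q in simp)
    then show "filterlim (\<lambda>n. real n / q) at_top sequentially" by simp
    have "real n / q \<le> Re (m * w' n)" for n
      unfolding Rem w'_def using good(1)[of "Suc (r n)"] rn[of n] q by (intro divide_right_mono) auto
    then show "eventually (\<lambda>n. real n / q \<le> Re (m * w' n)) sequentially" by simp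
  qed
  moreover have "(\<lambda>n. c' n * P (Re (m * w' n))) \<longlonglongrightarrow> 0"
  proof (rule Lim_null_comparison)
    show "(\<lambda>n. inverse (real (Suc n))) \<longlonglongrightarrow> 0" by (rule LIMSEQ_inverse_real_of_nat)
    have "norm (c' n * P (Re (m * w' n))) \<le> inverse (real (Suc n))" for n
    proof -
      let ?k = "Suc (r n)"
      have g: "real ?k \<le> Re (w ?k) + u * Im (w ?k)" "Re (w ?k) + u * Im (w ?k) \<le> 2 * real ?k" using good(1,2)[of ?k] by auto
      have "0 < Re (m * w' n)" unfolding Rem w'_def using g q by (intro divide_pos_pos) auto
      moreover have "Re (m * w' n) \<le> 2 * real ?k" 
      proof -
        have "Re (m * w' n) \<le> 2 * real ?k / q" unfolding Rem w'_def using g q by (intro divide_right_mono) auto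
        also have "\<dots> \<le> 2 * real ?k / 1" by (rule divide_left_mono) (use q in auto)
        also have "\<dots> = 2 * real ?k" by simp
        finally show ?thesis .
      qed
      ultimately have "0 < P (Re (m * w' n))" "P (Re (m * w' n)) \<le> P (2 * real ?k)"
        using Ppos by (auto intro!: mono_onD[OF Pmono])
      then have "norm (c' n * P (Re (m * w' n))) \<le> \<bar>c ?k\<bar> * P (2 * real ?k)"
        by (simp add: abs_mult c'_def mult_left_mono)
      also have "\<dots> < 1 / real ?k" using good(6)[of ?k] by simp
      also have "\<dots> \<le> inverse (real (Suc n))" using rn[of n] by (simp add: inverse_eq_divide frac_le)
      finally show ?thesis by simp
    qed
    then show "eventually (\<lambda>n. norm (c' n * P (Re (m * w' n))) \<le> inverse (real (Suc n))) sequentially" by simp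
  qed
  moreover have "\<And>n. s < norm (w' n)" using good(3) by (simp add: w'_def)
  moreover have "(\<lambda>n. F (w' n)) \<longlonglongrightarrow> T" using r(2) by (simp add: w'_def o_def)
  moreover have "\<And>n. \<exists>D. (F has_derivative D) (at (w' n)) \<and> real_eigenvalue D (c' n)" using good(5) by (simp add: w'_def c'_def)
  ultimately show False using W_contradiction[OF nm, of w' T c'] by blast
qed

end

section \<open>Curves trapped in a strip\<close>

text \<open>By inversion such a curve becomes a Jordan curve; the plane outside the half-strip that contains the
  curve is connected, so it lies on one side and the other side is trapped in the strip.\<close>

lemma trapped_side:
  fixes \<gamma> :: "real \<Rightarrow> complex"
  assumes cont: "continuous_on {0<..<1} \<gamma>" and inj: "inj_on \<gamma> {0<..<1}"
    and lim: "filterlim \<gamma> at_infinity (at_right 0)" "filterlim \<gamma> at_infinity (at_left 1)"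
    and strip: "\<And>t. t \<in> {0<..<1} \<Longrightarrow> \<bar>Re (\<gamma> t)\<bar> \<le> M \<and> y0 \<le> \<sigma> * Im (\<gamma> t)" and sg: "\<sigma> = 1 \<or> \<sigma> = -1"
  obtains W1 W2 where "open W1" "open W2" "W1 \<inter> W2 = {}" "W1 \<union> W2 = - \<gamma> ` {0<..<1}"
    "\<And>w. w \<in> W1 \<Longrightarrow> \<bar>Re w\<bar> \<le> M" "\<gamma> ` {0<..<1} \<subseteq> closure W1" "\<gamma> ` {0<..<1} \<subseteq> closure W2"
proof -
  define U where "U = \<gamma> ` {0<..<1}"
  \<comment> \<open>the centre of inversion is outside the half-strip\<close>
  define p where "p = Complex (\<bar>M\<bar> + 1) 0"
  define Out where "Out = {z. M < Re z} \<union> {z. \<sigma> * Im z < y0} \<union> {z. Re z < - M}"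
  have OU: "Out \<inter> U = {}" using strip by (fastforce simp: Out_def U_def)
  have "M < \<bar>M\<bar> + 1" by linarith
  then have pO: "p \<in> Out" by (simp add: Out_def p_def)
  have conO: "connected Out"
  proof -
    have c1: "convex {z. M < Re z}" "convex {z. Re z < - M}" by (simp_all add: convex_halfspace_Re_gt convex_halfspace_Re_lt)
    have c2: "convex {z. \<sigma> * Im z < y0}" using sg convex_halfspace_Im_lt[of y0] convex_halfspace_Im_gt[of "- y0"]
      by (auto simp: minus_less_iff)
    have "Complex (M + 1) (\<sigma> * (y0 - 1)) \<in> {z. M < Re z} \<inter> {z. \<sigma> * Im z < y0}" using sg by auto
    moreover have "Complex (- M - 1) (\<sigma> * (y0 - 1)) \<in> {z. Re z < - M} \<inter> {z. \<sigma> * Im z < y0}" using sg by auto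
    ultimately show ?thesis unfolding Out_def
      by (intro connected_Un convex_connected c1 c2) blast+
  qed
  have pU: "p \<notin> U" using pO OU by blast
  define \<iota> where "\<iota> = (\<lambda>z. inverse (z - p))"
  define \<kappa> where "\<kappa> = (\<lambda>\<zeta>. p + inverse \<zeta>)"
  have ki: "\<kappa> (\<iota> z) = z" for z by (simp add: \<iota>_def \<kappa>_def)
  have ik: "\<iota> (\<kappa> z) = z" for z by (simp add: \<iota>_def \<kappa>_def)
  have i0: "\<iota> z = 0 \<longleftrightarrow> z = p" for z by (simp add: \<iota>_def)
  \<comment> \<open>both ends at infinity become the point \<open>0\<close> and close the curve\<close>
  define c where "c = (\<lambda>t. if t \<in> {0<..<1} then \<iota> (\<gamma> t) else (0::complex))"
  have contc: "continuous (at t within {0..1}) c" if t: "t \<in> {0..1}" for t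
  proof -
    have lim0: "(c \<longlongrightarrow> 0) G" if G: "filterlim \<gamma> at_infinity G" and ev: "eventually (\<lambda>t. t \<in> {0<..<1}) G" for G
    proof -
      have "filterlim (\<lambda>t. \<gamma> t - p) at_infinity G"
        using tendsto_add_filterlim_at_infinity'[OF G tendsto_const[of "- p"]] by simp
      then have "((\<lambda>t. \<iota> (\<gamma> t)) \<longlongrightarrow> 0) G" unfolding \<iota>_def by (rule filterlim_compose[OF tendsto_inverse_0])
      then show ?thesis
        by (rule Lim_transform_eventually) (use ev in \<open>auto simp: c_def elim: eventually_mono\<close>)
    qed
    consider "t = 0" | "t = 1" | "t \<in> {0<..<1}" using t by fastforce
    then show ?thesis
    proof cases
      case 1
      have "(c \<longlongrightarrow> 0) (at_right 0)" by (rule lim0[OF lim(1)]) (rule eventually_at_right_real, simp)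
      then show ?thesis using 1 by (simp add: continuous_within c_def at_within_Icc_at_right)
    next
      case 2
      have "(c \<longlongrightarrow> 0) (at_left 1)" by (rule lim0[OF lim(2)]) (rule eventually_at_left_real, simp)
      then show ?thesis using 2 by (simp add: continuous_within c_def at_within_Icc_at_left)
    next
      case 3
      have "continuous_on {0<..<1} (\<lambda>t. \<iota> (\<gamma> t))" unfolding \<iota>_def
        using cont pU by (intro continuous_intros) (auto simp: U_def)
      then have "continuous_on {0<..<1} c" by (rule continuous_on_eq) (simp add: c_def)
      then have "continuous (at t) c" using 3 by (simp add: continuous_on_eq_continuous_at)
      then show ?thesis by (rule continuous_at_imp_continuous_at_within)
    qed
  qed
  have cne: "c t \<noteq> 0" if "t \<in> {0<..<1}" for t using that pU i0 by (auto simp: c_def U_def)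
  have "simple_path c"
    unfolding simple_path_def path_def loop_free_def
  proof (intro conjI ballI impI)
    show "continuous_on {0..1} c" using contc by (simp add: continuous_on_eq_continuous_within)
    fix x y assume xy: "x \<in> {0..1}" "y \<in> {0..1}" "c x = c y"
    show "x = y \<or> x = 0 \<and> y = 1 \<or> x = 1 \<and> y = 0"
    proof (cases "x \<in> {0<..<1} \<or> y \<in> {0<..<1}")
      case True
      then have b: "x \<in> {0<..<1}" "y \<in> {0<..<1}" using cne xy(3) by (metis c_def)+
      then have "\<gamma> x = \<gamma> y" using xy(3) ki by (metis c_def)
      then show ?thesis using b inj by (simp add: inj_on_def)
    next
      case False then show ?thesis using xy by fastforce
    qed
  qed
  moreover have "pathfinish c = pathstart c" by (simp add: pathfinish_def pathstart_def c_def)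
  ultimately have J: "open (inside (path_image c))" "open (outside (path_image c))" "bounded (inside (path_image c))"
      "inside (path_image c) \<inter> outside (path_image c) = {}" "inside (path_image c) \<union> outside (path_image c) = - path_image c"
      "frontier (inside (path_image c)) = path_image c" "frontier (outside (path_image c)) = path_image c"
    using Jordan_inside_outside by blast+
  have pic: "path_image c = insert 0 (\<iota> ` U)"
  proof -
    have "{0..1::real} = {0, 1} \<union> {0<..<1}" by auto
    then have "path_image c = c ` ({0, 1} \<union> {0<..<1})" by (simp add: path_image_def)
    also have "\<dots> = insert 0 (\<iota> ` U)" by (auto simp: c_def U_def image_Un)
    finally show ?thesis .
  qed
  define W1 where "W1 = {z. z \<noteq> p \<and> \<iota> z \<in> inside (path_image c)}"
  define W2 where "W2 = insert p {z. \<iota> z \<in> outside (path_image c)}"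
  have conti: "continuous_on (- {p}) \<iota>" unfolding \<iota>_def by (intro continuous_intros) auto
  have op: "open {z. z \<noteq> p \<and> \<iota> z \<in> A}" if "open A" for A
  proof -
    have "open (- {p} \<inter> \<iota> -` A)" by (rule continuous_open_preimage[OF conti _ that]) auto
    moreover have "- {p} \<inter> \<iota> -` A = {z. z \<noteq> p \<and> \<iota> z \<in> A}" by auto
    ultimately show ?thesis by simp
  qed
  have o1: "open W1" unfolding W1_def by (rule op[OF J(1)])
  have o2: "open W2"
  proof -
    have "bounded (inside (path_image c) \<union> path_image c)"
      using J(3) \<open>simple_path c\<close> by (simp add: bounded_simple_path_image)
    then obtain B where B: "B > 0" "\<And>z. z \<in> inside (path_image c) \<union> path_image c \<Longrightarrow> norm z \<le> B" by (metis bounded_pos)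
    have "ball p (1 / B) \<subseteq> W2"
    proof
      fix z assume z: "z \<in> ball p (1 / B)"
      show "z \<in> W2"
      proof (cases "z = p")
        case False
        have "norm (\<iota> z) = 1 / norm (z - p)" by (simp add: \<iota>_def norm_inverse divide_inverse del: inverse_eq_divide)
        moreover have "norm (z - p) < 1 / B" "norm (z - p) > 0" using z False by (auto simp: dist_norm norm_minus_commute)
        ultimately have "B * norm (z - p) < norm (\<iota> z) * norm (z - p)" using B(1) by (simp add: field_simps)
        then have "B < norm (\<iota> z)" using \<open>norm (z - p) > 0\<close> by (rule mult_less_cancel_right_pos[THEN iffD1, rotated])
        then have "\<iota> z \<notin> inside (path_image c) \<union> path_image c" using B(2)[of "\<iota> z"] by (meson not_less)
        then have "\<iota> z \<in> outside (path_image c)" using J(5) by blast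
        then show ?thesis by (simp add: W2_def)
      qed (simp add: W2_def)
    qed
    then have "W2 = ball p (1 / B) \<union> {z. z \<noteq> p \<and> \<iota> z \<in> outside (path_image c)}" using B(1) by (auto simp: W2_def)
    then show ?thesis using op[OF J(2)] by (metis open_Un open_ball)
  qed
  have dis: "W1 \<inter> W2 = {}" using J(4) unfolding W1_def W2_def by blast
  have un: "W1 \<union> W2 = - U"
  proof (intro equalityI subsetI)
    fix z assume z: "z \<in> W1 \<union> W2"
    show "z \<in> - U"
    proof
      assume zU: "z \<in> U"
      then have "\<iota> z \<in> path_image c" "z \<noteq> p" using pic pU by auto
      then show False using z J(5) unfolding W1_def W2_def by blast
    qed
  next
    fix z assume z: "z \<in> - U"
    show "z \<in> W1 \<union> W2"
    proof (cases "z = p")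
      case False
      have "\<iota> z \<notin> \<iota> ` U" using z ki by (metis ComplD imageE)
      then have "\<iota> z \<notin> path_image c" using pic False i0 by simp
      then show ?thesis using J(5) False unfolding W1_def W2_def by blast
    qed (simp add: W2_def)
  qed
  have "Out \<subseteq> W2"
  proof -
    have "Out \<subseteq> W1 \<union> W2" using OU un by blast
    moreover have "p \<in> W2" by (simp add: W2_def)
    ultimately have "W1 \<inter> Out = {}" using connectedD[OF conO o1 o2] pO dis by blast
    then show ?thesis using \<open>Out \<subseteq> W1 \<union> W2\<close> by blast
  qed
  then have Re1: "\<bar>Re w\<bar> \<le> M" if "w \<in> W1" for w
    using that dis by (fastforce simp: Out_def abs_le_iff)
  have cl: "z \<in> closure {z. z \<noteq> p \<and> \<iota> z \<in> A}" if z: "z \<in> U" and A: "frontier A = path_image c" "A \<inter> path_image c = {}" for z A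
  proof -
    have "\<iota> z \<in> closure A" using z pic A(1) by (auto simp: frontier_def)
    then obtain \<zeta> where ze: "\<And>n. \<zeta> n \<in> A" "\<zeta> \<longlonglongrightarrow> \<iota> z" unfolding closure_sequential by blast
    have "z \<noteq> p" using z pU by blast
    then have "\<iota> z \<noteq> 0" by (simp add: i0)
    then have "(\<lambda>n. \<kappa> (\<zeta> n)) \<longlonglongrightarrow> \<kappa> (\<iota> z)" unfolding \<kappa>_def by (intro tendsto_intros ze)
    moreover have "\<kappa> (\<zeta> n) \<in> {z. z \<noteq> p \<and> \<iota> z \<in> A}" for n
    proof -
      have "\<zeta> n \<noteq> 0" using ze(1)[of n] A(2) pic by auto
      then have "\<kappa> (\<zeta> n) \<noteq> p" by (simp add: \<kappa>_def)
      then show ?thesis using ze(1)[of n] ik by simp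
    qed
    ultimately show ?thesis unfolding closure_sequential ki by (intro exI[of _ "\<lambda>n. \<kappa> (\<zeta> n)"]) blast
  qed
  have "U \<subseteq> closure W1" using cl[OF _ J(6)] J(5) unfolding W1_def by blast
  moreover have "U \<subseteq> closure W2"
  proof
    fix z assume "z \<in> U"
    then have "z \<in> closure {z. z \<noteq> p \<and> \<iota> z \<in> outside (path_image c)}" using cl[OF _ J(7)] J(5) by blast
    then show "z \<in> closure W2" by (rule subsetD[OF closure_mono, rotated]) (auto simp: W2_def)
  qed
  ultimately show ?thesis using that o1 o2 dis un Re1 unfolding U_def by blast
qed

section \<open>The singular part of an edge has no gaps\<close>

text \<open>Every direction that points strictly below the edge enters the region.\<close>

lemma half_reeb_approach:
  fixes k :: complex
  assumes "half_reeb F m \<Delta> h K \<Phi>" "k \<in> K" "Re (m * v) < 0"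
  shows "eventually (\<lambda>t. k + of_real t * v \<in> \<Delta> - K \<and> Re (m * (k + of_real t * v)) < h) (at_right 0)"
proof -
  obtain \<rho> where r: "\<rho> > 0" "ball k \<rho> \<inter> {z. Re (m * z) \<le> h} \<subseteq> \<Delta>" "Re (m * k) = h"
    using assms(1,2) unfolding half_reeb_def by blast
  have "((\<lambda>t. k + of_real t * v) \<longlongrightarrow> k + of_real 0 * v) (at_right 0)" by (intro tendsto_intros)
  then have "eventually (\<lambda>t. k + of_real t * v \<in> ball k \<rho>) (at_right 0)"
    using r(1) by (intro topological_tendstoD) auto
  then show ?thesis using eventually_at_right_less[of "0::real"]
  proof eventually_elim
    case (elim t)
    have "Re (m * (k + of_real t * v)) = h + t * Re (m * v)" using r(3) by (simp add: algebra_simps)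
    then have lt: "Re (m * (k + of_real t * v)) < h" using elim assms(3) by (simp add: mult_pos_neg)
    then have "k + of_real t * v \<in> \<Delta>" using r(2) elim by auto
    moreover have "k + of_real t * v \<notin> K" using assms(1) lt by (auto simp: half_reeb_def)
    ultimately show ?case using lt by blast
  qed
qed

lemma half_reeb_limit:
  assumes hr: "half_reeb F m \<Delta> h K \<Phi>" and k: "k \<in> K" and v: "Re (m * v) < 0"
  shows "filterlim (\<lambda>t. \<Phi> (k + of_real t * v)) at_infinity (at_right 0)"
proof -
  have "v \<noteq> 0" using v by auto
  have "filterlim (\<lambda>t. k + of_real t * v) (at k within \<Delta> - K) (at_right 0)"
  proof (subst filterlim_at, intro conjI)
    have "((\<lambda>t. k + of_real t * v) \<longlongrightarrow> k + of_real 0 * v) (at_right 0)" by (intro tendsto_intros)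
    then show "((\<lambda>t. k + of_real t * v) \<longlongrightarrow> k) (at_right 0)" by simp
    show "eventually (\<lambda>t. k + of_real t * v \<in> \<Delta> - K \<and> k + of_real t * v \<noteq> k) (at_right 0)"
      using half_reeb_approach[OF hr k v] eventually_at_right_less[of "0::real"]
      by eventually_elim (use \<open>v \<noteq> 0\<close> in auto)
  qed
  moreover have "filterlim \<Phi> at_infinity (at k within \<Delta> - K)" using hr k by (simp add: half_reeb_def)
  ultimately show ?thesis by (rule filterlim_compose[rotated])
qed

context W_homeo begin

text \<open>A half-Reeb region inside two strips of different directions would be bounded. So a segment that is
  swept through a singular point of a half-Reeb region in a strip, at an angle, cannot
  stay on sheets that are confined to strips of the same direction.\<close>

lemma tilted_sweep_contradiction:
  assumes hr: "half_reeb F 1 \<Delta> h K \<Phi>" and M: "\<And>z. z \<in> \<Delta> - K \<Longrightarrow> \<bar>Re (\<Phi> z)\<bar> \<le> M"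
    and k1: "k1 \<in> K" and \<rho>: "ball k1 \<rho> \<inter> {z. Re z \<le> h} \<subseteq> \<Delta>"
    and sg: "sg = 1 \<or> sg = -1" and t: "0 < t" "t < \<rho> / 4"
    and a: "a = k1 + of_real (sg * t) * \<i>" "a \<notin> K"
    and \<psi>: "r > 0" "section_on F (ball a r) \<psi>" "\<psi> a = \<Phi> a" "\<And>z. z \<in> ball a r \<Longrightarrow> h < Re z \<Longrightarrow> \<psi> z \<in> W1"
    and W12: "open W1" "open W2" "W1 \<inter> W2 = {}" "\<And>v. v \<notin> W1 \<union> W2 \<Longrightarrow> Re (F v) = h" "\<And>w. w \<in> W1 \<Longrightarrow> \<bar>Re w\<bar> \<le> M'"
  shows False
proof -
  have H: "convex \<Delta>" "closed K" "Re k1 = h" "section_on F (\<Delta> - K) \<Phi>" "\<And>k. k \<in> K \<Longrightarrow> Re k = h"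
    using hr k1 by (auto simp: half_reeb_def compact_imp_closed)
  have Rea: "Re a = h" using a H by simp
  obtain r1 where r1: "r1 > 0" "ball a r1 \<inter> K = {}" using closed_ball_disjoint[OF H(2) a(2)] by blast
  define \<eta> where "\<eta> = min (min r r1) (\<rho> / 8) / 2"
  have rho: "\<rho> > 0" using t by simp
  have eta: "0 < \<eta>" "\<eta> < r" "\<eta> < r1" "\<eta> \<le> \<rho> / 16" using \<psi>(1) r1 rho by (auto simp: \<eta>_def)
  have near_k1: "z \<in> ball k1 \<rho>" if "\<bar>Re z - h\<bar> \<le> 3 * \<eta>" "\<bar>Im z - Im k1\<bar> \<le> t" for z
  proof -
    have "norm (k1 - z) \<le> \<bar>Re (k1 - z)\<bar> + \<bar>Im (k1 - z)\<bar>" by (rule cmod_le)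
    then show ?thesis using that eta t H(3) by (simp add: dist_norm)
  qed
  have inD: "z \<in> \<Delta> - K" if "\<bar>Re z - h\<bar> \<le> 3 * \<eta>" "\<bar>Im z - Im k1\<bar> \<le> t" "Re z < h" for z
    using near_k1[OF that(1,2)] \<rho> that(3) H(5) by auto
  \<comment> \<open>The segments start near the regular point \<open>a\<close> and end strictly left of the edge; the last one crosses the edge at
    \<open>k1\<close>, in its midpoint.\<close>
  define a0 w l where "a0 = a - of_real \<eta>" and "w = complex_of_real (2 * \<eta>)" and "l = Complex (- 2 * \<eta>) (- 2 * sg * t)"
  have pm: "Re (pmap a0 w l \<zeta>) = h - \<eta> + 2 * \<eta> * Re \<zeta> - 2 * \<eta> * Im \<zeta>" "Im (pmap a0 w l \<zeta>) = Im k1 + sg * t - 2 * sg * t * Im \<zeta>" for \<zeta>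
    by (simp_all add: pmap_def a0_def w_def l_def Rea algebra_simps) (simp_all add: a algebra_simps)
  have Imb: "\<bar>Im (pmap a0 w l \<zeta>) - Im k1\<bar> \<le> t" if "0 \<le> Im \<zeta>" "Im \<zeta> \<le> 1" for \<zeta>
  proof -
    have "Im (pmap a0 w l \<zeta>) - Im k1 = sg * (t * (1 - 2 * Im \<zeta>))" unfolding pm by (simp add: algebra_simps)
    then have "\<bar>Im (pmap a0 w l \<zeta>) - Im k1\<bar> = t * \<bar>1 - 2 * Im \<zeta>\<bar>" using sg t by (auto simp: abs_mult)
    also have "\<dots> \<le> t * 1" using that t by (intro mult_left_mono) (auto simp: abs_le_iff)
    finally show ?thesis by simp
  qed
  have Reb: "\<bar>Re (pmap a0 w l \<zeta>) - h\<bar> \<le> 3 * \<eta>" if "0 \<le> Im \<zeta>" "Im \<zeta> \<le> 1" "0 \<le> Re \<zeta>" "Re \<zeta> \<le> 1" for \<zeta>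
  proof -
    have "\<eta> * Re \<zeta> \<le> \<eta> * 1" "\<eta> * Im \<zeta> \<le> \<eta> * 1" "0 \<le> \<eta> * Re \<zeta>" "0 \<le> \<eta> * Im \<zeta>" using that eta by (auto intro: mult_left_mono)
    then show ?thesis unfolding pm by (auto simp: abs_le_iff)
  qed
  have parD: "z \<in> \<Delta> - K" if zp: "z \<in> par a0 w l {0..1} {0..1}" "Re z < h" for z
  proof -
    obtain \<zeta> where ze: "0 \<le> Re \<zeta>" "Re \<zeta> \<le> 1" "0 \<le> Im \<zeta>" "Im \<zeta> \<le> 1" "z = pmap a0 w l \<zeta>"
      using zp(1) by (auto simp: box_at_def)
    show ?thesis using inD[of z] Imb[of \<zeta>] Reb[of \<zeta>] ze zp(2) by blast
  qed
  have psi_Phi: "\<psi> z = \<Phi> z" if z: "z \<in> ball a (min r r1) \<inter> \<Delta>" for z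
  proof -
    have aD: "a \<in> \<Delta>"
    proof -
      have "\<bar>Im a - Im k1\<bar> = t" using a sg t by auto
      then show ?thesis using near_k1[of a] Rea eta \<rho> by auto
    qed
    have s1: "section_on F (ball a (min r r1) \<inter> \<Delta>) \<psi>" by (rule section_on_subset[OF \<psi>(2)]) auto
    have s2: "section_on F (ball a (min r r1) \<inter> \<Delta>) \<Phi>" by (rule section_on_subset[OF H(4)]) (use r1 in auto)
    show ?thesis by (rule section_unique_convex[OF _ s1 s2 _ \<psi>(3) z]) (use H(1) \<psi>(1) r1(1) aD in \<open>auto simp: convex_Int\<close>)
  qed
  have bot: "par a0 w l {0..1} {0} \<subseteq> ball a (min r r1)"
  proof
    fix z assume "z \<in> par a0 w l {0..1} {0}"
    then obtain \<zeta> where ze: "0 \<le> Re \<zeta>" "Re \<zeta> \<le> 1" "Im \<zeta> = 0" "z = pmap a0 w l \<zeta>" by (auto simp: box_at_def)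
    have "a - z = of_real (\<eta> - 2 * \<eta> * Re \<zeta>)" using ze by (simp add: pmap_def a0_def w_def algebra_simps)
    then have "norm (a - z) = \<bar>\<eta> - 2 * \<eta> * Re \<zeta>\<bar>" by (simp only: norm_of_real)
    also have "\<dots> \<le> \<eta>"
    proof -
      have "\<eta> * Re \<zeta> \<le> \<eta> * 1" "0 \<le> \<eta> * Re \<zeta>" using ze eta by (auto intro: mult_left_mono)
      then show ?thesis by (auto simp: abs_le_iff)
    qed
    finally show "z \<in> ball a (min r r1)" using eta by (simp add: dist_norm)
  qed
  have D: "Im (cnj w * l) \<noteq> 0" using eta t sg by (auto simp: w_def l_def)
  have s_bot: "section_on F (par a0 w l {0..1} {0}) \<psi>" by (rule section_on_subset[OF \<psi>(2)]) (use bot in auto)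
  have s_top: "section_on F (par a0 w l {0..1} {1}) \<Phi>"
  proof (rule section_on_subset[OF H(4)], rule subsetI)
    fix z assume "z \<in> par a0 w l {0..1} {1}"
    then obtain \<zeta> where ze: "0 \<le> Re \<zeta>" "Re \<zeta> \<le> 1" "Im \<zeta> = 1" "z = pmap a0 w l \<zeta>" by (auto simp: box_at_def)
    have "\<eta> * Re \<zeta> \<le> \<eta> * 1" using ze eta by (intro mult_left_mono) auto
    then have "Re z < h" using eta unfolding ze(4) pm ze(3) by simp
    then show "z \<in> \<Delta> - K" using parD[of z] ze by (auto simp: box_at_def)
  qed
  have left0: "Re z < h" if zl: "z \<in> par a0 w l {0} {0..1}" for z
  proof -
    obtain \<zeta> where ze: "Re \<zeta> = 0" "0 \<le> Im \<zeta>" "Im \<zeta> \<le> 1" "z = pmap a0 w l \<zeta>" using zl by (auto simp: box_at_def)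
    have "0 \<le> \<eta> * Im \<zeta>" using ze eta by simp
    then show ?thesis using eta unfolding ze(4) pm ze(1) by simp
  qed
  have s_left: "section_on F (par a0 w l {0} {0..1}) \<Phi>"
  proof (rule section_on_subset[OF H(4)], rule subsetI)
    fix z assume z: "z \<in> par a0 w l {0} {0..1}"
    then have "z \<in> par a0 w l {0..1} {0..1}" by (auto simp: box_at_def)
    then show "z \<in> \<Delta> - K" using parD left0[OF z] by blast
  qed
  have a0_in: "a0 \<in> par a0 w l {0..1} {0}" "a0 \<in> par a0 w l {0} {0..1}"
    by (rule image_eqI[of _ _ 0]; simp add: pmap_def box_at_def)+
  have e0: "\<Phi> a0 = \<psi> a0"
    using psi_Phi[of a0] bot a0_in left0[OF a0_in(2)] parD[of a0] by (auto simp: box_at_def)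
  \<comment> \<open>A section on the whole parallelogram would be finite at \<open>k1\<close>.\<close>
  have full_False: False if full: "section_on F (par a0 w l {0..1} {0..1}) \<Phi>'" "\<forall>z\<in>par a0 w l {0..1} {1}. \<Phi>' z = \<Phi> z" for \<Phi>'
  proof -
    \<comment> \<open>The last segment passes through \<open>k1\<close>, where \<open>\<Phi>\<close> escapes.\<close>
    define p where "p = (\<lambda>u. pmap a0 w l (Complex 1 (1 / 2 + u)))"
    have p: "p u = k1 + of_real u * l" for u
      by (simp add: p_def pmap_def a0_def a w_def l_def complex_eq_iff algebra_simps)
    have pin: "p u \<in> par a0 w l {1} {0..1}" if "0 \<le> u" "u \<le> 1/2" for u
      unfolding p_def using that by (intro imageI) (auto simp: box_at_def)
    have sub1: "par a0 w l {1} {1/2<..1} \<subseteq> par a0 w l {0..1} {0..1}" by (auto simp: box_at_def)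
    have lef: "z \<in> \<Delta> - K" if zl: "z \<in> par a0 w l {1} {1/2<..1}" for z
    proof (rule parD)
      show "z \<in> par a0 w l {0..1} {0..1}" using zl sub1 by blast
      obtain \<zeta> where ze: "Re \<zeta> = 1" "1/2 < Im \<zeta>" "z = pmap a0 w l \<zeta>" using zl by (auto simp: box_at_def)
      have "\<eta> * (1/2) < \<eta> * Im \<zeta>" using ze eta by (intro mult_strict_left_mono) auto
      then show "Re z < h" unfolding ze(3) pm ze(1) by simp
    qed
    have s1: "section_on F (par a0 w l {1} {1/2<..1}) \<Phi>'" by (rule section_on_subset[OF full(1) sub1])
    have s2: "section_on F (par a0 w l {1} {1/2<..1}) \<Phi>" by (rule section_on_subset[OF H(4)]) (use lef in blast)
    have end_in: "p (1/2) \<in> par a0 w l {1} {1/2<..1}" "p (1/2) \<in> par a0 w l {0..1} {1}"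
      unfolding p_def by (intro imageI; simp add: box_at_def)+
    have eq: "\<Phi>' z = \<Phi> z" if "z \<in> par a0 w l {1} {1/2<..1}" for z
      by (rule section_unique_convex[OF _ s1 s2 end_in(1) _ that]) (use full(2) end_in(2) in \<open>auto intro!: convex_par\<close>)
    have "filterlim (\<lambda>u. \<Phi> (k1 + of_real u * l)) at_infinity (at_right 0)"
      by (rule half_reeb_limit[OF hr k1]) (use eta in \<open>simp add: l_def\<close>)
    then have "filterlim (\<lambda>u. \<Phi>' (p u)) at_infinity (at_right 0)"
    proof (rule filterlim_cong[THEN iffD1, rotated -1])
      have "eventually (\<lambda>u. u \<in> {0<..<1/2}) (at_right (0::real))" by (rule eventually_at_right_real) simp
      then show "eventually (\<lambda>u. \<Phi> (k1 + of_real u * l) = \<Phi>' (p u)) (at_right 0)"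
      proof eventually_elim
        case (elim u)
        have "p u \<in> par a0 w l {1} {1/2<..1}" unfolding p_def using elim by (intro imageI) (auto simp: box_at_def)
        then show ?case using eq p by simp
      qed
    qed auto
    moreover have "((\<lambda>u. \<Phi>' (p u)) \<longlongrightarrow> \<Phi>' (p 0)) (at_right 0)"
    proof -
      have "continuous_on {0..1/2} (\<lambda>u. \<Phi>' (p u))"
        by (rule continuous_on_compose2[of "par a0 w l {0..1} {0..1}" \<Phi>'])
           (use full(1) pin in \<open>auto simp: section_on_def p intro!: continuous_intros\<close>, use pin in \<open>force simp: p[symmetric] box_at_def\<close>)
      then show ?thesis by (rule continuous_on_Icc_at_rightD) simp
    qed
    ultimately show False using not_tendsto_and_filterlim_at_infinity[OF trivial_limit_at_right_real] by blast
  qed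
  \<comment> \<open>A new half-Reeb region has an edge of another direction \<open>m'\<close>, and its section lies in two transversal
    strips.\<close>
  have part_False: False
    if part: "0 < T" "T \<le> 1" "compact K'" "K' \<noteq> {}" "K' \<subseteq> par a0 w l {T} {0<..<1}"
        "section_on F (par a0 w l {0..T} {0..1} - K') \<Phi>'"
        "\<forall>k\<in>K'. filterlim \<Phi>' at_infinity (at k within par a0 w l {0..T} {0..1} - K')"
        "\<forall>z\<in>par a0 w l {0..T} {0}. \<Phi>' z = \<psi> z" for T K' \<Phi>'
  proof -
    define m' where "m' = Complex t (sg * \<eta>)"
    let ?\<Delta>' = "par a0 w l {0..T} {0..1}"
    have "m' \<noteq> 0" "Re (m' * l) = 0" "Re (m' * w) > 0"
      using t eta sg by (auto simp: m'_def l_def w_def complex_eq_iff)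
    then have hr': "half_reeb F m' ?\<Delta>' (Re (m' * (a0 + of_real T * w))) K' \<Phi>'"
      using half_reeb_parallelogram[OF part(1) D _ _ _ part(3-7)] by blast
    then obtain M2 where M2: "\<And>z. z \<in> ?\<Delta>' - K' \<Longrightarrow> \<bar>Re (m' * \<Phi>' z)\<bar> \<le> M2" using half_reeb_bounded by blast
    obtain k' where k': "k' \<in> K'" using part(4) by blast
    have lim: "filterlim (\<lambda>u. \<Phi>' (k' + of_real u * (- 1))) at_infinity (at_right 0)"
      by (rule half_reeb_limit[OF hr' k']) (use t in \<open>simp add: m'_def\<close>)
    have inside: "eventually (\<lambda>u. k' + of_real u * (- 1) \<in> ?\<Delta>' - K' \<and> Re (m' * (k' + of_real u * (- 1))) < Re (m' * (a0 + of_real T * w))) (at_right 0)"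
      by (rule half_reeb_approach[OF hr' k']) (use t in \<open>simp add: m'_def\<close>)
    have Rem: "Re (m' * pmap a0 w l \<zeta>) = Re (m' * a0) + Re \<zeta> * Re (m' * w)" for \<zeta>
      using \<open>Re (m' * l) = 0\<close> by (simp add: pmap_def algebra_simps)
    have strictly: "z \<in> par a0 w l {0..<T} {0..1}" if zs: "z \<in> ?\<Delta>'" "Re (m' * z) < Re (m' * (a0 + of_real T * w))" for z
    proof -
      obtain \<zeta> where ze: "\<zeta> \<in> box_at {0..T} {0..1}" "z = pmap a0 w l \<zeta>" using zs(1) by blast
      have "Re (m' * a0) + Re \<zeta> * Re (m' * w) < Re (m' * a0) + T * Re (m' * w)"
        using zs(2) Rem[of "of_real T"] unfolding ze(2) Rem[of \<zeta>] by (simp add: pmap_def)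
      then have "Re \<zeta> < T" using \<open>Re (m' * w) > 0\<close> by simp
      then show ?thesis using ze by (auto simp: box_at_def)
    qed
    have KT: "z \<notin> K'" if zk: "z \<in> par a0 w l {0..<T} {0..1}" for z
    proof
      assume "z \<in> K'"
      then obtain \<xi> where x: "\<xi> \<in> box_at {T} {0<..<1}" "z = pmap a0 w l \<xi>" using part(5) by blast
      obtain \<zeta> where ze: "\<zeta> \<in> box_at {0..<T} {0..1}" "z = pmap a0 w l \<zeta>" using zk by blast
      have "\<xi> = \<zeta>" using x(2) ze(2) pinv_pmap[OF D] by metis
      then show False using x(1) ze(1) by (auto simp: box_at_def)
    qed
    have sub: "par a0 w l {0..<T} {0..1} \<subseteq> ?\<Delta>' - K'" using KT by (auto simp: box_at_def)
    have s': "section_on F (par a0 w l {0..<T} {0..1}) \<Phi>'" by (rule section_on_subset[OF part(6) sub])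
    have cv: "convex (par a0 w l {0..<T} {0..1})" by (intro convex_par) auto
    define M3 where "M3 = max M M'"
    have bdd: "eventually (\<lambda>u. \<bar>Re (\<Phi>' (k' + of_real u * (- 1)))\<bar> \<le> M3) (at_right 0)"
    proof (cases "Re k' \<le> h")
      case True
      let ?L = "par a0 w l {0..<T} {0..1} \<inter> {z. Re z < h}"
      have s1: "section_on F ?L \<Phi>'" by (rule section_on_subset[OF s']) auto
      have LD: "z \<in> \<Delta> - K" if "z \<in> ?L" for z
        by (rule parD) (use that part(2) in \<open>auto simp: box_at_def\<close>)
      have s2: "section_on F ?L \<Phi>" by (rule section_on_subset[OF H(4)]) (use LD in blast)
      have aL: "a0 \<in> ?L" using left0[OF a0_in(2)] part(1) by (auto intro!: image_eqI[of _ _ 0] simp: pmap_def box_at_def)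
      have "a0 \<in> par a0 w l {0..T} {0}"
        by (rule image_eqI[of _ _ 0]) (use part(1) in \<open>simp_all add: pmap_def box_at_def\<close>)
      then have ea: "\<Phi>' a0 = \<Phi> a0" using bspec[OF part(8)] e0 by metis
      have eq: "\<Phi>' z = \<Phi> z" if "z \<in> ?L" for z
        by (rule section_unique_convex[OF _ s1 s2 aL ea that]) (intro convex_Int cv convex_halfspace_Re_lt)
      show ?thesis using inside eventually_at_right_less[of "0::real"]
      proof eventually_elim
        case (elim u)
        then have "k' + of_real u * (- 1) \<in> ?L" using strictly True by auto
        then show ?case using eq M LD unfolding M3_def by (metis max.coboundedI1)
      qed
    next
      case False
      let ?R = "par a0 w l {0..<T} {0..1} \<inter> {z. h < Re z}"
      have s1: "section_on F ?R \<Phi>'" by (rule section_on_subset[OF s']) auto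
      have conn: "connected (\<Phi>' ` ?R)"
        by (rule connected_continuous_image)
           (use s1 cv in \<open>auto simp: section_on_def intro!: convex_connected convex_Int convex_halfspace_Re_gt\<close>)
      have avoid: "\<Phi>' ` ?R \<subseteq> W1 \<union> W2"
      proof
        fix v assume "v \<in> \<Phi>' ` ?R"
        then have "Re (F v) > h" using s1 by (auto simp: section_on_def)
        then show "v \<in> W1 \<union> W2" using W12(4) by force
      qed
      have T2: "1/2 < T"
      proof -
        obtain \<kappa> where kap: "\<kappa> \<in> box_at {T} {0<..<1}" "k' = pmap a0 w l \<kappa>" using k' part(5) by blast
        then have "0 \<le> \<eta> * Im \<kappa>" "Re \<kappa> = T" using eta by (auto simp: box_at_def)
        then have "\<eta> < 2 * \<eta> * T" using False unfolding kap(2) pm by simp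
        then show ?thesis using eta by simp
      qed
      define b where "b = pmap a0 w l (of_real ((T + 1/2) / 2))"
      have bR: "b \<in> ?R"
      proof -
        have "\<eta> * (1/2) < \<eta> * ((T + 1/2) / 2)" using eta T2 by (intro mult_strict_left_mono) auto
        then have "h < Re b" unfolding b_def pm by simp
        moreover have "b \<in> par a0 w l {0..<T} {0..1}" unfolding b_def using T2 by (intro imageI) (auto simp: box_at_def)
        ultimately show ?thesis by blast
      qed
      have b0: "b \<in> par a0 w l {0..T} {0}" unfolding b_def using T2 by (intro imageI) (auto simp: box_at_def)
      then have "b \<in> ball a r" using bot part(2) by (force simp: box_at_def)
      moreover have "\<Phi>' b = \<psi> b" using bspec[OF part(8) b0] .
      ultimately have "\<Phi>' b \<in> W1" using \<psi>(4) bR by simp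
      then have "W2 \<inter> \<Phi>' ` ?R = {}" using connectedD[OF conn W12(1,2)] avoid W12(3) bR by blast
      then have inW: "\<Phi>' z \<in> W1" if "z \<in> ?R" for z using avoid that by blast
      have "eventually (\<lambda>u. u \<in> {0<..<Re k' - h}) (at_right (0::real))" using False by (intro eventually_at_right_real) simp
      then show ?thesis using inside
      proof eventually_elim
        case (elim u)
        then have "k' + of_real u * (- 1) \<in> ?R" using strictly by auto
        then show ?case using inW W12(5) unfolding M3_def by (metis max.coboundedI2)
      qed
    qed
    have "eventually (\<lambda>u. norm (\<Phi>' (k' + of_real u * (- 1))) \<le> M3 + (M2 + t * M3) / \<eta>) (at_right 0)"
      using inside bdd
    proof eventually_elim
      case (elim u)
      define v where "v = \<Phi>' (k' + of_real u * (- 1))"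
      have 1: "\<bar>Re v\<bar> \<le> M3" using elim by (simp add: v_def)
      have "\<bar>Re (m' * v)\<bar> \<le> M2" using M2 elim unfolding v_def by blast
      then have "\<bar>t * Re v - sg * \<eta> * Im v\<bar> \<le> M2" by (simp add: m'_def)
      moreover have "\<bar>t * Re v\<bar> \<le> t * M3" using 1 t by (simp add: abs_mult)
      ultimately have "\<bar>sg * \<eta> * Im v\<bar> \<le> M2 + t * M3" by linarith
      then have "\<eta> * \<bar>Im v\<bar> \<le> M2 + t * M3" using sg eta by (auto simp: abs_mult)
      then have "\<bar>Im v\<bar> \<le> (M2 + t * M3) / \<eta>" using eta by (simp add: pos_le_divide_eq mult.commute)
      then show ?case using 1 cmod_le[of v] unfolding v_def by linarith
    qed
    moreover have "eventually (\<lambda>u. M3 + (M2 + t * M3) / \<eta> + 1 \<le> norm (\<Phi>' (k' + of_real u * (- 1)))) (at_right 0)"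
      using lim unfolding filterlim_at_infinity_iff_norm by (rule spec)
    ultimately have "eventually (\<lambda>u. False) (at_right (0::real))" by eventually_elim auto
    then show False by simp
  qed
  from sweep[OF D s_bot s_top s_left e0 refl] show False
    by (elim disjE exE conjE) (erule (1) full_False, erule (7) part_False)
qed

text \<open>Otherwise the preimage of a gap would be a curve with both ends in the same end of a strip. One side
  of it is trapped in the strip, and a tilted segment swept on that side towards a singular
  point gives a half-Reeb region confined to two strips.\<close>

lemma singular_set_no_gap:
  assumes hr: "half_reeb F 1 \<Delta> h K \<Phi>" and k: "k1 \<in> K" "k2 \<in> K" "Im k1 < Im k2"
    and sg: "\<sigma> = 1 \<or> \<sigma> = -1"
    and up: "\<And>k. k \<in> K \<Longrightarrow> filterlim (\<lambda>z. \<sigma> * Im (\<Phi> z)) at_top (at k within \<Delta> - K)"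
    and z: "Re z = h" "Im k1 < Im z" "Im z < Im k2"
  shows "z \<in> K"
proof (rule ccontr)
  assume zK: "z \<notin> K"
  have H: "convex \<Delta>" "compact K" "section_on F (\<Delta> - K) \<Phi>" "\<And>k. k \<in> K \<Longrightarrow> Re k = h" "K \<subseteq> \<Delta>"
    "\<And>k. k \<in> K \<Longrightarrow> \<exists>\<rho>>0. ball k \<rho> \<inter> {z. Re z \<le> h} \<subseteq> \<Delta>"
  proof -
    show hb: "\<exists>\<rho>>0. ball k \<rho> \<inter> {z. Re z \<le> h} \<subseteq> \<Delta>" if "k \<in> K" for k using hr that by (simp add: half_reeb_def)
    show Rk: "Re k = h" if "k \<in> K" for k using hr that by (simp add: half_reeb_def)
    show "K \<subseteq> \<Delta>"
    proof
      fix k assume kK: "k \<in> K"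
      then obtain \<rho> where "\<rho> > 0" "ball k \<rho> \<inter> {z. Re z \<le> h} \<subseteq> \<Delta>" using hb by blast
      moreover have "k \<in> ball k \<rho> \<inter> {z. Re z \<le> h}" using Rk[OF kK] \<open>\<rho> > 0\<close> by simp
      ultimately show "k \<in> \<Delta>" by blast
    qed
  qed (use hr in \<open>auto simp: half_reeb_def\<close>)
  obtain M where M: "\<And>z. z \<in> \<Delta> - K \<Longrightarrow> \<bar>Re (1 * \<Phi> z)\<bar> \<le> M" using half_reeb_bounded[OF hr] by blast
  then have M: "\<And>z. z \<in> \<Delta> - K \<Longrightarrow> \<bar>Re (\<Phi> z)\<bar> \<le> M" by simp
  \<comment> \<open>the gap around \<open>z\<close>\<close>
  have ne1: "K \<inter> {k. Im k \<le> Im z} \<noteq> {}" and ne2: "K \<inter> {k. Im z \<le> Im k} \<noteq> {}" using k z by force+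
  have cI: "continuous_on A Im" for A by (intro continuous_intros)
  obtain l1 where l1: "l1 \<in> K" "Im l1 < Im z" "\<And>k. k \<in> K \<Longrightarrow> Im k \<le> Im z \<Longrightarrow> Im k \<le> Im l1"
  proof -
    have cp: "compact (K \<inter> {k. Im k \<le> Im z})" by (intro compact_Int_closed H closed_Collect_le continuous_intros)
    then obtain l where "l \<in> K \<inter> {k. Im k \<le> Im z}" "\<And>k. k \<in> K \<inter> {k. Im k \<le> Im z} \<Longrightarrow> Im k \<le> Im l"
      using continuous_attains_sup[OF cp ne1 cI] by blast
    moreover have "Im l \<noteq> Im z"
    proof
      assume "Im l = Im z"
      then have "l = z" using z(1) H(4)[of l] calculation(1) by (simp add: complex_eq_iff)
      then show False using zK calculation(1) by blast
    qed
    ultimately show ?thesis using that[of l] by auto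
  qed
  obtain l2 where l2: "l2 \<in> K" "Im z < Im l2" "\<And>k. k \<in> K \<Longrightarrow> Im z \<le> Im k \<Longrightarrow> Im l2 \<le> Im k"
  proof -
    have cp: "compact (K \<inter> {k. Im z \<le> Im k})" by (intro compact_Int_closed H closed_Collect_le continuous_intros)
    then obtain l where "l \<in> K \<inter> {k. Im z \<le> Im k}" "\<And>k. k \<in> K \<inter> {k. Im z \<le> Im k} \<Longrightarrow> Im l \<le> Im k"
      using continuous_attains_inf[OF cp ne2 cI] by blast
    moreover have "Im l \<noteq> Im z"
    proof
      assume "Im l = Im z"
      then have "l = z" using z(1) H(4)[of l] calculation(1) by (simp add: complex_eq_iff)
      then show False using zK calculation(1) by blast
    qed
    ultimately show ?thesis using that[of l] by auto
  qed
  have Rel: "Re l1 = h" "Re l2 = h" using l1 l2 H by auto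
  define d where "d = Im l2 - Im l1"
  have d: "d > 0" using l1 l2 by (simp add: d_def)
  define g where "g = (\<lambda>t::real. Complex h (Im l1 + t * d))"
  have gap: "Complex h y \<in> \<Delta> - K" if "Im l1 < y" "y < Im l2" for y
  proof -
    have sum1: "(Im l2 - y) / d + (y - Im l1) / d = 1"
    proof -
      have "(Im l2 - y) / d + (y - Im l1) / d = d / d" by (simp add: add_divide_distrib[symmetric] d_def)
      then show ?thesis using d by simp
    qed
    have "Complex h y = ((Im l2 - y) / d) *\<^sub>R l1 + ((y - Im l1) / d) *\<^sub>R l2"
    proof -
      have "((Im l2 - y) / d + (y - Im l1) / d) * h = 1 * h" by (simp only: sum1)
      then have "((Im l2 - y) / d) * h + ((y - Im l1) / d) * h = h" by (simp only: distrib_right mult_1_left)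
      moreover have "((Im l2 - y) / d) * Im l1 + ((y - Im l1) / d) * Im l2 = y"
      proof -
        have "(Im l2 - y) * Im l1 + (y - Im l1) * Im l2 = y * d" by (simp add: d_def algebra_simps)
        then show ?thesis using d by (simp add: add_divide_distrib[symmetric])
      qed
      ultimately show ?thesis using Rel by (simp add: complex_eq_iff)
    qed
    also have "\<dots> \<in> \<Delta>" using that d l1(1) l2(1) H(5) sum1 by (intro convexD[OF H(1)]) auto
    finally have "Complex h y \<in> \<Delta>" .
    moreover have "Complex h y \<notin> K" using l1(3)[of "Complex h y"] l2(3)[of "Complex h y"] that by force
    ultimately show ?thesis by blast
  qed
  have gt: "g t \<in> \<Delta> - K" if "t \<in> {0<..<1}" for t
    unfolding g_def
  proof (rule gap)
    have "0 < t * d" "t * d < 1 * d" using that d by (auto intro: mult_strict_right_mono)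
    then show "Im l1 < Im l1 + t * d" "Im l1 + t * d < Im l2" by (auto simp: d_def)
  qed
  define \<gamma> where "\<gamma> = (\<lambda>t. \<Phi> (g t))"
  have contPhi: "continuous_on (\<Delta> - K) \<Phi>" using H(3) by (simp add: section_on_def)
  have cg: "continuous_on S g" for S unfolding g_def by (intro continuous_intros continuous_on_Complex)
  have cgam: "continuous_on {0<..<1} \<gamma>" unfolding \<gamma>_def
    by (rule continuous_on_compose2[OF contPhi cg]) (use gt in auto)
  have Fgam: "F (\<gamma> t) = g t" if "t \<in> {0<..<1}" for t using section_onD[OF H(3) gt[OF that]] by (simp add: \<gamma>_def)
  have ing: "inj_on \<gamma> {0<..<1}"
  proof (rule inj_onI)
    fix x y assume "x \<in> {0<..<1}" "y \<in> {0<..<1}" "\<gamma> x = \<gamma> y"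
    then have "g x = g y" using Fgam by metis
    then show "x = y" using d by (simp add: g_def)
  qed
  have lim_end: "filterlim g (at l within \<Delta> - K) G" if "(g \<longlongrightarrow> l) G" "eventually (\<lambda>t. t \<in> {0<..<1}) G" "l \<in> K" for l G
  proof (subst filterlim_at, intro conjI that(1))
    show "eventually (\<lambda>t. g t \<in> \<Delta> - K \<and> g t \<noteq> l) G"
      using that(2) by eventually_elim (use gt that(3) in blast)
  qed
  have ev0: "eventually (\<lambda>t::real. t \<in> {0<..<1}) (at_right 0)" by (rule eventually_at_right_real) simp
  have ev1: "eventually (\<lambda>t::real. t \<in> {0<..<1}) (at_left 1)" by (rule eventually_at_left_real) simp
  have g0: "(g \<longlongrightarrow> l1) (at_right 0)"
  proof -
    have "(g \<longlongrightarrow> Complex h (Im l1 + 0 * d)) (at_right 0)" unfolding g_def by (intro tendsto_intros)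
    then show ?thesis using Rel by (metis add_0_right complex_surj mult_zero_left)
  qed
  have g1: "(g \<longlongrightarrow> l2) (at_left 1)"
  proof -
    have "(g \<longlongrightarrow> Complex h (Im l1 + 1 * d)) (at_left 1)" unfolding g_def by (intro tendsto_intros)
    moreover have "Complex h (Im l1 + 1 * d) = l2" using Rel by (simp add: d_def complex_eq_iff)
    ultimately show ?thesis by simp
  qed
  note lim0 = lim_end[OF g0 ev0 l1(1)] and lim1 = lim_end[OF g1 ev1 l2(1)]
  have inf0: "filterlim \<gamma> at_infinity (at_right 0)" unfolding \<gamma>_def
    by (rule filterlim_compose[OF _ lim0]) (use hr l1(1) in \<open>simp add: half_reeb_def\<close>)
  have inf1: "filterlim \<gamma> at_infinity (at_left 1)" unfolding \<gamma>_def
    by (rule filterlim_compose[OF _ lim1]) (use hr l2(1) in \<open>simp add: half_reeb_def\<close>)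
  have up0: "filterlim (\<lambda>t. \<sigma> * Im (\<gamma> t)) at_top (at_right 0)" unfolding \<gamma>_def
    by (rule filterlim_compose[OF up[OF l1(1)] lim0])
  have up1: "filterlim (\<lambda>t. \<sigma> * Im (\<gamma> t)) at_top (at_left 1)" unfolding \<gamma>_def
    by (rule filterlim_compose[OF up[OF l2(1)] lim1])
  obtain b0 where b0: "0 < b0" "\<And>t. 0 < t \<Longrightarrow> t < b0 \<Longrightarrow> 0 \<le> \<sigma> * Im (\<gamma> t)"
    using up0 unfolding filterlim_at_top eventually_at_right_field by blast
  obtain b1 where b1: "b1 < 1" "\<And>t. b1 < t \<Longrightarrow> t < 1 \<Longrightarrow> 0 \<le> \<sigma> * Im (\<gamma> t)"
    using up1 unfolding filterlim_at_top eventually_at_left_field by blast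
  define c0 c1 where "c0 = min b0 1 / 2" and "c1 = (max b1 0 + 1) / 2"
  have c01: "0 < c0" "c0 < b0" "c0 < 1" "c1 < 1" "b1 < c1" "0 < c1" using b0(1) b1(1) by (auto simp: c0_def c1_def min_def max_def)
  have "compact ((\<lambda>t. \<sigma> * Im (\<gamma> t)) ` {c0..c1})"
    by (intro compact_continuous_image continuous_intros continuous_on_subset[OF cgam]) (use c01 in auto)
  then obtain B where B: "\<And>t. t \<in> {c0..c1} \<Longrightarrow> \<bar>\<sigma> * Im (\<gamma> t)\<bar> \<le> B"
    using compact_imp_bounded bounded_iff by (metis (no_types, lifting) imageI real_norm_def)
  define y0 where "y0 = - \<bar>B\<bar>"
  have strip: "\<bar>Re (\<gamma> t)\<bar> \<le> M \<and> y0 \<le> \<sigma> * Im (\<gamma> t)" if t: "t \<in> {0<..<1}" for t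
  proof -
    have "y0 \<le> \<sigma> * Im (\<gamma> t)"
    proof (cases "t \<in> {c0..c1}")
      case True then show ?thesis using B[of t] by (auto simp: y0_def abs_le_iff)
    next
      case False
      then have "0 \<le> \<sigma> * Im (\<gamma> t)" using b0(2)[of t] b1(2)[of t] c01 t by force
      then show ?thesis by (simp add: y0_def)
    qed
    then show ?thesis using M[OF gt[OF t]] by (simp add: \<gamma>_def)
  qed
  define U where "U = \<gamma> ` {0<..<1}"
  obtain W1 W2 where W: "open W1" "open W2" "W1 \<inter> W2 = {}" "W1 \<union> W2 = - U"
    "\<And>w. w \<in> W1 \<Longrightarrow> \<bar>Re w\<bar> \<le> M" "U \<subseteq> closure W1" "U \<subseteq> closure W2"
    using trapped_side[OF cgam ing inf0 inf1 strip sg] unfolding U_def by metis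
  have UF: "Re (F v) = h" if "v \<notin> W1 \<union> W2" for v
  proof -
    have "v \<in> U" using that W(4) by blast
    then show ?thesis using Fgam by (auto simp: U_def g_def)
  qed
  have sheet: "\<omega> ` S \<subseteq> W1" if "convex S" "section_on F S \<omega>" "\<And>z. z \<in> S \<Longrightarrow> Re z \<noteq> h" "x \<in> S" "\<omega> x \<in> W1" for S \<omega> x
  proof -
    have conn: "connected (\<omega> ` S)"
      by (rule connected_continuous_image) (use that in \<open>auto simp: section_on_def convex_connected\<close>)
    have av: "\<omega> ` S \<subseteq> W1 \<union> W2" using that(2,3) UF unfolding section_on_def by (metis image_subsetI)
    have "W2 \<inter> \<omega> ` S = {}" using connectedD[OF conn W(1,2)] av W(3) that(4,5) by blast
    then show ?thesis using av by blast
  qed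
  define b where "b = g (1/2)"
  have bD: "b \<in> \<Delta> - K" unfolding b_def by (rule gt) simp
  have Phib: "\<Phi> b \<in> U" unfolding U_def b_def \<gamma>_def by (intro imageI) simp
  \<comment> \<open>a point of the trapped side near \<open>\<Phi> b\<close>\<close>
  obtain r U' \<psi> where loc: "r > 0" "open U'" "\<Phi> b \<in> U'" "section_on F (ball (F (\<Phi> b)) r) \<psi>"
    "\<And>v. v \<in> U' \<Longrightarrow> F v \<in> ball (F (\<Phi> b)) r \<and> \<psi> (F v) = v" using local_section by metis
  have Fb: "F (\<Phi> b) = b" using section_onD[OF H(3) bD] .
  obtain r1 where r1: "r1 > 0" "ball b r1 \<inter> K = {}" using closed_ball_disjoint[of K b] H(2) bD compact_imp_closed by blast
  obtain \<rho>1 where rho1: "\<rho>1 > 0" "ball l1 \<rho>1 \<inter> {z. Re z \<le> h} \<subseteq> \<Delta>" using H(6) l1(1) by blast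
  obtain \<rho>2 where rho2: "\<rho>2 > 0" "ball l2 \<rho>2 \<inter> {z. Re z \<le> h} \<subseteq> \<Delta>" using H(6) l2(1) by blast
  define r0 where "r0 = min (min r r1) (min (min \<rho>1 \<rho>2) (d / 2))"
  have r0: "r0 > 0" "r0 \<le> r" "r0 \<le> r1" "r0 \<le> \<rho>1" "r0 \<le> \<rho>2" "r0 \<le> d / 2"
    using loc(1) r1(1) rho1(1) rho2(1) d by (auto simp: r0_def)
  have b_mid: "b = (1/2) *\<^sub>R l1 + (1/2) *\<^sub>R l2" using Rel by (simp add: b_def g_def d_def complex_eq_iff field_simps)
  have half_ball: "z \<in> \<Delta> - K" if zz: "z \<in> ball b r0" "Re z \<le> h" for z
  proof -
    have "l1 + (z - b) \<in> ball l1 \<rho>1" "l2 + (z - b) \<in> ball l2 \<rho>2"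
      using zz r0 by (auto simp: dist_norm norm_minus_commute)
    moreover have "Re (l1 + (z - b)) \<le> h" "Re (l2 + (z - b)) \<le> h" using zz Rel by (auto simp: b_def g_def)
    ultimately have "l1 + (z - b) \<in> \<Delta>" "l2 + (z - b) \<in> \<Delta>" using rho1 rho2 by blast+
    then have "(1/2) *\<^sub>R (l1 + (z - b)) + (1/2) *\<^sub>R (l2 + (z - b)) \<in> \<Delta>" by (intro convexD[OF H(1)]) auto
    moreover have "(1/2) *\<^sub>R (l1 + (z - b)) + (1/2) *\<^sub>R (l2 + (z - b)) = z" by (simp add: b_mid complex_eq_iff field_simps)
    moreover have "z \<in> ball b r1" using zz r0 by auto
    then have "z \<notin> K" using r1(2) by blast
    ultimately show ?thesis by simp
  qed
  have psi_Phi: "\<psi> z = \<Phi> z" if zz: "z \<in> ball b r0 \<inter> {z. Re z \<le> h}" for z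
  proof -
    have s1: "section_on F (ball b r0 \<inter> {z. Re z \<le> h}) \<psi>" by (rule section_on_subset[OF loc(4)]) (use r0 in \<open>auto simp: Fb\<close>)
    have s2: "section_on F (ball b r0 \<inter> {z. Re z \<le> h}) \<Phi>" by (rule section_on_subset[OF H(3)]) (use half_ball in auto)
    have "\<psi> b = \<Phi> b" using loc(5)[OF loc(3)] by (simp add: Fb)
    then show ?thesis
      by (intro section_unique_convex[OF _ s1 s2 _ _ zz, of b])
         (use r0 in \<open>auto simp: b_def g_def intro!: convex_Int convex_halfspace_Re_le\<close>)
  qed
  have "open (U' \<inter> F -` ball b r0)" by (intro open_Int loc open_vimage cont_F open_ball)
  moreover have "\<Phi> b \<in> U' \<inter> F -` ball b r0" using loc Fb r0 by simp
  moreover have "\<Phi> b \<in> closure W1" using Phib W(6) by blast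
  ultimately obtain v where v: "v \<in> W1" "v \<in> U'" "F v \<in> ball b r0"
    unfolding closure_iff_nhds_not_empty by blast
  have pv: "\<psi> (F v) = v" using loc(5)[OF v(2)] by simp
  have "Re (F v) \<noteq> h"
  proof
    assume e: "Re (F v) = h"
    define t where "t = (Im (F v) - Im l1) / d"
    have Ft: "F v = g t" using e d by (simp add: g_def t_def complex_eq_iff)
    have "\<bar>Im (F v - b)\<bar> \<le> norm (F v - b)" by (rule abs_Im_le_cmod)
    then have "\<bar>Im (F v) - (Im l1 + d / 2)\<bar> < d / 2" using v(3) r0 by (simp add: b_def g_def dist_norm norm_minus_commute)
    then have "0 < Im (F v) - Im l1" "Im (F v) - Im l1 < d" unfolding abs_less_iff by linarith+
    then have "t \<in> {0<..<1}" using d by (simp add: t_def)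
    moreover have "v = \<gamma> t" using psi_Phi[of "F v"] v(3) e pv by (simp add: \<gamma>_def Ft[symmetric])
    ultimately have "v \<in> U" by (auto simp: U_def)
    then show False using v(1) W(4) by blast
  qed
  then consider (right) "h < Re (F v)" | (left) "Re (F v) < h" by linarith
  then show False
  proof cases
    case right
    \<comment> \<open>The far side of the gap is trapped: approach the lower end of the gap from inside the gap.\<close>
    define t where "t = min (\<rho>1 / 8) (d / 4)"
    have t: "0 < t" "t < \<rho>1 / 4" "t < d / 2" using rho1 d by (auto simp: t_def)
    define a where "a = l1 + of_real (1 * t) * \<i>"
    have aeq: "a = Complex h (Im l1 + t)" using Rel by (simp add: a_def complex_eq_iff)
    have beq: "b = Complex h (Im l1 + d / 2)" by (simp add: b_def g_def)
    let ?Q = "box_at {h..h} {Im a..Im b}"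
    have QD: "?Q \<subseteq> \<Delta> - K"
    proof
      fix x assume "x \<in> ?Q"
      then have "Re x = h" "Im l1 + t \<le> Im x" "Im x \<le> Im l1 + d / 2" by (auto simp: box_at_def aeq beq)
      moreover have "Im l1 < Im x" "Im x < Im l2" using calculation t d d_def by linarith+
      ultimately have "x = Complex h (Im x)" "Im l1 < Im x" "Im x < Im l2" by (simp_all add: complex_eq_iff)
      then show "x \<in> \<Delta> - K" using gap by metis
    qed
    obtain \<epsilon> \<omega> where chi: "\<epsilon> > 0" "section_on F (\<Union>q\<in>?Q. ball q \<epsilon>) \<omega>" "\<And>x. x \<in> ?Q \<Longrightarrow> \<omega> x = \<Phi> x"
      using section_extends[OF compact_box_at section_on_subset[OF H(3) QD]] by blast
    define S where "S = (\<Union>q\<in>?Q. ball q \<epsilon>) \<inter> {z. h < Re z}"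
    have cS: "convex S"
    proof -
      have "(\<Union>q\<in>?Q. ball q \<epsilon>) = (\<Union>x\<in>?Q. \<Union>y\<in>ball 0 \<epsilon>. {x + y})"
      proof (intro equalityI subsetI)
        fix x assume "x \<in> (\<Union>q\<in>?Q. ball q \<epsilon>)"
        then obtain q where "q \<in> ?Q" "x \<in> ball q \<epsilon>" by blast
        then show "x \<in> (\<Union>x\<in>?Q. \<Union>y\<in>ball 0 \<epsilon>. {x + y})"
          by (intro UN_I[of q] UN_I[of "x - q"]) (auto simp: dist_norm norm_minus_commute)
      next
        fix x assume "x \<in> (\<Union>x\<in>?Q. \<Union>y\<in>ball 0 \<epsilon>. {x + y})"
        then obtain q y where "q \<in> ?Q" "norm y < \<epsilon>" "x = q + y" by (auto simp: dist_norm)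
        then show "x \<in> (\<Union>q\<in>?Q. ball q \<epsilon>)" by (intro UN_I[of q]) (auto simp: dist_norm)
      qed
      also have "convex \<dots>" by (intro convex_sums convex_box_at convex_ball) auto
      finally show ?thesis unfolding S_def by (intro convex_Int convex_halfspace_Re_gt)
    qed
    have sS: "section_on F S \<omega>" unfolding S_def by (rule section_on_subset[OF chi(2)]) auto
    have bQ: "b \<in> ?Q" and aQ: "a \<in> ?Q" using t by (auto simp: box_at_def aeq beq)
    \<comment> \<open>\<open>\<omega>\<close> and \<open>\<psi>\<close> agree near \<open>b\<close>\<close>
    define e where "e = min \<epsilon> r0"
    have e: "e > 0" "e \<le> \<epsilon>" "e \<le> r0" using chi r0 by (auto simp: e_def)
    have s1: "section_on F (ball b e) \<omega>" by (rule section_on_subset[OF chi(2)]) (use e bQ in force)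
    have s2: "section_on F (ball b e) \<psi>" by (rule section_on_subset[OF loc(4)]) (use e r0 in \<open>auto simp: Fb\<close>)
    have eb: "\<omega> b = \<psi> b" using chi(3)[OF bQ] loc(5)[OF loc(3)] by (simp add: Fb)
    define x where "x = b + of_real (e / 2)"
    have xb: "x \<in> ball b e" "h < Re x" using e by (auto simp: x_def dist_norm beq)
    have "\<psi> ` (ball b r0 \<inter> {z. h < Re z}) \<subseteq> W1"
    proof (rule sheet[of _ _ "F v"])
      show "section_on F (ball b r0 \<inter> {z. h < Re z}) \<psi>" by (rule section_on_subset[OF loc(4)]) (use r0 in \<open>auto simp: Fb\<close>)
    qed (use v right pv in \<open>auto intro!: convex_Int convex_halfspace_Re_gt\<close>)
    then have "\<psi> x \<in> W1" using xb e by auto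
    then have "\<omega> x \<in> W1" using section_unique_convex[OF convex_ball s1 s2 _ eb xb(1)] e by simp
    then have chiW: "\<omega> ` S \<subseteq> W1"
      by (intro sheet[OF cS sS, of x]) (use xb e bQ in \<open>auto simp: S_def intro!: bexI[of _ b]\<close>)
    show False
    proof (rule tilted_sweep_contradiction[OF hr M l1(1) rho1(2) _ t(1,2) a_def _ chi(1), of \<omega> W1 W2 M])
      show "(1::real) = 1 \<or> (1::real) = -1" by simp
      show "a \<notin> K" using aQ QD by blast
      show "section_on F (ball a \<epsilon>) \<omega>" by (rule section_on_subset[OF chi(2)]) (use aQ in blast)
      show "\<omega> a = \<Phi> a" using chi(3)[OF aQ] .
      show "\<omega> z \<in> W1" if "z \<in> ball a \<epsilon>" "h < Re z" for z
      proof -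
        have "z \<in> S" using that aQ unfolding S_def by blast
        then show ?thesis using chiW by blast
      qed
    qed (use W UF in auto)
  next
    case left
    \<comment> \<open>The near side is trapped, together with everything adjacent to it: approach the lowest
      singular point from below.\<close>
    obtain l0 where l0: "l0 \<in> K" "\<And>k. k \<in> K \<Longrightarrow> Im l0 \<le> Im k"
    proof -
      have "K \<noteq> {}" using l1(1) by blast
      then show ?thesis using continuous_attains_inf[OF H(2) _ cI] that by blast
    qed
    obtain \<rho>0 where rho0: "\<rho>0 > 0" "ball l0 \<rho>0 \<inter> {z. Re z \<le> h} \<subseteq> \<Delta>" using H(6) l0(1) by blast
    define t where "t = \<rho>0 / 8"
    have t: "0 < t" "t < \<rho>0 / 4" using rho0 by (auto simp: t_def)
    define a where "a = l0 + of_real (- 1 * t) * \<i>"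
    have Rea: "Re a = h" "Im a = Im l0 - t" using H(4)[OF l0(1)] by (auto simp: a_def)
    have aD: "a \<in> \<Delta>" using rho0 t Rea by (auto simp: a_def dist_norm norm_mult)
    have aK: "a \<notin> K" using l0(2)[of a] Rea t by auto
    have PhiL: "\<Phi> ` (\<Delta> \<inter> {z. Re z < h}) \<subseteq> W1"
    proof (rule sheet[of _ _ "F v"])
      show "section_on F (\<Delta> \<inter> {z. Re z < h}) \<Phi>" by (rule section_on_subset[OF H(3)]) (use H(4) in auto)
      show "F v \<in> \<Delta> \<inter> {z. Re z < h}" using half_ball[OF v(3)] left by auto
      show "\<Phi> (F v) \<in> W1" using psi_Phi[of "F v"] v left pv by simp
    qed (auto intro!: convex_Int H convex_halfspace_Re_lt)
    have "\<Phi> a \<in> W1"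
    proof -
      have "\<Phi> a \<notin> U"
      proof
        assume "\<Phi> a \<in> U"
        then obtain s where s: "s \<in> {0<..<1}" "\<Phi> a = \<Phi> (g s)" by (auto simp: U_def \<gamma>_def)
        then have "a = g s" using section_onD[OF H(3), of a] section_onD[OF H(3) gt[OF s(1)]] aD aK by (metis DiffI)
        then have "Im l1 < Im a" using s d by (simp add: g_def)
        then show False using l0(2)[OF l1(1)] Rea t by simp
      qed
      moreover have "\<Phi> a \<notin> W2"
      proof
        assume "\<Phi> a \<in> W2"
        have "continuous (at a within \<Delta> - K) \<Phi>" using contPhi aD aK by (auto simp: continuous_on_eq_continuous_within)
        then have lima: "(\<Phi> \<longlongrightarrow> \<Phi> a) (at a within \<Delta> - K)" by (simp add: continuous_within)
        have "filterlim (\<lambda>u. a + of_real u * (- 1)) (at a within \<Delta> - K) (at_right 0)"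
        proof (subst filterlim_at, intro conjI)
          have "((\<lambda>u. a + of_real u * (- 1)) \<longlongrightarrow> a + of_real 0 * (- 1)) (at_right 0)" by (intro tendsto_intros)
          then show "((\<lambda>u. a + of_real u * (- 1)) \<longlongrightarrow> a) (at_right 0)" by simp
          have "eventually (\<lambda>u. u \<in> {0<..<\<rho>0 / 2}) (at_right (0::real))" using rho0 by (intro eventually_at_right_real) simp
          then show "eventually (\<lambda>u. a + of_real u * (- 1) \<in> \<Delta> - K \<and> a + of_real u * (- 1) \<noteq> a) (at_right 0)"
          proof eventually_elim
            case (elim u)
            have "norm (l0 - (a + of_real u * (- 1))) \<le> t + u" 
              using norm_triangle_ineq[of "of_real t * \<i>" "of_real u"] elim t by (simp add: a_def norm_mult)
            then have "a + of_real u * (- 1) \<in> ball l0 \<rho>0" using elim t rho0 by (simp add: dist_norm t_def)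
            then show ?case using rho0(2) Rea elim H(4) by fastforce
          qed
        qed
        then have "((\<lambda>u. \<Phi> (a + of_real u * (- 1))) \<longlongrightarrow> \<Phi> a) (at_right 0)" by (rule filterlim_compose[OF lima])
        then have "eventually (\<lambda>u. \<Phi> (a + of_real u * (- 1)) \<in> W2) (at_right 0)"
          using W(2) \<open>\<Phi> a \<in> W2\<close> by (rule topological_tendstoD)
        moreover have "eventually (\<lambda>u. u \<in> {0<..<\<rho>0 / 2}) (at_right (0::real))" using rho0 by (intro eventually_at_right_real) simp
        ultimately have "eventually (\<lambda>u. False) (at_right (0::real))"
        proof eventually_elim
          case (elim u)
          have "norm (l0 - (a + of_real u * (- 1))) \<le> t + u" 
            using norm_triangle_ineq[of "of_real t * \<i>" "of_real u"] elim t by (simp add: a_def norm_mult)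
          then have "a + of_real u * (- 1) \<in> ball l0 \<rho>0" using elim t rho0 by (simp add: dist_norm t_def)
          then have "a + of_real u * (- 1) \<in> \<Delta> \<inter> {z. Re z < h}" using rho0(2) Rea elim by fastforce
          then show ?case using PhiL elim W(3) by blast
        qed
        then show False by simp
      qed
      ultimately show ?thesis using W(4) by blast
    qed
    obtain ra Ua \<psi>a where la: "ra > 0" "open Ua" "\<Phi> a \<in> Ua" "section_on F (ball (F (\<Phi> a)) ra) \<psi>a"
      "\<And>v. v \<in> Ua \<Longrightarrow> F v \<in> ball (F (\<Phi> a)) ra \<and> \<psi>a (F v) = v" using local_section by metis
    have Fa: "F (\<Phi> a) = a" using section_onD[OF H(3)] aD aK by blast
    have pa: "\<psi>a a = \<Phi> a" using la(5)[OF la(3)] by (simp add: Fa)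
    have "continuous (at a) \<psi>a" using la(1,4) by (auto simp: section_on_def Fa continuous_on_eq_continuous_at)
    then have "(\<psi>a \<longlongrightarrow> \<Phi> a) (at a)" using pa by (simp add: continuous_at)
    then have "eventually (\<lambda>z. \<psi>a z \<in> W1) (at a)" using W(1) \<open>\<Phi> a \<in> W1\<close> by (rule topological_tendstoD)
    then obtain e where e0: "e > 0" "\<And>z. z \<noteq> a \<Longrightarrow> dist z a < e \<Longrightarrow> \<psi>a z \<in> W1" unfolding eventually_at by blast
    have e: "\<psi>a z \<in> W1" if "dist z a < e" for z
      using e0(2)[of z] that pa \<open>\<Phi> a \<in> W1\<close> by (cases "z = a") auto
    show False
    proof (rule tilted_sweep_contradiction[OF hr M l0(1) rho0(2) _ t(1,2) a_def aK, of "min ra e" \<psi>a W1 W2 M])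
      show "section_on F (ball a (min ra e)) \<psi>a" by (rule section_on_subset[OF la(4)]) (auto simp: Fa)
    qed (use W UF la e0(1) e pa in \<open>auto simp: dist_commute\<close>)
  qed
qed

end

section \<open>Half-Reeb regions for all nearby slopes\<close>

text \<open>Approach \<open>k\<close> horizontally inside both sets: \<open>\<Phi>\<close> and \<open>\<Psi>\<close> agree there, but one escapes and the other converges.\<close>

lemma (in local_homeo) singular_point_no_section:
  assumes S: "convex S" "section_on F S \<Phi>" and lim: "filterlim \<Phi> at_infinity (at k within S)"
    and S': "convex S'" "section_on F S' \<Psi>" "k \<in> S'"
    and app: "0 < t0" "\<And>t. 0 < t \<Longrightarrow> t < t0 \<Longrightarrow> k - of_real t \<in> S \<inter> S'"
    and b: "b \<in> S \<inter> S'" "\<Phi> b = \<Psi> b"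
  shows False
proof -
  have s1: "section_on F (S \<inter> S') \<Phi>" and s2: "section_on F (S \<inter> S') \<Psi>"
    using S S' by (auto intro: section_on_subset)
  have eq: "\<Phi> z = \<Psi> z" if "z \<in> S \<inter> S'" for z
    by (rule section_unique_convex[OF _ s1 s2 b that]) (use S S' in \<open>simp add: convex_Int\<close>)
  have ev: "eventually (\<lambda>t. k - of_real t \<in> S \<inter> S' \<and> k - of_real t \<noteq> k) (at_right (0::real))"
    using eventually_at_right_real[OF app(1)] by eventually_elim (use app(2) in auto)
  have l0: "((\<lambda>t. k - of_real t) \<longlongrightarrow> k) (at_right (0::real))"
  proof -
    have "((\<lambda>t. k - of_real t) \<longlongrightarrow> k - of_real 0) (at_right (0::real))" by (intro tendsto_intros)
    then show ?thesis by simp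
  qed
  have f1: "filterlim (\<lambda>t. k - of_real t) (at k within S) (at_right (0::real))"
    unfolding filterlim_at using l0 ev by (auto elim: eventually_mono)
  have f2: "filterlim (\<lambda>t. k - of_real t) (at k within S') (at_right (0::real))"
    unfolding filterlim_at using l0 ev by (auto elim: eventually_mono)
  have inf: "filterlim (\<lambda>t. \<Phi> (k - of_real t)) at_infinity (at_right (0::real))"
    by (rule filterlim_compose[OF lim f1])
  have "(\<Psi> \<longlongrightarrow> \<Psi> k) (at k within S')"
    using S'(2,3) by (auto simp: section_on_def continuous_on_def)
  then have "((\<lambda>t. \<Psi> (k - of_real t)) \<longlongrightarrow> \<Psi> k) (at_right (0::real))" by (rule filterlim_compose[OF _ f2])
  moreover have "eventually (\<lambda>t. \<Psi> (k - of_real t) = \<Phi> (k - of_real t)) (at_right (0::real))"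
    using ev by eventually_elim (use eq in auto)
  ultimately have "((\<lambda>t. \<Phi> (k - of_real t)) \<longlongrightarrow> \<Psi> k) (at_right (0::real))"
    by (rule Lim_transform_eventually)
  then show False using inf not_tendsto_and_filterlim_at_infinity[OF trivial_limit_at_right_real] by blast
qed

definition below_line :: "real \<Rightarrow> real \<Rightarrow> (real \<Rightarrow> real) \<Rightarrow> real \<Rightarrow> complex set" where
  "below_line a \<delta> h u = {z. \<bar>Im z\<bar> \<le> \<delta> \<and> - a \<le> Re z \<and> Re z + u * Im z < h u}"

lemma convex_halfplane_lt: "convex {z. Re z + u * Im z < c}"
proof -
  have "{z. Re z + u * Im z < c} = {z. inner (Complex 1 u) z < c}" by (simp add: inner_complex_def)
  then show ?thesis by (simp add: convex_halfspace_lt)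
qed

lemma convex_below_line: "convex (below_line a \<delta> h u)"
proof -
  have "below_line a \<delta> h u = box_at {- a..} {- \<delta>..\<delta>} \<inter> {z. Re z + u * Im z < h u}"
    by (auto simp: below_line_def box_at_def abs_le_iff)
  then show ?thesis by (auto intro!: convex_Int convex_box_at convex_halfplane_lt)
qed

context W_homeo begin

text \<open>The singular points stay away from the ends of the edge, so near the ends the section extends across
  the edge. Tilted segments can therefore end slightly beyond it.\<close>

lemma edge_section:
  assumes a: "0 < a" "0 < \<delta>" and c: "c = - \<delta> \<or> c = \<delta>"
    and K0: "closed K0" "K0 \<subseteq> box_at {0} {-\<delta><..<\<delta>}" and s: "section_on F (box_at {-a..0} {-\<delta>..\<delta>} - K0) \<Phi>0"
  shows "\<exists>e>0. e < \<delta> \<and> (\<exists>\<beta>. section_on F (box_at {-a..e} {c-e..c+e}) \<beta> \<and>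
      (\<forall>z\<in>box_at {-a..0} {-\<delta>..\<delta>} \<inter> box_at {-a..e} {c-e..c+e}. z \<notin> K0 \<and> \<Phi>0 z = \<beta> z))"
proof -
  let ?Q = "box_at {-a..0} {c..c}"
  have QK: "?Q \<inter> K0 = {}" using K0(2) c a by (fastforce simp: box_at_def)
  have Qs: "?Q \<subseteq> box_at {-a..0} {-\<delta>..\<delta>} - K0" using QK c a by (auto simp: box_at_def)
  obtain \<epsilon> \<beta> where b: "\<epsilon> > 0" "section_on F (\<Union>q\<in>?Q. ball q \<epsilon>) \<beta>" "\<And>z. z \<in> ?Q \<Longrightarrow> \<beta> z = \<Phi>0 z"
    using section_extends[OF compact_box_at section_on_subset[OF s Qs]] by blast
  obtain d where d: "d > 0" "\<And>x y. x \<in> ?Q \<Longrightarrow> y \<in> K0 \<Longrightarrow> d \<le> dist x y"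
    using separate_compact_closed[OF compact_box_at K0(1) QK] by blast
  define e where "e = min (min \<epsilon> d) \<delta> / 4"
  have e: "0 < e" "2 * e < \<epsilon>" "2 * e < d" "e < \<delta>" using b d a by (auto simp: e_def)
  have near: "\<exists>q\<in>?Q. dist q z \<le> 2 * e" if z: "z \<in> box_at {-a..e} {c-e..c+e}" for z
  proof -
    let ?q = "Complex (min (Re z) 0) c"
    have "?q \<in> ?Q" using z a by (auto simp: box_at_def)
    moreover have "dist ?q z \<le> \<bar>Re (?q - z)\<bar> + \<bar>Im (?q - z)\<bar>" unfolding dist_norm by (rule cmod_le)
    moreover have "\<bar>Re (?q - z)\<bar> \<le> e" "\<bar>Im (?q - z)\<bar> \<le> e" using z e(1) by (auto simp: box_at_def)
    ultimately show ?thesis by force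
  qed
  have sb: "section_on F (box_at {-a..e} {c-e..c+e}) \<beta>"
    by (rule section_on_subset[OF b(2)]) (use near e in force)
  let ?C = "box_at {-a..0} ({-\<delta>..\<delta>} \<inter> {c-e..c+e})"
  have nK: "z \<notin> K0" if "z \<in> box_at {-a..e} {c-e..c+e}" for z
    using near[OF that] d(2) e(3) by fastforce
  have s1: "section_on F ?C \<Phi>0" by (rule section_on_subset[OF s]) (use nK e(1) in \<open>auto simp: box_at_def\<close>)
  have s2: "section_on F ?C \<beta>" by (rule section_on_subset[OF sb]) (use e(1) in \<open>auto simp: box_at_def\<close>)
  have cv: "convex ?C" by (intro convex_box_at convex_Int) auto
  have bC: "Complex (-a) c \<in> ?C" using a c e by (auto simp: box_at_def)
  have eb: "\<Phi>0 (Complex (-a) c) = \<beta> (Complex (-a) c)" using b(3)[of "Complex (-a) c"] a by (simp add: box_at_def)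
  have "\<Phi>0 z = \<beta> z" if "z \<in> ?C" for z by (rule section_unique_convex[OF cv s1 s2 bC eb that])
  then have "z \<notin> K0 \<and> \<Phi>0 z = \<beta> z" if "z \<in> box_at {-a..0} {-\<delta>..\<delta>} \<inter> box_at {-a..e} {c-e..c+e}" for z
    using that nK by (auto simp: box_at_def)
  then show ?thesis using e sb by blast
qed

text \<open>For every slope \<open>u\<close> near \<open>0\<close> the lines \<open>Re z + u Im z = c\<close> are swept until the first one that does not
  lift, at \<open>c = h u\<close>. A line of another slope through a singular point does not lift either, which
  makes \<open>h\<close> concave with the heights of the singular points as slopes.\<close>

lemma tangent_family:
  assumes a: "0 < a" "0 < \<delta>"
    and K0: "closed K0" "K0 \<noteq> {}" "K0 \<subseteq> box_at {0} {-\<delta><..<\<delta>}" and s: "section_on F (box_at {-a..0} {-\<delta>..\<delta>} - K0) \<Phi>0"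
    and lim0: "\<And>k. k \<in> K0 \<Longrightarrow> filterlim \<Phi>0 at_infinity (at k within box_at {-a..0} {-\<delta>..\<delta>} - K0)"
  obtains a' u0 \<eta> B0 h K \<Phi> \<Delta> where "0 < a'" "0 < u0" "u0 * \<delta> \<le> a' / 4" "0 < \<eta>"
    "\<And>u. \<bar>u\<bar> \<le> u0 \<Longrightarrow> half_reeb F (Complex 1 (-u)) (\<Delta> u) (h u) (K u) (\<Phi> u)"
    "\<And>u. \<bar>u\<bar> \<le> u0 \<Longrightarrow> below_line a' \<delta> h u \<subseteq> \<Delta> u - K u"
    "\<And>u. \<bar>u\<bar> \<le> u0 \<Longrightarrow> - a' / 4 \<le> h u"
    "\<And>u k. \<bar>u\<bar> \<le> u0 \<Longrightarrow> k \<in> K u \<Longrightarrow> 0 \<le> Re k \<and> \<bar>Im k\<bar> \<le> \<delta> - \<eta>"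
    "\<And>u z. \<bar>u\<bar> \<le> u0 \<Longrightarrow> \<bar>Im z\<bar> < \<delta> \<Longrightarrow> Re z + u * Im z = h u \<Longrightarrow> z \<in> \<Delta> u"
    "\<And>u u' k. \<bar>u\<bar> \<le> u0 \<Longrightarrow> \<bar>u'\<bar> \<le> u0 \<Longrightarrow> k \<in> K u \<Longrightarrow> h u' \<le> h u + (u' - u) * Im k"
    "\<And>u u' z. \<bar>u\<bar> \<le> u0 \<Longrightarrow> \<bar>u'\<bar> \<le> u0 \<Longrightarrow> z \<in> below_line a' \<delta> h u \<Longrightarrow> z \<in> below_line a' \<delta> h u' \<Longrightarrow> \<Phi> u z = \<Phi> u' z"
    "\<And>u z. \<bar>u\<bar> \<le> u0 \<Longrightarrow> z \<in> below_line a' \<delta> h u \<Longrightarrow> \<delta> - \<eta> \<le> \<bar>Im z\<bar> \<or> Re z \<le> - a' / 2 \<Longrightarrow> norm (\<Phi> u z) \<le> B0"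
proof -
  obtain eb \<beta>b where eb: "0 < eb" "eb < \<delta>" "section_on F (box_at {-a..eb} {-\<delta>-eb..-\<delta>+eb}) \<beta>b"
      "\<And>z. z \<in> box_at {-a..0} {-\<delta>..\<delta>} \<inter> box_at {-a..eb} {-\<delta>-eb..-\<delta>+eb} \<Longrightarrow> z \<notin> K0 \<and> \<Phi>0 z = \<beta>b z"
    using edge_section[OF a _ K0(1,3) s, of "-\<delta>"] by blast
  obtain et \<beta>t where et: "0 < et" "et < \<delta>" "section_on F (box_at {-a..et} {\<delta>-et..\<delta>+et}) \<beta>t"
      "\<And>z. z \<in> box_at {-a..0} {-\<delta>..\<delta>} \<inter> box_at {-a..et} {\<delta>-et..\<delta>+et} \<Longrightarrow> z \<notin> K0 \<and> \<Phi>0 z = \<beta>t z"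
    using edge_section[OF a _ K0(1,3) s, of \<delta>] by blast
  define e where "e = min eb et"
  have e: "0 < e" "e < \<delta>" "e \<le> eb" "e \<le> et" using eb et by (auto simp: e_def)
  let ?Bb = "box_at {-a..e} {-\<delta>..-\<delta>+e}" and ?Bt = "box_at {-a..e} {\<delta>-e..\<delta>}" and ?A = "box_at {-a..0} {-\<delta>..\<delta>}"
  have sb: "section_on F ?Bb \<beta>b" by (rule section_on_subset[OF eb(3)]) (use e in \<open>auto simp: box_at_def\<close>)
  have st: "section_on F ?Bt \<beta>t" by (rule section_on_subset[OF et(3)]) (use e in \<open>auto simp: box_at_def\<close>)
  have bb: "z \<notin> K0 \<and> \<Phi>0 z = \<beta>b z" if "z \<in> ?A" "z \<in> ?Bb" for z
    by (rule eb(4)) (use that e in \<open>auto simp: box_at_def\<close>)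
  have bt: "z \<notin> K0 \<and> \<Phi>0 z = \<beta>t z" if "z \<in> ?A" "z \<in> ?Bt" for z
    by (rule et(4)) (use that e in \<open>auto simp: box_at_def\<close>)
  define u0 where "u0 = min a e / (16 * \<delta>)"
  have u0: "0 < u0" "u0 * \<delta> = min a e / 16" using a e by (auto simp: u0_def)
  have ud: "\<bar>u * x\<bar> \<le> min a e / 16" if "\<bar>u\<bar> \<le> u0" "\<bar>x\<bar> \<le> \<delta>" for u x
  proof -
    have "\<bar>u * x\<bar> \<le> u0 * \<delta>" using that a unfolding abs_mult by (intro mult_mono) auto
    then show ?thesis using u0 by simp
  qed
  \<comment> \<open>the parallelogram swept by the lines of slope \<open>u\<close>\<close>
  define R where "R = (\<lambda>u c. {z. \<bar>Im z\<bar> \<le> \<delta> \<and> - a / 2 \<le> Re z + u * Im z \<and> Re z + u * Im z \<le> c})"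
  define S where "S = (\<lambda>u c. {z. \<bar>Im z\<bar> \<le> \<delta> \<and> - a / 2 \<le> Re z + u * Im z \<and> Re z + u * Im z < c})"
  have convS: "convex (S u c)" for u c
  proof -
    have eq: "S u c = box_at UNIV {- \<delta>..\<delta>} \<inter> {z. Re z + u * Im z < c} \<inter> {z. inner (Complex (-1) (-u)) z \<le> a / 2}"
      by (auto simp: S_def box_at_def abs_le_iff inner_complex_def)
    show ?thesis unfolding eq by (intro convex_Int convex_box_at convex_halfplane_lt convex_halfspace_le) auto
  qed
  define left where "left = ?A \<inter> {z. Re z < 0}"
  have convleft: "convex left" unfolding left_def by (intro convex_Int convex_box_at convex_halfspace_Re_lt) auto
  have sleft: "section_on F left \<Phi>0" by (rule section_on_subset[OF s]) (use K0(3) in \<open>auto simp: left_def box_at_def\<close>)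
  define b where "b = (\<lambda>u. Complex (- a / 2 + u * \<delta>) (- \<delta>))"
  have bl: "b u \<in> left" "b u \<in> ?Bb" if "\<bar>u\<bar> \<le> u0" for u
    using ud[OF that, of \<delta>] a e by (auto simp: b_def left_def box_at_def abs_le_iff)
  have main: "\<exists>c K \<Phi>. - a / 2 < c \<and> c \<le> e / 2 \<and> half_reeb F (Complex 1 (-u)) (R u c) c K \<Phi> \<and> (\<forall>k\<in>K. \<bar>Im k\<bar> < \<delta>) \<and>
      (\<forall>z\<in>R u c. Im z = - \<delta> \<longrightarrow> \<Phi> z = \<beta>b z) \<and> (\<forall>z\<in>R u c. Im z = \<delta> \<longrightarrow> \<Phi> z = \<beta>t z)" if u: "\<bar>u\<bar> \<le> u0" for u
  proof -
    define w l where "w = complex_of_real ((a + e) / 2)" and "l = Complex (- 2 * u * \<delta>) (2 * \<delta>)"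
    have D: "Im (cnj w * l) \<noteq> 0" using a e by (simp add: w_def l_def)
    have pm: "Re (pmap (b u) w l \<zeta>) = - a / 2 + u * \<delta> + Re \<zeta> * ((a + e) / 2) - 2 * u * \<delta> * Im \<zeta>"
        "Im (pmap (b u) w l \<zeta>) = - \<delta> + 2 * \<delta> * Im \<zeta>" for \<zeta>
      by (simp_all add: pmap_def b_def w_def l_def)
    have pl: "Re (pmap (b u) w l \<zeta>) + u * Im (pmap (b u) w l \<zeta>) = - a / 2 + Re \<zeta> * ((a + e) / 2)" for \<zeta>
      unfolding pm by (simp add: algebra_simps)
    have parR: "par (b u) w l {0..t} {0..1} = R u (- a / 2 + t * ((a + e) / 2))" for t
    proof (intro equalityI subsetI)
      fix z assume "z \<in> par (b u) w l {0..t} {0..1}"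
      then obtain \<zeta> where ze: "0 \<le> Re \<zeta>" "Re \<zeta> \<le> t" "0 \<le> Im \<zeta>" "Im \<zeta> \<le> 1" "z = pmap (b u) w l \<zeta>" by (auto simp: box_at_def)
      have "0 \<le> Re \<zeta> * ((a + e) / 2)" "Re \<zeta> * ((a + e) / 2) \<le> t * ((a + e) / 2)" using ze a e by (auto intro!: mult_right_mono)
      moreover have "0 \<le> \<delta> * Im \<zeta>" "\<delta> * Im \<zeta> \<le> \<delta> * 1" using ze a by (auto intro!: mult_left_mono simp del: mult_1_right)
      ultimately show "z \<in> R u (- a / 2 + t * ((a + e) / 2))"
        unfolding R_def mem_Collect_eq ze(5) pl by (auto simp: pm abs_le_iff)
    next
      fix z assume z: "z \<in> R u (- a / 2 + t * ((a + e) / 2))"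
      define \<zeta> where "\<zeta> = pinv (b u) w l z"
      have zz: "z = pmap (b u) w l \<zeta>" using D by (simp add: \<zeta>_def)
      have "0 \<le> Re \<zeta> * ((a + e) / 2)" "Re \<zeta> * ((a + e) / 2) \<le> t * ((a + e) / 2)"
        using z unfolding R_def mem_Collect_eq zz pl by auto
      then have "0 \<le> Re \<zeta>" "Re \<zeta> \<le> t" using a e by (auto simp: zero_le_mult_iff mult_le_cancel_right)
      moreover have "- \<delta> \<le> - \<delta> + 2 * \<delta> * Im \<zeta>" "- \<delta> + 2 * \<delta> * Im \<zeta> \<le> \<delta>"
        using z unfolding R_def mem_Collect_eq zz pm by (auto simp: abs_le_iff)
      then have "0 \<le> \<delta> * Im \<zeta>" "\<delta> * Im \<zeta> \<le> \<delta> * 1" by auto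
      then have "0 \<le> Im \<zeta>" "Im \<zeta> \<le> 1" using a by (auto simp: zero_le_mult_iff mult_le_cancel_left)
      ultimately show "z \<in> par (b u) w l {0..t} {0..1}" unfolding zz by (intro imageI) (simp add: box_at_def)
    qed
    have usmall: "\<bar>u * \<delta>\<bar> \<le> min a e / 16" using ud[OF u, of \<delta>] a by simp
    have end_in: "pmap (b u) w l \<zeta> \<in> box_at {-a..e} {-\<delta> + 2 * \<delta> * Im \<zeta>}" if "Re \<zeta> \<in> {0..1}" "Im \<zeta> = 0 \<or> Im \<zeta> = 1" for \<zeta>
    proof -
      define q where "q = Re \<zeta> * ((a + e) / 2)"
      have "q \<le> 1 * ((a + e) / 2)" unfolding q_def using that a e by (intro mult_right_mono) auto
      moreover have "0 \<le> q" unfolding q_def using that a e by simp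
      ultimately have q: "0 \<le> q" "q \<le> a / 2 + e / 2" by (simp_all add: add_divide_distrib)
      have v: "- (a / 16) \<le> u * \<delta>" "u * \<delta> \<le> a / 16" "- (e / 16) \<le> u * \<delta>" "u * \<delta> \<le> e / 16" using usmall by linarith+
      have "Re (pmap (b u) w l \<zeta>) = - a / 2 + u * \<delta> + q - 2 * (u * \<delta>) * Im \<zeta>" unfolding pm q_def by simp
      then have "Re (pmap (b u) w l \<zeta>) = - a / 2 + u * \<delta> + q \<or> Re (pmap (b u) w l \<zeta>) = - a / 2 - u * \<delta> + q"
        using that(2) by auto
      then have "- a \<le> Re (pmap (b u) w l \<zeta>)" "Re (pmap (b u) w l \<zeta>) \<le> e" using q v a e(1) by linarith+
      then show ?thesis unfolding box_at_def using pm(2)[of \<zeta>] by simp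
    qed
    have s_bot: "section_on F (par (b u) w l {0..1} {0}) \<beta>b"
    proof (rule section_on_subset[OF sb], rule subsetI)
      fix z assume "z \<in> par (b u) w l {0..1} {0}"
      then obtain \<zeta> where ze: "Re \<zeta> \<in> {0..1}" "Im \<zeta> = 0" "z = pmap (b u) w l \<zeta>" by (auto simp: box_at_def)
      then show "z \<in> ?Bb" using end_in[of \<zeta>] e by (auto simp: box_at_def)
    qed
    have s_top: "section_on F (par (b u) w l {0..1} {1}) \<beta>t"
    proof (rule section_on_subset[OF st], rule subsetI)
      fix z assume "z \<in> par (b u) w l {0..1} {1}"
      then obtain \<zeta> where ze: "Re \<zeta> \<in> {0..1}" "Im \<zeta> = 1" "z = pmap (b u) w l \<zeta>" by (auto simp: box_at_def)
      then show "z \<in> ?Bt" using end_in[of \<zeta>] e by (auto simp: box_at_def)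
    qed
    have left_in: "par (b u) w l {0} {0..1} \<subseteq> left"
    proof
      fix z assume "z \<in> par (b u) w l {0} {0..1}"
      then obtain \<zeta> where ze: "Re \<zeta> = 0" "0 \<le> Im \<zeta>" "Im \<zeta> \<le> 1" "z = pmap (b u) w l \<zeta>" by (auto simp: box_at_def)
      have "0 \<le> \<delta> * Im \<zeta>" "\<delta> * Im \<zeta> \<le> \<delta> * 1" using ze a by (auto intro!: mult_left_mono simp del: mult_1_right)
      then have im: "\<bar>Im z\<bar> \<le> \<delta>" unfolding ze(4) pm by (auto simp: abs_le_iff)
      have "Re z + u * Im z = - a / 2" using pl[of \<zeta>] ze by simp
      moreover have "\<bar>u * Im z\<bar> \<le> min a e / 16" using ud[OF u im] .
      ultimately show "z \<in> left" using a im by (auto simp: left_def box_at_def abs_le_iff min_def split: if_splits)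
    qed
    have s_left: "section_on F (par (b u) w l {0} {0..1}) \<Phi>0" by (rule section_on_subset[OF sleft left_in])
    have bu: "b u = pmap (b u) w l 0" "b u + l = pmap (b u) w l \<i>" by (simp_all add: pmap_def)
    have e0: "\<Phi>0 (b u) = \<beta>b (b u)" using bb[of "b u"] bl[OF u] by (auto simp: left_def)
    have e1: "\<Phi>0 (b u + l) = \<beta>t (b u + l)"
    proof -
      have "b u + l \<in> par (b u) w l {0} {0..1}" unfolding bu(2) by (intro imageI) (simp add: box_at_def)
      then have "b u + l \<in> left" using left_in by blast
      moreover have "b u + l \<in> ?Bt" using end_in[of \<i>] e unfolding bu(2) by (auto simp: box_at_def)
      ultimately show ?thesis using bt by (auto simp: left_def)
    qed
    have full: False if f: "section_on F (par (b u) w l {0..1} {0..1}) \<Phi>'" "\<forall>z\<in>par (b u) w l {0..1} {0}. \<Phi>' z = \<beta>b z" for \<Phi>'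
    proof -
      obtain k where k: "k \<in> K0" using K0(2) by blast
      have kk: "Re k = 0" "\<bar>Im k\<bar> < \<delta>" using K0(3) k by (auto simp: box_at_def)
      have uk: "\<bar>u * Im k\<bar> \<le> min a e / 16" using ud[OF u] kk by simp
      have par1: "par (b u) w l {0..1} {0..1} = R u (e / 2)" using parR[of 1] by (simp add: field_simps)
      have kR: "k - of_real t \<in> R u (e / 2)" if "0 \<le> t" "t < a / 4" for t
        using that kk uk a e by (auto simp: R_def abs_le_iff min_def split: if_splits)
      show False
      proof (rule singular_point_no_section[of left \<Phi>0 k "R u (e / 2)" \<Phi>' "a / 4" "b u"])
        show "convex left" by (rule convleft)
        show "section_on F left \<Phi>0" by (rule sleft)
        show "filterlim \<Phi>0 at_infinity (at k within left)"
          by (rule filterlim_mono[OF lim0[OF k] order_refl at_le]) (use K0(3) in \<open>auto simp: left_def box_at_def\<close>)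
        show "convex (R u (e / 2))" unfolding par1[symmetric] by (intro convex_par) auto
        show "section_on F (R u (e / 2)) \<Phi>'" using f(1) par1 by simp
        show "k \<in> R u (e / 2)" using kR[of 0] a by simp
        show "0 < a / 4" using a by simp
        show "k - of_real t \<in> left \<inter> R u (e / 2)" if "0 < t" "t < a / 4" for t
          using kR[of t] that kk a by (auto simp: left_def box_at_def)
        have "b u \<in> par (b u) w l {0..1} {0..1}" by (subst bu(1), intro imageI) (simp add: box_at_def)
        then show "b u \<in> left \<inter> R u (e / 2)" using bl[OF u] par1 by blast
        have "b u \<in> par (b u) w l {0..1} {0}" by (subst bu(1), intro imageI) (simp add: box_at_def)
        then show "\<Phi>0 (b u) = \<Phi>' (b u)" using bspec[OF f(2)] e0 by metis
      qed
    qed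
    have part: ?thesis if p: "0 < T" "T \<le> 1" "compact K'" "K' \<noteq> {}" "K' \<subseteq> par (b u) w l {T} {0<..<1}"
        "section_on F (par (b u) w l {0..T} {0..1} - K') \<Phi>'"
        "\<forall>k\<in>K'. filterlim \<Phi>' at_infinity (at k within par (b u) w l {0..T} {0..1} - K')"
        "\<forall>z\<in>par (b u) w l {0..T} {0}. \<Phi>' z = \<beta>b z" "\<forall>z\<in>par (b u) w l {0..T} {1}. \<Phi>' z = \<beta>t z" for T K' \<Phi>'
    proof -
      define c where "c = - a / 2 + T * ((a + e) / 2)"
      have c: "- a / 2 < c" "c \<le> e / 2"
      proof -
        have "0 < T * ((a + e) / 2)" "T * ((a + e) / 2) \<le> 1 * ((a + e) / 2)" using p a e by (auto intro!: mult_right_mono simp del: mult_1_left)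
        then show "- a / 2 < c" "c \<le> e / 2" by (auto simp: c_def)
      qed
      have m: "Complex 1 (-u) \<noteq> 0" "Re (Complex 1 (-u) * l) = 0" "Re (Complex 1 (-u) * w) > 0"
        using a e by (auto simp: l_def w_def complex_eq_iff)
      have hc: "Re (Complex 1 (-u) * (b u + of_real T * w)) = c"
        by (simp add: b_def w_def c_def algebra_simps)
      have hr: "half_reeb F (Complex 1 (-u)) (R u c) c K' \<Phi>'"
        using half_reeb_parallelogram[OF p(1) D m p(3-7)] unfolding hc parR[of T] c_def .
      have kin: "\<bar>Im k\<bar> < \<delta>" if kK: "k \<in> K'" for k
      proof -
        have "k \<in> par (b u) w l {T} {0<..<1}" using p(5) kK by blast
        then obtain \<zeta> where ze: "0 < Im \<zeta>" "Im \<zeta> < 1" "k = pmap (b u) w l \<zeta>" by (auto simp: box_at_def)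
        have "0 < \<delta> * Im \<zeta>" "\<delta> * Im \<zeta> < \<delta> * 1" using ze a by (auto intro!: mult_strict_left_mono simp del: mult_1_right)
        then show ?thesis unfolding ze(3) pm by (auto simp: abs_less_iff)
      qed
      have edge: "\<exists>\<zeta>. 0 \<le> Re \<zeta> \<and> Re \<zeta> \<le> T \<and> Im \<zeta> = (Im z + \<delta>) / (2 * \<delta>) \<and> z = pmap (b u) w l \<zeta>" if zR: "z \<in> R u c" for z
      proof -
        have "z \<in> par (b u) w l {0..T} {0..1}" using zR parR[of T] c_def by simp
        then obtain \<zeta> where ze: "0 \<le> Re \<zeta>" "Re \<zeta> \<le> T" "z = pmap (b u) w l \<zeta>" by (auto simp: box_at_def)
        moreover have "Im \<zeta> = (Im z + \<delta>) / (2 * \<delta>)" unfolding ze(3) pm using a by simp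
        ultimately show ?thesis by blast
      qed
      have "\<Phi>' z = \<beta>b z" if zz: "z \<in> R u c" "Im z = - \<delta>" for z
      proof -
        obtain \<zeta> where ze: "0 \<le> Re \<zeta>" "Re \<zeta> \<le> T" "Im \<zeta> = 0" "z = pmap (b u) w l \<zeta>" using edge[OF zz(1)] zz(2) by auto
        then have "z \<in> par (b u) w l {0..T} {0}" by (auto simp: box_at_def)
        then show ?thesis using p(8) by blast
      qed
      moreover have "\<Phi>' z = \<beta>t z" if zz: "z \<in> R u c" "Im z = \<delta>" for z
      proof -
        obtain \<zeta> where ze: "0 \<le> Re \<zeta>" "Re \<zeta> \<le> T" "Im \<zeta> = 1" "z = pmap (b u) w l \<zeta>" using edge[OF zz(1)] zz(2) a by auto
        then have "z \<in> par (b u) w l {0..T} {1}" by (auto simp: box_at_def)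
        then show ?thesis using p(9) by blast
      qed
      ultimately show ?thesis using c hr kin by blast
    qed
    from sweep[OF D s_bot s_top s_left e0 e1] show ?thesis
      by (elim disjE exE conjE) (erule (1) full[THEN FalseE], erule (8) part)
  qed
  define good where "good = (\<lambda>u c K \<Phi>. - a / 2 < c \<and> c \<le> e / 2 \<and> half_reeb F (Complex 1 (-u)) (R u c) c K \<Phi> \<and> (\<forall>k\<in>K. \<bar>Im k\<bar> < \<delta>) \<and>
      (\<forall>z\<in>R u c. Im z = - \<delta> \<longrightarrow> \<Phi> z = \<beta>b z) \<and> (\<forall>z\<in>R u c. Im z = \<delta> \<longrightarrow> \<Phi> z = \<beta>t z))"
  have "\<forall>u. \<exists>x. \<bar>u\<bar> \<le> u0 \<longrightarrow> good u (fst x) (fst (snd x)) (snd (snd x))"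
  proof
    fix u
    show "\<exists>x. \<bar>u\<bar> \<le> u0 \<longrightarrow> good u (fst x) (fst (snd x)) (snd (snd x))"
    proof (cases "\<bar>u\<bar> \<le> u0")
      case True
      then obtain c K \<Phi> where "good u c K \<Phi>" using main unfolding good_def by blast
      then show ?thesis by (intro exI[of _ "(c, K, \<Phi>)"]) simp
    qed simp
  qed
  then obtain X where X: "\<And>u. \<bar>u\<bar> \<le> u0 \<Longrightarrow> good u (fst (X u)) (fst (snd (X u))) (snd (snd (X u)))" by metis
  define h K \<Phi> where "h = (\<lambda>u. fst (X u))" and "K = (\<lambda>u. fst (snd (X u)))" and "\<Phi> = (\<lambda>u. snd (snd (X u)))"
  have gd: "good u (h u) (K u) (\<Phi> u)" if "\<bar>u\<bar> \<le> u0" for u using X[OF that] by (simp add: h_def K_def \<Phi>_def)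
  have fam: "\<And>u. \<bar>u\<bar> \<le> u0 \<Longrightarrow> - a / 2 < h u" "\<And>u. \<bar>u\<bar> \<le> u0 \<Longrightarrow> h u \<le> e / 2"
      "\<And>u. \<bar>u\<bar> \<le> u0 \<Longrightarrow> half_reeb F (Complex 1 (-u)) (R u (h u)) (h u) (K u) (\<Phi> u)"
      "\<And>u k. \<bar>u\<bar> \<le> u0 \<Longrightarrow> k \<in> K u \<Longrightarrow> \<bar>Im k\<bar> < \<delta>"
      "\<And>u z. \<bar>u\<bar> \<le> u0 \<Longrightarrow> z \<in> R u (h u) \<Longrightarrow> Im z = - \<delta> \<Longrightarrow> \<Phi> u z = \<beta>b z"
      "\<And>u z. \<bar>u\<bar> \<le> u0 \<Longrightarrow> z \<in> R u (h u) \<Longrightarrow> Im z = \<delta> \<Longrightarrow> \<Phi> u z = \<beta>t z"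
    using gd unfolding good_def by blast+
  have Kh: "Re k + u * Im k = h u" if "\<bar>u\<bar> \<le> u0" "k \<in> K u" for u k
    using fam(3)[OF that(1)] that(2) by (auto simp: half_reeb_def)
  have SK: "S u (h u) \<subseteq> R u (h u) - K u" if "\<bar>u\<bar> \<le> u0" for u
    using Kh[OF that] by (fastforce simp: S_def R_def)
  have sS: "section_on F (S u (h u)) (\<Phi> u)" if "\<bar>u\<bar> \<le> u0" for u
    using fam(3)[OF that] SK[OF that] by (auto simp: half_reeb_def intro: section_on_subset)
  have limS: "filterlim (\<Phi> u) at_infinity (at k within S u (h u))" if "\<bar>u\<bar> \<le> u0" "k \<in> K u" for u k
  proof -
    have "filterlim (\<Phi> u) at_infinity (at k within R u (h u) - K u)" using fam(3)[OF that(1)] that(2) by (simp add: half_reeb_def)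
    then show ?thesis by (rule filterlim_mono[OF _ order_refl at_le[OF SK[OF that(1)]]])
  qed
  have appS: "k - of_real t \<in> S u (h u)" if "\<bar>u\<bar> \<le> u0" "k \<in> K u" "0 < t" "t < h u + a / 2" for u k t
    using Kh[OF that(1,2)] fam(4)[OF that(1,2)] that(3,4) by (auto simp: S_def)
  have bS: "b u \<in> S u (h u)" if "\<bar>u\<bar> \<le> u0" for u
    using fam(1)[OF that] a by (auto simp: b_def S_def)
  have PhiB: "\<Phi> u (b u) = \<Phi>0 (b u)" if "\<bar>u\<bar> \<le> u0" for u
  proof -
    have "b u \<in> R u (h u)" using bS[OF that] SK[OF that] by blast
    then have "\<Phi> u (b u) = \<beta>b (b u)" using fam(5)[OF that] by (simp add: b_def)
    then show ?thesis using bb[of "b u"] bl[OF that] by (auto simp: left_def)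
  qed
  have agree0: "\<Phi> u z = \<Phi>0 z" if u: "\<bar>u\<bar> \<le> u0" and z: "z \<in> S u (h u) \<inter> left" for u z
  proof -
    have s1: "section_on F (S u (h u) \<inter> left) (\<Phi> u)" by (rule section_on_subset[OF sS[OF u]]) auto
    have s2: "section_on F (S u (h u) \<inter> left) \<Phi>0" by (rule section_on_subset[OF sleft]) auto
    show ?thesis
      by (rule section_unique_convex[OF _ s1 s2 _ PhiB[OF u] z]) (use bS[OF u] bl[OF u] convS convleft in \<open>auto simp: convex_Int\<close>)
  qed
  have Re_K: "0 \<le> Re k" if u: "\<bar>u\<bar> \<le> u0" and k: "k \<in> K u" for u k
  proof (rule ccontr)
    assume neg: "\<not> ?thesis"
    have uk: "\<bar>u * Im k\<bar> \<le> min a e / 16" using ud[OF u] fam(4)[OF u k] by simp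
    have ka: "- a < Re k" using Kh[OF u k] fam(1)[OF u] uk a by (auto simp: abs_le_iff min_def split: if_splits)
    show False
    proof (rule singular_point_no_section[OF convS sS[OF u] limS[OF u k] convleft sleft _ _ _ _ PhiB[OF u]])
      show "k \<in> left" using ka neg fam(4)[OF u k] by (auto simp: left_def box_at_def abs_less_iff)
      show "0 < min (h u + a / 2) (Re k + a)" using fam(1)[OF u] ka by simp
      show "k - of_real t \<in> S u (h u) \<inter> left" if "0 < t" "t < min (h u + a / 2) (Re k + a)" for t
        using appS[OF u k, of t] that neg fam(4)[OF u k] by (auto simp: left_def box_at_def abs_less_iff)
      show "b u \<in> S u (h u) \<inter> left" using bS[OF u] bl[OF u] by blast
    qed
  qed
  have Kne: "K u \<noteq> {}" if "\<bar>u\<bar> \<le> u0" for u using fam(3)[OF that] by (simp add: half_reeb_def)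
  have hlow: "- (min a e / 16) \<le> h u" if u: "\<bar>u\<bar> \<le> u0" for u
  proof -
    obtain k where k: "k \<in> K u" using Kne[OF u] by blast
    have "\<bar>u * Im k\<bar> \<le> min a e / 16" using ud[OF u] fam(4)[OF u k] by simp
    then show ?thesis using Kh[OF u k] Re_K[OF u k] by (auto simp: abs_le_iff)
  qed
  define p where "p = Complex (- a / 4) (- \<delta>)"
  have pS: "p \<in> S u (h u) \<inter> left" if "\<bar>u\<bar> \<le> u0" for u
    using hlow[OF that] ud[OF that, of \<delta>] a e by (auto simp: p_def S_def left_def box_at_def abs_le_iff min_def split: if_splits)
  have agree: "\<Phi> u z = \<Phi> u' z" if u: "\<bar>u\<bar> \<le> u0" "\<bar>u'\<bar> \<le> u0" and z: "z \<in> S u (h u) \<inter> S u' (h u')" for u u' z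
  proof -
    have s1: "section_on F (S u (h u) \<inter> S u' (h u')) (\<Phi> u)" by (rule section_on_subset[OF sS[OF u(1)]]) auto
    have s2: "section_on F (S u (h u) \<inter> S u' (h u')) (\<Phi> u')" by (rule section_on_subset[OF sS[OF u(2)]]) auto
    have "\<Phi> u p = \<Phi> u' p" using agree0[OF u(1) pS[OF u(1)]] agree0[OF u(2) pS[OF u(2)]] by simp
    then show ?thesis
      by (intro section_unique_convex[OF _ s1 s2 _ _ z, of p]) (use pS[OF u(1)] pS[OF u(2)] convS in \<open>auto simp: convex_Int\<close>)
  qed
  have super: "h u' \<le> h u + (u' - u) * Im k" if u: "\<bar>u\<bar> \<le> u0" "\<bar>u'\<bar> \<le> u0" and k: "k \<in> K u" for u u' k
  proof (rule ccontr)
    assume neg: "\<not> ?thesis"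
    have line: "Re k + u' * Im k = h u + (u' - u) * Im k" using Kh[OF u(1) k] by (simp add: algebra_simps)
    have uk: "\<bar>u' * Im k\<bar> \<le> min a e / 16" using ud[OF u(2)] fam(4)[OF u(1) k] by simp
    have low: "- a / 2 + a / 4 < Re k + u' * Im k" using Re_K[OF u(1) k] uk a by (auto simp: abs_le_iff min_def split: if_splits)
    have inS: "k - of_real t \<in> S u' (h u')" if "0 \<le> t" "t < a / 4" for t
      using that low line neg fam(4)[OF u(1) k] by (auto simp: S_def)
    have pe: "\<Phi> u p = \<Phi> u' p" using agree[OF u, of p] pS[OF u(1)] pS[OF u(2)] by blast
    show False
    proof (rule singular_point_no_section[OF convS sS[OF u(1)] limS[OF u(1) k] convS sS[OF u(2)] _ _ _ _ pe])
      show "k \<in> S u' (h u')" using inS[of 0] a by simp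
      show "0 < min (h u + a / 2) (a / 4)" using fam(1)[OF u(1)] a by simp
      show "k - of_real t \<in> S u (h u) \<inter> S u' (h u')" if "0 < t" "t < min (h u + a / 2) (a / 4)" for t
        using appS[OF u(1) k, of t] inS[of t] that by auto
      show "p \<in> S u (h u) \<inter> S u' (h u')" using pS[OF u(1)] pS[OF u(2)] by blast
    qed
  qed
  \<comment> \<open>bounds near the ends of the swept segments\<close>
  have cBb: "compact (\<beta>b ` ?Bb)" and cBt: "compact (\<beta>t ` ?Bt)"
    using sb st by (auto simp: section_on_def intro!: compact_continuous_image compact_box_at)
  have cleft: "compact (\<Phi>0 ` box_at {-a..-a/8} {-\<delta>..\<delta>})"
  proof (rule compact_continuous_image[OF _ compact_box_at])
    have "box_at {-a..-a/8} {-\<delta>..\<delta>} \<subseteq> left" using a by (auto simp: left_def box_at_def)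
    then show "continuous_on (box_at {-a..-a/8} {-\<delta>..\<delta>}) \<Phi>0" using sleft by (auto simp: section_on_def intro: continuous_on_subset)
  qed
  have "bounded (\<beta>b ` ?Bb \<union> \<beta>t ` ?Bt \<union> \<Phi>0 ` box_at {-a..-a/8} {-\<delta>..\<delta>})"
    using cBb cBt cleft by (simp add: compact_imp_bounded)
  then obtain B0 where B0: "\<And>v. v \<in> \<beta>b ` ?Bb \<union> \<beta>t ` ?Bt \<union> \<Phi>0 ` box_at {-a..-a/8} {-\<delta>..\<delta>} \<Longrightarrow> norm v \<le> B0"
    unfolding bounded_iff by blast
  have edge_eq: "\<Phi> u z = \<beta> z" if u: "\<bar>u\<bar> \<le> u0" and z: "z \<in> S u (h u) \<inter> B" and B: "convex B" "section_on F B \<beta>"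
      "q \<in> S u (h u) \<inter> B" "\<Phi> u q = \<beta> q" for u z B \<beta> q
  proof -
    have s1: "section_on F (S u (h u) \<inter> B) (\<Phi> u)" by (rule section_on_subset[OF sS[OF u]]) auto
    have s2: "section_on F (S u (h u) \<inter> B) \<beta>" by (rule section_on_subset[OF B(2)]) auto
    show ?thesis by (rule section_unique_convex[OF _ s1 s2 B(3,4) z]) (use convS B(1) in \<open>simp add: convex_Int\<close>)
  qed
  have bot_eq: "\<Phi> u z = \<beta>b z" if u: "\<bar>u\<bar> \<le> u0" and z: "z \<in> S u (h u) \<inter> ?Bb" for u z
  proof (rule edge_eq[OF u z _ sb])
    show "b u \<in> S u (h u) \<inter> ?Bb" using bS[OF u] bl[OF u] by blast
    show "\<Phi> u (b u) = \<beta>b (b u)" using fam(5)[OF u, of "b u"] SK[OF u] bS[OF u] by (auto simp: b_def)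
  qed (intro convex_box_at; simp)
  have top_eq: "\<Phi> u z = \<beta>t z" if u: "\<bar>u\<bar> \<le> u0" and z: "z \<in> S u (h u) \<inter> ?Bt" for u z
  proof (rule edge_eq[OF u z _ st])
    let ?q = "Complex (- a / 2 - u * \<delta>) \<delta>"
    have qS: "?q \<in> S u (h u)" using fam(1)[OF u] a by (auto simp: S_def)
    then show "?q \<in> S u (h u) \<inter> ?Bt" using ud[OF u, of \<delta>] a e by (auto simp: box_at_def abs_le_iff min_def split: if_splits)
    show "\<Phi> u ?q = \<beta>t ?q" using fam(6)[OF u, of ?q] SK[OF u] qS by auto
  qed (intro convex_box_at; simp)
  define a' where "a' = a / 4"
  have a': "0 < a'" "u0 * \<delta> \<le> a' / 4" using a u0(2) by (auto simp: a'_def)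
  have TS: "below_line a' \<delta> h u \<subseteq> S u (h u)" if u: "\<bar>u\<bar> \<le> u0" for u
  proof
    fix z assume z: "z \<in> below_line a' \<delta> h u"
    then have "\<bar>u * Im z\<bar> \<le> min a e / 16" using ud[OF u] by (simp add: below_line_def)
    then show "z \<in> S u (h u)" using z a by (auto simp: below_line_def S_def a'_def abs_le_iff min_def split: if_splits)
  qed
  have Re_T: "- a \<le> Re z" "Re z \<le> e" "\<bar>Im z\<bar> \<le> \<delta>" if u: "\<bar>u\<bar> \<le> u0" and z: "z \<in> below_line a' \<delta> h u" for u z
  proof -
    have "\<bar>u * Im z\<bar> \<le> min a e / 16" using ud[OF u] z by (simp add: below_line_def)
    then show "- a \<le> Re z" "Re z \<le> e" "\<bar>Im z\<bar> \<le> \<delta>" using z fam(2)[OF u] a e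
      by (auto simp: below_line_def a'_def abs_le_iff min_def split: if_splits)
  qed
  show ?thesis
  proof (rule that[of a' u0 e "\<lambda>u. R u (h u)" h K \<Phi> B0])
    show "below_line a' \<delta> h u \<subseteq> R u (h u) - K u" if "\<bar>u\<bar> \<le> u0" for u using TS[OF that] SK[OF that] by blast
    show "- a' / 4 \<le> h u" if "\<bar>u\<bar> \<le> u0" for u using hlow[OF that] a e by (auto simp: a'_def min_def split: if_splits)
    show "0 \<le> Re k \<and> \<bar>Im k\<bar> \<le> \<delta> - e" if u: "\<bar>u\<bar> \<le> u0" and k: "k \<in> K u" for u k
    proof (rule conjI[OF Re_K[OF u k]], rule ccontr)
      assume neg: "\<not> \<bar>Im k\<bar> \<le> \<delta> - e"
      have ks: "\<bar>Im k\<bar> < \<delta>" using fam(4)[OF u k] .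
      have uk: "\<bar>u * Im k\<bar> \<le> min a e / 16" using ud[OF u] ks by simp
      have Rk: "Re k < e" using Kh[OF u k] fam(2)[OF u] uk e a by (auto simp: abs_le_iff min_def split: if_splits)
      have cvBt: "convex ?Bt" and cvBb: "convex ?Bb" by (intro convex_box_at; simp)+
      have sing: False if B: "convex B" "section_on F B \<beta>" "k \<in> B" "\<And>t. 0 < t \<Longrightarrow> t < a \<Longrightarrow> k - of_real t \<in> B"
          "q \<in> S u (h u) \<inter> B" "\<Phi> u q = \<beta> q" for B \<beta> q
      proof (rule singular_point_no_section[OF convS sS[OF u] limS[OF u k] B(1-3) _ _ B(5,6)])
        show "0 < min (h u + a / 2) a" using fam(1)[OF u] a by simp
        show "k - of_real t \<in> S u (h u) \<inter> B" if "0 < t" "t < min (h u + a / 2) a" for t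
          using appS[OF u k, of t] B(4)[of t] that by auto
      qed
      show False
      proof (cases "0 \<le> Im k")
        case True
        let ?q = "Complex (- a / 2 - u * \<delta>) \<delta>"
        have qS: "?q \<in> S u (h u)" using fam(1)[OF u] a by (auto simp: S_def)
        show False
        proof (rule sing[OF cvBt st])
          show "?q \<in> S u (h u) \<inter> ?Bt" using qS ud[OF u, of \<delta>] a e by (auto simp: box_at_def abs_le_iff min_def split: if_splits)
          then show "\<Phi> u ?q = \<beta>t ?q" by (rule top_eq[OF u])
        qed (use True neg ks Rk Re_K[OF u k] a in \<open>auto simp: box_at_def\<close>)
      next
        case False
        show False
        proof (rule sing[OF cvBb sb])
          show "b u \<in> S u (h u) \<inter> ?Bb" using bS[OF u] bl[OF u] by blast
          then show "\<Phi> u (b u) = \<beta>b (b u)" by (rule bot_eq[OF u])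
        qed (use False neg ks Rk Re_K[OF u k] a in \<open>auto simp: box_at_def\<close>)
      qed
    qed
    show "z \<in> R u (h u)" if "\<bar>u\<bar> \<le> u0" "\<bar>Im z\<bar> < \<delta>" "Re z + u * Im z = h u" for u z
      using that fam(1)[OF that(1)] by (auto simp: R_def)
    show "\<Phi> u z = \<Phi> u' z" if "\<bar>u\<bar> \<le> u0" "\<bar>u'\<bar> \<le> u0" "z \<in> below_line a' \<delta> h u" "z \<in> below_line a' \<delta> h u'" for u u' z
      using agree[OF that(1,2), of z] TS[OF that(1)] TS[OF that(2)] that(3,4) by blast
    show "norm (\<Phi> u z) \<le> B0" if u: "\<bar>u\<bar> \<le> u0" and z: "z \<in> below_line a' \<delta> h u" and c: "\<delta> - e \<le> \<bar>Im z\<bar> \<or> Re z \<le> - a' / 2" for u z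
    proof -
      have zS: "z \<in> S u (h u)" using TS[OF u] z by blast
      note r = Re_T[OF u z]
      consider "Re z \<le> - a / 8" | "z \<in> ?Bb" | "z \<in> ?Bt" using c r by (force simp: box_at_def a'_def abs_le_iff)
      then show ?thesis
      proof cases
        case 1
        then have "z \<in> box_at {-a..-a/8} {-\<delta>..\<delta>}" "z \<in> left" using r a by (auto simp: box_at_def left_def abs_le_iff)
        then show ?thesis using B0 agree0[OF u, of z] zS by auto
      next
        case 2
        then show ?thesis using B0 bot_eq[OF u, of z] zS by auto
      next
        case 3
        then show ?thesis using B0 top_eq[OF u, of z] zS by auto
      qed
    qed
  qed (use a' u0 e fam super in auto)
qed

end

section \<open>Continuity in the slope\<close>

abbreviation tilt :: "real \<Rightarrow> complex \<Rightarrow> real" where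
  "tilt u z \<equiv> Re z + u * Im z"

text \<open>The family of half-Reeb regions for the slopes in an interval. Lines of slope \<open>u\<close> are the level lines of \<open>tilt u\<close>, and
  \<open>tilt u z = h u\<close> is the first one that does not lift. The two fields \<open>edge\<close> and \<open>K_box\<close> keep the singular points
  and all points with large preimages away from the horizontal sides and the left side of the rectangle. The
  locale speaks of a local homeomorphism only, so that it applies after a reflection of the source as well.\<close>

locale tangent_lines = local_homeo +
  fixes a \<delta> \<eta> B0 u1 u2 :: real and h :: "real \<Rightarrow> real" and K :: "real \<Rightarrow> complex set"
    and \<Phi> :: "real \<Rightarrow> complex \<Rightarrow> complex" and \<Delta> :: "real \<Rightarrow> complex set"
  assumes pos: "0 < a" "0 < \<delta>" "0 < \<eta>" "u1 < u2"
    and hr: "u \<in> {u1..u2} \<Longrightarrow> half_reeb F (Complex 1 (-u)) (\<Delta> u) (h u) (K u) (\<Phi> u)"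
    and T_sub: "u \<in> {u1..u2} \<Longrightarrow> below_line a \<delta> h u \<subseteq> \<Delta> u - K u"
    and h_low: "u \<in> {u1..u2} \<Longrightarrow> - a / 4 \<le> h u \<and> \<bar>u * \<delta>\<bar> \<le> a / 4"
    and K_box: "u \<in> {u1..u2} \<Longrightarrow> k \<in> K u \<Longrightarrow> 0 \<le> Re k \<and> \<bar>Im k\<bar> \<le> \<delta> - \<eta>"
    and line_sub: "u \<in> {u1..u2} \<Longrightarrow> \<bar>Im z\<bar> < \<delta> \<Longrightarrow> tilt u z = h u \<Longrightarrow> z \<in> \<Delta> u"
    and super: "u \<in> {u1..u2} \<Longrightarrow> u' \<in> {u1..u2} \<Longrightarrow> k \<in> K u \<Longrightarrow> h u' \<le> h u + (u' - u) * Im k"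
    and agree: "u \<in> {u1..u2} \<Longrightarrow> u' \<in> {u1..u2} \<Longrightarrow> z \<in> below_line a \<delta> h u \<Longrightarrow> z \<in> below_line a \<delta> h u' \<Longrightarrow> \<Phi> u z = \<Phi> u' z"
    and edge: "u \<in> {u1..u2} \<Longrightarrow> z \<in> below_line a \<delta> h u \<Longrightarrow> \<delta> - \<eta> \<le> \<bar>Im z\<bar> \<or> Re z \<le> - a / 2 \<Longrightarrow> norm (\<Phi> u z) \<le> B0"
    and strip_ex: "u \<in> {u1..u2} \<Longrightarrow> \<exists>M. \<forall>z\<in>\<Delta> u - K u. \<bar>tilt u (\<Phi> u z)\<bar> \<le> M"
begin

abbreviation I :: "real set" where "I \<equiv> {u1..u2}"
abbreviation T :: "real \<Rightarrow> complex set" where "T \<equiv> below_line a \<delta> h"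

lemma K_facts: assumes "u \<in> I"
  shows "compact (K u)" "K u \<noteq> {}" "\<And>k. k \<in> K u \<Longrightarrow> tilt u k = h u" "K u \<subseteq> \<Delta> u"
    "section_on F (\<Delta> u - K u) (\<Phi> u)" "section_on F (T u) (\<Phi> u)"
    "\<And>k. k \<in> K u \<Longrightarrow> filterlim (\<Phi> u) at_infinity (at k within \<Delta> u - K u)"
    "\<And>k. k \<in> K u \<Longrightarrow> filterlim (\<Phi> u) at_infinity (at k within T u)" "convex (\<Delta> u)"
    "\<And>z. z \<in> \<Delta> u \<Longrightarrow> tilt u z \<le> h u"
proof -
  note d = hr[OF assms, unfolded half_reeb_def]
  show "compact (K u)" "K u \<noteq> {}" "convex (\<Delta> u)" using d by blast+
  show "K u \<subseteq> \<Delta> u"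
  proof
    fix k assume k: "k \<in> K u"
    then obtain \<rho> where "\<rho> > 0" "ball k \<rho> \<inter> {z. Re (Complex 1 (-u) * z) \<le> h u} \<subseteq> \<Delta> u" "Re (Complex 1 (-u) * k) = h u"
      using d by blast
    moreover have "k \<in> ball k \<rho> \<inter> {z. Re (Complex 1 (-u) * z) \<le> h u}"
      unfolding Int_iff mem_Collect_eq \<open>Re (Complex 1 (-u) * k) = h u\<close> using \<open>\<rho> > 0\<close> centre_in_ball by blast
    ultimately show "k \<in> \<Delta> u" by blast
  qed
  show s: "section_on F (\<Delta> u - K u) (\<Phi> u)" using d by blast
  show l: "\<And>k. k \<in> K u \<Longrightarrow> filterlim (\<Phi> u) at_infinity (at k within \<Delta> u - K u)" using d by blast
  show "tilt u k = h u" if "k \<in> K u" for k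
  proof -
    have "Re (Complex 1 (-u) * k) = h u" using d that by blast
    then show ?thesis by simp
  qed
  show "tilt u z \<le> h u" if "z \<in> \<Delta> u" for z
  proof -
    have "Re (Complex 1 (-u) * z) \<le> h u" using d that by blast
    then show ?thesis by simp
  qed
  show "section_on F (T u) (\<Phi> u)" by (rule section_on_subset[OF s T_sub[OF assms]])
  show "filterlim (\<Phi> u) at_infinity (at k within T u)" if "k \<in> K u" for k
    by (rule filterlim_mono[OF l[OF that] order_refl at_le[OF T_sub[OF assms]]])
qed

lemma h_lipschitz:
  assumes "u \<in> I" "u' \<in> I" shows "\<bar>h u - h u'\<bar> \<le> \<delta> * \<bar>u - u'\<bar>"
proof -
  have *: "h v' - h v \<le> \<delta> * \<bar>v' - v\<bar>" if v: "v \<in> I" "v' \<in> I" for v v'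
  proof -
    obtain k where k: "k \<in> K v" using K_facts(2)[OF v(1)] by blast
    have "(v' - v) * Im k \<le> \<bar>v' - v\<bar> * \<bar>Im k\<bar>" by (metis abs_ge_self abs_mult)
    also have "\<dots> \<le> \<bar>v' - v\<bar> * \<delta>" using K_box[OF v(1) k] pos by (intro mult_left_mono) auto
    finally show ?thesis using super[OF v k] by (simp add: mult.commute)
  qed
  show ?thesis using *[OF assms] *[OF assms(2,1)] by (simp add: abs_le_iff abs_minus_commute)
qed

lemma h_tendsto:
  assumes "(v \<longlongrightarrow> u) G" "u \<in> I" "eventually (\<lambda>n. v n \<in> I) G"
  shows "((\<lambda>n. h (v n)) \<longlongrightarrow> h u) G"
proof -
  have "((\<lambda>n. \<delta> * \<bar>v n - u\<bar>) \<longlongrightarrow> \<delta> * \<bar>u - u\<bar>) G" by (intro tendsto_intros assms(1))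
  then have "((\<lambda>n. \<delta> * \<bar>v n - u\<bar>) \<longlongrightarrow> 0) G" by simp
  moreover have "eventually (\<lambda>n. norm (h (v n) - h u) \<le> \<delta> * \<bar>v n - u\<bar>) G"
    using assms(3) by eventually_elim (use h_lipschitz assms(2) in auto)
  ultimately have "((\<lambda>n. h (v n) - h u) \<longlongrightarrow> 0) G" by (rule Lim_null_comparison[rotated])
  then show ?thesis by (simp add: LIM_zero_iff)
qed

text \<open>Relative to the rectangle, the region below the line is open jointly in the point and the slope.\<close>

lemma eventually_below_line:
  assumes z: "z \<longlonglongrightarrow> z0" "\<And>n. \<bar>Im (z n)\<bar> \<le> \<delta> \<and> - a \<le> Re (z n)" and v: "v \<longlonglongrightarrow> u" "u \<in> I" "\<And>n. v n \<in> I"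
    and b: "tilt u z0 < h u"
  shows "eventually (\<lambda>n. z n \<in> T (v n)) sequentially"
proof -
  have "(\<lambda>n. h (v n)) \<longlonglongrightarrow> h u" by (rule h_tendsto[OF v(1,2)], rule always_eventually, use v(3) in blast)
  then have "(\<lambda>n. h (v n) - tilt (v n) (z n)) \<longlonglongrightarrow> h u - tilt u z0" by (intro tendsto_intros z(1) v(1))
  then have "eventually (\<lambda>n. 0 < h (v n) - tilt (v n) (z n)) sequentially" by (rule order_tendstoD) (use b in simp)
  then show ?thesis by eventually_elim (use z(2) in \<open>auto simp: below_line_def\<close>)
qed

lemma below_singular: assumes "u \<in> I" "k \<in> K u" "0 < t" "t \<le> a" shows "k - of_real t \<in> T u"
  using K_box[OF assms(1,2)] K_facts(3)[OF assms(1,2)] assms(3,4) pos by (auto simp: below_line_def)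

text \<open>The limit lies below a line of slope \<open>u\<close>, so eventually the points do too, and there all sections agree.\<close>

lemma section_continuous_in_slope:
  assumes v: "\<And>n. v n \<in> I" "\<And>n. z n \<in> T (v n)" and z: "z \<longlonglongrightarrow> z0" and u: "u \<in> I" "z0 \<in> T u"
  shows "(\<lambda>n. \<Phi> (v n) (z n)) \<longlonglongrightarrow> \<Phi> u z0"
proof -
  have ev: "eventually (\<lambda>n. z n \<in> T u) sequentially"
    by (rule eventually_below_line[OF z]) (use v u in \<open>auto simp: below_line_def\<close>)
  have "continuous_on (T u) (\<Phi> u)" using K_facts(6)[OF u(1)] by (simp add: section_on_def)
  then have "(\<lambda>n. \<Phi> u (z n)) \<longlonglongrightarrow> \<Phi> u z0" by (rule continuous_on_tendsto_compose[OF _ z u(2) ev])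
  then show ?thesis
    by (rule Lim_transform_eventually) (use ev in \<open>eventually_elim, use agree[OF u(1) v(1)] v(2) in auto\<close>)
qed

text \<open>Sections of different slopes escape simultaneously: a finite limit would give a local section that
  continues \<open>\<Phi> u\<close> across the singular point.\<close>

lemma no_finite_limit_at_singular_point:
  assumes v: "v \<longlonglongrightarrow> u" "u \<in> I" "\<And>n. v n \<in> I" and z: "\<And>n. z n \<in> T (v n)" "z \<longlonglongrightarrow> k" "k \<in> K u"
    and w: "(\<lambda>n. \<Phi> (v n) (z n)) \<longlonglongrightarrow> w"
  shows False
proof -
  obtain r U \<psi> where l: "r > 0" "open U" "w \<in> U" "section_on F (ball (F w) r) \<psi>"
    "\<And>x. x \<in> U \<Longrightarrow> F x \<in> ball (F w) r \<and> \<psi> (F x) = x" using local_section by metis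
  have Fz: "F (\<Phi> (v n) (z n)) = z n" for n by (rule section_onD[OF K_facts(6)[OF v(3)] z(1)])
  have "(\<lambda>n. F (\<Phi> (v n) (z n))) \<longlonglongrightarrow> F w" by (rule tendsto_F[OF w])
  then have Fw: "F w = k" using z(2) LIMSEQ_unique unfolding Fz by blast
  define t1 where "t1 = min a r / 2"
  define b where "b = k - of_real t1"
  have t1: "0 < t1" "t1 \<le> a" "t1 < r" using pos l(1) by (auto simp: t1_def)
  have bT: "b \<in> T u" unfolding b_def by (rule below_singular[OF v(2) z(3) t1(1,2)])
  have bb: "b \<in> ball k r" using t1 by (simp add: b_def dist_norm)
  have e1: "eventually (\<lambda>n. b \<in> T (v n)) sequentially"
    by (rule eventually_below_line[OF tendsto_const _ v]) (use bT in \<open>auto simp: below_line_def\<close>)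
  have e2: "eventually (\<lambda>n. \<Phi> (v n) (z n) \<in> U) sequentially" by (rule topological_tendstoD[OF w l(2,3)])
  obtain n where n: "b \<in> T (v n)" "\<Phi> (v n) (z n) \<in> U"
    using eventually_happens[OF eventually_conj[OF e1 e2]] by auto
  have zb: "z n \<in> ball k r" "\<psi> (z n) = \<Phi> (v n) (z n)" using l(5)[OF n(2)] by (auto simp: Fz Fw)
  have s1: "section_on F (T (v n) \<inter> ball k r) (\<Phi> (v n))" by (rule section_on_subset[OF K_facts(6)[OF v(3)]]) auto
  have s2: "section_on F (T (v n) \<inter> ball k r) \<psi>" by (rule section_on_subset[OF l(4)]) (auto simp: Fw)
  have zin: "z n \<in> T (v n) \<inter> ball k r" and bin: "b \<in> T (v n) \<inter> ball k r" using z(1) zb n bb by auto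
  have "\<Phi> (v n) b = \<psi> b"
    by (rule section_unique_convex[OF convex_Int[OF convex_below_line convex_ball] s1 s2 zin zb(2)[symmetric] bin])
  then have e: "\<Phi> u b = \<psi> b" using agree[OF v(2,3) bT n(1)] by simp
  show False
  proof (rule singular_point_no_section[OF convex_below_line K_facts(6)[OF v(2)] K_facts(8)[OF v(2) z(3)]
        convex_ball l(4)[unfolded Fw] _ _ _ _ e])
    show "0 < min a r" using pos l by simp
    show "k - of_real t \<in> T u \<inter> ball k r" if "0 < t" "t < min a r" for t
      using below_singular[OF v(2) z(3), of t] that by (simp add: dist_norm)
  qed (use l bT bb in auto)
qed

text \<open>A regular point of the line of slope \<open>u\<close> has a local section that continues \<open>\<Phi> u\<close>. Sections of nearby
  slopes agree with it, so they have no singular points nearby.\<close>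

lemma singular_points_closed:
  assumes v: "v \<longlonglongrightarrow> u" "u \<in> I" "\<And>n. v n \<in> I" and k: "\<And>n. k n \<in> K (v n)" "k \<longlonglongrightarrow> k0"
  shows "k0 \<in> K u"
proof (rule ccontr)
  assume nK: "k0 \<notin> K u"
  have kn: "0 \<le> Re (k n)" "\<bar>Im (k n)\<bar> \<le> \<delta> - \<eta>" "tilt (v n) (k n) = h (v n)" for n
    using K_box[OF v(3) k(1)] K_facts(3)[OF v(3) k(1)] by auto
  have "0 \<le> Re k0" by (rule LIMSEQ_le_const[OF tendsto_Re[OF k(2)]]) (use kn in auto)
  moreover have "\<bar>Im k0\<bar> \<le> \<delta> - \<eta>" by (rule LIMSEQ_le_const2[OF tendsto_rabs[OF tendsto_Im[OF k(2)]]]) (use kn in auto)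
  moreover have "tilt u k0 = h u"
  proof (rule LIMSEQ_unique)
    show "(\<lambda>n. tilt (v n) (k n)) \<longlonglongrightarrow> tilt u k0" by (intro tendsto_intros v k)
    show "(\<lambda>n. tilt (v n) (k n)) \<longlonglongrightarrow> h u" unfolding kn by (rule h_tendsto[OF v(1,2)], rule always_eventually, use v(3) in blast)
  qed
  ultimately have k0: "0 \<le> Re k0" "\<bar>Im k0\<bar> \<le> \<delta> - \<eta>" "tilt u k0 = h u" by auto
  have kD: "k0 \<in> \<Delta> u - K u" using line_sub[OF v(2) _ k0(3)] k0 pos nK by simp
  define w where "w = \<Phi> u k0"
  have Fw: "F w = k0" unfolding w_def by (rule section_onD[OF K_facts(5)[OF v(2)] kD])
  obtain r U \<psi> where l: "r > 0" "open U" "w \<in> U" "section_on F (ball (F w) r) \<psi>"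
    "\<And>x. x \<in> U \<Longrightarrow> F x \<in> ball (F w) r \<and> \<psi> (F x) = x" using local_section by metis
  have in_T: "k0 - of_real t \<in> T u" if "0 < t" "t \<le> a" for t using k0 that pos by (auto simp: below_line_def)
  have c: "continuous_on (\<Delta> u - K u) (\<Phi> u)" using K_facts(5)[OF v(2)] by (simp add: section_on_def)
  have lim: "((\<lambda>t. k0 - of_real t) \<longlongrightarrow> k0) (at_right (0::real))"
    by (rule tendsto_eq_intros refl | simp)+
  have ev: "eventually (\<lambda>t. k0 - of_real t \<in> \<Delta> u - K u) (at_right (0::real))"
    using eventually_at_right_real[OF pos(1)]
  proof eventually_elim
    case (elim t)
    then have "k0 - of_real t \<in> T u" by (intro in_T) auto
    then show ?case using T_sub[OF v(2)] by blast
  qed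
  have "((\<lambda>t. \<Phi> u (k0 - of_real t)) \<longlongrightarrow> w) (at_right (0::real))"
    unfolding w_def by (rule continuous_on_tendsto_compose[OF c lim kD ev])
  then have e1: "eventually (\<lambda>t. \<Phi> u (k0 - of_real t) \<in> U) (at_right (0::real))" by (rule topological_tendstoD[OF _ l(2,3)])
  have "0 < min a r" using pos l by simp
  then have e2: "eventually (\<lambda>t. t \<in> {0<..<min a r}) (at_right (0::real))" by (rule eventually_at_right_real)
  obtain t1 where t1: "\<Phi> u (k0 - of_real t1) \<in> U" "0 < t1" "t1 < a" "t1 < r"
    using eventually_happens'[OF trivial_limit_at_right_real eventually_conj[OF e1 e2]] that by fastforce
  define b where "b = k0 - of_real t1"
  have bT: "b \<in> T u" unfolding b_def by (rule in_T) (use t1 in auto)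
  have "F (\<Phi> u b) = b" by (rule section_onD[OF K_facts(6)[OF v(2)] bT])
  then have bu: "\<Phi> u b = \<psi> b" using l(5)[OF t1(1)] by (simp add: b_def)
  have e3: "eventually (\<lambda>n. b \<in> T (v n)) sequentially"
    by (rule eventually_below_line[OF tendsto_const _ v]) (use bT in \<open>auto simp: below_line_def\<close>)
  have e4: "eventually (\<lambda>n. k n \<in> ball k0 r) sequentially"
    by (rule topological_tendstoD[OF k(2)]) (use l in auto)
  obtain n where n: "b \<in> T (v n)" "k n \<in> ball k0 r"
    using eventually_happens[OF eventually_conj[OF e3 e4]] by auto
  have e: "\<Phi> (v n) b = \<psi> b" using agree[OF v(2,3) bT n(1)] bu by simp
  define r' where "r' = r - dist k0 (k n)"
  have r': "0 < r'" using n(2) by (simp add: r'_def)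
  show False
  proof (rule singular_point_no_section[OF convex_below_line K_facts(6)[OF v(3)] K_facts(8)[OF v(3) k(1)]
        convex_ball l(4)[unfolded Fw] _ _ _ _ e])
    show "0 < min a r'" using pos r' by simp
    show "k n - of_real t \<in> T (v n) \<inter> ball k0 r" if t: "0 < t" "t < min a r'" for t
    proof -
      have "dist k0 (k n - of_real t) \<le> dist k0 (k n) + dist (k n) (k n - of_real t)" by (rule dist_triangle)
      also have "dist (k n) (k n - of_real t) = t" using t by (simp add: dist_norm)
      finally show ?thesis using below_singular[OF v(3)[of n] k(1)[of n], of t] t by (simp add: r'_def)
    qed
  qed (use n bT t1 in \<open>auto simp: b_def dist_norm\<close>)
qed

lemma K_bounded: assumes "u \<in> I" "k \<in> K u" shows "norm k \<le> \<bar>h u1\<bar> + \<delta> * \<bar>u2 - u1\<bar> + max \<bar>u1\<bar> \<bar>u2\<bar> * \<delta> + \<delta>"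
proof -
  have i: "\<bar>Im k\<bar> \<le> \<delta>" using K_box[OF assms] pos by simp
  have "\<bar>u * Im k\<bar> \<le> max \<bar>u1\<bar> \<bar>u2\<bar> * \<delta>" unfolding abs_mult using i assms(1) by (intro mult_mono) auto
  moreover have "\<delta> * \<bar>u - u1\<bar> \<le> \<delta> * \<bar>u2 - u1\<bar>" using assms(1) pos by (intro mult_left_mono) auto
  moreover have "\<bar>h u - h u1\<bar> \<le> \<delta> * \<bar>u - u1\<bar>" by (rule h_lipschitz[OF assms(1)]) (use pos in simp)
  moreover have "\<bar>h u\<bar> \<le> \<bar>h u1\<bar> + \<bar>h u - h u1\<bar>" by simp
  moreover have "\<bar>Re k\<bar> \<le> \<bar>h u\<bar> + \<bar>u * Im k\<bar>"
  proof -
    have "Re k = h u - u * Im k" using K_facts(3)[OF assms] by simp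
    then show ?thesis by simp
  qed
  moreover note i cmod_le[of k]
  ultimately show ?thesis by (meson add_mono order_trans order_refl)
qed

lemma tangent_lines_subinterval:
  assumes "u1 \<le> v1" "v1 < v2" "v2 \<le> u2"
  shows "tangent_lines F a \<delta> \<eta> B0 v1 v2 h K \<Phi> \<Delta>"
proof -
  have *: "u \<in> I" if "u \<in> {v1..v2}" for u using that assms by auto
  show ?thesis
    by (unfold_locales; (rule pos assms hr[OF *] T_sub[OF *] h_low[OF *] K_box[OF *] line_sub[OF *]
        super[OF * *] agree[OF * *] edge[OF *] strip_ex[OF *]; assumption?))
qed

text \<open>Each section lies in some strip. The slopes for which a strip of width \<open>2 * n\<close> suffices form a closed set,
  so by the Baire category theorem one of these sets contains an interval.\<close>

lemma uniform_strip:
  obtains v1 v2 M where "u1 \<le> v1" "v1 < v2" "v2 \<le> u2" "\<And>u z. u \<in> {v1..v2} \<Longrightarrow> z \<in> T u \<Longrightarrow> \<bar>tilt u (\<Phi> u z)\<bar> \<le> M"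
proof -
  define A where "A = (\<lambda>n::nat. {u\<in>I. \<forall>z\<in>T u. \<bar>tilt u (\<Phi> u z)\<bar> \<le> real n})"
  have clA: "closed (A n)" for n
    unfolding closed_sequential_limits
  proof (intro allI impI, elim conjE)
    fix v u assume v: "\<forall>j. v j \<in> A n" "v \<longlonglongrightarrow> u"
    have vI: "v j \<in> I" for j using v by (simp add: A_def)
    have uI: "u \<in> I" using closed_sequentially[OF closed_atLeastAtMost _ v(2)] vI by blast
    have "\<bar>tilt u (\<Phi> u z)\<bar> \<le> real n" if z: "z \<in> T u" for z
    proof (rule tendsto_upperbound)
      show "(\<lambda>j. \<bar>tilt (v j) (\<Phi> u z)\<bar>) \<longlonglongrightarrow> \<bar>tilt u (\<Phi> u z)\<bar>" by (intro tendsto_intros v)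
      have "eventually (\<lambda>j. z \<in> T (v j)) sequentially"
        by (rule eventually_below_line[OF tendsto_const _ v(2) uI vI]) (use z in \<open>auto simp: below_line_def\<close>)
      then show "eventually (\<lambda>j. \<bar>tilt (v j) (\<Phi> u z)\<bar> \<le> real n) sequentially"
      proof eventually_elim
        case (elim j)
        have "\<bar>tilt (v j) (\<Phi> (v j) z)\<bar> \<le> real n" using v(1) elim by (simp add: A_def)
        then show ?case using agree[OF uI vI z elim] by simp
      qed
    qed simp
    then show "u \<in> A n" using uI by (simp add: A_def)
  qed
  have cov: "\<exists>n. u \<in> A n" if u: "u \<in> I" for u
  proof -
    obtain M where M: "\<And>z. z \<in> \<Delta> u - K u \<Longrightarrow> \<bar>tilt u (\<Phi> u z)\<bar> \<le> M" using strip_ex[OF u] by blast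
    obtain n where n: "M \<le> real n" using real_arch_simple by blast
    have "\<bar>tilt u (\<Phi> u z)\<bar> \<le> real n" if "z \<in> T u" for z
      using M[of z] T_sub[OF u] that n by (meson order_trans subsetD)
    then show ?thesis using u by (auto simp: A_def)
  qed
  have "\<exists>n u. u \<in> I \<and> u \<notin> closure (I - A n)"
  proof (rule ccontr)
    assume neg: "\<not> ?thesis"
    let ?G = "range (\<lambda>n. I - A n)"
    have "I \<subseteq> closure (\<Inter>?G)"
    proof (rule Baire)
      fix S assume "S \<in> ?G"
      then obtain n where S: "S = I - A n" by blast
      have "openin (top_of_set I) (I \<inter> - A n)" by (rule openin_open_Int, rule open_Compl, rule clA)
      then show "openin (top_of_set I) S \<and> I \<subseteq> closure S" using neg by (auto simp: S Diff_eq)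
    qed auto
    moreover have e: "\<Inter>?G = {}" using cov by blast
    ultimately have "I \<subseteq> {}" unfolding e by simp
    then show False using pos by auto
  qed
  then obtain n u where u: "u \<in> I" "u \<notin> closure (I - A n)" by blast
  then obtain e where e: "e > 0" "ball u e \<inter> closure (I - A n) = {}"
    using closed_ball_disjoint[OF closed_closure] by blast
  have inA: "v \<in> A n" if "v \<in> I" "\<bar>v - u\<bar> < e" for v
  proof (rule ccontr)
    assume "v \<notin> A n"
    then have "v \<in> closure (I - A n)" by (intro subsetD[OF closure_subset] DiffI that(1))
    moreover have "v \<in> ball u e" using that by (simp add: dist_real_def abs_minus_commute)
    ultimately show False using e(2) by blast
  qed
  show ?thesis
  proof
    show "u1 \<le> max u1 (u - e/2)" "max u1 (u - e/2) < min u2 (u + e/2)" "min u2 (u + e/2) \<le> u2" using u e pos by auto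
    show "\<bar>tilt v (\<Phi> v z)\<bar> \<le> real n" if "v \<in> {max u1 (u - e/2)..min u2 (u + e/2)}" "z \<in> T v" for v z
    proof -
      have "v \<in> A n" 
      proof (rule inA)
        show "v \<in> I" "\<bar>v - u\<bar> < e" using that(1) e(1) by (simp_all add: abs_less_iff)
      qed
      then show ?thesis using that(2) by (simp add: A_def)
    qed
  qed
qed

end

section \<open>The ends of the strips\<close>

lemma tendsto_if_dist_less_inverse:
  fixes v :: "nat \<Rightarrow> 'a::metric_space"
  assumes "\<And>n. dist (v n) u < 1 / Suc n" shows "v \<longlonglongrightarrow> u"
proof -
  have "(\<lambda>n. dist (v n) u) \<longlonglongrightarrow> 0"
  proof (rule Lim_null_comparison)
    show "(\<lambda>n. 1 / real (Suc n)) \<longlonglongrightarrow> 0" using LIMSEQ_Suc[OF lim_1_over_n] by simp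
    show "eventually (\<lambda>n. norm (dist (v n) u) \<le> 1 / real (Suc n)) sequentially"
      by (intro always_eventually allI, simp only: real_norm_def abs_of_nonneg[OF zero_le_dist], rule less_imp_le[OF assms])
  qed
  then show ?thesis by (rule tendsto_dist_iff[THEN iffD2])
qed

locale tangent_lines_strip = tangent_lines +
  fixes M :: real
  assumes strip: "u \<in> {u1..u2} \<Longrightarrow> z \<in> below_line a \<delta> h u \<Longrightarrow> \<bar>tilt u (\<Phi> u z)\<bar> \<le> M"
begin

text \<open>A common singular point of two slopes would be approached along a common horizontal segment,
  on which the section stays in two transversal strips.\<close>

lemma Im_K_strictly_decreasing:
  assumes u: "u \<in> I" "u' \<in> I" "u < u'" and k: "k \<in> K u" "k' \<in> K u'"
  shows "Im k' < Im k"
proof (rule ccontr)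
  assume neg: "\<not> ?thesis"
  have "h u' - h u \<le> (u' - u) * Im k" "(u' - u) * Im k' \<le> h u' - h u"
    using super[OF u(1,2) k(1)] super[OF u(2,1) k(2)] by (auto simp: algebra_simps)
  then have "(u' - u) * Im k' \<le> (u' - u) * Im k" by linarith
  then have "Im k' \<le> Im k" using u(3) by (simp add: mult_le_cancel_left)
  with neg have Im: "Im k = Im k'" by simp
  then have "h u' = h u + (u' - u) * Im k"
    using super[OF u(1,2) k(1)] super[OF u(2,1) k(2)] by (auto simp: algebra_simps)
  then have "Re k = Re k'" using K_facts(3)[OF u(1) k(1)] K_facts(3)[OF u(2) k(2)] Im by (simp add: algebra_simps)
  with Im have kk: "k = k'" by (simp add: complex_eq_iff)
  define t where "t = (\<lambda>n::nat. a / real (Suc n))"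
  have t: "0 < t n" "t n \<le> a" for n using pos by (auto simp: t_def field_simps)
  have "t \<longlonglongrightarrow> 0" unfolding t_def using LIMSEQ_Suc[OF lim_const_over_n] by simp
  then have "(\<lambda>n. k - of_real (t n)) \<longlonglongrightarrow> k - of_real 0" by (intro tendsto_intros)
  then have l: "(\<lambda>n. k - of_real (t n)) \<longlonglongrightarrow> k" by simp
  have in_T: "k - of_real (t n) \<in> T u" "k - of_real (t n) \<in> T u'" for n
    using below_singular[OF u(1) k(1) t(1,2)] below_singular[OF u(2) k(2) t(1,2)] kk by auto
  define w where "w = (\<lambda>n. \<Phi> u (k - of_real (t n)))"
  have bw: "norm (w n) \<le> M + \<bar>u\<bar> * (2 * M / (u' - u)) + 2 * M / (u' - u)" for n
  proof -
    have a1: "\<bar>tilt u (w n)\<bar> \<le> M" unfolding w_def by (rule strip[OF u(1) in_T(1)])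
    have a2: "\<bar>tilt u' (w n)\<bar> \<le> M" unfolding w_def agree[OF u(1,2) in_T(1,2)] by (rule strip[OF u(2) in_T(2)])
    have "(u' - u) * Im (w n) = tilt u' (w n) - tilt u (w n)" by (simp add: algebra_simps)
    then have "\<bar>(u' - u) * Im (w n)\<bar> \<le> 2 * M" using a1 a2 by linarith
    then have i: "\<bar>Im (w n)\<bar> \<le> 2 * M / (u' - u)" using u(3) by (simp add: abs_mult field_simps)
    then have "\<bar>u * Im (w n)\<bar> \<le> \<bar>u\<bar> * (2 * M / (u' - u))" unfolding abs_mult by (rule mult_left_mono) simp
    then have "\<bar>Re (w n)\<bar> \<le> M + \<bar>u\<bar> * (2 * M / (u' - u))" using a1 by linarith
    then show ?thesis using i cmod_le[of "w n"] by linarith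
  qed
  then have "bounded (range w)" unfolding bounded_iff by blast
  then obtain x r where r: "strict_mono r" "(w \<circ> r) \<longlonglongrightarrow> x"
    using bounded_imp_convergent_subsequence by blast
  show False
  proof (rule no_finite_limit_at_singular_point[of "\<lambda>_. u" u "\<lambda>n. k - of_real (t (r n))" k x])
    show "(\<lambda>n. k - of_real (t (r n))) \<longlonglongrightarrow> k" using LIMSEQ_subseq_LIMSEQ[OF l r(1)] by (simp add: o_def)
    show "(\<lambda>n. \<Phi> u (k - of_real (t (r n)))) \<longlonglongrightarrow> x" using r(2) by (simp add: w_def o_def)
  qed (use u k in_T in auto)
qed

text \<open>The section escapes near a singular point but stays in a strip that is not horizontal.\<close>

lemma Im_large_near_singular_point:
  assumes u: "u \<in> I" and k: "k \<in> K u"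
  obtains \<rho> where "\<rho> > 0" "\<And>u' z. u' \<in> I \<Longrightarrow> \<bar>u' - u\<bar> < \<rho> \<Longrightarrow> z \<in> T u' \<Longrightarrow> dist z k < \<rho> \<Longrightarrow> 1 \<le> \<bar>Im (\<Phi> u' z)\<bar>"
proof -
  have "\<exists>\<rho>>0. \<forall>u' z. u' \<in> I \<longrightarrow> \<bar>u' - u\<bar> < \<rho> \<longrightarrow> z \<in> T u' \<longrightarrow> dist z k < \<rho> \<longrightarrow> 1 \<le> \<bar>Im (\<Phi> u' z)\<bar>"
  proof (rule ccontr)
    assume neg: "\<not> ?thesis"
    have "\<exists>v z. v \<in> I \<and> \<bar>v - u\<bar> < 1 / Suc n \<and> z \<in> T v \<and> dist z k < 1 / Suc n \<and> \<bar>Im (\<Phi> v z)\<bar> < 1" for n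
    proof -
      have "\<not> (\<forall>u' z. u' \<in> I \<longrightarrow> \<bar>u' - u\<bar> < 1 / Suc n \<longrightarrow> z \<in> T u' \<longrightarrow> dist z k < 1 / Suc n \<longrightarrow> 1 \<le> \<bar>Im (\<Phi> u' z)\<bar>)"
        using neg by (metis of_nat_0_less_iff zero_less_Suc zero_less_divide_1_iff)
      then show ?thesis by (meson not_le)
    qed
    then obtain v z where v: "\<And>n. v n \<in> I" "\<And>n. \<bar>v n - u\<bar> < 1 / Suc n" "\<And>n. z n \<in> T (v n)" "\<And>n. dist (z n) k < 1 / Suc n"
        "\<And>n. \<bar>Im (\<Phi> (v n) (z n))\<bar> < 1" by metis
    have vl: "v \<longlonglongrightarrow> u" by (rule tendsto_if_dist_less_inverse) (use v(2) in \<open>simp add: dist_real_def\<close>)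
    have zl: "z \<longlonglongrightarrow> k" by (rule tendsto_if_dist_less_inverse) (rule v(4))
    define w where "w = (\<lambda>n. \<Phi> (v n) (z n))"
    have "norm (w n) \<le> M + max \<bar>u1\<bar> \<bar>u2\<bar> + 1" for n
    proof -
      have a1: "\<bar>tilt (v n) (w n)\<bar> \<le> M" unfolding w_def by (rule strip[OF v(1,3)])
      have i: "\<bar>Im (w n)\<bar> \<le> 1" using v(5)[of n] by (simp add: w_def)
      have "\<bar>v n * Im (w n)\<bar> \<le> max \<bar>u1\<bar> \<bar>u2\<bar> * 1" unfolding abs_mult using i v(1)[of n] by (intro mult_mono) auto
      then show ?thesis using i a1 cmod_le[of "w n"] by linarith
    qed
    then have "bounded (range w)" unfolding bounded_iff by blast
    then obtain x r where r: "strict_mono r" "(w \<circ> r) \<longlonglongrightarrow> x"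
      using bounded_imp_convergent_subsequence by blast
    show False
    proof (rule no_finite_limit_at_singular_point[of "\<lambda>n. v (r n)" u "\<lambda>n. z (r n)" k x])
      show "(\<lambda>n. v (r n)) \<longlonglongrightarrow> u" using LIMSEQ_subseq_LIMSEQ[OF vl r(1)] by (simp add: o_def)
      show "(\<lambda>n. z (r n)) \<longlonglongrightarrow> k" using LIMSEQ_subseq_LIMSEQ[OF zl r(1)] by (simp add: o_def)
      show "(\<lambda>n. \<Phi> (v (r n)) (z (r n))) \<longlonglongrightarrow> x" using r(2) by (simp add: w_def o_def)
    qed (use u k v in auto)
  qed
  then show ?thesis using that by blast
qed

text \<open>For larger slopes the singular points are lower than all those of slope \<open>u\<close>, and they accumulate only at the
  latter, so only at the lowest one.\<close>

lemma K_right_of_lowest: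
  assumes u: "u \<in> I" and k0: "k0 \<in> K u" "\<And>k. k \<in> K u \<Longrightarrow> Im k0 \<le> Im k" and \<rho>: "\<rho> > 0"
  obtains e where "e > 0" "\<And>u' k. u' \<in> I \<Longrightarrow> u < u' \<Longrightarrow> u' < u + e \<Longrightarrow> k \<in> K u' \<Longrightarrow> dist k k0 < \<rho>"
proof -
  have "\<exists>e>0. \<forall>u' k. u' \<in> I \<longrightarrow> u < u' \<longrightarrow> u' < u + e \<longrightarrow> k \<in> K u' \<longrightarrow> dist k k0 < \<rho>"
  proof (rule ccontr)
    assume neg: "\<not> ?thesis"
    have "\<exists>v k. v \<in> I \<and> u < v \<and> v < u + 1 / Suc n \<and> k \<in> K v \<and> \<rho> \<le> dist k k0" for n
    proof -
      have "\<not> (\<forall>u' k. u' \<in> I \<longrightarrow> u < u' \<longrightarrow> u' < u + 1 / Suc n \<longrightarrow> k \<in> K u' \<longrightarrow> dist k k0 < \<rho>)"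
        using neg by (metis of_nat_0_less_iff zero_less_Suc zero_less_divide_1_iff)
      then show ?thesis by (meson not_le)
    qed
    then obtain v k where v: "\<And>n. v n \<in> I" "\<And>n. u < v n" "\<And>n. v n < u + 1 / Suc n" "\<And>n. k n \<in> K (v n)" "\<And>n. \<rho> \<le> dist (k n) k0"
      by metis
    have 0: "(\<lambda>n. u + 1 / real (Suc n)) \<longlonglongrightarrow> u + 0" by (intro tendsto_intros) (use LIMSEQ_Suc[OF lim_1_over_n] in simp)
    have vl: "v \<longlonglongrightarrow> u"
      by (rule tendsto_sandwich[OF _ _ tendsto_const 0[simplified add_0_right]]) (use v in \<open>auto intro!: always_eventually less_imp_le\<close>)
    have "bounded (range k)" unfolding bounded_iff using K_bounded[OF v(1,4)] by blast
    then obtain x r where r: "strict_mono r" "(k \<circ> r) \<longlonglongrightarrow> x"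
      using bounded_imp_convergent_subsequence by blast
    then have kl: "(\<lambda>n. k (r n)) \<longlonglongrightarrow> x" by (simp add: o_def)
    have xK: "x \<in> K u"
    proof (rule singular_points_closed[of "\<lambda>n. v (r n)" u "\<lambda>n. k (r n)"])
      show "(\<lambda>n. v (r n)) \<longlonglongrightarrow> u" using LIMSEQ_subseq_LIMSEQ[OF vl r(1)] by (simp add: o_def)
    qed (use u v kl in auto)
    have "Im (k n) \<le> Im k0" for n using Im_K_strictly_decreasing[OF u v(1,2) k0(1) v(4)] by (rule less_imp_le)
    then have "Im x \<le> Im k0" by (intro LIMSEQ_le_const2[OF tendsto_Im[OF kl]]) auto
    then have i: "Im x = Im k0" using k0(2)[OF xK] by simp
    then have "Re x = Re k0" using K_facts(3)[OF u xK] K_facts(3)[OF u k0(1)] by simp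
    with i have "x = k0" by (simp add: complex_eq_iff)
    moreover have "\<rho> \<le> dist x k0" by (rule LIMSEQ_le_const[OF tendsto_dist[OF kl tendsto_const]]) (use v in auto)
    ultimately show False using \<rho> by simp
  qed
  then show ?thesis using that by blast
qed

text \<open>Just after a slope \<open>u\<close> all singular points are near the lowest one of \<open>u\<close>, and the section escapes
  there through the same end of its strip.\<close>

lemma common_end:
  obtains v1 v2 \<sigma> where "u1 \<le> v1" "v1 < v2" "v2 \<le> u2" "\<sigma> = 1 \<or> \<sigma> = (-1::real)"
    "\<And>u k. u \<in> {v1..v2} \<Longrightarrow> k \<in> K u \<Longrightarrow> filterlim (\<lambda>z. \<sigma> * Im (\<Phi> u z)) at_top (at k within \<Delta> u - K u)"
proof -
  have uI: "u1 \<in> I" using pos by simp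
  have "\<exists>k\<in>K u1. \<forall>k'\<in>K u1. Im k \<le> Im k'"
    by (rule continuous_attains_inf[OF K_facts(1,2)[OF uI]]) (intro continuous_intros)
  then obtain k0 where k0: "k0 \<in> K u1" "\<And>k. k \<in> K u1 \<Longrightarrow> Im k0 \<le> Im k" by blast
  obtain \<rho> where r: "\<rho> > 0" "\<And>u' z. u' \<in> I \<Longrightarrow> \<bar>u' - u1\<bar> < \<rho> \<Longrightarrow> z \<in> T u' \<Longrightarrow> dist z k0 < \<rho> \<Longrightarrow> 1 \<le> \<bar>Im (\<Phi> u' z)\<bar>"
    using Im_large_near_singular_point[OF uI k0(1)] by blast
  define t1 where "t1 = min a \<rho> / 2"
  \<comment> \<open>this point is below the lines of all slopes near \<open>u1\<close> and fixes the end of the strips\<close>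
  define b where "b = k0 - of_real t1"
  have t1: "0 < t1" "t1 \<le> a" "t1 < \<rho>" using pos r(1) by (auto simp: t1_def)
  have bT: "b \<in> T u1" unfolding b_def by (rule below_singular[OF uI k0(1) t1(1,2)])
  have bb: "dist b k0 < \<rho>" using t1 by (simp add: b_def dist_norm)
  obtain e where e: "e > 0" "\<And>u' k. u' \<in> I \<Longrightarrow> u1 < u' \<Longrightarrow> u' < u1 + e \<Longrightarrow> k \<in> K u' \<Longrightarrow> dist k k0 < \<rho> / 2"
    using K_right_of_lowest[OF uI k0, of "\<rho> / 2"] r(1) by auto
  define c where "c = h u1 - tilt u1 b"
  have c: "0 < c" using bT by (simp add: c_def below_line_def)
  define d where "d = Min {u2 - u1, \<rho> / 2, e / 2, c / (4 * \<delta>)}"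
  have d: "0 < d" "d \<le> u2 - u1" "d \<le> \<rho> / 2" "d \<le> e / 2" "d \<le> c / (4 * \<delta>)"
    unfolding d_def using pos r e c by (auto simp: min_def)
  have bT': "b \<in> T u" if u: "u \<in> {u1..u1 + d}" for u
  proof -
    have ib: "\<bar>Im b\<bar> \<le> \<delta>" using bT by (simp add: below_line_def)
    have uu: "u \<in> I" using u d by auto
    have x: "\<bar>h u - h u1\<bar> \<le> \<delta> * \<bar>u - u1\<bar>" by (rule h_lipschitz[OF uu uI])
    have y: "\<bar>(u - u1) * Im b\<bar> \<le> \<bar>u - u1\<bar> * \<delta>" unfolding abs_mult using ib by (intro mult_left_mono) auto
    have "\<bar>u - u1\<bar> * \<delta> \<le> d * \<delta>" using u pos by (intro mult_right_mono) auto
    also have "\<dots> \<le> c / (4 * \<delta>) * \<delta>" using d(5) pos by (intro mult_right_mono) auto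
    also have "\<dots> = c / 4" using pos by simp
    finally have z: "\<bar>u - u1\<bar> * \<delta> \<le> c / 4" .
    have "tilt u b = tilt u1 b + (u - u1) * Im b" by (simp add: algebra_simps)
    then have "tilt u b < h u" using x y z c by (simp add: c_def mult.commute abs_le_iff)
    then show ?thesis using bT by (simp add: below_line_def)
  qed
  define \<sigma> where "\<sigma> = sgn (Im (\<Phi> u1 b))"
  have "1 \<le> \<bar>Im (\<Phi> u1 b)\<bar>" by (rule r(2)[OF uI _ bT bb]) (use r in simp)
  then have sg: "\<sigma> = 1 \<or> \<sigma> = -1" and sb: "0 < \<sigma> * Im (\<Phi> u1 b)" by (auto simp: \<sigma>_def sgn_if)
  have large: "1 \<le> \<sigma> * Im (\<Phi> u z)" if u: "u \<in> {u1..u1 + d}" and z: "z \<in> T u" "dist z k0 < \<rho>" for u z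
  proof (rule ccontr)
    assume neg: "\<not> ?thesis"
    have uu: "u \<in> I" and ur: "\<bar>u - u1\<bar> < \<rho>" using u d r(1) by auto
    let ?S = "T u \<inter> ball k0 \<rho>"
    have "continuous_on ?S (\<Phi> u)" using K_facts(6)[OF uu] by (auto simp: section_on_def intro: continuous_on_subset)
    then have conn: "connected ((\<lambda>z. \<sigma> * Im (\<Phi> u z)) ` ?S)"
      by (intro connected_continuous_image continuous_intros convex_connected convex_Int convex_below_line convex_ball)
    have "\<Phi> u b = \<Phi> u1 b" by (rule agree[OF uu uI bT'[OF u] bT])
    then have m1: "\<sigma> * Im (\<Phi> u1 b) \<in> (\<lambda>z. \<sigma> * Im (\<Phi> u z)) ` ?S" using bT'[OF u] bb by (intro image_eqI[of _ _ b]) (auto simp: dist_commute)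
    have m2: "\<sigma> * Im (\<Phi> u z) \<in> (\<lambda>z. \<sigma> * Im (\<Phi> u z)) ` ?S" using z by (intro imageI) (auto simp: dist_commute)
    have "\<sigma> * Im (\<Phi> u z) \<le> 0" using r(2)[OF uu ur z] neg sg by auto
    then have "0 \<in> {\<sigma> * Im (\<Phi> u z)..\<sigma> * Im (\<Phi> u1 b)}" using sb by simp
    then have "0 \<in> (\<lambda>z. \<sigma> * Im (\<Phi> u z)) ` ?S" by (rule subsetD[OF connected_contains_Icc[OF conn m2 m1]])
    then obtain y where y: "y \<in> ?S" "\<sigma> * Im (\<Phi> u y) = 0" by auto
    then have "1 \<le> \<bar>Im (\<Phi> u y)\<bar>" by (intro r(2)[OF uu ur]) (auto simp: dist_commute)
    then show False using y sg by auto
  qed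
  show ?thesis
  proof
    show "u1 \<le> u1 + d / 2" "u1 + d / 2 < u1 + d" "u1 + d \<le> u2" using d by auto
    show "\<sigma> = 1 \<or> \<sigma> = -1" by (rule sg)
    fix u k assume u: "u \<in> {u1 + d / 2..u1 + d}" and k: "k \<in> K u"
    have uu: "u \<in> I" and u': "u \<in> {u1..u1 + d}" "u1 < u" "u < u1 + e" using u d e(1) by auto
    let ?D = "\<Delta> u - K u"
    have dk: "dist k k0 < \<rho> / 2" by (rule e(2)[OF uu u'(2,3) k])
    obtain M' where M': "\<And>z. z \<in> ?D \<Longrightarrow> \<bar>tilt u (\<Phi> u z)\<bar> \<le> M'" using strip_ex[OF uu] by blast
    have up: "0 \<le> \<sigma> * Im (\<Phi> u z)" if z: "z \<in> ?D" "dist z k < \<rho> / 2" "dist z k < min (a / 2) \<eta>" for z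
    proof -
      have zb: "\<bar>Im z\<bar> \<le> \<delta>" "- a / 2 \<le> Re z"
      proof -
        have "\<bar>Re (z - k)\<bar> < a / 2" "\<bar>Im (z - k)\<bar> < \<eta>"
          using z(3) abs_Re_le_cmod[of "z - k"] abs_Im_le_cmod[of "z - k"] by (auto simp: dist_norm)
        then have "- (a / 2) < Re z - Re k" "Im z - Im k < \<eta>" "- \<eta> < Im z - Im k"
          unfolding minus_complex.sel by linarith+
        moreover have "0 \<le> Re k" "Im k \<le> \<delta> - \<eta>" "- (\<delta> - \<eta>) \<le> Im k" using K_box[OF uu k] by (auto simp: abs_le_iff)
        ultimately have "- (a / 2) \<le> Re z" "Im z \<le> \<delta>" "- \<delta> \<le> Im z" by linarith+
        then show "\<bar>Im z\<bar> \<le> \<delta>" "- a / 2 \<le> Re z" by (simp_all add: abs_le_iff)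
      qed
      have in_T: "z - of_real t \<in> T u" if "0 < t" "t \<le> a / 2" for t
        using zb that K_facts(10)[OF uu, of z] z(1) by (auto simp: below_line_def)
      have c: "continuous_on ?D (\<Phi> u)" using K_facts(5)[OF uu] by (simp add: section_on_def)
      have lim: "((\<lambda>t. z - of_real t) \<longlongrightarrow> z) (at_right (0::real))" by (rule tendsto_eq_intros refl | simp)+
      have a2: "0 < a / 2" using pos by simp
      have ev: "eventually (\<lambda>t. z - of_real t \<in> ?D) (at_right (0::real))"
        using eventually_at_right_real[OF a2]
      proof eventually_elim
        case (elim t)
        then have "z - of_real t \<in> T u" by (intro in_T) auto
        then show ?case using T_sub[OF uu] by blast
      qed
      have l: "((\<lambda>t. \<sigma> * Im (\<Phi> u (z - of_real t))) \<longlongrightarrow> \<sigma> * Im (\<Phi> u z)) (at_right (0::real))"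
        by (intro tendsto_intros continuous_on_tendsto_compose[OF c lim z(1) ev])
      have zk: "dist z k0 < \<rho>" using dist_triangle[of z k0 k] z(2) dk by linarith
      have "eventually (\<lambda>t. dist (z - of_real t) k0 < \<rho>) (at_right (0::real))"
        by (rule order_tendstoD(2)[OF tendsto_dist[OF lim tendsto_const] zk])
      then have "eventually (\<lambda>t. 0 \<le> \<sigma> * Im (\<Phi> u (z - of_real t))) (at_right (0::real))"
        using eventually_at_right_real[OF a2]
      proof eventually_elim
        case (elim t)
        then have "z - of_real t \<in> T u" by (intro in_T) auto
        then show ?case using large[OF u'(1) _ elim(1)] by linarith
      qed
      then show ?thesis by (rule tendsto_lowerbound[OF l]) (rule trivial_limit_at_right_real)
    qed
    show "filterlim (\<lambda>z. \<sigma> * Im (\<Phi> u z)) at_top (at k within ?D)"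
      unfolding filterlim_at_top
    proof
      fix Z
      have ev0: "eventually (\<lambda>z. z \<in> ?D) (at k within ?D)" by (simp add: eventually_at_topological) blast
      have ev1: "eventually (\<lambda>z. M' + (\<bar>u\<bar> + 1) * \<bar>Z\<bar> \<le> norm (\<Phi> u z)) (at k within ?D)"
        using K_facts(7)[OF uu k] unfolding filterlim_at_infinity_iff_norm by blast
      have ev2: "eventually (\<lambda>z. dist z k < Min {\<rho> / 2, a / 2, \<eta>}) (at k within ?D)"
        unfolding eventually_at by (rule exI[of _ "Min {\<rho> / 2, a / 2, \<eta>}"]) (use r pos in auto)
      show "eventually (\<lambda>z. Z \<le> \<sigma> * Im (\<Phi> u z)) (at k within ?D)"
        using ev0 ev1 ev2
      proof eventually_elim
        case (elim z)
        have p: "0 \<le> \<sigma> * Im (\<Phi> u z)" by (rule up) (use elim in auto)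
        have "\<bar>tilt u (\<Phi> u z)\<bar> \<le> M'" by (rule M'[OF elim(1)])
        moreover have "\<bar>u * Im (\<Phi> u z)\<bar> = \<bar>u\<bar> * \<bar>Im (\<Phi> u z)\<bar>" by (rule abs_mult)
        ultimately have "norm (\<Phi> u z) \<le> M' + (\<bar>u\<bar> + 1) * \<bar>Im (\<Phi> u z)\<bar>"
          using cmod_le[of "\<Phi> u z"] by (simp add: algebra_simps abs_le_iff) linarith
        then have "(\<bar>u\<bar> + 1) * \<bar>Z\<bar> \<le> (\<bar>u\<bar> + 1) * \<bar>Im (\<Phi> u z)\<bar>" using elim(2) by linarith
        then have "\<bar>Z\<bar> \<le> \<bar>Im (\<Phi> u z)\<bar>" by (simp add: mult_le_cancel_left)
        then show ?case using p sg by auto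
      qed
    qed
  qed
qed

end

section \<open>Orientation of injective maps\<close>

text \<open>The change of a logarithm along an antiperiodic path. It is an odd multiple of \<open>\<pi> \<i>\<close>, hence nonzero.\<close>

definition log_change :: "(real \<Rightarrow> complex) \<Rightarrow> complex \<Rightarrow> bool" where
  "log_change q c \<longleftrightarrow> (\<exists>g. continuous_on {0..1} g \<and> (\<forall>t\<in>{0..1}. q t = exp (g t)) \<and> g 1 - g 0 = c)"

lemma constant_if_exp_constant:
  fixes d :: "'a::topological_space \<Rightarrow> complex"
  assumes "connected S" "continuous_on S d" "\<And>x. x \<in> S \<Longrightarrow> exp (d x) = w" "x \<in> S" "y \<in> S"
  shows "d x = d y"
proof -
  have "d constant_on S"
  proof (rule continuous_discrete_range_constant[OF assms(1,2)])
    fix x assume x: "x \<in> S"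
    have "2 * pi \<le> norm (d y - d x)" if y: "y \<in> S" "d y \<noteq> d x" for y
    proof -
      have "exp (d y) = exp (d x)" using assms(3) x y by simp
      then obtain n :: int where n: "d y = d x + (of_int (2 * n) * pi) * \<i>" unfolding exp_eq by blast
      then have "n \<noteq> 0" using y by auto
      then have "1 \<le> \<bar>real_of_int n\<bar>" by linarith
      moreover have "norm (d y - d x) = 2 * pi * \<bar>real_of_int n\<bar>" using n by (simp add: norm_mult abs_mult)
      ultimately show ?thesis using pi_gt_zero by simp
    qed
    then show "\<exists>e>0. \<forall>y. y \<in> S \<and> d y \<noteq> d x \<longrightarrow> e \<le> norm (d y - d x)" using pi_gt_zero by (intro exI[of _ "2 * pi"]) auto
  qed
  then show ?thesis using assms(4,5) by (auto simp: constant_on_def)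
qed

lemma log_change_unique: assumes "log_change q c" "log_change q c'" shows "c = c'"
proof -
  obtain g where g: "continuous_on {0..1} g" "\<And>t. t \<in> {0..1} \<Longrightarrow> q t = exp (g t)" "g 1 - g 0 = c"
    using assms(1) by (auto simp: log_change_def)
  obtain g' where g': "continuous_on {0..1} g'" "\<And>t. t \<in> {0..1} \<Longrightarrow> q t = exp (g' t)" "g' 1 - g' 0 = c'"
    using assms(2) by (auto simp: log_change_def)
  have "g 0 - g' 0 = g 1 - g' 1"
  proof (rule constant_if_exp_constant[of "{0..1::real}" "\<lambda>t. g t - g' t" 1])
    show "exp (g t - g' t) = 1" if "t \<in> {0..1}" for t
      using g(2)[OF that] g'(2)[OF that] by (simp add: exp_diff)
  qed (auto intro!: continuous_intros g g')
  then show ?thesis using g(3) g'(3) by (simp add: algebra_simps)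
qed

lemma log_change_mult: assumes "\<alpha> \<noteq> 0" "log_change q c" shows "log_change (\<lambda>t. \<alpha> * q t) c"
proof -
  obtain g where g: "continuous_on {0..1} g" "\<forall>t\<in>{0..1}. q t = exp (g t)" "g 1 - g 0 = c"
    using assms(2) unfolding log_change_def by blast
  obtain L where L: "\<alpha> = exp L" using assms(1) by (metis exp_Ln)
  show ?thesis unfolding log_change_def
    by (rule exI[of _ "\<lambda>t. L + g t"]) (use g in \<open>auto intro!: continuous_intros simp: exp_add L\<close>)
qed

lemma log_change_cnj: assumes "log_change q c" shows "log_change (\<lambda>t. cnj (q t)) (cnj c)"
proof -
  obtain g where g: "continuous_on {0..1} g" "\<forall>t\<in>{0..1}. q t = exp (g t)" "g 1 - g 0 = c"
    using assms unfolding log_change_def by blast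
  show ?thesis unfolding log_change_def
    by (rule exI[of _ "\<lambda>t. cnj (g t)"]) (use g in \<open>auto intro!: continuous_intros simp: exp_cnj\<close>)
qed

text \<open>The logarithm of the homotopy exists on the whole square. Its change along the paths varies
  continuously and is a logarithm of \<open>-1\<close>, so it is constant.\<close>

lemma log_change_homotopy:
  fixes H :: "real \<times> real \<Rightarrow> complex"
  assumes H: "continuous_on ({0..1} \<times> {0..1}) H" "\<And>s t. s \<in> {0..1} \<Longrightarrow> t \<in> {0..1} \<Longrightarrow> H (s, t) \<noteq> 0"
    and anti: "\<And>s. s \<in> {0..1} \<Longrightarrow> H (s, 1) = - H (s, 0)"
  obtains c where "log_change (\<lambda>t. H (0, t)) c" "log_change (\<lambda>t. H (1, t)) c"
proof -
  have "convex ({0..1::real} \<times> {0..1::real})" by (intro convex_Times) auto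
  then have "contractible ({0..1::real} \<times> {0..1::real})" by (rule convex_imp_contractible)
  then obtain G where G: "continuous_on ({0..1} \<times> {0..1}) G" "\<And>x. x \<in> {0..1} \<times> {0..1} \<Longrightarrow> H x = exp (G x)"
    using continuous_logarithm_on_contractible[OF H(1)] H(2) by (metis mem_Sigma_iff prod.collapse)
  have cG: "continuous_on S (\<lambda>x. G (f x))" if "continuous_on S f" "f ` S \<subseteq> {0..1} \<times> {0..1}" for S and f :: "real \<Rightarrow> real \<times> real"
    by (rule continuous_on_compose2[OF G(1) that])
  have "G (0, 1) - G (0, 0) = G (1, 1) - G (1, 0)"
  proof (rule constant_if_exp_constant[of "{0..1::real}" "\<lambda>s. G (s, 1) - G (s, 0)" "-1"])
    show "continuous_on {0..1} (\<lambda>s. G (s, 1) - G (s, 0))" by (intro continuous_intros cG) auto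
    show "exp (G (s, 1) - G (s, 0)) = -1" if s: "s \<in> {0..1}" for s
    proof -
      have "exp (G (s, 1)) = - exp (G (s, 0))" using G(2)[of "(s,1)"] G(2)[of "(s,0)"] anti[OF s] s by simp
      then show ?thesis by (simp add: exp_diff)
    qed
  qed auto
  moreover have "log_change (\<lambda>t. H (s, t)) (G (s, 1) - G (s, 0))" if "s \<in> {0..1}" for s
    unfolding log_change_def by (rule exI[of _ "\<lambda>t. G (s, t)"]) (use G(2) that in \<open>auto intro!: cG continuous_intros\<close>)
  ultimately show ?thesis using that[of "G (1, 1) - G (1, 0)"] by (metis atLeastAtMost_iff order_refl zero_le_one)
qed

text \<open>At \<open>w1\<close> this is the definition of the derivative. The relative remainder is what makes difference quotients
  along a contraction to \<open>w1\<close> jointly continuous, although \<open>F\<close> need not be continuously differentiable.\<close>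

lemma continuous_on_first_order_remainder:
  fixes F :: "complex \<Rightarrow> complex"
  assumes F: "continuous_on S F" and D: "(F has_derivative D) (at w1 within S)"
  shows "continuous_on S (\<lambda>y. if y = w1 then 0 else (F y - F w1 - D (y - w1)) / of_real (norm (y - w1)))" (is "continuous_on S ?\<rho>")
  unfolding continuous_on_def
proof
  fix y assume y: "y \<in> S"
  let ?q = "\<lambda>y. (F y - F w1 - D (y - w1)) / of_real (norm (y - w1))"
  have ev: "eventually (\<lambda>x. ?q x = ?\<rho> x) (at y within S)" if "y \<noteq> w1"
  proof -
    have "eventually (\<lambda>x. x \<noteq> w1) (at y within S)" using that by (auto intro: tendsto_imp_eventually_ne tendsto_ident_at)
    then show ?thesis by eventually_elim simp
  qed
  show "(?\<rho> \<longlongrightarrow> ?\<rho> y) (at y within S)"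
  proof (cases "y = w1")
    case True
    have "((\<lambda>x. (F x - F w1 - D (x - w1)) /\<^sub>R norm (x - w1)) \<longlongrightarrow> 0) (at w1 within S)"
      using D unfolding has_derivative_at_within by blast
    then have "(?q \<longlongrightarrow> 0) (at w1 within S)" by (simp add: scaleR_conv_of_real divide_inverse mult.commute)
    moreover have "eventually (\<lambda>x. ?q x = ?\<rho> x) (at w1 within S)"
      using eventually_neq_at_within[of w1 w1 S] by eventually_elim simp
    ultimately have "(?\<rho> \<longlongrightarrow> 0) (at w1 within S)" by (rule Lim_transform_eventually)
    then show ?thesis using True by simp
  next
    case False
    have bl: "bounded_linear D" using D by (rule has_derivative_bounded_linear)
    have "(F \<longlongrightarrow> F y) (at y within S)" using F y by (simp add: continuous_on_def)
    then have "(?q \<longlongrightarrow> ?q y) (at y within S)"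
      by (intro tendsto_intros bounded_linear.tendsto[OF bl] tendsto_ident_at) (use False in auto)
    then have "(?\<rho> \<longlongrightarrow> ?q y) (at y within S)" using ev[OF False] by (rule Lim_transform_eventually)
    then show ?thesis using False by simp
  qed
qed

text \<open>Exchange two points of a convex set by moving them. The image pair turns along with the
  pair under a map of positive Jacobian, since the pair can be shrunk to a point of differentiability.
  The sign condition says that the image pair instead turns like the reflection of the pair.\<close>

lemma swapped_pair_reverses_orientation:
  fixes F :: "complex \<Rightarrow> complex" and w w' :: "real \<Rightarrow> complex"
  assumes S: "convex S" and F: "continuous_on S F" "inj_on F S"
    and D: "(F has_derivative D) (at w1 within S)" "w1 \<in> S" "\<And>v. D v = \<alpha> * v + \<beta> * cnj v"
    and w: "continuous_on {0..1} w" "continuous_on {0..1} w'" "\<And>t. t \<in> {0..1} \<Longrightarrow> w t \<in> S \<and> w' t \<in> S"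
    and swap: "w 1 = w' 0" "w' 1 = w 0"
    and sgn: "\<And>t. t \<in> {0..1} \<Longrightarrow>
       (0 < Im (w' t - w t) \<and> 0 < Re (F (w' t) - F (w t)) + u * Im (F (w' t) - F (w t))) \<or>
       (Re (w' t - w t) + u * Im (w' t - w t) < 0 \<and> Im (F (w' t) - F (w t)) < 0)"
  shows "norm \<alpha> \<le> norm \<beta>"
proof (rule ccontr)
  assume "\<not> ?thesis"
  then have ab: "norm \<beta> < norm \<alpha>" by simp
  define l p where "l = (\<lambda>t. w' t - w t)" and "p = (\<lambda>t. F (w' t) - F (w t))"
  have cl: "continuous_on {0..1} l" unfolding l_def by (intro continuous_intros w)
  have cp: "continuous_on {0..1} p" unfolding p_def
    by (intro continuous_intros continuous_on_compose2[OF F(1)] w) (use w(3) in auto)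
  have l0: "l t \<noteq> 0" if "t \<in> {0..1}" for t using sgn[OF that] by (auto simp: l_def)
  have l10: "l 1 = - l 0" and p10: "p 1 = - p 0" by (auto simp: l_def p_def swap)
  have snd_le: "continuous_on ({0..1} \<times> {0..1}) (\<lambda>x::real \<times> real. q (snd x))" if "continuous_on {0..1} q" for q :: "real \<Rightarrow> complex"
    by (rule continuous_on_compose2[OF that continuous_on_snd[OF continuous_on_id]]) auto
  define \<rho> where "\<rho> = (\<lambda>y. if y = w1 then 0 else (F y - F w1 - D (y - w1)) / of_real (norm (y - w1)))"
  have c\<rho>: "continuous_on S \<rho>" unfolding \<rho>_def by (rule continuous_on_first_order_remainder[OF F(1) D(1)])
  have F\<rho>: "F y = F w1 + D (y - w1) + of_real (norm (y - w1)) * \<rho> y" for y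
    by (cases "y = w1") (auto simp: \<rho>_def D(3))
  define m where "m = (\<lambda>s v. w1 + of_real s * (v - w1))"
  have mS: "m s v \<in> S" if "s \<in> {0..1}" "v \<in> S" for s v
  proof -
    have "m s v = (1 - s) *\<^sub>R w1 + s *\<^sub>R v" by (simp add: m_def scaleR_conv_of_real algebra_simps)
    then show ?thesis using convexD[OF S D(2) that(2), of "1 - s" s] that(1) by simp
  qed
  \<comment> \<open>the image of the pair shrunk towards \<open>w1\<close>, divided by the factor \<open>s\<close>; at \<open>s = 0\<close> it is the derivative\<close>
  define H1 where "H1 = (\<lambda>x. D (l (snd x)) + of_real (norm (w' (snd x) - w1)) * \<rho> (m (fst x) (w' (snd x)))
      - of_real (norm (w (snd x) - w1)) * \<rho> (m (fst x) (w (snd x))))"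
  have Fm: "F (m s v) = F w1 + of_real s * (D (v - w1) + of_real (norm (v - w1)) * \<rho> (m s v))" if "0 \<le> s" for s v
  proof -
    have d: "m s v - w1 = of_real s * (v - w1)" by (simp add: m_def)
    have n: "norm (m s v - w1) = s * norm (v - w1)" unfolding d using that by (simp add: norm_mult)
    have "D (of_real s * (v - w1)) = of_real s * D (v - w1)" by (simp add: D(3) algebra_simps)
    then show ?thesis using F\<rho>[of "m s v", unfolded n, unfolded d] by (simp add: algebra_simps)
  qed
  have H1s: "of_real s * H1 (s, t) = F (m s (w' t)) - F (m s (w t))" if "0 \<le> s" for s t
    unfolding Fm[OF that] by (simp add: H1_def l_def D(3) algebra_simps)
  have cw: "continuous_on ({0..1} \<times> {0..1}) (\<lambda>x::real \<times> real. w (snd x))" "continuous_on ({0..1} \<times> {0..1}) (\<lambda>x::real \<times> real. w' (snd x))"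
    by (rule snd_le[OF w(1)], rule snd_le[OF w(2)])
  have cH1: "continuous_on ({0..1} \<times> {0..1}) H1"
  proof -
    have r: "continuous_on ({0..1} \<times> {0..1}) (\<lambda>x. \<rho> (m (fst x) (v (snd x))))"
      if v: "continuous_on ({0..1} \<times> {0..1}) (\<lambda>x::real \<times> real. v (snd x))" "\<And>t. t \<in> {0..1} \<Longrightarrow> v t \<in> S" for v :: "real \<Rightarrow> complex"
    proof (rule continuous_on_compose2[OF c\<rho>])
      show "continuous_on ({0..1} \<times> {0..1}) (\<lambda>x. m (fst x) (v (snd x)))" unfolding m_def by (intro continuous_intros v(1))
      show "(\<lambda>x. m (fst x) (v (snd x))) ` ({0..1} \<times> {0..1}) \<subseteq> S" using mS v(2) by auto
    qed
    have 1: "continuous_on ({0..1} \<times> {0..1}) (\<lambda>x. \<rho> (m (fst x) (w (snd x))))" using r[OF cw(1)] w(3) by blast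
    have 2: "continuous_on ({0..1} \<times> {0..1}) (\<lambda>x. \<rho> (m (fst x) (w' (snd x))))" using r[OF cw(2)] w(3) by blast
    show ?thesis unfolding H1_def D(3) by (intro continuous_intros 1 2 cw snd_le[OF cl])
  qed
  have H1nz: "H1 (s, t) \<noteq> 0" if s: "s \<in> {0..1}" and t: "t \<in> {0..1}" for s t
  proof (cases "s = 0")
    case True
    have "m 0 v = w1" for v by (simp add: m_def)
    moreover have "\<rho> w1 = 0" by (simp add: \<rho>_def)
    ultimately have e: "H1 (s, t) = \<alpha> * l t + \<beta> * cnj (l t)" by (simp add: H1_def True D(3))
    have "norm (\<beta> * cnj (l t)) < norm (\<alpha> * l t)" using ab l0[OF t] by (simp add: norm_mult)
    then show ?thesis unfolding e by (metis add_eq_0_iff norm_minus_cancel order_less_irrefl)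
  next
    case False
    have "m s (w' t) \<noteq> m s (w t)" using False l0[OF t] by (simp add: m_def l_def)
    then have "F (m s (w' t)) \<noteq> F (m s (w t))" using F(2) mS[OF s] w(3)[OF t] by (auto simp: inj_on_def)
    then show ?thesis using H1s[of s t] s by auto
  qed
  have H1anti: "H1 (s, 1) = - H1 (s, 0)" for s by (simp add: H1_def l_def swap D(3) algebra_simps)
  obtain c where c: "log_change (\<lambda>t. H1 (0, t)) c" "log_change (\<lambda>t. H1 (1, t)) c"
    using log_change_homotopy[OF cH1 H1nz H1anti] by blast
  have H11: "H1 (1, t) = p t" for t using H1s[of 1 t] by (simp add: m_def p_def)
  have H10: "H1 (0, t) = \<alpha> * l t + \<beta> * cnj (l t)" for t by (simp add: H1_def m_def \<rho>_def D(3))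
  \<comment> \<open>the linear map on the small pair deforms to a rotation\<close>
  have deform: "\<exists>c. log_change (\<lambda>t. \<gamma> * l t + \<mu> * cnj (l t)) c \<and> log_change l c" if g: "norm \<mu> < norm \<gamma>" for \<gamma> \<mu>
  proof -
    obtain c where c: "log_change (\<lambda>t. \<gamma> * l t + of_real (1 - 0) * \<mu> * cnj (l t)) c" "log_change (\<lambda>t. \<gamma> * l t + of_real (1 - 1) * \<mu> * cnj (l t)) c"
    proof (rule log_change_homotopy[of "\<lambda>x. \<gamma> * l (snd x) + of_real (1 - fst x) * \<mu> * cnj (l (snd x))"])
      show "continuous_on ({0..1} \<times> {0..1}) (\<lambda>x. \<gamma> * l (snd x) + of_real (1 - fst x) * \<mu> * cnj (l (snd x)))"
        by (intro continuous_intros snd_le cl)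
      show "\<gamma> * l (snd (s, t)) + of_real (1 - fst (s, t)) * \<mu> * cnj (l (snd (s, t))) \<noteq> 0" if s: "s \<in> {0..1}" and t: "t \<in> {0..1}" for s t
      proof -
        have "norm (of_real (1 - s) * \<mu> * cnj (l t)) = \<bar>1 - s\<bar> * (norm \<mu> * norm (l t))" by (simp only: norm_mult norm_of_real complex_mod_cnj mult.assoc)
        also have "\<dots> \<le> 1 * (norm \<mu> * norm (l t))" using s by (intro mult_right_mono) auto
        also have "\<dots> < norm (\<gamma> * l t)" using g l0[OF t] by (simp add: norm_mult)
        finally show ?thesis by (metis add_eq_0_iff norm_minus_cancel order_less_irrefl fst_conv snd_conv)
      qed
      show "\<gamma> * l (snd (s, 1)) + of_real (1 - fst (s, 1)) * \<mu> * cnj (l (snd (s, 1))) = - (\<gamma> * l (snd (s, 0)) + of_real (1 - fst (s, 0)) * \<mu> * cnj (l (snd (s, 0))))" for s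
        by (simp add: l10)
    qed auto
    have "\<gamma> \<noteq> 0" using g by auto
    then have "inverse \<gamma> \<noteq> 0" by simp
    from log_change_mult[OF this c(2)] have "log_change l c" using \<open>\<gamma> \<noteq> 0\<close> by (simp add: mult.assoc[symmetric])
    then show ?thesis using c(1) by auto
  qed
  have cl': "log_change l c"
    using deform[OF ab] c(1) log_change_unique unfolding H10 by blast
  \<comment> \<open>the reflection that exchanges the two linear functionals in the sign condition\<close>
  define B where "B = (\<lambda>v. Complex (Im v - u * (Re v + u * Im v)) (Re v + u * Im v))"
  define a' b' where "a' = Complex 0 (u\<^sup>2 / 2)" and "b' = Complex (- u) (1 - u\<^sup>2 / 2)"
  have Bab: "B v = a' * v + b' * cnj v" for v
    by (simp add: B_def a'_def b'_def complex_eq_iff power2_eq_square algebra_simps)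
  have "(norm b')\<^sup>2 - (norm a')\<^sup>2 = 1"
    unfolding cmod_power2 a'_def b'_def by (simp add: power2_eq_square field_simps)
  then have "(norm a')\<^sup>2 < (norm b')\<^sup>2" by linarith
  then have ab': "norm a' < norm b'" by (rule power_less_imp_less_base) simp
  obtain c2 where c2: "log_change (\<lambda>t. (1 - of_real 0) * p t + of_real 0 * B (l t)) c2" "log_change (\<lambda>t. (1 - of_real 1) * p t + of_real 1 * B (l t)) c2"
  proof (rule log_change_homotopy[of "\<lambda>x. (1 - of_real (fst x)) * p (snd x) + of_real (fst x) * B (l (snd x))"])
    show "continuous_on ({0..1} \<times> {0..1}) (\<lambda>x. (1 - of_real (fst x)) * p (snd x) + of_real (fst x) * B (l (snd x)))"
      unfolding Bab by (intro continuous_intros snd_le cl cp)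
    show "(1 - of_real (fst (s, t))) * p (snd (s, t)) + of_real (fst (s, t)) * B (l (snd (s, t))) \<noteq> 0" if s: "s \<in> {0..1}" and t: "t \<in> {0..1}" for s t
    proof
      assume "(1 - of_real (fst (s, t))) * p (snd (s, t)) + of_real (fst (s, t)) * B (l (snd (s, t))) = 0"
      then have z: "of_real (1 - s) * p t + of_real s * B (l t) = 0" by simp
      then have r: "(1 - s) * Re (p t) + s * Re (B (l t)) = 0" and i: "(1 - s) * Im (p t) + s * Im (B (l t)) = 0"
        by (metis plus_complex.sel(1) Re_complex_of_real mult_zero_left times_complex.sel(1) Im_complex_of_real diff_zero zero_complex.sel(1),
            metis plus_complex.sel(2) Re_complex_of_real mult_zero_left times_complex.sel(2) Im_complex_of_real add_0_right zero_complex.sel(2))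
      have i': "(1 - s) * Im (p t) + s * (Re (l t) + u * Im (l t)) = 0" using i by (simp add: B_def)
      have "(1 - s) * (Re (p t) + u * Im (p t)) + s * (Re (B (l t)) + u * Im (B (l t))) = 0"
        using arg_cong[OF i, of "\<lambda>x. u * x"] r by (simp add: algebra_simps)
      then have r': "(1 - s) * (Re (p t) + u * Im (p t)) + s * Im (l t) = 0" by (simp add: B_def)
      have pos: "0 < (1 - s) * A + s * C" if "0 < A" "0 < C" for A C :: real
      proof (cases "s = 0")
        case False
        then have "0 < s * C" "0 \<le> (1 - s) * A" using s that by auto
        then show ?thesis by linarith
      qed (use that in simp)
      from sgn[OF t] show False
      proof
        assume "0 < Im (w' t - w t) \<and> 0 < Re (F (w' t) - F (w t)) + u * Im (F (w' t) - F (w t))"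
        then show False using pos[of "Re (p t) + u * Im (p t)" "Im (l t)"] r' by (simp add: l_def p_def)
      next
        assume "Re (w' t - w t) + u * Im (w' t - w t) < 0 \<and> Im (F (w' t) - F (w t)) < 0"
        then have "0 < - (Im (p t))" "0 < - (Re (l t) + u * Im (l t))" by (simp_all add: l_def p_def)
        from pos[OF this] i' show False by (simp add: algebra_simps)
      qed
    qed
    show "(1 - of_real (fst (s, 1))) * p (snd (s, 1)) + of_real (fst (s, 1)) * B (l (snd (s, 1))) =
        - ((1 - of_real (fst (s, 0))) * p (snd (s, 0)) + of_real (fst (s, 0)) * B (l (snd (s, 0))))" for s
      by (simp add: l10 p10 Bab algebra_simps)
  qed auto
  have "log_change (\<lambda>t. p t) c2" "log_change (\<lambda>t. B (l t)) c2" using c2 by simp_all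
  moreover have "c2 = c" using \<open>log_change (\<lambda>t. p t) c2\<close> c(2) log_change_unique unfolding H11 by blast
  ultimately have "log_change (\<lambda>t. B (l t)) c" by simp
  then have 1: "log_change (\<lambda>t. cnj (B (l t))) (cnj c)" by (rule log_change_cnj)
  have "cnj (B v) = cnj b' * v + cnj a' * cnj v" for v by (simp add: Bab)
  then have 1: "log_change (\<lambda>t. cnj b' * l t + cnj a' * cnj (l t)) (cnj c)" using 1 by simp
  obtain c3 where c3: "log_change (\<lambda>t. cnj b' * l t + cnj a' * cnj (l t)) c3" "log_change l c3"
    using deform[of "cnj a'" "cnj b'"] ab' by auto
  have cc: "cnj c = c" using log_change_unique[OF c3(1) 1] log_change_unique[OF c3(2) cl'] by simp
  obtain g where g: "\<forall>t\<in>{0..1}. l t = exp (g t)" "g 1 - g 0 = c" using cl' unfolding log_change_def by blast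
  have "exp (g 1) = - exp (g 0)" using g(1) l10 by (metis atLeastAtMost_iff order_refl zero_le_one)
  then have "exp c = -1" unfolding g(2)[symmetric] by (simp add: exp_diff)
  moreover obtain x :: real where "c = of_real x" using cc by (metis Reals_cnj_iff Reals_cases)
  ultimately have "complex_of_real (exp x) = of_real (-1)" by (simp add: exp_of_real)
  then have "exp x = -1" by (simp only: of_real_eq_iff)
  then show False using exp_gt_zero[of x] by simp
qed

text \<open>The swap runs along the boundary of a triangle.\<close>

lemma triangle_reverses_orientation:
  fixes F :: "complex \<Rightarrow> complex"
  assumes S: "convex S" and F: "continuous_on S F" "inj_on F S"
    and D: "(F has_derivative D) (at w1 within S)" "w1 \<in> S" "\<And>v. D v = \<alpha> * v + \<beta> * cnj v"
    and abc: "a \<in> S" "b \<in> S" "c \<in> S"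
    and bc: "\<And>w. w \<in> closed_segment b c \<Longrightarrow> Im a < Im w \<and> Re (F a) + u * Im (F a) < Re (F w) + u * Im (F w)"
    and ab: "\<And>w. w \<in> closed_segment a b \<Longrightarrow> Re c + u * Im c < Re w + u * Im w \<and> Im (F c) < Im (F w)"
    and ca: "\<And>w. w \<in> closed_segment c a \<Longrightarrow> Re w + u * Im w < Re b + u * Im b \<and> Im (F w) < Im (F b)"
  shows "norm \<alpha> \<le> norm \<beta>"
proof (rule swapped_pair_reverses_orientation[OF S F D, of "linepath a a +++ (linepath a b +++ linepath b b)"
      "linepath b c +++ (linepath c c +++ linepath c a)" u])
  let ?w = "linepath a a +++ (linepath a b +++ linepath b b)" and ?w' = "linepath b c +++ (linepath c c +++ linepath c a)"
  have "path ?w" "path ?w'" by simp_all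
  then show "continuous_on {0..1} ?w" "continuous_on {0..1} ?w'" by (simp_all add: path_def)
  show "?w 1 = ?w' 0" "?w' 1 = ?w 0" by (simp_all add: joinpaths_def linepath_def)
  have seg: "linepath x y t \<in> closed_segment x y" if "0 \<le> t" "t \<le> 1" for x y :: complex and t
    using that by (simp add: linepath_in_path)
  have cS: "closed_segment x y \<subseteq> S" if "x \<in> S" "y \<in> S" for x y using closed_segment_subset[OF that S] .
  fix t :: real assume t: "t \<in> {0..1}"
  consider "t \<le> 1/2" | "1/2 < t" "2 * t - 1 \<le> 1/2" | "1/2 < 2 * t - 1" by linarith
  then have "(\<exists>x. ?w t = a \<and> ?w' t = x \<and> x \<in> closed_segment b c) \<or> (\<exists>x. ?w t = x \<and> ?w' t = c \<and> x \<in> closed_segment a b) \<or>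
      (\<exists>x. ?w t = b \<and> ?w' t = x \<and> x \<in> closed_segment c a)"
  proof cases
    case 1
    then show ?thesis using t seg[of "2 * t" b c] by (intro disjI1) (simp add: joinpaths_def linepath_refl)
  next
    case 2
    then show ?thesis using t seg[of "2 * (2 * t - 1)" a b] by - (rule disjI2, rule disjI1, simp add: joinpaths_def linepath_refl)
  next
    case 3
    then show ?thesis using t seg[of "2 * (2 * t - 1) - 1" c a] by (intro disjI2) (simp add: joinpaths_def linepath_refl)
  qed
  then consider x where "?w t = a" "?w' t = x" "x \<in> closed_segment b c" | x where "?w t = x" "?w' t = c" "x \<in> closed_segment a b"
    | x where "?w t = b" "?w' t = x" "x \<in> closed_segment c a" by blast
  then have "?w t \<in> S \<and> ?w' t \<in> S \<and> (0 < Im (?w' t - ?w t) \<and> 0 < Re (F (?w' t) - F (?w t)) + u * Im (F (?w' t) - F (?w t)) \<or>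
       Re (?w' t - ?w t) + u * Im (?w' t - ?w t) < 0 \<and> Im (F (?w' t) - F (?w t)) < 0)"
  proof cases
    case 1
    then show ?thesis using bc[OF 1(3)] cS[OF abc(2,3)] abc by (auto simp: algebra_simps)
  next
    case 2
    then show ?thesis using ab[OF 2(3)] cS[OF abc(1,2)] abc by (auto simp: algebra_simps)
  next
    case 3
    then show ?thesis using ca[OF 3(3)] cS[OF abc(3,1)] abc by (auto simp: algebra_simps)
  qed
  then show "?w t \<in> S \<and> ?w' t \<in> S" "0 < Im (?w' t - ?w t) \<and> 0 < Re (F (?w' t) - F (?w t)) + u * Im (F (?w' t) - F (?w t)) \<or>
       Re (?w' t - ?w t) + u * Im (?w' t - ?w t) < 0 \<and> Im (F (?w' t) - F (?w t)) < 0" by blast+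
qed

section \<open>Areas of injective images\<close>

lemma real_linear_complex:
  assumes "linear D" obtains \<alpha> \<beta> where "\<And>v. D v = \<alpha> * v + \<beta> * cnj v"
proof
  fix v
  let ?a = "(D 1 - \<i> * D \<i>) / 2" and ?b = "(D 1 + \<i> * D \<i>) / 2"
  have "v = Re v *\<^sub>R 1 + Im v *\<^sub>R \<i>" by (simp add: complex_eq_iff)
  then have "D v = Re v *\<^sub>R D 1 + Im v *\<^sub>R D \<i>" using assms by (metis linear_add linear_scale)
  then show "D v = ?a * v + ?b * cnj v" by (simp add: complex_eq_iff field_simps)
qed

text \<open>For \<open>norm \<alpha> \<le> norm \<beta>\<close> both eigenvalues are real and the determinant is their product.\<close>

lemma determinant_bound_from_eigenvalues:
  assumes ab: "norm \<alpha> \<le> norm \<beta>" and \<epsilon>: "0 \<le> \<epsilon>"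
    and e: "\<And>c. real_eigenvalue (\<lambda>v. \<alpha> * v + \<beta> * cnj v) c \<Longrightarrow> \<epsilon> \<le> \<bar>c\<bar>"
  shows "\<epsilon>\<^sup>2 \<le> \<bar>(norm \<alpha>)\<^sup>2 - (norm \<beta>)\<^sup>2\<bar>"
proof -
  define r where "r = sqrt ((norm \<beta>)\<^sup>2 - (Im \<alpha>)\<^sup>2)"
  have "\<bar>Im \<alpha>\<bar> \<le> \<bar>norm \<beta>\<bar>" using abs_Im_le_cmod[of \<alpha>] ab by simp
  then have "(Im \<alpha>)\<^sup>2 \<le> (norm \<beta>)\<^sup>2" by (rule abs_le_square_iff[THEN iffD1])
  then have r2: "r\<^sup>2 = (norm \<beta>)\<^sup>2 - (Im \<alpha>)\<^sup>2" by (simp add: r_def)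
  have eig: "real_eigenvalue (\<lambda>v. \<alpha> * v + \<beta> * cnj v) c" if c: "(Re \<alpha> - c)\<^sup>2 = r\<^sup>2" for c
  proof -
    let ?d = "\<alpha> - of_real c"
    have "(norm ?d)\<^sup>2 = (norm \<beta>)\<^sup>2" using c r2 by (simp add: cmod_power2)
    then have d: "norm ?d = norm \<beta>" by simp
    show ?thesis
    proof (cases "\<beta> = 0")
      case True
      then have "\<alpha> = of_real c" using d by simp
      then show ?thesis using True by (auto simp: real_eigenvalue_def scaleR_conv_of_real intro!: exI[of _ 1])
    next
      case False
      define q where "q = - \<beta> / ?d"
      define v where "v = csqrt q"
      have d0: "?d \<noteq> 0" using d False by auto
      have q1: "norm q = 1" using d False by (simp add: q_def norm_divide)
      have vv: "v * v = q" by (simp add: v_def power2_eq_square[symmetric])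
      have "norm v * norm v = 1" using q1 vv by (metis norm_mult)
      then have "norm v ^ 2 = 1" by (simp add: power2_eq_square)
      then have vc: "v * cnj v = 1" by (simp add: complex_norm_square[symmetric])
      have "?d * v = ?d * (v * (v * cnj v))" by (simp add: vc)
      also have "\<dots> = ?d * q * cnj v" unfolding vv[symmetric] by (simp add: mult.assoc)
      also have "?d * q = - \<beta>" using d0 by (simp add: q_def)
      finally have "\<alpha> * v + \<beta> * cnj v = c *\<^sub>R v" by (simp add: scaleR_conv_of_real algebra_simps)
      moreover have "v \<noteq> 0" using vc by auto
      ultimately show ?thesis unfolding real_eigenvalue_def by blast
    qed
  qed
  have "\<epsilon> * \<epsilon> \<le> \<bar>Re \<alpha> + r\<bar> * \<bar>Re \<alpha> - r\<bar>"
    by (intro mult_mono e eig) (use \<epsilon> in auto)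
  also have "\<dots> = \<bar>(Re \<alpha> + r) * (Re \<alpha> - r)\<bar>" by (simp add: abs_mult)
  also have "(Re \<alpha> + r) * (Re \<alpha> - r) = (Re \<alpha>)\<^sup>2 - r\<^sup>2" by (simp add: power2_eq_square algebra_simps)
  also have "\<dots> = (norm \<alpha>)\<^sup>2 - (norm \<beta>)\<^sup>2" unfolding r2 by (simp add: cmod_power2)
  finally show ?thesis by (simp add: power2_eq_square)
qed

definition vec_of_complex :: "complex \<Rightarrow> real^2" where "vec_of_complex w = vector [Re w, Im w]"
definition complex_of_vec :: "real^2 \<Rightarrow> complex" where "complex_of_vec x = Complex (x $ 1) (x $ 2)"

lemma vec_of_complex_nth [simp]: "vec_of_complex w $ 1 = Re w" "vec_of_complex w $ 2 = Im w"
  by (simp_all add: vec_of_complex_def)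

lemma complex_of_vec_sel [simp]: "Re (complex_of_vec x) = x $ 1" "Im (complex_of_vec x) = x $ 2"
  by (simp_all add: complex_of_vec_def)

lemma complex_vec_inverse [simp]: "complex_of_vec (vec_of_complex w) = w" "vec_of_complex (complex_of_vec x) = x"
  by (simp_all add: complex_eq_iff vec_eq_iff forall_2)

lemma norm_complex_of_vec [simp]: "norm (complex_of_vec x) = norm x"
  by (simp add: cmod_def norm_vec_def L2_set_def sum_2)

lemma norm_vec_of_complex [simp]: "norm (vec_of_complex w) = norm w"
  using norm_complex_of_vec[of "vec_of_complex w"] by simp

lemma bounded_linear_complex_of_vec: "bounded_linear complex_of_vec"
  by (rule bounded_linear_intro[where K = 1]) (auto simp: complex_eq_iff)

lemma bounded_linear_vec_of_complex: "bounded_linear vec_of_complex"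
  by (rule bounded_linear_intro[where K = 1]) (auto simp: vec_eq_iff forall_2)

text \<open>The area of the image is the integral of the Jacobian.\<close>

lemma jacobian_area_bound:
  fixes F :: "complex \<Rightarrow> complex"
  assumes Q: "Q = {w. x1 \<le> Re w \<and> Re w \<le> x2 \<and> y1 \<le> Im w \<and> Im w \<le> y2}" and le: "x1 \<le> x2" "y1 \<le> y2"
    and inj: "inj_on F Q" and C: "\<And>w. w \<in> Q \<Longrightarrow> norm (F w) \<le> C"
    and D: "\<And>w. w \<in> Q \<Longrightarrow> \<exists>\<alpha> \<beta>. (F has_derivative (\<lambda>v. \<alpha> * v + \<beta> * cnj v)) (at w) \<and> \<kappa> \<le> \<bar>(norm \<alpha>)\<^sup>2 - (norm \<beta>)\<^sup>2\<bar>"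
  shows "\<kappa> * ((x2 - x1) * (y2 - y1)) \<le> 4 * C\<^sup>2"
proof -
  define B :: "(real^2) set" where "B = cbox (vector [x1, y1]) (vector [x2, y2])"
  define f where "f = (\<lambda>x. vec_of_complex (F (complex_of_vec x)))"
  have BQ: "x \<in> B \<longleftrightarrow> complex_of_vec x \<in> Q" for x by (auto simp: B_def Q mem_box_cart forall_2)
  obtain \<alpha> \<beta> where ab: "\<And>w. w \<in> Q \<Longrightarrow> (F has_derivative (\<lambda>v. \<alpha> w * v + \<beta> w * cnj v)) (at w)"
      "\<And>w. w \<in> Q \<Longrightarrow> \<kappa> \<le> \<bar>(norm (\<alpha> w))\<^sup>2 - (norm (\<beta> w))\<^sup>2\<bar>" using D by metis
  define f' where "f' = (\<lambda>x v. vec_of_complex (\<alpha> (complex_of_vec x) * complex_of_vec v + \<beta> (complex_of_vec x) * cnj (complex_of_vec v)))"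
  have der: "(f has_derivative f' x) (at x within B)" if x: "x \<in> B" for x
  proof -
    have 1: "(complex_of_vec has_derivative complex_of_vec) (at x within B)"
      by (rule bounded_linear.has_derivative[OF bounded_linear_complex_of_vec has_derivative_ident])
    have 2: "(F has_derivative (\<lambda>v. \<alpha> (complex_of_vec x) * v + \<beta> (complex_of_vec x) * cnj v)) (at (complex_of_vec x))"
      by (rule ab(1)) (use x BQ in blast)
    show ?thesis unfolding f_def f'_def
      by (rule bounded_linear.has_derivative[OF bounded_linear_vec_of_complex has_derivative_compose[OF 1 2]])
  qed
  have injf: "inj_on f B"
  proof (rule inj_onI)
    fix x y assume x: "x \<in> B" and y: "y \<in> B" and e: "f x = f y"
    have "F (complex_of_vec x) = F (complex_of_vec y)" using arg_cong[OF e, of complex_of_vec] by (simp add: f_def)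
    then have "complex_of_vec x = complex_of_vec y" using inj x y BQ by (auto dest: inj_onD)
    then show "x = y" by (metis complex_vec_inverse(2))
  qed
  have "continuous_on B f" using der by (auto simp: continuous_on_eq_continuous_within intro: has_derivative_continuous)
  then have cpt: "compact (f ` B)" by (rule compact_continuous_image) (simp add: B_def)
  then have lm: "f ` B \<in> lmeasurable" by (rule lmeasurable_compact)
  have B0: "B \<in> sets lebesgue" by (simp add: B_def)
  have int: "((\<lambda>x. \<bar>det (matrix (f' x))\<bar>) has_integral measure lebesgue (f ` B)) B"
    using has_measure_differentiable_image[OF B0 der injf] lm by blast
  have det: "det (matrix (f' x)) = (norm (\<alpha> (complex_of_vec x)))\<^sup>2 - (norm (\<beta> (complex_of_vec x)))\<^sup>2" for x
    unfolding cmod_power2 by (simp add: det_2 matrix_def f'_def axis_def power2_eq_square algebra_simps)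
  have cb: "measure lebesgue B = (x2 - x1) * (y2 - y1)"
  proof -
    have ne: "cbox (vector [x1, y1] :: real^2) (vector [x2, y2]) \<noteq> {}" using le by (auto simp: interval_ne_empty_cart forall_2)
    show ?thesis unfolding B_def using content_cbox_cart[OF ne] by (simp add: UNIV_2)
  qed
  have "((\<lambda>x. \<kappa>) has_integral measure lebesgue B *\<^sub>R \<kappa>) B" unfolding B_def using has_integral_const[of \<kappa>] by simp
  then have "measure lebesgue B *\<^sub>R \<kappa> \<le> measure lebesgue (f ` B)"
    by (rule has_integral_le[OF _ int]) (use ab(2) BQ det in auto)
  also have "\<dots> \<le> measure lebesgue (cbox (vector [-C, -C] :: real^2) (vector [C, C]))"
  proof (rule measure_mono_fmeasurable)
    show "f ` B \<subseteq> cbox (vector [-C, -C]) (vector [C, C])"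
    proof
      fix y assume "y \<in> f ` B"
      then obtain x where x: "x \<in> B" "y = f x" by blast
      have "norm (F (complex_of_vec x)) \<le> C" using C x(1) BQ by blast
      then show "y \<in> cbox (vector [-C, -C]) (vector [C, C])"
        using abs_Re_le_cmod[of "F (complex_of_vec x)"] abs_Im_le_cmod[of "F (complex_of_vec x)"]
        by (auto simp: x(2) f_def mem_box_cart forall_2 abs_le_iff)
    qed
  qed (use lm in \<open>auto simp: fmeasurableD\<close>)
  also have "\<dots> = 4 * C\<^sup>2"
  proof -
    have "Complex x1 y1 \<in> Q" using le by (simp add: Q)
    then have "0 \<le> C" using C norm_ge_zero order_trans by blast
    then have ne: "cbox (vector [-C, -C] :: real^2) (vector [C, C]) \<noteq> {}" by (auto simp: interval_ne_empty_cart forall_2)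
    show ?thesis using content_cbox_cart[OF ne] by (simp add: UNIV_2 power2_eq_square)
  qed
  finally show ?thesis by (simp add: cb mult.commute)
qed

section \<open>A sector that is mapped injectively onto a bounded set\<close>

context tangent_lines begin

lemma T_bounded: obtains C where "\<And>u z. u \<in> I \<Longrightarrow> z \<in> T u \<Longrightarrow> norm z \<le> C"
proof
  fix u z assume u: "u \<in> I" and z: "z \<in> T u"
  have i: "\<bar>Im z\<bar> \<le> \<delta>" using z by (simp add: below_line_def)
  have uz: "\<bar>u * Im z\<bar> \<le> max \<bar>u1\<bar> \<bar>u2\<bar> * \<delta>" unfolding abs_mult using i u by (intro mult_mono) auto
  have "\<bar>h u - h u1\<bar> \<le> \<delta> * \<bar>u - u1\<bar>" by (rule h_lipschitz[OF u]) (use pos in simp)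
  also have "\<dots> \<le> \<delta> * \<bar>u2 - u1\<bar>" using u pos by (intro mult_left_mono) auto
  finally have hu: "\<bar>h u\<bar> \<le> \<bar>h u1\<bar> + \<delta> * \<bar>u2 - u1\<bar>" by linarith
  have "Re z < h u - u * Im z" "- a \<le> Re z" using z by (auto simp: below_line_def)
  then have "\<bar>Re z\<bar> \<le> a + (\<bar>h u\<bar> + \<bar>u * Im z\<bar>)" using pos(1) by linarith
  then have "norm z \<le> a + (\<bar>h u\<bar> + \<bar>u * Im z\<bar>) + \<delta>" using cmod_le[of z] i by linarith
  then show "norm z \<le> a + (\<bar>h u1\<bar> + \<delta> * \<bar>u2 - u1\<bar> + max \<bar>u1\<bar> \<bar>u2\<bar> * \<delta>) + \<delta>" using hu uz by linarith
qed

text \<open>A point of the tangent line of slope \<open>u\<close> that is on or above all tangent lines. Singular points of slopes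
  slightly closer to \<open>\<tau>\<close> lie on one side of it, by concavity of \<open>h\<close>, and accumulate in \<open>K u\<close>.\<close>

lemma singular_point_towards:
  assumes u: "u \<in> I" "\<tau> \<in> I" "\<tau> \<noteq> u" and z: "tilt u z = h u" "\<And>v. v \<in> I \<Longrightarrow> h v \<le> tilt v z"
  obtains k where "k \<in> K u" "0 \<le> (\<tau> - u) * (Im z - Im k)"
proof -
  define v where "v = (\<lambda>n. u + (\<tau> - u) * (1 / real (Suc n)))"
  have vI: "v n \<in> I" for n
  proof -
    have "v n = (1 - 1 / real (Suc n)) *\<^sub>R u + (1 / real (Suc n)) *\<^sub>R \<tau>" by (simp add: v_def algebra_simps diff_divide_distrib)
    moreover have "0 \<le> 1 - 1 / real (Suc n)" "0 \<le> 1 / real (Suc n)" by (auto simp: field_simps)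
    ultimately show ?thesis using convexD[OF convex_real_interval(5)[of u1 u2] u(1,2), of "1 - 1 / real (Suc n)" "1 / real (Suc n)"] by simp
  qed
  have "v \<longlonglongrightarrow> u + (\<tau> - u) * 0" unfolding v_def by (intro tendsto_intros) (use LIMSEQ_Suc[OF lim_1_over_n] in simp)
  then have vl: "v \<longlonglongrightarrow> u" by simp
  have "\<forall>n. \<exists>k. k \<in> K (v n)" using K_facts(2)[OF vI] by blast
  then obtain k where k: "\<And>n. k n \<in> K (v n)" by metis
  have "bounded (range k)" unfolding bounded_iff using K_bounded[OF vI k] by blast
  then obtain x r where r: "strict_mono r" "(k \<circ> r) \<longlonglongrightarrow> x" using bounded_imp_convergent_subsequence by blast
  then have kl: "(\<lambda>n. k (r n)) \<longlonglongrightarrow> x" by (simp add: o_def)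
  have xK: "x \<in> K u"
  proof (rule singular_points_closed[of "\<lambda>n. v (r n)" u "\<lambda>n. k (r n)"])
    show "(\<lambda>n. v (r n)) \<longlonglongrightarrow> u" using LIMSEQ_subseq_LIMSEQ[OF vl r(1)] by (simp add: o_def)
  qed (use u vI k kl in auto)
  have le: "0 \<le> (\<tau> - u) * (Im z - Im (k n))" for n
  proof -
    have "h u \<le> h (v n) + (u - v n) * Im (k n)" by (rule super[OF vI u(1) k])
    moreover have "h (v n) \<le> tilt (v n) z" by (rule z(2)[OF vI])
    moreover have "tilt (v n) z = h u + (v n - u) * Im z" unfolding z(1)[symmetric] by (simp add: algebra_simps)
    ultimately have "0 \<le> (v n - u) * (Im z - Im (k n))" by (simp add: algebra_simps)
    moreover have "(v n - u) * (Im z - Im (k n)) = (1 / real (Suc n)) * ((\<tau> - u) * (Im z - Im (k n)))" by (simp add: v_def)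
    moreover have "0 < 1 / real (Suc n)" by simp
    ultimately show ?thesis by (simp only: zero_le_mult_iff) linarith
  qed
  have "0 \<le> (\<tau> - u) * (Im z - Im x)"
    by (rule LIMSEQ_le_const[of "\<lambda>n. (\<tau> - u) * (Im z - Im (k (r n)))"]) (use le in \<open>auto intro!: tendsto_intros kl\<close>)
  then show ?thesis using that xK by blast
qed

end

text \<open>The section escapes through the upper ends of the strips, and the singular sets are segments.\<close>

locale tangent_lines_up = tangent_lines_strip +
  assumes up: "u \<in> {u1..u2} \<Longrightarrow> k \<in> K u \<Longrightarrow> filterlim (\<lambda>z. Im (\<Phi> u z)) at_top (at k within \<Delta> u - K u)"
    and no_gap: "u \<in> {u1..u2} \<Longrightarrow> k1 \<in> K u \<Longrightarrow> k2 \<in> K u \<Longrightarrow> Im k1 < Im z \<Longrightarrow> Im z < Im k2 \<Longrightarrow> tilt u z = h u \<Longrightarrow> z \<in> K u"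
begin

definition um :: real where "um = (u1 + u2) / 2"
definition d :: real where "d = (u2 - u1) / 4"

lemma mid_slope_bounds: "0 < d" "um \<in> I" "um - d \<in> I" "um + d \<in> I" "u1 + 2 * d = um" "u2 - 2 * d = um"
  using pos by (auto simp: um_def d_def field_simps)

text \<open>The points whose direction, as a slope \<open>- Re w / Im w\<close>, is within \<open>d\<close> of the middle slope \<open>um\<close>.\<close>

definition sector :: "real \<Rightarrow> complex set" where
  "sector R = {w. R < Im w \<and> \<bar>tilt um w\<bar> < d * Im w}"

definition R0 :: real where "R0 = max B0 (max 0 (M / d))"

lemma R0_bounds: "B0 \<le> R0" "0 \<le> R0" "M \<le> d * R0"
proof -
  have "M / d \<le> R0" by (simp add: R0_def)
  then show "M \<le> d * R0" using mid_slope_bounds(1) by (simp add: field_simps)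
qed (auto simp: R0_def)

lemma convex_sector: "convex (sector R)"
proof -
  have eq: "sector R = {w. inner (Complex 0 1) w > R} \<inter> {w. inner (Complex 1 (um - d)) w < 0} \<inter> {w. inner (Complex 1 (um + d)) w > 0}"
    by (auto simp: sector_def inner_complex_def abs_less_iff algebra_simps)
  show ?thesis unfolding eq by (intro convex_Int convex_halfspace_lt convex_halfspace_gt)
qed

lemma lifted_interior: assumes "u \<in> I" "z \<in> T u" "B0 < norm (\<Phi> u z)"
  shows "\<bar>Im z\<bar> < \<delta> - \<eta>" "- a / 2 < Re z"
  using edge[OF assms(1,2)] assms(3) by force+

text \<open>A point of the strip of slope \<open>u\<close> has direction close to \<open>u\<close> once it is far out.\<close>

lemma slope_near:
  assumes "u \<in> I" "\<bar>tilt u w\<bar> \<le> M" "w \<in> sector R0" shows "u1 < u" "u < u2"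
proof -
  have w: "R0 < Im w" "\<bar>tilt um w\<bar> < d * Im w" using assms(3) by (auto simp: sector_def)
  have "d * R0 \<le> d * Im w" using w mid_slope_bounds(1) by (intro mult_left_mono) auto
  moreover have "tilt u w - tilt um w = (u - um) * Im w" by (simp add: algebra_simps)
  ultimately have "\<bar>(u - um) * Im w\<bar> < (2 * d) * Im w" using w(2) assms(2) R0_bounds(3) by linarith
  moreover have iw: "0 < Im w" using w R0_bounds by linarith
  ultimately have "\<bar>u - um\<bar> < 2 * d" by (simp add: abs_mult)
  then show "u1 < u" "u < u2" using mid_slope_bounds(5,6) by (auto simp: abs_less_iff)
qed

text \<open>The image of the common section of all slopes.\<close>

definition lifted :: "complex set" where
  "lifted = {w. \<exists>u\<in>I. F w \<in> T u \<and> \<Phi> u (F w) = w}"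

lemma lifted_strip: assumes "u \<in> I" "F w \<in> T u" "\<Phi> u (F w) = w" shows "\<bar>tilt u w\<bar> \<le> M"
  using strip[OF assms(1,2)] assms(3) by simp

lemma lifted_unique: assumes "w \<in> lifted" "u \<in> I" "F w \<in> T u" shows "\<Phi> u (F w) = w"
proof -
  obtain v where v: "v \<in> I" "F w \<in> T v" "\<Phi> v (F w) = w" using assms(1) by (auto simp: lifted_def)
  show ?thesis using agree[OF assms(2) v(1) assms(3) v(2)] v(3) by simp
qed

text \<open>Towards a singular point of the middle slope, the section escapes along the middle of the sector.\<close>

lemma lifted_deep: obtains w where "w \<in> lifted" "R < Im w" "F w \<in> T um" "\<bar>tilt um w\<bar> \<le> M"
proof -
  obtain k where k: "k \<in> K um" using K_facts(2)[OF mid_slope_bounds(2)] by blast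
  have in_T: "k - of_real t \<in> T um" if "0 < t" "t \<le> a" for t by (rule below_singular[OF mid_slope_bounds(2) k that])
  have lim: "((\<lambda>t. k - of_real t) \<longlongrightarrow> k) (at_right (0::real))" by (rule tendsto_eq_intros refl | simp)+
  have ev: "eventually (\<lambda>t. k - of_real t \<in> \<Delta> um - K um \<and> k - of_real t \<noteq> k) (at_right (0::real))"
    using eventually_at_right_real[OF pos(1)]
  proof eventually_elim
    case (elim t)
    then have "k - of_real t \<in> T um" by (intro in_T) auto
    then have "k - of_real t \<in> \<Delta> um - K um" using T_sub[OF mid_slope_bounds(2)] by blast
    moreover have "k - of_real t \<noteq> k" using elim by simp
    ultimately show ?case by blast
  qed
  have fl: "filterlim (\<lambda>t. k - of_real t) (at k within \<Delta> um - K um) (at_right (0::real))"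
    unfolding filterlim_at using lim ev by blast
  have "filterlim (\<lambda>t. Im (\<Phi> um (k - of_real t))) at_top (at_right (0::real))"
    by (rule filterlim_compose[OF up[OF mid_slope_bounds(2) k] fl])
  then have "eventually (\<lambda>t. R < Im (\<Phi> um (k - of_real t))) (at_right (0::real))" unfolding filterlim_at_top_dense by blast
  then obtain t where t: "R < Im (\<Phi> um (k - of_real t))" "0 < t" "t < a"
    using eventually_happens'[OF trivial_limit_at_right_real eventually_conj[OF _ eventually_at_right_real[OF pos(1)]]]
    by (metis (no_types, lifting) greaterThanLessThan_iff)
  let ?z = "k - of_real t"
  have zT: "?z \<in> T um" by (rule in_T) (use t in auto)
  have Fz: "F (\<Phi> um ?z) = ?z" by (rule section_onD[OF K_facts(6)[OF mid_slope_bounds(2)] zT])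
  show ?thesis
  proof (rule that[of "\<Phi> um ?z"])
    show "\<Phi> um ?z \<in> lifted" unfolding lifted_def using mid_slope_bounds(2) zT Fz by auto
    show "\<bar>tilt um (\<Phi> um ?z)\<bar> \<le> M" by (rule strip[OF mid_slope_bounds(2) zT])
  qed (use t zT Fz in auto)
qed

text \<open>Far from the origin, values of the section come from the interior of the rectangle, by the bound on its
  sides.\<close>

lemma lifted_open:
  assumes w: "w \<in> lifted" "B0 < norm w"
  obtains e where "e > 0" "ball w e \<subseteq> lifted"
proof -
  obtain u where u: "u \<in> I" "F w \<in> T u" "\<Phi> u (F w) = w" using w by (auto simp: lifted_def)
  let ?z = "F w"
  have st: "\<bar>Im ?z\<bar> < \<delta> - \<eta>" "- a / 2 < Re ?z" using lifted_interior[OF u(1,2)] u(3) w(2) by auto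
  let ?O = "{z. \<bar>Im z\<bar> < \<delta> \<and> - a < Re z \<and> tilt u z < h u}"
  have "open ?O" by (intro open_Collect_conj open_Collect_less continuous_intros)
  moreover have "?z \<in> ?O" using st u(2) pos by (auto simp: below_line_def)
  ultimately obtain e where e: "e > 0" "ball ?z e \<subseteq> ?O" by (meson open_contains_ball)
  have bT: "ball ?z e \<subseteq> T u" using e(2) by (auto simp: below_line_def)
  have s: "section_on F (ball ?z e) (\<Phi> u)" by (rule section_on_subset[OF K_facts(6)[OF u(1)] bT])
  obtain e' where e': "e' > 0" "\<And>v. v \<in> ball (\<Phi> u ?z) e' \<Longrightarrow> F v \<in> ball ?z e \<and> \<Phi> u (F v) = v"
    using section_local_inverse[OF open_ball s, of ?z] e(1) by auto
  show ?thesis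
  proof
    show "ball w e' \<subseteq> lifted"
    proof
      fix v assume "v \<in> ball w e'"
      then have "F v \<in> ball ?z e \<and> \<Phi> u (F v) = v" by (intro e'(2)) (simp add: u(3))
      then show "v \<in> lifted" unfolding lifted_def using u(1) bT by blast
    qed
  qed (rule e')
qed

text \<open>Let \<open>z\<close> be the image of a limit \<open>w\<close> of lifted points. Unless \<open>z\<close> lies below some tangent line, so that the
  section reaches \<open>w\<close>, it lies on a tangent line, at a point that is not singular. It is neither above nor below
  all singular points of that line, since otherwise the tangent lines of nearby slopes would pass
  to the right of it. So it is in a gap between singular points, and there are none.\<close>

lemma lifted_closed:
  assumes w: "w \<in> sector R0" and wn: "\<And>n. wn n \<in> lifted" "wn \<longlonglongrightarrow> w"
  shows "w \<in> lifted"
proof (rule ccontr)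
  assume nl: "w \<notin> lifted"
  have "\<forall>n. \<exists>u. u \<in> I \<and> F (wn n) \<in> T u \<and> \<Phi> u (F (wn n)) = wn n" using wn(1) unfolding lifted_def by blast
  then obtain v where v: "\<And>n. v n \<in> I" "\<And>n. F (wn n) \<in> T (v n)" "\<And>n. \<Phi> (v n) (F (wn n)) = wn n" by metis
  obtain u r where u: "u \<in> I" "strict_mono r" "(v \<circ> r) \<longlonglongrightarrow> u"
    using compact_Icc[of u1 u2] v(1) unfolding compact_def by metis
  let ?v = "\<lambda>n. v (r n)" and ?w = "\<lambda>n. wn (r n)" and ?z = "F w"
  have vl: "?v \<longlonglongrightarrow> u" using u(3) by (simp add: o_def)
  have wl: "?w \<longlonglongrightarrow> w" using LIMSEQ_subseq_LIMSEQ[OF wn(2) u(2)] by (simp add: o_def)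
  have zl: "(\<lambda>n. F (?w n)) \<longlonglongrightarrow> ?z" by (rule tendsto_F[OF wl])
  have box: "\<bar>Im (F (?w n))\<bar> \<le> \<delta>" "- a \<le> Re (F (?w n))" "tilt (?v n) (F (?w n)) < h (?v n)" for n
    using v(2)[of "r n"] by (auto simp: below_line_def)
  have b1: "\<bar>Im ?z\<bar> \<le> \<delta>" by (rule LIMSEQ_le_const2[OF tendsto_rabs[OF tendsto_Im[OF zl]]]) (use box in auto)
  have b2: "- a \<le> Re ?z" by (rule LIMSEQ_le_const[OF tendsto_Re[OF zl]]) (use box in auto)
  have \<Phi>l: "(\<lambda>n. \<Phi> (?v n) (F (?w n))) \<longlonglongrightarrow> w" using wl v(3) by simp
  have no: "h \<tau> \<le> tilt \<tau> ?z" if t: "\<tau> \<in> I" for \<tau>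
  proof (rule ccontr)
    assume "\<not> ?thesis"
    then have zT: "?z \<in> T \<tau>" using b1 b2 by (simp add: below_line_def)
    have "(\<lambda>n. \<Phi> (?v n) (F (?w n))) \<longlonglongrightarrow> \<Phi> \<tau> ?z"
      by (rule section_continuous_in_slope[OF v(1) v(2) zl t zT])
    then have "\<Phi> \<tau> ?z = w" using \<Phi>l LIMSEQ_unique by blast
    then show False using nl t zT by (auto simp: lifted_def)
  qed
  have hl: "(\<lambda>n. h (?v n)) \<longlonglongrightarrow> h u" by (rule h_tendsto[OF vl u(1)], rule always_eventually) (use v(1) in blast)
  have tl: "(\<lambda>n. tilt (?v n) (F (?w n))) \<longlonglongrightarrow> tilt u ?z" by (intro tendsto_intros vl zl)
  have "tilt u ?z \<le> h u" by (rule LIMSEQ_le[OF tl hl]) (use box(3) less_imp_le in blast)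
  then have line: "tilt u ?z = h u" using no[OF u(1)] by simp
  have nK: "?z \<notin> K u"
    using no_finite_limit_at_singular_point[OF vl u(1) v(1) v(2) zl _ \<Phi>l] by blast
  have "\<bar>tilt u w\<bar> \<le> M"
  proof (rule LIMSEQ_le_const2[of "\<lambda>n. \<bar>tilt (?v n) (?w n)\<bar>"])
    show "(\<lambda>n. \<bar>tilt (?v n) (?w n)\<bar>) \<longlonglongrightarrow> \<bar>tilt u w\<bar>" by (intro tendsto_intros vl wl)
    show "\<exists>N. \<forall>n\<ge>N. \<bar>tilt (?v n) (?w n)\<bar> \<le> M" using lifted_strip[OF v] by blast
  qed
  then have int: "u1 < u" "u < u2" using slope_near[OF u(1) _ w] by auto
  obtain k2 where k2: "k2 \<in> K u" "0 \<le> (u2 - u) * (Im ?z - Im k2)"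
    using singular_point_towards[OF u(1) _ _ line no, of u2] int by auto
  obtain k1 where k1: "k1 \<in> K u" "0 \<le> (u1 - u) * (Im ?z - Im k1)"
    using singular_point_towards[OF u(1) _ _ line no, of u1] int by auto
  have le: "Im k2 \<le> Im ?z" "Im ?z \<le> Im k1" using k1(2) k2(2) int by (auto simp: zero_le_mult_iff)
  have same: "?z = k" if "k \<in> K u" "Im ?z = Im k" for k
    using K_facts(3)[OF u(1) that(1)] line that(2) by (simp add: complex_eq_iff)
  have "Im k2 < Im ?z" "Im ?z < Im k1" using le same k1(1) k2(1) nK by (metis order_le_less)+
  then show False using no_gap[OF u(1) k2(1) k1(1) _ _ line] nK by blast
qed

text \<open>The sector is connected, and lifted points are open and closed in it.\<close>

lemma sector_lifted: "sector R0 \<subseteq> lifted"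
proof -
  let ?P = "sector R0 \<inter> lifted"
  have nb: "B0 < norm w" if "w \<in> sector R0" for w
    using that R0_bounds(1) abs_Im_le_cmod[of w] by (auto simp: sector_def)
  have "openin (top_of_set (sector R0)) ?P"
  proof (subst openin_subopen, safe)
    fix w assume w: "w \<in> sector R0" "w \<in> lifted"
    obtain e where e: "e > 0" "ball w e \<subseteq> lifted" using lifted_open[OF w(2) nb[OF w(1)]] by blast
    then show "\<exists>T. openin (top_of_set (sector R0)) T \<and> w \<in> T \<and> T \<subseteq> ?P"
      by (intro exI[of _ "sector R0 \<inter> ball w e"]) (use w in \<open>auto simp: openin_open_Int\<close>)
  qed
  moreover have "closedin (top_of_set (sector R0)) ?P"
    unfolding closedin_limpt
  proof (intro conjI allI impI)
    fix w assume w: "w islimpt ?P \<and> w \<in> sector R0"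
    then obtain f where "\<And>n. f n \<in> ?P - {w}" "f \<longlonglongrightarrow> w" unfolding islimpt_sequential by blast
    then show "w \<in> ?P" using w lifted_closed[of w f] by blast
  qed auto
  moreover have "?P \<noteq> {}"
  proof -
    obtain w where w: "w \<in> lifted" "R0 < Im w" "\<bar>tilt um w\<bar> \<le> M" using lifted_deep by blast
    have "d * R0 < d * Im w" using w(2) mid_slope_bounds(1) by simp
    then have "w \<in> sector R0" using w R0_bounds(3) by (simp add: sector_def)
    then show ?thesis using w by blast
  qed
  moreover have "connected (sector R0)" by (rule convex_connected[OF convex_sector])
  ultimately have "?P = sector R0" unfolding connected_clopen by blast
  then show ?thesis by blast
qed

lemma inj_on_sector: "inj_on F (sector R0)"
proof (rule inj_onI)
  fix w w' assume w: "w \<in> sector R0" "w' \<in> sector R0" and e: "F w = F w'"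
  obtain u where u: "u \<in> I" "F w \<in> T u" "\<Phi> u (F w) = w" using w(1) sector_lifted by (auto simp: lifted_def)
  have "\<Phi> u (F w') = w'" by (rule lifted_unique[OF _ u(1)]) (use w(2) sector_lifted u e in auto)
  then show "w = w'" using u(3) e by simp
qed

text \<open>In the sector the height \<open>Im (F w)\<close> is ordered like the direction of \<open>w\<close>: points far to one side of
  direction \<open>v\<close> have images on one side of the singular points of slope \<open>v\<close>.\<close>

lemma height_order:
  assumes w: "w \<in> sector R0" and v: "v \<in> I" "k \<in> K v"
  shows "M < tilt v w \<Longrightarrow> Im k < Im (F w)" "tilt v w < - M \<Longrightarrow> Im (F w) < Im k"
proof -
  obtain u where u: "u \<in> I" "F w \<in> T u" "\<Phi> u (F w) = w" using w sector_lifted by (auto simp: lifted_def)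
  have uM: "\<bar>tilt u w\<bar> \<le> M" by (rule lifted_strip[OF u])
  have iw: "0 < Im w" using w R0_bounds by (auto simp: sector_def)
  have *: "(v - u) * Im k < (v - u) * Im (F w)" if "M < \<bar>tilt v w\<bar>"
  proof -
    have "F w \<notin> T v"
    proof
      assume vT: "F w \<in> T v"
      have "\<Phi> v (F w) = w" by (rule lifted_unique[OF _ v(1) vT]) (use w sector_lifted in blast)
      then show False using lifted_strip[OF v(1) vT] that by simp
    qed
    then have "h v \<le> tilt v (F w)" using u(2) by (auto simp: below_line_def)
    moreover have "h u \<le> h v + (u - v) * Im k" by (rule super[OF v(1) u(1) v(2)])
    moreover have "tilt u (F w) < h u" using u(2) by (simp add: below_line_def)
    ultimately show ?thesis by (simp add: algebra_simps)
  qed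
  have dif: "tilt v w - tilt u w = (v - u) * Im w" by (simp add: algebra_simps)
  show "Im k < Im (F w)" if "M < tilt v w"
  proof -
    have "0 < (v - u) * Im w" using that uM dif by linarith
    then have "0 < v - u" using iw by (simp add: zero_less_mult_iff)
    then show ?thesis using * that by (simp add: mult_less_cancel_left)
  qed
  show "Im (F w) < Im k" if "tilt v w < - M"
  proof -
    have "(v - u) * Im w < 0" using that uM dif by linarith
    then have "v - u < 0" using iw by (simp add: mult_less_0_iff)
    then show ?thesis using * that by (simp add: mult_less_cancel_left)
  qed
qed

text \<open>Up to a line parallel to the tangent and strictly to its left, the section is continuous on a compact set,
  hence bounded.\<close>

lemma far_image_close_to_line:
  assumes h': "h' < h um"
  obtains Y where "\<And>w. w \<in> lifted \<Longrightarrow> Y < norm w \<Longrightarrow> h' < tilt um (F w)"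
proof -
  obtain C where C: "\<And>u z. u \<in> I \<Longrightarrow> z \<in> T u \<Longrightarrow> norm z \<le> C" using T_bounded by blast
  let ?A = "{z. \<bar>Im z\<bar> \<le> \<delta> \<and> - a \<le> Re z \<and> tilt um z \<le> h'}"
  have AT: "?A \<subseteq> T um" using h' by (auto simp: below_line_def)
  have "closed ?A" by (intro closed_Collect_conj closed_Collect_le continuous_intros)
  moreover have "bounded ?A" unfolding bounded_iff using C[OF mid_slope_bounds(2)] AT by blast
  ultimately have "compact ?A" by (simp add: compact_eq_bounded_closed)
  moreover have "continuous_on ?A (\<Phi> um)"
    using K_facts(6)[OF mid_slope_bounds(2)] AT by (auto simp: section_on_def intro: continuous_on_subset)
  ultimately have "bounded (\<Phi> um ` ?A)" by (intro compact_imp_bounded compact_continuous_image)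
  then obtain Y where "\<forall>v\<in>\<Phi> um ` ?A. norm v \<le> Y" unfolding bounded_iff by (rule exE)
  then have Y: "norm v \<le> Y" if "v \<in> \<Phi> um ` ?A" for v using that by (rule bspec)
  show ?thesis
  proof
    fix w assume w: "w \<in> lifted" "Y < norm w"
    show "h' < tilt um (F w)"
    proof (rule ccontr)
      assume neg: "\<not> ?thesis"
      obtain u where u: "u \<in> I" "F w \<in> T u" using w by (auto simp: lifted_def)
      have A: "F w \<in> ?A" using u(2) neg by (auto simp: below_line_def)
      then have "\<Phi> um (F w) = w" by (intro lifted_unique[OF w(1) mid_slope_bounds(2)]) (use AT in blast)
      then have "w \<in> \<Phi> um ` ?A" using A by (intro image_eqI[of w "\<Phi> um" "F w"]) simp_all
      from Y[OF this] show False using w(2) by simp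
    qed
  qed
qed

text \<open>Choose a lifted point \<open>a\<close>, and far out in the sector points \<open>b\<close> to its right and \<open>c\<close> to its left. Moving from \<open>b\<close>
  to \<open>c\<close> stays so far out that the images stay to the right of that of \<open>a\<close>. The images of the other two sides of
  the triangle are separated in height from those of \<open>c\<close> and \<open>b\<close> by singular points of suitable slopes.\<close>

lemma sector_orientation:
  obtains R where "R0 \<le> R"
    "\<And>w D \<alpha> \<beta>. w \<in> sector R \<Longrightarrow> (F has_derivative D) (at w) \<Longrightarrow> (\<And>v. D v = \<alpha> * v + \<beta> * cnj v) \<Longrightarrow> norm \<alpha> \<le> norm \<beta>"
proof -
  \<comment> \<open>Four slopes between \<open>um - d\<close> and \<open>um + d\<close>, and singular points of these, separate the heights. The corners \<open>b\<close> and \<open>c\<close> below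
    have directions \<open>um - 3 * \<rho>\<close> and \<open>um + 3 * \<rho>\<close>.\<close>
  define \<rho> where "\<rho> = d / 4"
  have \<rho>: "0 < \<rho>" "3 * \<rho> < d" using mid_slope_bounds(1) by (auto simp: \<rho>_def)
  have inI: "um + \<rho> \<in> I" "um + 2 * \<rho> \<in> I" "um - \<rho> \<in> I" "um - 2 * \<rho> \<in> I"
    using mid_slope_bounds \<rho> by auto
  define R where "R = max R0 (2 * \<bar>M\<bar> / \<rho>) + 1"
  have R: "R0 < R" "0 < R" "2 * \<bar>M\<bar> < \<rho> * R"
  proof -
    have "2 * \<bar>M\<bar> / \<rho> < R" by (simp add: R_def)
    then show "2 * \<bar>M\<bar> < \<rho> * R" using \<rho>(1) by (simp add: field_simps)
  qed (use R0_bounds(2) in \<open>auto simp: R_def\<close>)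
  have secR: "sector R \<subseteq> sector R0" using R(1) by (auto simp: sector_def)
  obtain a where a: "a \<in> lifted" "R < Im a" "F a \<in> T um" "\<bar>tilt um a\<bar> \<le> M" using lifted_deep by blast
  obtain Y0 where Y0: "\<And>w. w \<in> lifted \<Longrightarrow> Y0 < norm w \<Longrightarrow> tilt um (F a) < tilt um (F w)"
    using far_image_close_to_line[of "tilt um (F a)"] a(3) by (auto simp: below_line_def)
  define Y where "Y = max Y0 (Im a) + 1"
  have Y: "Y0 < Y" "Im a < Y" "R < Y" using a(2) by (auto simp: Y_def)
  have big: "2 * \<bar>M\<bar> < \<rho> * y" if "R < y" for y
  proof -
    have "\<rho> * R \<le> \<rho> * y" using that \<rho> by (intro mult_left_mono) auto
    then show ?thesis using R(3) by linarith
  qed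
  define b c where "b = Complex (3 * \<rho> * Y - um * Y) Y" and "c = Complex (- 3 * \<rho> * Y - um * Y) Y"
  have tb: "tilt v b = 3 * \<rho> * Y + (v - um) * Y" and tc: "tilt v c = - 3 * \<rho> * Y + (v - um) * Y" for v
    by (simp_all add: b_def c_def algebra_simps)
  have tbu: "tilt um b = 3 * \<rho> * Y" and tcu: "tilt um c = - (3 * \<rho> * Y)" using tb[of um] tc[of um] by simp_all
  have Ybc: "Im b = Y" "Im c = Y" by (simp_all add: b_def c_def)
  have Ypos: "0 < Y" using Y R by linarith
  have "3 * \<rho> * Y < d * Y" using \<rho> Ypos by simp
  moreover have p3: "0 < 3 * \<rho> * Y" using \<rho> Ypos by simp
  ultimately have bcS: "b \<in> sector R" "c \<in> sector R" using Y tb[of um] tc[of um] by (auto simp: sector_def Ybc)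
  have "\<rho> * Im a \<le> d * Im a" using \<rho> a(2) R(2) by (intro mult_right_mono) auto
  then have "2 * \<bar>M\<bar> < d * Im a" using big[OF a(2)] by linarith
  then have aS: "a \<in> sector R" using a by (simp add: sector_def)
  have cS: "closed_segment x y \<subseteq> sector R" if "x \<in> sector R" "y \<in> sector R" for x y
    by (rule closed_segment_subset[OF that convex_sector])
  have half: "convex {w. c \<le> tilt v w}" "convex {w. tilt v w \<le> c}" for v c
  proof -
    have "{w. c \<le> tilt v w} = {w. inner (Complex 1 v) w \<ge> c}" "{w. tilt v w \<le> c} = {w. inner (Complex 1 v) w \<le> c}"
      by (simp_all add: inner_complex_def)
    then show "convex {w. c \<le> tilt v w}" "convex {w. tilt v w \<le> c}" by (simp_all add: convex_halfspace_le convex_halfspace_ge)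
  qed
  obtain k1 k2 k3 k4 where k: "k1 \<in> K (um + \<rho>)" "k2 \<in> K (um + 2 * \<rho>)" "k3 \<in> K (um - \<rho>)" "k4 \<in> K (um - 2 * \<rho>)"
    using K_facts(2)[OF inI(1)] K_facts(2)[OF inI(2)] K_facts(2)[OF inI(3)] K_facts(2)[OF inI(4)] by blast
  have k12: "Im k2 < Im k1" by (rule Im_K_strictly_decreasing[OF inI(1,2) _ k(1,2)]) (use \<rho> in simp)
  have k34: "Im k3 < Im k4" by (rule Im_K_strictly_decreasing[OF inI(4,3) _ k(4,3)]) (use \<rho> in simp)
  have YM: "2 * \<bar>M\<bar> < \<rho> * Y" by (rule big[OF Y(3)])
  show ?thesis
  proof
    show "R0 \<le> R" using R by simp
    fix w D \<alpha> \<beta> assume w: "w \<in> sector R" and D: "(F has_derivative D) (at w)" "\<And>v. D v = \<alpha> * v + \<beta> * cnj v"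
    show "norm \<alpha> \<le> norm \<beta>"
    proof (rule triangle_reverses_orientation[OF convex_sector cont_F_on inj_on_subset[OF inj_on_sector secR]
          has_derivative_at_withinI[OF D(1)] w D(2) aS bcS])
      fix x assume x: "x \<in> closed_segment b c"
      have xS: "x \<in> sector R" using cS bcS x by blast
      have "x \<in> {w. inner \<i> w = Y}"
        by (rule subsetD[OF closed_segment_subset[OF _ _ convex_hyperplane] x]) (simp_all add: inner_complex_def Ybc)
      then have ix: "Im x = Y" by (simp add: inner_complex_def)
      have "Y0 < norm x" using ix Y abs_Im_le_cmod[of x] by linarith
      then show "Im a < Im x \<and> tilt um (F a) < tilt um (F x)"
        using Y0[of x] xS secR sector_lifted ix Y by auto
    next
      fix x assume x: "x \<in> closed_segment a b"
      have xS: "x \<in> sector R" using cS aS bcS x by blast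
      have "closed_segment a b \<subseteq> {w. - \<bar>M\<bar> \<le> tilt um w}"
        by (rule closed_segment_subset[OF _ _ half(1)]; unfold mem_Collect_eq tbu) (use a(4) p3 in linarith)+
      then have tx: "- \<bar>M\<bar> \<le> tilt um x" using x by blast
      have "2 * \<bar>M\<bar> < \<rho> * Im x" by (rule big) (use xS in \<open>simp add: sector_def\<close>)
      then have "M < tilt (um + \<rho>) x" using tx by (simp add: algebra_simps) 
      then have "Im k1 < Im (F x)" by (intro height_order(1)[OF _ inI(1) k(1)]) (use xS secR in auto)
      moreover have "tilt (um + 2 * \<rho>) c < - M" unfolding tc using YM by (simp add: algebra_simps)
      then have "Im (F c) < Im k2" by (intro height_order(2)[OF _ inI(2) k(2)]) (use bcS secR in auto)
      ultimately have "Im (F c) < Im (F x)" using k12 by linarith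
      moreover have "tilt um c < tilt um x" unfolding tc using YM tx by (simp add: algebra_simps)
      ultimately show "tilt um c < tilt um x \<and> Im (F c) < Im (F x)" by blast
    next
      fix x assume x: "x \<in> closed_segment c a"
      have xS: "x \<in> sector R" using cS aS bcS x by blast
      have "closed_segment c a \<subseteq> {w. tilt um w \<le> \<bar>M\<bar>}"
        by (rule closed_segment_subset[OF _ _ half(2)]; unfold mem_Collect_eq tcu) (use a(4) p3 in linarith)+
      then have tx: "tilt um x \<le> \<bar>M\<bar>" using x by blast
      have "2 * \<bar>M\<bar> < \<rho> * Im x" by (rule big) (use xS in \<open>simp add: sector_def\<close>)
      then have "tilt (um - \<rho>) x < - M" using tx by (simp add: algebra_simps)
      then have "Im (F x) < Im k3" by (intro height_order(2)[OF _ inI(3) k(3)]) (use xS secR in auto)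
      moreover have "M < tilt (um - 2 * \<rho>) b" unfolding tb using YM by (simp add: algebra_simps)
      then have "Im k4 < Im (F b)" by (intro height_order(1)[OF _ inI(4) k(4)]) (use bcS secR in auto)
      ultimately have "Im (F x) < Im (F b)" using k34 by linarith
      moreover have "tilt um x < tilt um b" unfolding tb using YM tx by (simp add: algebra_simps)
      ultimately show "tilt um x < tilt um b \<and> Im (F x) < Im (F b)" by blast
    qed
  qed
qed

text \<open>Boxes in the sector have arbitrarily large area, and their injective images stay in a disc of radius
  \<open>C\<close>.\<close>

lemma eigenvalue_bound_contradiction:
  assumes diff: "\<And>w. s < norm w \<Longrightarrow> F differentiable (at w)" and \<epsilon>: "0 < \<epsilon>"
    and C: "\<And>u z. u \<in> I \<Longrightarrow> z \<in> T u \<Longrightarrow> norm z \<le> C"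
    and e: "\<And>w D c. R < \<bar>Im w\<bar> \<Longrightarrow> u1 < - Re w / Im w \<Longrightarrow> - Re w / Im w < u2 \<Longrightarrow> norm (F w) \<le> C \<Longrightarrow>
       (F has_derivative D) (at w) \<Longrightarrow> real_eigenvalue D c \<Longrightarrow> \<epsilon> \<le> \<bar>c\<bar>"
  shows False
proof -
  obtain R1 where R1: "R0 \<le> R1"
    "\<And>w D \<alpha> \<beta>. w \<in> sector R1 \<Longrightarrow> (F has_derivative D) (at w) \<Longrightarrow> (\<And>v. D v = \<alpha> * v + \<beta> * cnj v) \<Longrightarrow> norm \<alpha> \<le> norm \<beta>"
    using sector_orientation by metis
  define X where "X = max (max R1 R) (max s 0) + 1"
  have X: "R1 < X" "R < X" "s < X" "0 < X" by (auto simp: X_def)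
  have FC: "norm (F w) \<le> C" if "w \<in> sector R0" for w
    using that sector_lifted C by (auto simp: lifted_def)
  have jac: "\<exists>\<alpha> \<beta>. (F has_derivative (\<lambda>v. \<alpha> * v + \<beta> * cnj v)) (at w) \<and> \<epsilon>\<^sup>2 \<le> \<bar>(norm \<alpha>)\<^sup>2 - (norm \<beta>)\<^sup>2\<bar>"
    if w: "w \<in> sector R1" "X \<le> Im w" for w
  proof -
    have iw: "0 < Im w" using w X by linarith
    have "s < norm w" using w(2) X abs_Im_le_cmod[of w] by linarith
    then obtain D where D: "(F has_derivative D) (at w)" using diff unfolding differentiable_def by blast
    then obtain \<alpha> \<beta> where ab: "\<And>v. D v = \<alpha> * v + \<beta> * cnj v" using real_linear_complex has_derivative_linear by metis
    then have De: "D = (\<lambda>v. \<alpha> * v + \<beta> * cnj v)" by blast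
    have le: "norm \<alpha> \<le> norm \<beta>" by (rule R1(2)[OF w(1) D ab])
    have t: "\<bar>tilt um w\<bar> < d * Im w" using w by (simp add: sector_def)
    have p: "u1 * Im w = um * Im w - 2 * (d * Im w)" using arg_cong[OF mid_slope_bounds(5), of "\<lambda>x. x * Im w"] by (simp add: algebra_simps)
    have q: "u2 * Im w = um * Im w + 2 * (d * Im w)" using arg_cong[OF mid_slope_bounds(6), of "\<lambda>x. x * Im w"] by (simp add: algebra_simps)
    have "0 < d * Im w" using mid_slope_bounds(1) iw by simp
    then have "u1 * Im w < - Re w" "- Re w < u2 * Im w" using p q t by linarith+
    then have sl: "u1 < - Re w / Im w" "- Re w / Im w < u2" using iw by (simp_all only: pos_less_divide_eq pos_divide_less_eq)
    have w0: "w \<in> sector R0" using w R1(1) by (auto simp: sector_def)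
    have "\<epsilon> \<le> \<bar>c\<bar>" if "real_eigenvalue D c" for c
      by (rule e[OF _ sl FC[OF w0] D that]) (use w X in linarith)
    then have "\<epsilon>\<^sup>2 \<le> \<bar>(norm \<alpha>)\<^sup>2 - (norm \<beta>)\<^sup>2\<bar>"
      by (intro determinant_bound_from_eigenvalues[OF le]) (use \<epsilon> De in auto)
    then show ?thesis using D De by blast
  qed
  define \<mu> where "\<mu> = d / (2 * (\<bar>um\<bar> + 1))"
  have \<mu>: "0 < \<mu>" "\<bar>um\<bar> * \<mu> \<le> d / 2" using mid_slope_bounds(1) by (auto simp: \<mu>_def field_simps)
  \<comment> \<open>a large box in the sector\<close>
  have area: "\<epsilon>\<^sup>2 * (d * Y / 2 * (\<mu> * Y)) \<le> 4 * C\<^sup>2" if Y: "X \<le> Y" for Y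
  proof -
    define x1 where "x1 = - um * Y - d * Y / 4"
    define x2 where "x2 = - um * Y + d * Y / 4"
    define Q where "Q = {w. x1 \<le> Re w \<and> Re w \<le> x2 \<and> Y \<le> Im w \<and> Im w \<le> Y + \<mu> * Y}"
    have Yp: "0 < Y" "0 < d * Y" "0 < \<mu> * Y" using Y X mid_slope_bounds(1) \<mu> by auto
    have Qs: "w \<in> sector R1 \<and> X \<le> Im w" if w: "w \<in> Q" for w
    proof -
      have 1: "\<bar>um * (Im w - Y)\<bar> \<le> \<bar>um\<bar> * (\<mu> * Y)" unfolding abs_mult using w by (intro mult_left_mono) (auto simp: Q_def)
      have "\<bar>um\<bar> * (\<mu> * Y) = (\<bar>um\<bar> * \<mu>) * Y" by simp
      also have "\<dots> \<le> (d / 2) * Y" using \<mu>(2) Yp by (intro mult_right_mono) auto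
      finally have 2: "\<bar>um * (Im w - Y)\<bar> \<le> d * Y / 2" using 1 by simp
      have 3: "\<bar>Re w + um * Y\<bar> \<le> d * Y / 4"
      using w unfolding Q_def x1_def x2_def mem_Collect_eq minus_mult_left[symmetric] by linarith
      have "tilt um w = (Re w + um * Y) + um * (Im w - Y)" by (simp add: algebra_simps)
      then have "\<bar>tilt um w\<bar> \<le> d * Y / 4 + d * Y / 2" using 2 3 by linarith
      moreover have "d * Y \<le> d * Im w" using w mid_slope_bounds(1) by (intro mult_left_mono) (auto simp: Q_def)
      ultimately have "\<bar>tilt um w\<bar> < d * Im w" using Yp by linarith
      then show ?thesis using w X Y by (auto simp: sector_def Q_def)
    qed
    have s0: "Q \<subseteq> sector R0" using Qs R1(1) by (fastforce simp: sector_def)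
    have "\<epsilon>\<^sup>2 * ((x2 - x1) * ((Y + \<mu> * Y) - Y)) \<le> 4 * C\<^sup>2"
    proof (rule jacobian_area_bound[OF Q_def])
      show "x1 \<le> x2" "Y \<le> Y + \<mu> * Y" using Yp by (auto simp: x1_def x2_def)
      show "inj_on F Q" by (rule inj_on_subset[OF inj_on_sector s0])
    qed (use FC s0 Qs jac in blast)+
    moreover have "x2 - x1 = d * Y / 2" by (simp add: x1_def x2_def)
    ultimately show ?thesis by simp
  qed
  define c where "c = \<epsilon>\<^sup>2 * (d / 2 * \<mu>)"
  have c: "0 < c" using \<epsilon> mid_slope_bounds(1) \<mu> by (simp add: c_def)
  define Y where "Y = max (max X 1) (4 * C\<^sup>2 / c + 1)"
  have Y: "X \<le> Y" "1 \<le> Y" "4 * C\<^sup>2 / c < Y" by (auto simp: Y_def)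
  have "c * (Y * Y) \<le> 4 * C\<^sup>2" using area[OF Y(1)] by (simp add: c_def algebra_simps)
  moreover have "4 * C\<^sup>2 < c * Y" using Y(3) c by (simp add: field_simps)
  moreover have "c * Y * 1 \<le> c * Y * Y" using Y c by (intro mult_left_mono) auto
  ultimately show False by (simp add: mult.assoc)
qed

end

section \<open>Rotations and reflections of the setting\<close>

text \<open>Conjugation by the rotation \<open>m\<close>, followed by a translation of the target, makes the edge vertical and moves it to
  any chosen place.\<close>

lemma half_reeb_rotate:
  assumes hr: "half_reeb F m \<Delta> h K \<Phi>" and m: "norm m = 1"
  shows "half_reeb (\<lambda>w. m * F (w / m) - c0) 1 ((\<lambda>z. m * z - c0) ` \<Delta>) (h - Re c0) ((\<lambda>z. m * z - c0) ` K) (\<lambda>z. m * \<Phi> ((z + c0) / m))"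
proof -
  have m0: "m \<noteq> 0" using m by auto
  let ?f = "\<lambda>z. m * z - c0" and ?g = "\<lambda>z. (z + c0) / m"
  have gf: "?g (?f z) = z" and fg: "?f (?g z) = z" for z using m0 by (simp_all add: field_simps)
  have d: "compact \<Delta>" "convex \<Delta>" "\<And>z. z \<in> \<Delta> \<Longrightarrow> Re (m * z) \<le> h" "compact K" "K \<noteq> {}"
      "\<And>k. k \<in> K \<Longrightarrow> Re (m * k) = h \<and> (\<exists>\<rho>>0. ball k \<rho> \<inter> {z. Re (m * z) \<le> h} \<subseteq> \<Delta>)"
      "section_on F (\<Delta> - K) \<Phi>" "\<And>k. k \<in> K \<Longrightarrow> filterlim \<Phi> at_infinity (at k within \<Delta> - K)"
    using hr unfolding half_reeb_def by blast+
  have cf: "continuous_on S ?f" for S by (intro continuous_intros)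
  have cg: "continuous_on S ?g" for S by (intro continuous_intros) (use m0 in auto)
  have fdiff: "?f ` \<Delta> - ?f ` K = ?f ` (\<Delta> - K)" using m0 by (intro image_set_diff[symmetric] injI) simp
  have gmem: "?g z \<in> \<Delta> - K" if z: "z \<in> ?f ` \<Delta> - ?f ` K" for z
  proof -
    obtain y where "y \<in> \<Delta> - K" "z = ?f y" using z unfolding fdiff by blast
    then show ?thesis using gf by simp
  qed
  show ?thesis unfolding half_reeb_def
  proof (intro conjI ballI)
    show "convex (?f ` \<Delta>)"
    proof (rule convexI)
      fix x y u v assume "x \<in> ?f ` \<Delta>" "y \<in> ?f ` \<Delta>" and uv: "0 \<le> u" "0 \<le> v" "u + v = (1::real)"
      then obtain x' y' where e: "x' \<in> \<Delta>" "y' \<in> \<Delta>" "x = ?f x'" "y = ?f y'" by blast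
      have "of_real u + of_real v = (1::complex)" using uv(3) by (metis of_real_1 of_real_add)
      then have "c0 = (of_real u + of_real v) * c0" by simp
      then have "u *\<^sub>R x + v *\<^sub>R y = ?f (u *\<^sub>R x' + v *\<^sub>R y')" unfolding e by (simp add: scaleR_conv_of_real algebra_simps)
      then show "u *\<^sub>R x + v *\<^sub>R y \<in> ?f ` \<Delta>" using convexD[OF d(2) e(1,2) uv] by (intro image_eqI) 
    qed
    show "compact (?f ` \<Delta>)" "compact (?f ` K)" by (intro compact_continuous_image cf d)+
    fix z assume "z \<in> ?f ` \<Delta>"
    then obtain y where "y \<in> \<Delta>" "z = ?f y" by blast
    then show "Re (1 * z) \<le> h - Re c0" using d(3)[of y] by simp
  next
    fix k assume "k \<in> ?f ` K"
    then obtain k' where k: "k' \<in> K" "k = ?f k'" by blast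
    show "Re (1 * k) = h - Re c0" using d(6)[OF k(1)] k(2) by simp
    obtain \<rho> where r: "\<rho> > 0" "ball k' \<rho> \<inter> {z. Re (m * z) \<le> h} \<subseteq> \<Delta>" using d(6)[OF k(1)] by blast
    have "z \<in> ?f ` \<Delta>" if z: "z \<in> ball k \<rho>" "Re z \<le> h - Re c0" for z
    proof -
      have "k' - ?g z = (k - z) / m" using k(2) m0 by (simp add: field_simps)
      then have "dist k' (?g z) < \<rho>" using z(1) m by (simp add: dist_norm norm_divide)
      moreover have "Re (m * ?g z) \<le> h" using z(2) m0 by simp
      ultimately have "?g z \<in> ball k' \<rho> \<inter> {z. Re (m * z) \<le> h}" unfolding Int_iff mem_Collect_eq mem_ball by (rule conjI)
      then have "?g z \<in> \<Delta>" by (rule subsetD[OF r(2)])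
      then show ?thesis using fg[of z] by (intro image_eqI[of z ?f "?g z"]) auto
    qed
    then show "\<exists>\<rho>>0. ball k \<rho> \<inter> {z. Re (1 * z) \<le> h - Re c0} \<subseteq> ?f ` \<Delta>" using r(1) by (intro exI[of _ \<rho>]) auto
    have lim: "filterlim \<Phi> at_infinity (at k' within \<Delta> - K)" by (rule d(8)[OF k(1)])
    have "filterlim ?g (at k' within \<Delta> - K) (at k within ?f ` \<Delta> - ?f ` K)"
      unfolding filterlim_at
    proof
      have "(?g \<longlongrightarrow> ?g k) (at k within ?f ` \<Delta> - ?f ` K)" by (intro tendsto_intros) (use m0 in auto)
      then show "(?g \<longlongrightarrow> k') (at k within ?f ` \<Delta> - ?f ` K)" using gf k(2) by simp
      have "eventually (\<lambda>z. z \<in> ?f ` \<Delta> - ?f ` K \<and> z \<noteq> k) (at k within ?f ` \<Delta> - ?f ` K)"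
        by (auto simp: eventually_at_filter)
      then show "eventually (\<lambda>z. ?g z \<in> \<Delta> - K \<and> ?g z \<noteq> k') (at k within ?f ` \<Delta> - ?f ` K)"
      proof eventually_elim
        case (elim z)
        then have "?g z \<in> \<Delta> - K" using gmem by blast
        then show ?case using k(1) by auto
      qed
    qed
    from filterlim_compose[OF lim this]
    show "filterlim (\<lambda>z. m * \<Phi> (?g z)) at_infinity (at k within ?f ` \<Delta> - ?f ` K)"
      unfolding filterlim_at_infinity_iff_norm by (simp add: norm_mult m)
  next
    show "section_on (\<lambda>w. m * F (w / m) - c0) (?f ` \<Delta> - ?f ` K) (\<lambda>z. m * \<Phi> (?g z))"
      unfolding section_on_def
    proof
      have "continuous_on (\<Delta> - K) \<Phi>" using d(7) by (simp add: section_on_def)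
      then show "continuous_on (?f ` \<Delta> - ?f ` K) (\<lambda>z. m * \<Phi> (?g z))"
        by (intro continuous_on_mult continuous_on_const continuous_on_compose2[OF _ cg]) (use gmem in auto)
      show "\<forall>z\<in>?f ` \<Delta> - ?f ` K. m * F (m * \<Phi> (?g z) / m) - c0 = z"
      proof
        fix z assume z: "z \<in> ?f ` \<Delta> - ?f ` K"
        have "F (\<Phi> (?g z)) = ?g z" by (rule section_onD[OF d(7) gmem[OF z]])
        moreover have "m * \<Phi> (?g z) / m = \<Phi> (?g z)" using m0 by simp
        ultimately show "m * F (m * \<Phi> (?g z) / m) - c0 = z" using fg by simp
      qed
    qed
  qed (use d in auto)
qed

context W_homeo begin

lemma W_homeo_rotate:
  assumes m: "norm m = 1" shows "W_homeo (\<lambda>w. m * F (w / m) - c0) s P"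
proof
  have m0: "m \<noteq> 0" using m by auto
  let ?F = "\<lambda>w. m * F (w / m) - c0"
  show "continuous_on UNIV ?F"
    by (intro continuous_intros continuous_on_compose2[OF cont_F]) (use m0 in auto)
  show "\<exists>e>0. inj_on ?F (ball w e)" for w
  proof -
    obtain e where e: "e > 0" "inj_on F (ball (w / m) e)" using locally_inj by blast
    have b: "x / m \<in> ball (w / m) e" if "x \<in> ball w e" for x
      using that m by (simp add: dist_norm diff_divide_distrib[symmetric] norm_divide)
    have "inj_on ?F (ball w e)"
    proof (rule inj_onI)
      fix x y assume x: "x \<in> ball w e" and y: "y \<in> ball w e" and "?F x = ?F y"
      then have "F (x / m) = F (y / m)" using m0 by simp
      then have "x / m = y / m" by (rule inj_onD[OF e(2) _ b[OF x] b[OF y]])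
      then show "x = y" using m0 by simp
    qed
    then show ?thesis using e(1) by blast
  qed
  show "?F differentiable at w" if "s < norm w" for w
  proof -
    have "F differentiable at (w / m)" using diff_F[of "w / m"] that m by (simp add: norm_divide)
    then obtain D where D: "(F has_derivative D) (at (w / m))" unfolding differentiable_def by blast
    have "((\<lambda>w. w / m) has_derivative (\<lambda>h. h / m)) (at w)" by (auto intro!: derivative_eq_intros simp: m0)
    from has_derivative_compose[OF this D] have "((\<lambda>w. F (w / m)) has_derivative (\<lambda>h. D (h / m))) (at w)" .
    then have "(?F has_derivative (\<lambda>h. m * D (h / m) - 0)) (at w)" by (intro derivative_intros)
    then show ?thesis unfolding differentiable_def by blast
  qed
  show "P \<in> growth_functions" by (rule growth_P)
  show "complex_W s P ?F" unfolding complex_W_def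
  proof (intro allI impI notI)
    fix m1 :: complex assume m1: "norm m1 = 1"
    assume "\<exists>w c T. (\<forall>k. s < norm (w k)) \<and> filterlim (\<lambda>k. Re (m1 * w k)) at_top sequentially \<and>
          (\<lambda>k. ?F (w k)) \<longlonglongrightarrow> T \<and> (\<forall>k. \<exists>D. (?F has_derivative D) (at (w k)) \<and> real_eigenvalue D (c k)) \<and>
          (\<lambda>k. c k * P (Re (m1 * w k))) \<longlonglongrightarrow> 0"
    then obtain w c T where w: "\<And>k. s < norm (w k)" "filterlim (\<lambda>k. Re (m1 * w k)) at_top sequentially"
        "(\<lambda>k. ?F (w k)) \<longlonglongrightarrow> T" "\<And>k. \<exists>D. (?F has_derivative D) (at (w k)) \<and> real_eigenvalue D (c k)"
        "(\<lambda>k. c k * P (Re (m1 * w k))) \<longlonglongrightarrow> 0" by blast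
    have e: "m1 * m * (w k / m) = m1 * w k" for k using m0 by simp
    show False
    proof (rule W_contradiction[of "m1 * m" "\<lambda>k. w k / m" "(T + c0) / m" c])
      show "norm (m1 * m) = 1" using m m1 by (simp add: norm_mult)
      show "s < norm (w k / m)" for k using w(1) m by (simp add: norm_divide)
      show "filterlim (\<lambda>k. Re (m1 * m * (w k / m))) at_top sequentially" unfolding e by (rule w(2))
      show "(\<lambda>k. c k * P (Re (m1 * m * (w k / m)))) \<longlonglongrightarrow> 0" unfolding e by (rule w(5))
      have "(\<lambda>k. (?F (w k) + c0) / m) \<longlonglongrightarrow> (T + c0) / m" by (intro tendsto_intros w(3) m0)
      then show "(\<lambda>k. F (w k / m)) \<longlonglongrightarrow> (T + c0) / m" using m0 by simp
      show "\<exists>D. (F has_derivative D) (at (w k / m)) \<and> real_eigenvalue D (c k)" for k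
      proof -
        obtain D where D: "(?F has_derivative D) (at (w k))" "real_eigenvalue D (c k)" using w(4) by blast
        have "((\<lambda>v. m * v) has_derivative (\<lambda>h. m * h)) (at (w k / m))" by (auto intro!: derivative_eq_intros)
        moreover have "(?F has_derivative D) (at (m * (w k / m)))" using D(1) m0 by simp
        ultimately have "((\<lambda>v. ?F (m * v)) has_derivative (\<lambda>h. D (m * h))) (at (w k / m))" by (rule has_derivative_compose)
        then have "((\<lambda>v. (?F (m * v) + c0) * inverse m) has_derivative (\<lambda>h. (D (m * h) + 0) * inverse m)) (at (w k / m))"
          by (intro has_derivative_mult_left has_derivative_add has_derivative_const)
        then have "((\<lambda>v. (?F (m * v) + c0) / m) has_derivative (\<lambda>h. (D (m * h) + 0) / m)) (at (w k / m))"
          by (simp only: divide_inverse)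
        moreover have "(\<lambda>v. (?F (m * v) + c0) / m) = F" using m0 by simp
        ultimately have F: "(F has_derivative (\<lambda>h. D (m * h) / m)) (at (w k / m))" by simp
        obtain v where v: "v \<noteq> 0" "D v = c k *\<^sub>R v" using D(2) by (auto simp: real_eigenvalue_def)
        have "real_eigenvalue (\<lambda>h. D (m * h) / m) (c k)" unfolding real_eigenvalue_def
          by (rule exI[of _ "v / m"]) (use v m0 in \<open>simp add: scaleR_conv_of_real\<close>)
        then show ?thesis using F by blast
      qed
    qed
  qed
qed

text \<open>A rotation reduces a tilted edge to a vertical one. It preserves the end through which the section
  escapes, because the section is bounded across its strip.\<close>

lemma tilted_no_gap:
  assumes hr: "half_reeb F (Complex 1 (-u)) \<Delta> h K \<Phi>" and k: "k1 \<in> K" "k2 \<in> K"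
    and sg: "\<sigma> = 1 \<or> \<sigma> = -1"
    and up: "\<And>k. k \<in> K \<Longrightarrow> filterlim (\<lambda>z. \<sigma> * Im (\<Phi> z)) at_top (at k within \<Delta> - K)"
    and z: "Im k1 < Im z" "Im z < Im k2" "tilt u z = h"
  shows "z \<in> K"
proof -
  define r where "r = inverse (norm (Complex 1 (-u)))"
  define m where "m = of_real r * Complex 1 (-u)"
  have ne: "Complex 1 (-u) \<noteq> 0" by (simp add: complex_eq_iff)
  have r: "0 < r" using ne by (simp add: r_def)
  have m1: "norm m = 1" using ne by (simp add: m_def r_def norm_mult norm_inverse)
  then have m0: "m \<noteq> 0" by auto
  have Im_m: "Im (m * w) = r * ((1 + u\<^sup>2) * Im w - u * tilt u w)" and Re_m: "Re (m * w) = r * tilt u w" for w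
    by (simp_all add: m_def power2_eq_square algebra_simps)
  have hrm: "half_reeb F m \<Delta> (r * h) K \<Phi>" unfolding m_def by (rule half_reeb_scale[OF hr r])
  let ?F = "\<lambda>w. m * F (w / m) - 0" and ?\<Phi> = "\<lambda>z. m * \<Phi> ((z + 0) / m)"
  interpret R: W_homeo ?F s P by (rule W_homeo_rotate[OF m1])
  let ?f = "\<lambda>z. m * z - 0"
  note hr' = half_reeb_rotate[OF hrm m1, of 0]
  have line: "tilt u k = h" if "k \<in> K" for k
  proof -
    have "Re (Complex 1 (-u) * k) = h" using hr that unfolding half_reeb_def by blast
    then show ?thesis by simp
  qed
  have u2: "0 < 1 + u\<^sup>2" by (simp add: add_pos_nonneg)
  have mono: "Im (?f x) < Im (?f y)" if "tilt u x = h" "tilt u y = h" "Im x < Im y" for x y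
  proof -
    have "(1 + u\<^sup>2) * Im x < (1 + u\<^sup>2) * Im y" using that(3) u2 by (rule mult_strict_left_mono)
    then show ?thesis unfolding diff_0_right Im_m that(1,2) using r by simp
  qed
  obtain M where M: "\<And>z. z \<in> \<Delta> - K \<Longrightarrow> \<bar>Re (Complex 1 (-u) * \<Phi> z)\<bar> \<le> M" using half_reeb_bounded[OF hr] by blast
  have inj: "inj ?f" using m0 by (simp add: inj_def)
  have "?f z \<in> ?f ` K"
  proof (rule R.singular_set_no_gap[OF hr' _ _ _ sg])
    show "?f k1 \<in> ?f ` K" "?f k2 \<in> ?f ` K" using k by blast+
    show "Im (?f k1) < Im (?f k2)" "Im (?f k1) < Im (?f z)" "Im (?f z) < Im (?f k2)"
      using mono line k z by auto
    show "Re (?f z) = r * h - Re 0" using z(3) by (simp only: diff_0_right Re_m zero_complex.sel)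
    fix k' assume "k' \<in> ?f ` K"
    then obtain k where kk: "k \<in> K" "k' = m * k" by auto
    have fdiff: "?f ` \<Delta> - ?f ` K = ?f ` (\<Delta> - K)" by (rule image_set_diff[OF inj, symmetric])
    have lim: "filterlim (\<lambda>z. z / m) (at k within \<Delta> - K) (at k' within ?f ` \<Delta> - ?f ` K)"
      unfolding filterlim_at
    proof
      have "((\<lambda>z. z / m) \<longlongrightarrow> k' / m) (at k' within ?f ` \<Delta> - ?f ` K)" by (intro tendsto_intros m0)
      then show "((\<lambda>z. z / m) \<longlongrightarrow> k) (at k' within ?f ` \<Delta> - ?f ` K)" using kk m0 by simp
      have "eventually (\<lambda>z. z \<in> ?f ` (\<Delta> - K)) (at k' within ?f ` \<Delta> - ?f ` K)"
        unfolding fdiff by (auto simp: eventually_at_filter)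
      then show "eventually (\<lambda>z. z / m \<in> \<Delta> - K \<and> z / m \<noteq> k) (at k' within ?f ` \<Delta> - ?f ` K)"
        by eventually_elim (use kk(1) m0 in auto)
    qed
    have "filterlim (\<lambda>z. \<sigma> * Im (m * \<Phi> z)) at_top (at k within \<Delta> - K)"
      unfolding filterlim_at_top
    proof
      fix Z
      define N where "N = (Z / r + \<bar>u\<bar> * M) / (1 + u\<^sup>2)"
      have ev: "eventually (\<lambda>z. N \<le> \<sigma> * Im (\<Phi> z)) (at k within \<Delta> - K)" using up[OF kk(1)] unfolding filterlim_at_top by blast
      have ev2: "eventually (\<lambda>z. z \<in> \<Delta> - K) (at k within \<Delta> - K)" by (auto simp: eventually_at_filter)
      show "eventually (\<lambda>z. Z \<le> \<sigma> * Im (m * \<Phi> z)) (at k within \<Delta> - K)" using ev ev2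
      proof eventually_elim
        case (elim z)
        have "\<bar>tilt u (\<Phi> z)\<bar> \<le> M" using M[OF elim(2)] by simp
        then have "\<bar>u * tilt u (\<Phi> z)\<bar> \<le> \<bar>u\<bar> * M" unfolding abs_mult by (rule mult_left_mono) simp
        then have b: "- (\<bar>u\<bar> * M) \<le> - (\<sigma> * (u * tilt u (\<Phi> z)))" using sg by auto
        have "Z / r + \<bar>u\<bar> * M = (1 + u\<^sup>2) * N" using u2 by (simp add: N_def)
        also have "\<dots> \<le> (1 + u\<^sup>2) * (\<sigma> * Im (\<Phi> z))" using elim(1) u2 by (intro mult_left_mono) auto
        finally have "Z / r \<le> \<sigma> * ((1 + u\<^sup>2) * Im (\<Phi> z) - u * tilt u (\<Phi> z))" using b by (simp only: right_diff_distrib mult.left_commute)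
        then have "Z \<le> r * (\<sigma> * ((1 + u\<^sup>2) * Im (\<Phi> z) - u * tilt u (\<Phi> z)))" using r by (simp add: pos_divide_le_eq mult.commute)
        then show ?case unfolding Im_m by (simp only: mult.left_commute)
      qed
    qed
    from filterlim_compose[OF this lim]
    show "filterlim (\<lambda>z. \<sigma> * Im (?\<Phi> z)) at_top (at k' within ?f ` \<Delta> - ?f ` K)" by simp
  qed
  then show ?thesis using inj by (auto simp: inj_def)
qed

end

text \<open>Reflecting the source in the origin exchanges the two ends of every strip.\<close>

lemma local_homeo_flip: assumes "local_homeo F" shows "local_homeo (\<lambda>w. F (- w))"
proof
  interpret local_homeo F by (rule assms)
  show "continuous_on UNIV (\<lambda>w. F (- w))" by (intro continuous_on_compose2[OF cont_F] continuous_intros) auto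
  show "\<exists>e>0. inj_on (\<lambda>w. F (- w)) (ball w e)" for w
  proof -
    obtain e where e: "e > 0" "inj_on F (ball (- w) e)" using locally_inj by blast
    have b: "- x \<in> ball (- w) e" if "x \<in> ball w e" for x using that by (simp add: dist_norm norm_minus_commute)
    have "inj_on (\<lambda>w. F (- w)) (ball w e)"
      by (rule inj_onI) (metis b e(2) inj_onD neg_equal_iff_equal)
    then show ?thesis using e(1) by blast
  qed
qed

lemma section_on_flip: "section_on F S \<Phi> \<Longrightarrow> section_on (\<lambda>w. F (- w)) S (\<lambda>z. - \<Phi> z)"
  unfolding section_on_def by (auto intro: continuous_on_minus)

lemma half_reeb_flip: "half_reeb F m \<Delta> h K \<Phi> \<Longrightarrow> half_reeb (\<lambda>w. F (- w)) m \<Delta> h K (\<lambda>z. - \<Phi> z)"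
  unfolding half_reeb_def filterlim_at_infinity_iff_norm norm_minus_cancel using section_on_flip by blast

lemma (in tangent_lines_strip) tangent_lines_strip_flip:
  "tangent_lines_strip (\<lambda>w. F (- w)) a \<delta> \<eta> B0 u1 u2 h K (\<lambda>u z. - \<Phi> u z) \<Delta> M"
proof -
  interpret flip: local_homeo "\<lambda>w. F (- w)" by (rule local_homeo_flip) unfold_locales
  have neg: "\<bar>tilt u (- w)\<bar> = \<bar>tilt u w\<bar>" for u w
  proof -
    have "tilt u (- w) = - tilt u w" by simp
    then show ?thesis by (simp only: abs_minus_cancel)
  qed
  show ?thesis
  proof
    show "half_reeb (\<lambda>w. F (- w)) (Complex 1 (- u)) (\<Delta> u) (h u) (K u) (\<lambda>z. - \<Phi> u z)" if "u \<in> I" for u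
      by (rule half_reeb_flip[OF hr[OF that]])
    show "- \<Phi> u z = - \<Phi> u' z" if "u \<in> I" "u' \<in> I" "z \<in> T u" "z \<in> T u'" for u u' z using agree[OF that] by simp
    show "norm (- \<Phi> u z) \<le> B0" if "u \<in> I" "z \<in> T u" "\<delta> - \<eta> \<le> \<bar>Im z\<bar> \<or> Re z \<le> - a / 2" for u z
      using edge[OF that] by simp
    show "\<exists>M. \<forall>z\<in>\<Delta> u - K u. \<bar>tilt u (- \<Phi> u z)\<bar> \<le> M" if "u \<in> I" for u unfolding neg by (rule strip_ex[OF that])
    show "\<bar>tilt u (- \<Phi> u z)\<bar> \<le> M" if "u \<in> I" "z \<in> T u" for u z unfolding neg by (rule strip[OF that])
  qed (fact pos T_sub h_low K_box line_sub super)+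
qed

section \<open>There are no half-Reeb regions\<close>

context W_homeo begin

text \<open>The interval of slopes is shrunk three times: to make the strips uniform, to make all sections escape
  through the same end, and to bound the eigenvalues away from zero. If that end is the lower one, a reflection of
  the source makes it the upper one.\<close>

lemma no_vertical_half_reeb:
  assumes a: "0 < a" "0 < \<delta>"
    and K0: "closed K0" "K0 \<noteq> {}" "K0 \<subseteq> box_at {0} {-\<delta><..<\<delta>}" and s: "section_on F (box_at {-a..0} {-\<delta>..\<delta>} - K0) \<Phi>0"
    and lim0: "\<And>k. k \<in> K0 \<Longrightarrow> filterlim \<Phi>0 at_infinity (at k within box_at {-a..0} {-\<delta>..\<delta>} - K0)"
  shows False
proof (rule tangent_family[OF a K0 s lim0])
  fix a' u0 \<eta> B0 :: real and h :: "real \<Rightarrow> real" and K \<Delta> :: "real \<Rightarrow> complex set" and \<Phi> :: "real \<Rightarrow> complex \<Rightarrow> complex"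
  assume f: "0 < a'" "0 < u0" "u0 * \<delta> \<le> a' / 4" "0 < \<eta>"
    "\<And>u. \<bar>u\<bar> \<le> u0 \<Longrightarrow> half_reeb F (Complex 1 (-u)) (\<Delta> u) (h u) (K u) (\<Phi> u)"
    "\<And>u. \<bar>u\<bar> \<le> u0 \<Longrightarrow> below_line a' \<delta> h u \<subseteq> \<Delta> u - K u"
    "\<And>u. \<bar>u\<bar> \<le> u0 \<Longrightarrow> - a' / 4 \<le> h u"
    "\<And>u k. \<bar>u\<bar> \<le> u0 \<Longrightarrow> k \<in> K u \<Longrightarrow> 0 \<le> Re k \<and> \<bar>Im k\<bar> \<le> \<delta> - \<eta>"
    "\<And>u z. \<bar>u\<bar> \<le> u0 \<Longrightarrow> \<bar>Im z\<bar> < \<delta> \<Longrightarrow> Re z + u * Im z = h u \<Longrightarrow> z \<in> \<Delta> u"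
    "\<And>u u' k. \<bar>u\<bar> \<le> u0 \<Longrightarrow> \<bar>u'\<bar> \<le> u0 \<Longrightarrow> k \<in> K u \<Longrightarrow> h u' \<le> h u + (u' - u) * Im k"
    "\<And>u u' z. \<bar>u\<bar> \<le> u0 \<Longrightarrow> \<bar>u'\<bar> \<le> u0 \<Longrightarrow> z \<in> below_line a' \<delta> h u \<Longrightarrow> z \<in> below_line a' \<delta> h u' \<Longrightarrow> \<Phi> u z = \<Phi> u' z"
    "\<And>u z. \<bar>u\<bar> \<le> u0 \<Longrightarrow> z \<in> below_line a' \<delta> h u \<Longrightarrow> \<delta> - \<eta> \<le> \<bar>Im z\<bar> \<or> Re z \<le> - a' / 2 \<Longrightarrow> norm (\<Phi> u z) \<le> B0"
  have ab: "\<bar>u\<bar> \<le> u0" if "u \<in> {-u0..u0}" for u using that by auto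
  interpret L: tangent_lines F a' \<delta> \<eta> B0 "-u0" u0 h K \<Phi> \<Delta>
  proof
    show "- a' / 4 \<le> h u \<and> \<bar>u * \<delta>\<bar> \<le> a' / 4" if "u \<in> {-u0..u0}" for u
    proof -
      have "\<bar>u * \<delta>\<bar> \<le> u0 * \<delta>" unfolding abs_mult using ab[OF that] a by (intro mult_mono) auto
      then show ?thesis using f(3) f(7)[OF ab[OF that]] by linarith
    qed
    show "\<exists>M. \<forall>z\<in>\<Delta> u - K u. \<bar>tilt u (\<Phi> u z)\<bar> \<le> M" if uu: "u \<in> {-u0..u0}" for u
    proof -
      obtain M where M: "\<And>z. z \<in> \<Delta> u - K u \<Longrightarrow> \<bar>Re (Complex 1 (-u) * \<Phi> u z)\<bar> \<le> M"
        using half_reeb_bounded[OF f(5)[OF ab[OF uu]]] by blast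
      have "\<bar>tilt u (\<Phi> u z)\<bar> \<le> M" if "z \<in> \<Delta> u - K u" for z using M[OF that] by simp
      then show ?thesis by blast
    qed
    show "- u0 < u0" using f(2) by simp
  qed ((rule f(1) a(2) f(4) f(5)[OF ab] f(6)[OF ab] f(8)[OF ab] f(9)[OF ab] f(10)[OF ab ab] f(11)[OF ab ab] f(12)[OF ab]; assumption)+)
  obtain v1 v2 M where v: "-u0 \<le> v1" "v1 < v2" "v2 \<le> u0" "\<And>u z. u \<in> {v1..v2} \<Longrightarrow> z \<in> L.T u \<Longrightarrow> \<bar>tilt u (\<Phi> u z)\<bar> \<le> M"
    using L.uniform_strip by blast
  interpret S: tangent_lines_strip F a' \<delta> \<eta> B0 v1 v2 h K \<Phi> \<Delta> M
    by (rule tangent_lines_strip.intro[OF L.tangent_lines_subinterval[OF v(1-3)]]) (unfold_locales, rule v(4))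
  obtain w1 w2 \<sigma> where w: "v1 \<le> w1" "w1 < w2" "w2 \<le> v2" "\<sigma> = 1 \<or> \<sigma> = (-1::real)"
    "\<And>u k. u \<in> {w1..w2} \<Longrightarrow> k \<in> K u \<Longrightarrow> filterlim (\<lambda>z. \<sigma> * Im (\<Phi> u z)) at_top (at k within \<Delta> u - K u)"
    using S.common_end by metis
  obtain C where C: "\<And>u z. u \<in> {v1..v2} \<Longrightarrow> z \<in> S.T u \<Longrightarrow> norm z \<le> C" using S.T_bounded by blast
  obtain x1 x2 R \<epsilon> where x: "w1 < x1" "x1 < x2" "x2 < w2" "\<epsilon> > 0"
    "\<And>w D c. R < \<bar>Im w\<bar> \<Longrightarrow> x1 < - Re w / Im w \<Longrightarrow> - Re w / Im w < x2 \<Longrightarrow> norm (F w) \<le> C \<Longrightarrow>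
       (F has_derivative D) (at w) \<Longrightarrow> real_eigenvalue D c \<Longrightarrow> \<epsilon> \<le> \<bar>c\<bar>"
    using eigenvalues_bounded_below[OF w(2), of C] by metis
  have vx: "v1 \<le> x1" "x2 \<le> v2" using x w by auto
  have xv: "u \<in> {v1..v2}" and xw: "u \<in> {w1..w2}" if "u \<in> {x1..x2}" for u using that x w by auto
  interpret X: tangent_lines_strip F a' \<delta> \<eta> B0 x1 x2 h K \<Phi> \<Delta> M
    by (rule tangent_lines_strip.intro[OF S.tangent_lines_subinterval[OF vx(1) x(2) vx(2)]]) (unfold_locales, rule S.strip[OF xv])
  have gap: "z \<in> K u" if "u \<in> {x1..x2}" "k1 \<in> K u" "k2 \<in> K u" "Im k1 < Im z" "Im z < Im k2" "tilt u z = h u" for u k1 k2 z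
    by (rule tilted_no_gap[OF X.hr[OF that(1)] that(2,3) w(4) _ that(4-6)]) (rule w(5)[OF xw[OF that(1)]])
  have CX: "norm z \<le> C" if "u \<in> {x1..x2}" "z \<in> X.T u" for u z by (rule C[OF xv[OF that(1)] that(2)])
  from w(4) show False
  proof
    assume sg: "\<sigma> = 1"
    interpret U: tangent_lines_up F a' \<delta> \<eta> B0 x1 x2 h K \<Phi> \<Delta> M
    proof
      show "filterlim (\<lambda>z. Im (\<Phi> u z)) at_top (at k within \<Delta> u - K u)" if "u \<in> {x1..x2}" "k \<in> K u" for u k
        using w(5)[OF xw[OF that(1)] that(2)] sg by simp
    qed (rule gap)
    show False by (rule U.eigenvalue_bound_contradiction[OF diff_F x(4) CX x(5)])
  next
    assume sg: "\<sigma> = -1"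
    interpret Y: tangent_lines_strip "\<lambda>w. F (- w)" a' \<delta> \<eta> B0 x1 x2 h K "\<lambda>u z. - \<Phi> u z" \<Delta> M
      by (rule X.tangent_lines_strip_flip)
    interpret U: tangent_lines_up "\<lambda>w. F (- w)" a' \<delta> \<eta> B0 x1 x2 h K "\<lambda>u z. - \<Phi> u z" \<Delta> M
    proof
      show "filterlim (\<lambda>z. Im (- \<Phi> u z)) at_top (at k within \<Delta> u - K u)" if "u \<in> {x1..x2}" "k \<in> K u" for u k
        using w(5)[OF xw[OF that(1)] that(2)] sg by simp
    qed (rule gap)
    have neg: "((\<lambda>w. - w) has_derivative (\<lambda>h. - h)) (at w)" for w :: complex by (auto intro!: derivative_eq_intros)
    show False
    proof (rule U.eigenvalue_bound_contradiction[OF _ x(4) CX])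
      show "(\<lambda>w. F (- w)) differentiable at w" if "s < norm w" for w
      proof -
        obtain D where D: "(F has_derivative D) (at (- w))" using diff_F[of "- w"] \<open>s < norm w\<close> unfolding differentiable_def by auto
        from has_derivative_compose[OF neg D] show ?thesis unfolding differentiable_def by blast
      qed
      fix w D c assume w': "R < \<bar>Im w\<bar>" "x1 < - Re w / Im w" "- Re w / Im w < x2" "norm (F (- w)) \<le> C"
        "((\<lambda>w. F (- w)) has_derivative D) (at w)" "real_eigenvalue D c"
      have "((\<lambda>w. F (- w)) has_derivative D) (at (- (- w)))" using w'(5) by simp
      from has_derivative_compose[OF neg this] have D: "(F has_derivative (\<lambda>h. D (- h))) (at (- w))" by simp
      have lin: "D (- v) = - D v" for v using linear_neg[OF has_derivative_linear[OF w'(5)]] .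
      obtain v where v: "v \<noteq> 0" "D v = c *\<^sub>R v" using w'(6) by (auto simp: real_eigenvalue_def)
      have "real_eigenvalue (\<lambda>h. D (- h)) (- c)" unfolding real_eigenvalue_def
        by (rule exI[of _ v]) (use v lin in simp)
      then have "\<epsilon> \<le> \<bar>- c\<bar>" by (intro x(5)[OF _ _ _ _ D]) (use w' in auto)
      then show "\<epsilon> \<le> \<bar>c\<bar>" by simp
    qed
  qed
qed

text \<open>A rotation and a translation make the edge vertical and centre the singular set.\<close>

theorem no_half_reeb:
  assumes hr0: "half_reeb F m0 \<Delta>0 h0 K0 \<Phi>0" shows False
proof -
  have m0: "m0 \<noteq> 0" using hr0 by (simp add: half_reeb_def)
  define r where "r = inverse (norm m0)"
  define m where "m = of_real r * m0"
  have r: "0 < r" using m0 by (simp add: r_def)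
  have m1: "norm m = 1" using m0 by (simp add: m_def r_def norm_mult norm_inverse)
  have hr1: "half_reeb F m \<Delta>0 (r * h0) K0 \<Phi>0" unfolding m_def by (rule half_reeb_scale[OF hr0 r])
  have K0: "compact K0" "K0 \<noteq> {}" using hr1 unfolding half_reeb_def by blast+
  have cI: "continuous_on K0 (\<lambda>k. Im (m * k))" by (intro continuous_intros)
  obtain kb where kb: "kb \<in> K0" "\<forall>k\<in>K0. Im (m * kb) \<le> Im (m * k)" using continuous_attains_inf[OF K0 cI] by blast
  obtain kt where kt: "kt \<in> K0" "\<forall>k\<in>K0. Im (m * k) \<le> Im (m * kt)" using continuous_attains_sup[OF K0 cI] by blast
  define c0 where "c0 = Complex (r * h0) ((Im (m * kb) + Im (m * kt)) / 2)"
  define L where "L = (Im (m * kt) - Im (m * kb)) / 2"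
  have L: "0 \<le> L" using kb kt by (simp add: L_def)
  define G where "G = (\<lambda>w. m * F (w / m) - c0)"
  define \<Delta> where "\<Delta> = (\<lambda>z. m * z - c0) ` \<Delta>0"
  define K where "K = (\<lambda>z. m * z - c0) ` K0"
  define \<Phi> where "\<Phi> = (\<lambda>z. m * \<Phi>0 ((z + c0) / m))"
  have hr: "half_reeb G 1 \<Delta> 0 K \<Phi>"
    using half_reeb_rotate[OF hr1 m1, of c0] by (simp add: G_def \<Delta>_def K_def \<Phi>_def c0_def)
  interpret G: W_homeo G s P unfolding G_def by (rule W_homeo_rotate[OF m1])
  have d: "convex \<Delta>" "compact K" "K \<noteq> {}" "\<And>k. k \<in> K \<Longrightarrow> Re k = 0"
      "\<And>k. k \<in> K \<Longrightarrow> \<exists>\<rho>>0. ball k \<rho> \<inter> {z. Re z \<le> 0} \<subseteq> \<Delta>"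
      "section_on G (\<Delta> - K) \<Phi>" "\<And>k. k \<in> K \<Longrightarrow> filterlim \<Phi> at_infinity (at k within \<Delta> - K)"
    using hr unfolding half_reeb_def mult_1 by blast+
  have ImK: "\<bar>Im k\<bar> \<le> L" if k: "k \<in> K" for k
  proof -
    obtain y where y: "y \<in> K0" "k = m * y - c0" using k by (auto simp: K_def)
    have mid: "\<bar>x - (b + t) / 2\<bar> \<le> (t - b) / 2" if "b \<le> x" "x \<le> t" for b x t :: real
      using that unfolding abs_le_iff by (simp add: field_simps)
    have "Im (m * kb) \<le> Im (m * y)" "Im (m * y) \<le> Im (m * kt)" using kb kt y by blast+
    then have "\<bar>Im (m * y) - (Im (m * kb) + Im (m * kt)) / 2\<bar> \<le> L" unfolding L_def by (rule mid)
    then show ?thesis by (simp only: y(2) minus_complex.sel c0_def complex.sel)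
  qed
  have ends: "Complex 0 (- L) \<in> K" "Complex 0 L \<in> K"
  proof -
    have half: "b - (b + t) / 2 = - ((t - b) / 2) \<and> t - (b + t) / 2 = (t - b) / 2" for b t :: real by (simp add: field_simps)
    have "m * kb - c0 \<in> K" "m * kt - c0 \<in> K" using kb kt by (auto simp: K_def)
    moreover have "Im (m * kb - c0) = - L" "Im (m * kt - c0) = L"
      using half[of "Im (m * kb)" "Im (m * kt)"] unfolding minus_complex.sel c0_def complex.sel L_def by blast+
    ultimately show "Complex 0 (- L) \<in> K" "Complex 0 L \<in> K" using d(4) by (metis complex.collapse)+
  qed
  obtain \<rho>1 where r1: "\<rho>1 > 0" "ball (Complex 0 (- L)) \<rho>1 \<inter> {z. Re z \<le> 0} \<subseteq> \<Delta>" using d(5)[OF ends(1)] by blast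
  obtain \<rho>2 where r2: "\<rho>2 > 0" "ball (Complex 0 L) \<rho>2 \<inter> {z. Re z \<le> 0} \<subseteq> \<Delta>" using d(5)[OF ends(2)] by blast
  define a where "a = min \<rho>1 \<rho>2 / 4"
  define \<delta> where "\<delta> = L + a"
  have a: "0 < a" "2 * a < \<rho>1" "2 * a < \<rho>2" using r1 r2 by (auto simp: a_def)
  have \<delta>: "0 < \<delta>" using a L by (simp add: \<delta>_def)
  have near: "Complex x (y + l) \<in> ball (Complex 0 l) \<rho>" if "\<bar>x\<bar> \<le> a" "\<bar>y\<bar> \<le> a" "2 * a < \<rho>" for x y l \<rho>
  proof -
    have "norm (Complex x y) \<le> \<bar>x\<bar> + \<bar>y\<bar>" using cmod_le[of "Complex x y"] by simp
    moreover have "Complex 0 l - Complex x (y + l) = - Complex x y" by (simp add: complex_eq_iff)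
    ultimately show ?thesis using that by (simp add: dist_norm)
  qed
  have near1: "Complex x y \<in> \<Delta>" if "- a \<le> x" "x \<le> 0" "\<bar>y - L\<bar> \<le> a" for x y
    using near[of x "y - L" \<rho>2 L] that a r2(2) by auto
  have near2: "Complex x y \<in> \<Delta>" if "- a \<le> x" "x \<le> 0" "\<bar>y + L\<bar> \<le> a" for x y
    using near[of x "y + L" \<rho>1 "- L"] that a r1(2) by auto
  have box: "box_at {-a..0} {-\<delta>..\<delta>} \<subseteq> \<Delta>"
  proof
    fix z assume z: "z \<in> box_at {-a..0} {-\<delta>..\<delta>}"
    then have zr: "- a \<le> Re z" "Re z \<le> 0" "- L - a \<le> Im z" "Im z \<le> L + a" by (auto simp: box_at_def \<delta>_def)
    consider "Im z \<le> - L" | "L \<le> Im z" | "- L < Im z" "Im z < L" by linarith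
    then show "z \<in> \<Delta>"
    proof cases
      case 1
      then show ?thesis using near2[of "Re z" "Im z"] zr by auto
    next
      case 2
      then show ?thesis using near1[of "Re z" "Im z"] zr by auto
    next
      case 3
      define t where "t = (Im z + L) / (2 * L)"
      have L0: "0 < L" using 3 by simp
      have t: "0 \<le> t" "t \<le> 1" "Im z = (1 - t) * (- L) + t * L" using 3 L0 by (auto simp: t_def field_simps)
      have "(1 - t) *\<^sub>R Complex (Re z) (- L) + t *\<^sub>R Complex (Re z) L \<in> \<Delta>"
        by (rule convexD[OF d(1)]) (use near1 near2 zr t a in auto)
      moreover have "(1 - t) *\<^sub>R Complex (Re z) (- L) + t *\<^sub>R Complex (Re z) L = z"
        using t(3) by (simp add: complex_eq_iff algebra_simps)
      ultimately show ?thesis by simp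
    qed
  qed
  then have sub: "box_at {-a..0} {-\<delta>..\<delta>} - K \<subseteq> \<Delta> - K" by blast
  show False
  proof (rule G.no_vertical_half_reeb[OF a(1) \<delta> compact_imp_closed[OF d(2)] d(3)])
    show "K \<subseteq> box_at {0} {-\<delta><..<\<delta>}"
    proof
      fix k assume "k \<in> K"
      then have "Re k = 0" "\<bar>Im k\<bar> < \<delta>" using d(4) ImK[of k] a(1) by (auto simp: \<delta>_def)
      then show "k \<in> box_at {0} {-\<delta><..<\<delta>}" by (auto simp: box_at_def)
    qed
    show "section_on G (box_at {-a..0} {-\<delta>..\<delta>} - K) \<Phi>" by (rule section_on_subset[OF d(6) sub])
    show "filterlim \<Phi> at_infinity (at k within box_at {-a..0} {-\<delta>..\<delta>} - K)" if "k \<in> K" for k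
      by (rule filterlim_mono[OF d(7)[OF that] order_refl at_le[OF sub]])
  qed
qed

end

section \<open>Lifting segments\<close>

definition segment_lifts :: "(complex \<Rightarrow> complex) \<Rightarrow> complex \<Rightarrow> complex \<Rightarrow> bool" where
  "segment_lifts F p q \<longleftrightarrow> (\<exists>\<Psi>. section_on F (closed_segment (F p) (F q)) \<Psi> \<and> \<Psi> (F p) = p \<and> \<Psi> (F q) = q)"

lemma all_segments_lift_imp:
  assumes "\<And>p q. segment_lifts F p q" shows "inj F \<and> convex (range F)"
proof
  show "inj F"
  proof (rule injI)
    fix p q assume e: "F p = F q"
    have "\<exists>\<Psi>. section_on F (closed_segment (F p) (F q)) \<Psi> \<and> \<Psi> (F p) = p \<and> \<Psi> (F q) = q"
      using assms[of p q] by (simp only: segment_lifts_def)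
    then obtain \<Psi> where "\<Psi> (F p) = p \<and> \<Psi> (F q) = q" by (elim exE conjE) (rule that, rule conjI)
    then have "\<Psi> (F p) = p" "\<Psi> (F p) = q" unfolding e by (rule conjunct1, rule conjunct2)
    then show "p = q" by (rule trans[OF sym])
  qed
  show "convex (range F)" unfolding convex_contains_segment
  proof (intro ballI subsetI)
    fix x y z assume "x \<in> range F" "y \<in> range F" and z: "z \<in> closed_segment x y"
    then obtain p q where pq: "x = F p" "y = F q" by blast
    have "\<exists>\<Psi>. section_on F (closed_segment (F p) (F q)) \<Psi> \<and> \<Psi> (F p) = p \<and> \<Psi> (F q) = q"
      using assms[of p q] by (simp only: segment_lifts_def)
    then obtain \<Psi> where "section_on F (closed_segment (F p) (F q)) \<Psi>" by (elim exE conjE) (rule that)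
    then have "F (\<Psi> z) = z" using z pq by (auto simp: section_on_def)
    then show "z \<in> range F" by (metis rangeI)
  qed
qed

text \<open>The section on the segment extends to a neighbourhood, which contains the segments to nearby points.\<close>

lemma (in local_homeo) segment_lifts_near:
  assumes "segment_lifts F p q" obtains e where "e > 0" "\<And>v. v \<in> ball q e \<Longrightarrow> segment_lifts F p v"
proof -
  obtain \<Psi> where s: "section_on F (closed_segment (F p) (F q)) \<Psi>" "\<Psi> (F p) = p" "\<Psi> (F q) = q"
    using assms unfolding segment_lifts_def by blast
  obtain \<epsilon> \<Psi>' where n: "\<epsilon> > 0" "section_on F (\<Union>z\<in>closed_segment (F p) (F q). ball z \<epsilon>) \<Psi>'"
      "\<And>z. z \<in> closed_segment (F p) (F q) \<Longrightarrow> \<Psi>' z = \<Psi> z"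
    using section_extends[OF compact_segment s(1)] by blast
  let ?O = "\<Union>z\<in>closed_segment (F p) (F q). ball z \<epsilon>"
  have sub: "closed_segment (F p) y \<subseteq> ?O" if y: "y \<in> ball (F q) \<epsilon>" for y
  proof
    fix x assume "x \<in> closed_segment (F p) y"
    then obtain u where u: "0 \<le> u" "u \<le> 1" "x = (1 - u) *\<^sub>R F p + u *\<^sub>R y" by (auto simp: closed_segment_def)
    let ?x = "(1 - u) *\<^sub>R F p + u *\<^sub>R F q"
    have "dist ?x x = u * dist (F q) y" using u by (simp add: dist_norm scaleR_diff_right[symmetric])
    also have "\<dots> \<le> 1 * dist (F q) y" using u by (intro mult_right_mono) auto
    finally have "x \<in> ball ?x \<epsilon>" using y by simp
    moreover have "?x \<in> closed_segment (F p) (F q)" using u by (auto simp: closed_segment_def)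
    ultimately show "x \<in> ?O" by blast
  qed
  have sb: "section_on F (ball (F q) \<epsilon>) \<Psi>'" by (rule section_on_subset[OF n(2)]) (use ends_in_segment(2) in blast)
  have "F q \<in> ball (F q) \<epsilon>" using n(1) by simp
  then obtain e where e: "e > 0" "\<And>v. v \<in> ball (\<Psi>' (F q)) e \<Longrightarrow> F v \<in> ball (F q) \<epsilon> \<and> \<Psi>' (F v) = v"
    using section_local_inverse[OF open_ball sb] by blast
  have pe: "\<Psi>' (F p) = p" "\<Psi>' (F q) = q" using n(3) s by auto
  show ?thesis
  proof
    fix v assume "v \<in> ball q e"
    then have v: "F v \<in> ball (F q) \<epsilon>" "\<Psi>' (F v) = v" using e(2) pe(2) by auto
    then show "segment_lifts F p v" unfolding segment_lifts_def
      using section_on_subset[OF n(2) sub[OF v(1)]] pe(1) by blast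
  qed (rule e(1))
qed

lemma (in local_homeo) segment_lifts_refl: "segment_lifts F p p"
  unfolding segment_lifts_def by (rule exI[of _ "\<lambda>_. p"]) (simp add: section_on_def)

text \<open>Lifting a segment can only fail by running into a half-Reeb region: near the first endpoint that cannot
  be reached there are reachable ones, and the segments to them sweep a parallelogram whose diagonal is
  the segment in question.\<close>

lemma (in W_homeo) segment_lifts_all: "segment_lifts F p q"
proof (rule ccontr)
  assume nl: "\<not> ?thesis"
  define S where "S = {q. segment_lifts F p q}"
  have oS: "open S" unfolding open_contains_ball S_def
  proof safe
    fix q assume "segment_lifts F p q"
    then obtain e where "e > 0" "\<And>v. v \<in> ball q e \<Longrightarrow> segment_lifts F p v" using segment_lifts_near by blast
    then show "\<exists>e>0. ball q e \<subseteq> {q. segment_lifts F p q}" by blast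
  qed
  have pS: "p \<in> S" by (simp add: S_def segment_lifts_refl)
  have "\<not> closed S"
  proof
    assume "closed S"
    then have "S = {} \<or> S = UNIV" using oS clopen by blast
    then show False using pS nl by (auto simp: S_def)
  qed
  then have "\<exists>b. b \<in> closure S \<and> b \<notin> S" using closure_subset_eq by blast
  then obtain b where b: "b \<in> closure S" "b \<notin> S" by blast
  obtain r U \<psi> where l: "r > 0" "open U" "b \<in> U" "section_on F (ball (F b) r) \<psi>"
    "\<And>v. v \<in> U \<Longrightarrow> F v \<in> ball (F b) r \<and> \<psi> (F v) = v" using local_section by metis
  obtain rp Up \<psi>p where lp: "rp > 0" "open Up" "p \<in> Up" "section_on F (ball (F p) rp) \<psi>p"
    "\<And>v. v \<in> Up \<Longrightarrow> F v \<in> ball (F p) rp \<and> \<psi>p (F v) = v" using local_section by metis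
  define A B where "A = F p" and "B = F b"
  define V where "V = S \<inter> U \<inter> F -` ball B rp"
  have oV: "open V" unfolding V_def by (intro open_Int oS l(2) open_vimage open_ball cont_F)
  have Vne: "V \<inter> W \<noteq> {}" if W: "open W" "b \<in> W" for W
  proof -
    have "open (U \<inter> F -` ball B rp \<inter> W)" by (intro open_Int l(2) open_vimage open_ball cont_F W)
    moreover have "b \<in> U \<inter> F -` ball B rp \<inter> W" using l lp W by (simp add: B_def)
    ultimately have "(U \<inter> F -` ball B rp \<inter> W) \<inter> S \<noteq> {}" using b(1) by (metis Int_iff closure_iff_nhds_not_empty inf_commute open_Int_closure_eq_empty empty_iff)
    then show ?thesis unfolding V_def by blast
  qed
  show False
  proof (cases "A = B")
    case True
    \<comment> \<open>short segments at \<open>A\<close> lift to short arcs at \<open>p\<close>\<close>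
    have "p \<noteq> b" using pS b(2) by blast
    have arc: "\<psi>p (F v) = v" if v: "v \<in> V" for v
    proof -
      obtain \<Psi> where P: "section_on F (closed_segment (F p) (F v)) \<Psi>" "\<Psi> (F p) = p" "\<Psi> (F v) = v"
        using v by (auto simp: V_def S_def segment_lifts_def)
      have "closed_segment (F p) (F v) \<subseteq> ball (F p) rp"
        by (rule closed_segment_subset[OF _ _ convex_ball]) (use v True lp(1) in \<open>auto simp: V_def A_def B_def\<close>)
      from section_on_subset[OF lp(4) this] have s2: "section_on F (closed_segment (F p) (F v)) \<psi>p" .
      have e: "\<psi>p (F p) = \<Psi> (F p)" using lp(3,5) P(2) by simp
      have "\<psi>p (F v) = \<Psi> (F v)"
        by (rule section_unique_convex[OF convex_closed_segment s2 P(1) _ e]) simp_all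
      then show ?thesis using P(3) by simp
    qed
    have "b \<in> closure V" unfolding closure_iff_nhds_not_empty using Vne by blast
    then obtain v where v: "\<And>n. v n \<in> V" "v \<longlonglongrightarrow> b" unfolding closure_sequential by blast
    have c: "continuous_on (ball (F p) rp) \<psi>p" using lp(4) by (simp add: section_on_def)
    have Fv: "(\<lambda>n. F (v n)) \<longlonglongrightarrow> F p" using tendsto_F[OF v(2)] True by (simp add: A_def B_def)
    have Fp: "F p \<in> ball (F p) rp" using lp(1) by simp
    have "(\<lambda>n. \<psi>p (F (v n))) \<longlonglongrightarrow> \<psi>p (F p)"
      by (rule continuous_on_tendsto_compose[OF c Fv Fp topological_tendstoD[OF Fv open_ball Fp]])
    moreover have "\<psi>p (F (v n)) = v n" for n by (rule arc[OF v(1)])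
    moreover have "\<psi>p (F p) = p" using lp(5)[OF lp(3)] by (rule conjunct2)
    ultimately have "v \<longlonglongrightarrow> p" by simp
    then have "p = b" using v(2) LIMSEQ_unique by blast
    then show False using \<open>p \<noteq> b\<close> by simp
  next
    case False
    define g where "g = (\<lambda>z. Im (cnj (B - A) * (z - A)))"
    \<comment> \<open>The reachable points near \<open>b\<close> have an open image, so it is not contained in the line through \<open>A\<close> and \<open>B\<close>.\<close>
    have "\<exists>v\<in>V. g (F v) \<noteq> 0"
    proof (rule ccontr)
      assume "\<not> ?thesis"
      then have z: "g y = 0" if "y \<in> F ` V" for y using that by blast
      have "V \<noteq> {}" using Vne[of UNIV] by simp
      then obtain y e where y: "e > 0" "ball y e \<subseteq> F ` V" using open_image[OF oV] by (metis all_not_in_conv image_is_empty open_contains_ball)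
      define t where "t = e / (2 * norm (B - A))"
      let ?y = "y + of_real t * \<i> * (B - A)"
      have t: "t > 0" "t * norm (B - A) = e / 2" using y False by (auto simp: t_def)
      have "norm (of_real t * \<i> * (B - A)) = e / 2" using t by (simp add: norm_mult)
      then have "?y \<in> ball y e" "y \<in> ball y e" using y(1) by (simp_all add: dist_norm)
      then have "g ?y = 0" "g y = 0" by (auto intro!: z subsetD[OF y(2)] simp del: mem_ball)
      moreover have "g ?y - g y = t * ((Re (B - A))\<^sup>2 + (Im (B - A))\<^sup>2)" by (simp add: g_def power2_eq_square algebra_simps)
      moreover have "(Re (B - A))\<^sup>2 + (Im (B - A))\<^sup>2 > 0" using False by (metis cmod_power2 right_minus_eq zero_less_norm_iff zero_less_power)
      ultimately show False using t(1) by simp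
    qed
    then obtain v where v: "v \<in> V" "g (F v) \<noteq> 0" by blast
    define w l' where "w = B - F v" and "l' = F v - A"
    have D: "Im (cnj w * l') \<noteq> 0"
    proof -
      have "Im (cnj w * l') = g (F v)" by (simp add: w_def l'_def g_def algebra_simps)
      then show ?thesis using v(2) by simp
    qed
    have vB: "F v \<in> ball B r" "F v \<in> ball B rp" "\<psi> (F v) = v" using v(1) l(5) by (auto simp: V_def B_def)
    obtain \<Psi> where P: "section_on F (closed_segment A (F v)) \<Psi>" "\<Psi> A = p" "\<Psi> (F v) = v"
      using v(1) by (auto simp: V_def S_def segment_lifts_def A_def)
    have pmA: "pmap A w l' \<zeta> = A + of_real (Re \<zeta>) * w" if "Im \<zeta> = 0" for \<zeta> using that by (simp add: pmap_def)
    have nw: "norm (of_real x * w) < rp" if "0 \<le> x" "x \<le> 1" for x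
    proof -
      have "x * norm w \<le> 1 * norm w" using that by (intro mult_right_mono) auto
      then show ?thesis using vB(2) that by (simp add: w_def dist_norm norm_mult)
    qed
    have s1: "section_on F (par A w l' {0..1} {0}) \<psi>p"
      by (rule section_on_subset[OF lp(4)]) (use nw in \<open>auto simp: box_at_def pmA A_def[symmetric] dist_norm\<close>)
    have s2: "section_on F (par A w l' {0..1} {1}) \<psi>"
    proof (rule section_on_subset[OF l(4)], safe)
      fix \<zeta> assume z: "\<zeta> \<in> box_at {0..1} {1}"
      have "pmap A w l' \<zeta> = (1 - Re \<zeta>) *\<^sub>R F v + Re \<zeta> *\<^sub>R B"
        using z by (simp add: box_at_def pmap_def w_def l'_def scaleR_conv_of_real algebra_simps)
      also have "\<dots> \<in> ball B r" by (rule convexD[OF convex_ball vB(1)]) (use z l(1) in \<open>auto simp: box_at_def\<close>)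
      finally show "pmap A w l' \<zeta> \<in> ball (F b) r" by (simp add: B_def)
    qed
    have s3: "section_on F (par A w l' {0} {0..1}) \<Psi>"
    proof (rule section_on_subset[OF P(1)], safe)
      fix \<zeta> assume z: "\<zeta> \<in> box_at {0} {0..1}"
      have "pmap A w l' \<zeta> = (1 - Im \<zeta>) *\<^sub>R A + Im \<zeta> *\<^sub>R F v"
        using z by (simp add: box_at_def pmap_def l'_def scaleR_conv_of_real algebra_simps)
      then show "pmap A w l' \<zeta> \<in> closed_segment A (F v)" using z by (auto simp: closed_segment_def box_at_def)
    qed
    have e1: "\<Psi> A = \<psi>p A" using P(2) lp(3,5) by (simp add: A_def)
    have Al: "A + l' = F v" by (simp add: l'_def)
    have e2: "\<Psi> (A + l') = \<psi> (A + l')" using P(3) vB(3) by (simp add: Al)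
    \<comment> \<open>the diagonal from \<open>A\<close> is the segment to \<open>B\<close>\<close>
    have corner: "pmap A w l' 0 = A" "pmap A w l' (1 + \<i>) = B" by (simp_all add: pmap_def w_def l'_def)
    have full: False if f: "section_on F (par A w l' {0..1} {0..1}) \<Phi>" "\<forall>z\<in>par A w l' {0..1} {0}. \<Phi> z = \<psi>p z"
        "\<forall>z\<in>par A w l' {0..1} {1}. \<Phi> z = \<psi> z" for \<Phi>
    proof -
      have "A \<in> par A w l' {0..1} {0}" "A \<in> par A w l' {0..1} {0..1}"
        by (rule image_eqI[of _ _ 0], simp_all add: corner box_at_def)+
      moreover have "B \<in> par A w l' {0..1} {1}" "B \<in> par A w l' {0..1} {0..1}"
        by (rule image_eqI[of _ _ "1 + \<i>"], simp_all add: corner box_at_def)+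
      ultimately have "\<Phi> A = \<psi>p A" "\<Phi> B = \<psi> B" and sub: "closed_segment A B \<subseteq> par A w l' {0..1} {0..1}"
        using bspec[OF f(2)] bspec[OF f(3)] closed_segment_subset[OF _ _ convex_par[of "{0..1}" "{0..1}"]] by simp_all
      then have "\<Phi> (F p) = p" "\<Phi> (F b) = b" using lp(3,5) l(3,5) by (simp_all add: A_def B_def)
      moreover have "section_on F (closed_segment (F p) (F b)) \<Phi>" using section_on_subset[OF f(1) sub] by (simp add: A_def B_def)
      ultimately have "segment_lifts F p b" unfolding segment_lifts_def by blast
      then show False using b(2) by (simp add: S_def)
    qed
    have part: False if f: "0 < T" "compact K" "K \<noteq> {}" "K \<subseteq> par A w l' {T} {0<..<1}"
        "section_on F (par A w l' {0..T} {0..1} - K) \<Phi>"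
        "\<forall>k\<in>K. filterlim \<Phi> at_infinity (at k within par A w l' {0..T} {0..1} - K)" for T K \<Phi>
    proof -
      define \<tau> where "\<tau> = Im (cnj w * l')"
      define m where "m = of_real \<tau> * (\<i> * cnj l')"
      have t: "\<tau> \<noteq> 0" using D by (simp add: \<tau>_def)
      have "l' \<noteq> 0" using D by auto
      then have m0: "m \<noteq> 0" using t by (simp add: m_def)
      have ml: "Re (m * l') = 0" by (simp add: m_def algebra_simps)
      have "Re (m * w) = \<tau> * \<tau>" by (simp add: m_def \<tau>_def algebra_simps)
      moreover have "0 < \<tau> * \<tau>" using t by (simp add: zero_less_mult_iff) linarith
      ultimately have mw: "0 < Re (m * w)" by simp
      show False by (rule no_half_reeb[OF half_reeb_parallelogram[OF f(1) D m0 ml mw f(2-6)]])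
    qed
    from sweep[OF D s1 s2 s3 e1 e2] show False
    proof (elim disjE exE conjE)
      fix \<Phi> assume "section_on F (par A w l' {0..1} {0..1}) \<Phi>" "\<forall>z\<in>par A w l' {0..1} {0}. \<Phi> z = \<psi>p z"
        "\<forall>z\<in>par A w l' {0..1} {1}. \<Phi> z = \<psi> z"
      then show False by (rule full)
    next
      fix T K \<Phi> assume "0 < T" "compact K" "K \<noteq> {}" "K \<subseteq> par A w l' {T} {0<..<1}"
        "section_on F (par A w l' {0..T} {0..1} - K) \<Phi>"
        "\<forall>k\<in>K. filterlim \<Phi> at_infinity (at k within par A w l' {0..T} {0..1} - K)"
      then show False by (rule part)
    qed
  qed
qed

section \<open>The real plane\<close>

text \<open>Rotations of the real plane are multiplications by complex numbers of modulus one.\<close>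

lemma rot_mat_mult: "rot_mat \<theta> *v x = vec_of_complex (cis \<theta> * complex_of_vec x)"
  by (simp add: rot_mat_def vec_eq_iff forall_2 matrix_vector_mult_def sum_2 algebra_simps)

text \<open>The complex form of the hypotheses. Outside the closed disc of radius \<open>s\<close>, derivatives within the complement
  of the open disc are ordinary ones.\<close>

lemma W_homeo_complex_of_vec:
  assumes F: "local_homeomorphism F" and s: "s > 0" and diff: "F differentiable_on (- ball 0 s)" and W: "W_condition s F"
  obtains P where "W_homeo (\<lambda>w. complex_of_vec (F (vec_of_complex w))) s P"
proof -
  obtain P where P: "P \<in> growth_functions"
    "\<And>\<theta>. \<not> (\<exists>z c T. (\<forall>k. z k \<notin> ball 0 s) \<and> filterlim (\<lambda>k. z k $ 1) at_top sequentially \<and>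
              (\<lambda>k. rot_conj \<theta> F (z k)) \<longlonglongrightarrow> T \<and>
              (\<forall>k. \<exists>D. (rot_conj \<theta> F has_derivative D) (at (z k) within - ball 0 s) \<and> real_eigenvalue D (c k)) \<and>
              (\<lambda>k. c k * P (z k $ 1)) \<longlonglongrightarrow> 0)"
    using W unfolding W_condition_def by blast
  let ?c = complex_of_vec and ?v = vec_of_complex
  let ?F = "\<lambda>w. ?c (F (?v w))"
  have lc: "continuous_on S ?c" "continuous_on S' ?v" for S S'
    using bounded_linear_complex_of_vec bounded_linear_vec_of_complex by (auto intro: linear_continuous_on)
  have dc: "(?c has_derivative ?c) (at x within S)" for x S
    by (rule bounded_linear.has_derivative[OF bounded_linear_complex_of_vec has_derivative_ident])
  have dv: "(?v has_derivative ?v) (at w within S)" for w S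
    by (rule bounded_linear.has_derivative[OF bounded_linear_vec_of_complex has_derivative_ident])
  have "continuous_on UNIV F"
  proof (rule continuous_at_imp_continuous_on, intro ballI)
    fix x :: "real^2"
    obtain U g where "open U" "x \<in> U" "homeomorphism U (F ` U) F g" using F unfolding local_homeomorphism_def by blast
    then show "isCont F x" using continuous_on_eq_continuous_at homeomorphism_cont1 by blast
  qed
  then have cF: "continuous_on UNIV ?F"
    by (intro continuous_on_compose2[OF lc(1)[of UNIV]] continuous_on_compose2[OF _ lc(2)]) auto
  have inj: "\<exists>e>0. inj_on ?F (ball w e)" for w
  proof -
    obtain U g where U: "open U" "?v w \<in> U" "homeomorphism U (F ` U) F g" using F unfolding local_homeomorphism_def by blast
    obtain e where e: "e > 0" "ball (?v w) e \<subseteq> U" using U open_contains_ball by blast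
    have injU: "inj_on F U" using U(3) by (metis homeomorphism_apply1 inj_on_inverseI)
    have b: "?v x \<in> U" if "x \<in> ball w e" for x
    proof -
      have "?v w - ?v x = ?v (w - x)" using bounded_linear.linear[OF bounded_linear_vec_of_complex] by (simp add: linear_diff)
      then have "dist (?v w) (?v x) = dist w x" by (simp add: dist_norm)
      then show ?thesis using that e(2) by auto
    qed
    have "inj_on ?F (ball w e)"
    proof (rule inj_onI)
      fix x y assume x: "x \<in> ball w e" and y: "y \<in> ball w e" and eq: "?F x = ?F y"
      have "F (?v x) = F (?v y)" using eq by (metis complex_vec_inverse(2))
      then have "?v x = ?v y" by (rule inj_onD[OF injU _ b[OF x] b[OF y]])
      then show "x = y" by (metis complex_vec_inverse(1))
    qed
    then show ?thesis using e(1) by blast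
  qed
  have df: "?F differentiable at w" if w: "s < norm w" for w
  proof -
    let ?O = "- cball (0::real^2) s"
    have "?v w \<in> ?O" using w by simp
    moreover have "?O \<subseteq> - ball 0 s" by auto
    ultimately have "F differentiable (at (?v w) within ?O)" using diff by (meson differentiable_on_def differentiable_within_subset subsetD)
    then have "F differentiable at (?v w)" using \<open>?v w \<in> ?O\<close> at_within_open[of "?v w" ?O] by (simp add: open_Compl)
    then obtain D where "(F has_derivative D) (at (?v w))" unfolding differentiable_def by blast
    from has_derivative_compose[OF dv this] have "((\<lambda>w. F (?v w)) has_derivative (\<lambda>h. D (?v h))) (at w)" .
    from has_derivative_compose[OF this dc] show ?thesis unfolding differentiable_def by blast
  qed
  have cW: "complex_W s P ?F" unfolding complex_W_def
  proof (intro allI impI notI)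
    fix m :: complex assume m: "norm m = 1"
    assume "\<exists>w c T. (\<forall>k. s < norm (w k)) \<and> filterlim (\<lambda>k. Re (m * w k)) at_top sequentially \<and>
          (\<lambda>k. ?F (w k)) \<longlonglongrightarrow> T \<and> (\<forall>k. \<exists>D. (?F has_derivative D) (at (w k)) \<and> real_eigenvalue D (c k)) \<and>
          (\<lambda>k. c k * P (Re (m * w k))) \<longlonglongrightarrow> 0"
    then obtain w c T where w: "\<And>k. s < norm (w k)" "filterlim (\<lambda>k. Re (m * w k)) at_top sequentially"
        "(\<lambda>k. ?F (w k)) \<longlonglongrightarrow> T" "\<And>k. \<exists>D. (?F has_derivative D) (at (w k)) \<and> real_eigenvalue D (c k)"
        "(\<lambda>k. c k * P (Re (m * w k))) \<longlonglongrightarrow> 0" by blast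
    obtain \<theta> where th: "m = cis \<theta>" using m by (metis complex_norm_eq_1_exp cis_conv_exp)
    have th': "cis (- \<theta>) * m = 1" by (simp add: th cis_mult)
    define z where "z = (\<lambda>k. ?v (m * w k))"
    have rF: "rot_conj \<theta> F x = ?v (m * ?F (cis (- \<theta>) * ?c x))" for x by (simp add: rot_conj_def rot_mat_mult th)
    have zk: "cis (- \<theta>) * ?c (z k) = w k" for k by (simp add: z_def mult.assoc[symmetric] th')
    have "\<exists>z c T. (\<forall>k. z k \<notin> ball 0 s) \<and> filterlim (\<lambda>k. z k $ 1) at_top sequentially \<and>
              (\<lambda>k. rot_conj \<theta> F (z k)) \<longlonglongrightarrow> T \<and>
              (\<forall>k. \<exists>D. (rot_conj \<theta> F has_derivative D) (at (z k) within - ball 0 s) \<and> real_eigenvalue D (c k)) \<and>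
              (\<lambda>k. c k * P (z k $ 1)) \<longlonglongrightarrow> 0"
    proof (intro exI[of _ z] exI[of _ c] exI[of _ "?v (m * T)"] conjI allI)
      have norm: "norm (z k) = norm (w k)" for k by (simp add: z_def norm_mult m)
      show "z k \<notin> ball 0 s" for k using w(1)[of k] norm[of k] by simp
      have re: "z k $ 1 = Re (m * w k)" for k unfolding z_def vec_of_complex_nth(1) ..
      show "filterlim (\<lambda>k. z k $ 1) at_top sequentially" "(\<lambda>k. c k * P (z k $ 1)) \<longlonglongrightarrow> 0" unfolding re by (rule w)+
      have "(\<lambda>k. ?v (m * ?F (w k))) \<longlonglongrightarrow> ?v (m * T)"
        by (intro bounded_linear.tendsto[OF bounded_linear_vec_of_complex] tendsto_intros w(3))
      then show "(\<lambda>k. rot_conj \<theta> F (z k)) \<longlonglongrightarrow> ?v (m * T)" unfolding rF zk .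
      show "\<exists>D. (rot_conj \<theta> F has_derivative D) (at (z k) within - ball 0 s) \<and> real_eigenvalue D (c k)" for k
      proof -
        obtain D where D: "(?F has_derivative D) (at (w k))" "real_eigenvalue D (c k)" using w(4) by blast
        have 1: "((\<lambda>x. cis (- \<theta>) * ?c x) has_derivative (\<lambda>h. cis (- \<theta>) * ?c h)) (at (z k) within - ball 0 s)"
          by (intro has_derivative_mult_right dc)
        have "(?F has_derivative D) (at (cis (- \<theta>) * ?c (z k)))" using D(1) unfolding zk .
        from has_derivative_compose[OF 1 this]
        have 2: "((\<lambda>x. m * ?F (cis (- \<theta>) * ?c x)) has_derivative (\<lambda>h. m * D (cis (- \<theta>) * ?c h))) (at (z k) within - ball 0 s)"
          by (intro has_derivative_mult_right)
        have rF': "rot_conj \<theta> F = (\<lambda>x. ?v (m * ?F (cis (- \<theta>) * ?c x)))" using rF by blast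
        have 3: "(rot_conj \<theta> F has_derivative (\<lambda>h. ?v (m * D (cis (- \<theta>) * ?c h)))) (at (z k) within - ball 0 s)"
          unfolding rF' by (rule bounded_linear.has_derivative[OF bounded_linear_vec_of_complex 2])
        obtain v where v: "v \<noteq> 0" "D v = c k *\<^sub>R v" using D(2) by (auto simp: real_eigenvalue_def)
        have e: "cis (- \<theta>) * ?c (?v (m * v)) = v" by (simp add: mult.assoc[symmetric] th')
        have "?v (m * D (cis (- \<theta>) * ?c (?v (m * v)))) = c k *\<^sub>R ?v (m * v)"
          unfolding e v(2) mult_scaleR_right by (rule linear_scale[OF bounded_linear.linear[OF bounded_linear_vec_of_complex]])
        moreover have "?v (m * v) \<noteq> 0"
        proof -
          have "norm (?v (m * v)) = norm v" by (simp add: norm_mult m)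
          then show ?thesis using v(1) by (metis norm_eq_zero)
        qed
        ultimately have "real_eigenvalue (\<lambda>h. ?v (m * D (cis (- \<theta>) * ?c h))) (c k)" unfolding real_eigenvalue_def by blast
        then show ?thesis using 3 by blast
      qed
    qed
    then show False using P(2) by blast
  qed
  have "W_homeo ?F s P"
    by unfold_locales (fact cF inj df P(1) cW)+
  then show ?thesis by (rule that)
qed

theorem theorem1p8:
  fixes F :: "real^2 \<Rightarrow> real^2" and s :: real
  assumes "local_homeomorphism F"
    and "s > 0"
    and "F differentiable_on (- ball 0 s)"
    and "W_condition s F"
  shows "inj F \<and> convex (range F)"
proof -
  let ?G = "\<lambda>w. complex_of_vec (F (vec_of_complex w))"
  obtain P where "W_homeo ?G s P" using W_homeo_complex_of_vec[OF assms] by blast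
  then have "segment_lifts ?G p q" for p q by (rule W_homeo.segment_lifts_all)
  then have G: "inj ?G" "convex (range ?G)" using all_segments_lift_imp by blast+
  have eq: "F = (\<lambda>x. vec_of_complex (?G (complex_of_vec x)))" by simp
  have "inj F"
  proof (rule injI)
    fix x y assume "F x = F y"
    then have "?G (complex_of_vec x) = ?G (complex_of_vec y)" by simp
    then have "complex_of_vec x = complex_of_vec y" by (rule injD[OF G(1)])
    then show "x = y" by (metis complex_vec_inverse(2))
  qed
  moreover have "range F = vec_of_complex ` range ?G"
  proof
    show "range F \<subseteq> vec_of_complex ` range ?G"
    proof
      fix y assume "y \<in> range F"
      then obtain x where "y = F x" by blast
      then have "y = vec_of_complex (?G (complex_of_vec x))" by simp
      then show "y \<in> vec_of_complex ` range ?G" by blast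
    qed
  qed auto
  then have "convex (range F)"
    using convex_linear_image[OF bounded_linear.linear[OF bounded_linear_vec_of_complex] G(2)] by simp
  ultimately show ?thesis by blast
qed

end
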